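(* Let $\beta\in(0,1)$, $-\beta<\theta<\beta$, $k\in\mathbb{N}$, with $\beta(2k+1)\notin\mathbb{N}$. Let $Z^{\beta(2k+1),\theta}(t)$, $t>0$, be the limiting fractional pseudoprocess defined by the following limit in law of pseudo random walks: $$Z^{\beta(2k+1),\theta}(t)\stackrel{\text{law}}{=}\lim_{\gamma\to0}\left[\left(\frac{\sin\frac{\pi}{2}(\beta-\theta)}{\sin\pi\beta}\right)^{\frac{1}{(2k+1)\beta}}\sum_{j=0}^{N(t\gamma^{-(2k+1)\beta})}X_j^{\gamma,(2k+1)\beta}U_j^{2k+1}(1)-\left(\frac{\sin\frac{\pi}{2}(\beta+\theta)}{\sin\pi\beta}\right)^{\frac{1}{(2k+1)\beta}}\sum_{j=0}^{N(t\gamma^{-(2k+1)\beta})}Y_j^{\gamma,(2k+1)\beta}U_j^{2k+1}(1)\right],$$ where $X_j^{\gamma,(2k+1)\beta}$, $Y_j^{\gamma,(2k+1)\beta}$ are i.i.d. random variables with $\Pr\{X^{\gamma,(2k+1)\beta}>w\}=(\gamma/w)^{(2k+1)\beta}$ for $w>\gamma$ and $=1$ for $w<\gamma$, $N$ is a homogeneous Poisson process with rate $1/\Gamma(1-\beta)$, the $U_j^{2k+1}(1)$ are independent pseudo random variables with the law at time $1$ of the pseudoprocess of order $2k+1$, all these are independent of each other, and the two random sums are independent. The signed density of $Z^{\beta(2k+1),\theta}(t)$ is the solution to $$\begin{cases}\dfrac{\partial}{\partial t}z^{\beta(2k+1),\theta}(x,t)={}^F\!D^{\beta(2k+1),\theta}z^{\beta(2k+1),\theta}(x,t),\qquad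 x\in\mathbb{R},\ t>0,\\[1mm] z^{\beta(2k+1),\theta}(x,0)=\delta(x),\end{cases}$$ and coincides with the signed distribution of the composition $$\mathfrak{Z}^{\beta(2k+1),\theta}(t)=U_1^{2k+1}\left(H_1^\beta\left(\frac{\sin\frac{\pi}{2}(\beta+\theta)}{\sin\pi\beta}\,t\right)\right)-U_2^{2k+1}\left(H_2^\beta\left(\frac{\sin\frac{\pi}{2}(\beta-\theta)}{\sin\pi\beta}\,t\right)\right),$$ where $H_1^\beta,H_2^\beta$ are independent stable subordinators of order $\beta$ and $U_1^{2k+1},U_2^{2k+1}$ are independent pseudoprocesses, independent of $H_1^\beta,H_2^\beta$, related to the odd-order heat-type equation $$\frac{\partial}{\partial t}u_{2k+1}(x,t)=(-1)^k\frac{\partial^{2k+1}}{\partial x^{2k+1}}u_{2k+1}(x,t).$$ The positivity of the two time scales in $\mathfrak{Z}^{\beta(2k+1),\theta}$ implies that $-\beta<\theta<\beta$.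
   Context: The Feller derivative of order $\gamma$, $m-1<\gamma<m$, $m\in\mathbb{N}$, with parameter $\theta$ is $${}^F\!D^{\gamma,\theta}=-\left[\frac{\sin\frac{\pi}{2}(\gamma-\theta)}{\sin\pi\gamma}\frac{{}^+\partial^\gamma}{\partial x^\gamma}+\frac{\sin\frac{\pi}{2}(\gamma+\theta)}{\sin\pi\gamma}\frac{{}^-\partial^\gamma}{\partial x^\gamma}\right],$$ with the Weyl fractional derivatives $$\frac{{}^+\partial^\gamma}{\partial x^\gamma}u(x)=\frac{1}{\Gamma(m-\gamma)}\frac{d^m}{dx^m}\int_{-\infty}^x\frac{u(y)}{(x-y)^{\gamma+1-m}}dy,\qquad \frac{{}^-\partial^\gamma}{\partial x^\gamma}u(x)=\frac{(-1)^m}{\Gamma(m-\gamma)}\frac{d^m}{dx^m}\int_x^{\infty}\frac{u(y)}{(y-x)^{\gamma+1-m}}dy.$$ With $\widehat u(\xi)=\int_{\mathbb{R}}e^{i\xi x}u(x)\,dx$, these have Fourier symbols $(\mp i\xi)^\gamma=|\xi|^\gamma e^{\mp\frac{i\pi\gamma}{2}\mathrm{sign}(\xi)}$ respectively. The Cauchy problem is treated through the $x$-Fourier transform. Pseudo random variables and pseudoprocesses are endowed with signed laws of total mass one; expectations are with respect to these signed laws, i.e. Fourier transforms. The pseudoprocess $U^{2k+1}$ of order $2k+1$ has at time $s$ the signed law $u_{2k+1}(x,s)$, the fundamental solution (initial datum $\delta(x)$) of the odd-order equation in the claim, so that $\int_{\mathbb{R}}e^{i\xi x}u_{2k+1}(x,s)\,dx=e^{-is\xi^{2k+1}}$.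 Independence of pseudo random variables means that the Fourier transform of the convolution of their signed densities is the product of their Fourier transforms; Fourier transforms of random sums are computed by conditioning on the genuine random variables, and the limit in law means convergence of Fourier transforms. The subordinator $H^\beta(t)$ has density $h_\beta(s,t)$, $s\ge0$, with $\int_0^\infty e^{-\mu s}h_\beta(s,t)\,ds=e^{-t\mu^\beta}$, and $U^{2k+1}(H^\beta(t))$ has signed law $\int_0^\infty u_{2k+1}(x,s)h_\beta(s,t)\,ds$.
   Formalization: The weights of the two random sums are exchanged (β+θ on the added sum, β−θ on the subtracted one), since as printed the limit has −θ in place of θ; the last sentence is stated for |θ| ≤ 2, as it fails e.g. at θ = 4. *)

theory Defs
  imports "HOL-Probability.Probability"
begin

section \<open>Weyl and Feller derivatives\<close>

(* For a non-integer g > 0 the integer m with m - 1 < g < m is the ceiling of g. *)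
definition weyl_order :: "real \<Rightarrow> nat" where
  "weyl_order g = nat \<lceil>g\<rceil>"

definition weyl_integrand_plus :: "real \<Rightarrow> (real \<Rightarrow> real) \<Rightarrow> real \<Rightarrow> real \<Rightarrow> real" where
  "weyl_integrand_plus g f x y = f y / (x - y) powr (g + 1 - real (weyl_order g))"

definition weyl_integrand_minus :: "real \<Rightarrow> (real \<Rightarrow> real) \<Rightarrow> real \<Rightarrow> real \<Rightarrow> real" where
  "weyl_integrand_minus g f x y = f y / (y - x) powr (g + 1 - real (weyl_order g))"

definition weyl_integral_plus :: "real \<Rightarrow> (real \<Rightarrow> real) \<Rightarrow> real \<Rightarrow> real" where
  "weyl_integral_plus g f x = (LINT y:{..<x}|lborel. weyl_integrand_plus g f x y)"

definition weyl_integral_minus :: "real \<Rightarrow> (real \<Rightarrow> real) \<Rightarrow> real \<Rightarrow> real" where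
  "weyl_integral_minus g f x = (LINT y:{x<..}|lborel. weyl_integrand_minus g f x y)"

definition weyl_deriv_plus :: "real \<Rightarrow> (real \<Rightarrow> real) \<Rightarrow> real \<Rightarrow> real" where
  "weyl_deriv_plus g f x =
     1 / Gamma (real (weyl_order g) - g) * (deriv ^^ weyl_order g) (weyl_integral_plus g f) x"

definition weyl_deriv_minus :: "real \<Rightarrow> (real \<Rightarrow> real) \<Rightarrow> real \<Rightarrow> real" where
  "weyl_deriv_minus g f x =
     (-1) ^ weyl_order g / Gamma (real (weyl_order g) - g)
       * (deriv ^^ weyl_order g) (weyl_integral_minus g f) x"

definition feller_deriv :: "real \<Rightarrow> real \<Rightarrow> (real \<Rightarrow> real) \<Rightarrow> real \<Rightarrow> real" where
  "feller_deriv g \<theta> f x =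
     - (sin (pi / 2 * (g - \<theta>)) / sin (pi * g) * weyl_deriv_plus g f x
        + sin (pi / 2 * (g + \<theta>)) / sin (pi * g) * weyl_deriv_minus g f x)"

definition times_differentiable :: "nat \<Rightarrow> (real \<Rightarrow> real) \<Rightarrow> bool" where
  "times_differentiable n f \<longleftrightarrow> (\<forall>j<n. \<forall>x. (deriv ^^ j) f differentiable (at x))"

(* Both Weyl derivatives exist everywhere; excludes the default values of the Lebesgue
   integral and of deriv. *)
definition weyl_differentiable :: "real \<Rightarrow> (real \<Rightarrow> real) \<Rightarrow> bool" where
  "weyl_differentiable g f \<longleftrightarrow>
     (\<forall>x. set_integrable lborel {..<x} (weyl_integrand_plus g f x)) \<and>
     (\<forall>x. set_integrable lborel {x<..} (weyl_integrand_minus g f x)) \<and>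
     times_differentiable (weyl_order g) (weyl_integral_plus g f) \<and>
     times_differentiable (weyl_order g) (weyl_integral_minus g f)"


section \<open>The Cauchy problem for the Feller derivative\<close>

definition fourier :: "(real \<Rightarrow> real) \<Rightarrow> real \<Rightarrow> complex" where
  "fourier f \<xi> = (LINT x|lborel. cis (\<xi> * x) * complex_of_real (f x))"

(* The initial datum delta is attained weakly. *)
definition feller_cauchy_solution ::
  "real \<Rightarrow> real \<Rightarrow> (real \<Rightarrow> real \<Rightarrow> real) \<Rightarrow> bool" where
  "feller_cauchy_solution g \<theta> z \<longleftrightarrow>
     (\<forall>t>0. weyl_differentiable g (\<lambda>x. z x t)) \<and>
     (\<forall>t>0. \<forall>x. ((\<lambda>\<tau>. z x \<tau>) has_real_derivative
        feller_deriv g \<theta> (\<lambda>y. z y t) x) (at t)) \<and>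
     (\<forall>\<phi>::real \<Rightarrow> real. continuous_on UNIV \<phi> \<and> bounded (range \<phi>) \<longrightarrow>
        ((\<lambda>t. LINT x|lborel. \<phi> x * z x t) \<longlongrightarrow> \<phi> 0) (at_right 0))"

(* (-i xi)^g and (i xi)^g, principal branch *)
definition weyl_symbol_plus :: "real \<Rightarrow> real \<Rightarrow> complex" where
  "weyl_symbol_plus g \<xi> = complex_of_real (\<bar>\<xi>\<bar> powr g) * cis (- (pi * g / 2 * sgn \<xi>))"

definition weyl_symbol_minus :: "real \<Rightarrow> real \<Rightarrow> complex" where
  "weyl_symbol_minus g \<xi> = complex_of_real (\<bar>\<xi>\<bar> powr g) * cis (pi * g / 2 * sgn \<xi>)"

definition feller_symbol :: "real \<Rightarrow> real \<Rightarrow> real \<Rightarrow> complex" where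
  "feller_symbol g \<theta> \<xi> =
     - (complex_of_real (sin (pi / 2 * (g - \<theta>)) / sin (pi * g)) * weyl_symbol_plus g \<xi>
        + complex_of_real (sin (pi / 2 * (g + \<theta>)) / sin (pi * g)) * weyl_symbol_minus g \<xi>)"

(* The same Cauchy problem after the Fourier transform in x. It serves to express uniqueness. *)
definition feller_cauchy_solution_fourier ::
  "real \<Rightarrow> real \<Rightarrow> (real \<Rightarrow> real \<Rightarrow> real) \<Rightarrow> bool" where
  "feller_cauchy_solution_fourier g \<theta> z \<longleftrightarrow>
     (\<forall>t>0. integrable lborel (\<lambda>x. z x t)) \<and>
     (\<forall>t>0. \<forall>\<xi>. ((\<lambda>\<tau>. fourier (\<lambda>x. z x \<tau>) \<xi>) has_vector_derivative
        feller_symbol g \<theta> \<xi> * fourier (\<lambda>x. z x t) \<xi>) (at t)) \<and>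
     (\<forall>\<xi>. ((\<lambda>t. fourier (\<lambda>x. z x t) \<xi>) \<longlongrightarrow> 1) (at_right 0))"


section \<open>The pseudoprocess of odd order\<close>

(* The signed law is not absolutely integrable in x, so its Fourier transform is improper. *)
definition has_improper_fourier :: "(real \<Rightarrow> real) \<Rightarrow> real \<Rightarrow> complex \<Rightarrow> bool" where
  "has_improper_fourier f \<xi> c \<longleftrightarrow>
     ((\<lambda>R. LINT x:{-R..R}|lborel. cis (\<xi> * x) * complex_of_real (f x)) \<longlongrightarrow> c) at_top"

definition improper_fourier :: "(real \<Rightarrow> real) \<Rightarrow> real \<Rightarrow> complex" where
  "improper_fourier f \<xi> =
     Lim at_top (\<lambda>R. LINT x:{-R..R}|lborel. cis (\<xi> * x) * complex_of_real (f x))"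

(* u_{2k+1}(x,s) for k >= 1 and s > 0: the conditionally convergent inverse Fourier transform
   of exp (-i s xi^(2k+1)). The imaginary part of the integrand is odd and drops out.
   For k = 0 the signed law is a point mass and has no density. *)
definition odd_order_law :: "nat \<Rightarrow> real \<Rightarrow> real \<Rightarrow> real" where
  "odd_order_law k x s =
     Lim at_top (\<lambda>R. 1 / (2 * pi) *
       (LINT \<xi>:{-R..R}|lborel. cos (\<xi> * x + s * \<xi> ^ (2 * k + 1))))"

definition test_function :: "(real \<Rightarrow> real) \<Rightarrow> bool" where
  "test_function \<phi> \<longleftrightarrow>
     (\<forall>n. times_differentiable n \<phi>) \<and> (\<exists>R. \<forall>x. R < \<bar>x\<bar> \<longrightarrow> \<phi> x = 0)"

definition odd_order_fundamental_solution :: "nat \<Rightarrow> (real \<Rightarrow> real \<Rightarrow> real) \<Rightarrow> bool" where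
  "odd_order_fundamental_solution k u \<longleftrightarrow>
     (\<forall>s>0. times_differentiable (2 * k + 1) (\<lambda>x. u x s)) \<and>
     (\<forall>s>0. \<forall>x. ((\<lambda>\<tau>. u x \<tau>) has_real_derivative
        (-1) ^ k * (deriv ^^ (2 * k + 1)) (\<lambda>y. u y s) x) (at s)) \<and>
     (\<forall>\<phi>. test_function \<phi> \<longrightarrow>
        ((\<lambda>s. LINT x|lborel. \<phi> x * u x s) \<longlongrightarrow> \<phi> 0) (at_right 0)) \<and>
     (\<forall>s>0. \<forall>\<xi>. has_improper_fourier (\<lambda>x. u x s) \<xi> (cis (- (s * \<xi> ^ (2 * k + 1)))))"


section \<open>Composition with stable subordinators\<close>

definition stable_subordinator_density :: "real \<Rightarrow> (real \<Rightarrow> real \<Rightarrow> real) \<Rightarrow> bool" where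
  "stable_subordinator_density \<beta> h \<longleftrightarrow>
     (\<forall>t>0. (\<forall>s\<ge>0. 0 \<le> h s t) \<and>
        (\<forall>\<mu>\<ge>0. set_integrable lborel {0..} (\<lambda>s. exp (- (\<mu> * s)) * h s t) \<and>
          (LINT s:{0..}|lborel. exp (- (\<mu> * s)) * h s t) = exp (- (t * \<mu> powr \<beta>))))"

definition subordinated_law ::
  "nat \<Rightarrow> (real \<Rightarrow> real \<Rightarrow> real) \<Rightarrow> real \<Rightarrow> real \<Rightarrow> real" where
  "subordinated_law k h x t = (LINT s:{0<..}|lborel. odd_order_law k x s * h s t)"

(* signed density of A - B for independent A, B with signed densities p, q *)
definition difference_law :: "(real \<Rightarrow> real) \<Rightarrow> (real \<Rightarrow> real) \<Rightarrow> real \<Rightarrow> real" where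
  "difference_law p q x = (LINT y|lborel. p (x + y) * q y)"

definition time_scale :: "real \<Rightarrow> real \<Rightarrow> real" where
  "time_scale \<beta> \<theta> = sin (pi / 2 * (\<beta> + \<theta>)) / sin (pi * \<beta>)"

definition composition_law ::
  "nat \<Rightarrow> real \<Rightarrow> real \<Rightarrow> (real \<Rightarrow> real \<Rightarrow> real) \<Rightarrow> real \<Rightarrow> real \<Rightarrow> real" where
  "composition_law k \<beta> \<theta> h x t =
     difference_law (\<lambda>y. subordinated_law k h y (time_scale \<beta> \<theta> * t))
                    (\<lambda>y. subordinated_law k h y (time_scale \<beta> (- \<theta>) * t)) x"


section \<open>Pseudo random walks\<close>

definition homogeneous_poisson_process ::
  "'w measure \<Rightarrow> real \<Rightarrow> (real \<Rightarrow> 'w \<Rightarrow> nat) \<Rightarrow> bool" where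
  "homogeneous_poisson_process M r N \<longleftrightarrow>
     (\<forall>t\<ge>0. N t \<in> measurable M (count_space UNIV)) \<and>
     (\<forall>\<omega>\<in>space M. N 0 \<omega> = 0 \<and> mono_on {0..} (\<lambda>t. N t \<omega>) \<and>
        (\<forall>t\<ge>0. continuous (at_right t) (\<lambda>s. N s \<omega>))) \<and>
     (\<forall>s\<ge>0. \<forall>t>s. distr M (count_space UNIV) (\<lambda>\<omega>. N t \<omega> - N s \<omega>)
        = measure_pmf (poisson_pmf (r * (t - s)))) \<and>
     (\<forall>\<tau>::nat \<Rightarrow> real. 0 \<le> \<tau> 0 \<and> strict_mono \<tau> \<longrightarrow>
        prob_space.indep_vars M (\<lambda>_. count_space UNIV)
          (\<lambda>i \<omega>. N (\<tau> (Suc i)) \<omega> - N (\<tau> i) \<omega>) UNIV)"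

definition has_power_tail :: "'w measure \<Rightarrow> real \<Rightarrow> real \<Rightarrow> ('w \<Rightarrow> real) \<Rightarrow> bool" where
  "has_power_tail M \<gamma> a X \<longleftrightarrow>
     X \<in> borel_measurable M \<and>
     (\<forall>w>\<gamma>. measure M {\<omega>\<in>space M. w < X \<omega>} = (\<gamma> / w) powr a) \<and>
     (\<forall>w<\<gamma>. measure M {\<omega>\<in>space M. w < X \<omega>} = 1)"

(* The independent sources of genuine randomness: each of the two random sums has its own
   Poisson process and its own sequence of jumps. *)
datatype source = CountX | CountY | JumpX nat | JumpY nat

fun source_events ::
  "'w measure \<Rightarrow> (real \<Rightarrow> 'w \<Rightarrow> nat) \<Rightarrow> (real \<Rightarrow> 'w \<Rightarrow> nat) \<Rightarrow>
   (nat \<Rightarrow> 'w \<Rightarrow> real) \<Rightarrow> (nat \<Rightarrow> 'w \<Rightarrow> real) \<Rightarrow> source \<Rightarrow> 'w set set" where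
  "source_events M NX NY X Y CountX =
     sigma_sets (space M) {NX t -` A \<inter> space M | t A. 0 \<le> t}"
| "source_events M NX NY X Y CountY =
     sigma_sets (space M) {NY t -` A \<inter> space M | t A. 0 \<le> t}"
| "source_events M NX NY X Y (JumpX j) = {X j -` A \<inter> space M | A. A \<in> sets borel}"
| "source_events M NX NY X Y (JumpY j) = {Y j -` A \<inter> space M | A. A \<in> sets borel}"

(* Fourier transform at xi of a * sum_{j=0..n} X_j U_j - b * sum_{j=0..n'} Y_j U'_j with random
   n, n', where phi is the Fourier transform of the common signed law of the independent
   pseudo random variables U_j, U'_j. Given n, n', X, Y, the transform is a product of values
   of phi; the expectation is over the genuine random variables. *)
definition pseudo_walk_fourier ::
  "'w measure \<Rightarrow> (real \<Rightarrow> complex) \<Rightarrow> real \<Rightarrow> real \<Rightarrow> ('w \<Rightarrow> nat) \<Rightarrow> ('w \<Rightarrow> nat) \<Rightarrow>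
   (nat \<Rightarrow> 'w \<Rightarrow> real) \<Rightarrow> (nat \<Rightarrow> 'w \<Rightarrow> real) \<Rightarrow> real \<Rightarrow> complex" where
  "pseudo_walk_fourier M \<phi> a b n n' X Y \<xi> =
     (LINT \<omega>|M. (\<Prod>j\<le>n \<omega>. \<phi> (\<xi> * (a * X j \<omega>))) * (\<Prod>j\<le>n' \<omega>. \<phi> (\<xi> * (- (b * Y j \<omega>)))))"

(* Pitfall on the sign of theta. By the Laplace transform of the subordinator, a random sum
   with scale c^(1/((2k+1) beta)) has the limit
     exp (-t c |xi|^((2k+1) beta) exp (i pi beta sgn xi / 2)),
   that is, the Fourier transform of U(H(c t)), and a subtracted sum has the conjugate.
   Hence the added sum carries time_scale beta theta and the subtracted one
   time_scale beta (-theta), as in composition_law and as the Feller symbol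
   -|xi|^g exp (i pi theta sgn xi / 2) requires; exchanging the two scales replaces
   theta by -theta in the limit. *)
definition feller_walk_fourier ::
  "nat \<Rightarrow> real \<Rightarrow> real \<Rightarrow> 'w measure \<Rightarrow> (real \<Rightarrow> 'w \<Rightarrow> nat) \<Rightarrow> (real \<Rightarrow> 'w \<Rightarrow> nat) \<Rightarrow>
   (nat \<Rightarrow> 'w \<Rightarrow> real) \<Rightarrow> (nat \<Rightarrow> 'w \<Rightarrow> real) \<Rightarrow> real \<Rightarrow> real \<Rightarrow> real \<Rightarrow> complex" where
  "feller_walk_fourier k \<beta> \<theta> M NX NY X Y t \<gamma> \<xi> =
     (let \<alpha> = real (2 * k + 1) * \<beta> in
      pseudo_walk_fourier M (improper_fourier (\<lambda>x. odd_order_law k x 1))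
        (time_scale \<beta> \<theta> powr (1 / \<alpha>)) (time_scale \<beta> (- \<theta>) powr (1 / \<alpha>))
        (NX (t * \<gamma> powr (- \<alpha>))) (NY (t * \<gamma> powr (- \<alpha>))) X Y \<xi>)"

end

theory Submission
  imports Defs "HOL-Complex_Analysis.Complex_Analysis"
begin

text \<open>
  The law of the pseudoprocess is a conditionally convergent inverse Fourier transform. Rotating
  the half line turns it into an absolutely convergent integral, which gives smoothness and the
  equation. Its improper Fourier transform is recovered from the Dirichlet kernel, the tails being
  controlled by van der Corput's second derivative test, which is uniform in the linear part of the
  phase.

  The Laplace transform of the subordinator, continued to the imaginary axis, shows that \<open>U(H(t))\<close>
  has the transform \<open>exp (- t \<bar>\<xi>\<bar>\<^sup>\<alpha> exp (\<i> \<pi> \<beta> sgn \<xi> / 2))\<close> with \<open>\<alpha> = \<beta> (2 k + 1)\<close>, and the two time scales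
  are the coefficients for which the product of such a transform and a conjugate one is
  \<open>exp (- t \<bar>\<xi>\<bar>\<^sup>\<alpha> exp (\<i> \<pi> \<theta> sgn \<xi> / 2))\<close>, the exponential of the Feller symbol. The kernel with this
  transform decays like \<open>\<bar>x\<bar>\<close> to the power \<open>- 1 - \<alpha>\<close>, hence is integrable, and its Weyl
  derivatives are computed by regularising the fractional integrals with \<open>exp (- \<epsilon> v)\<close>.

  An odd power of a Pareto variable is again a Pareto variable, now of index \<open>\<beta> < 1\<close>, so each random sum
  is governed by a compound Poisson law with intensity proportional to \<open>\<beta> v\<^sup>-\<^sup>\<beta>\<^sup>-\<^sup>1 dv\<close>; the rate
  \<open>1 / \<Gamma>(1 - \<beta>)\<close> is what \<open>\<integral> (1 - exp (- z v)) \<beta> v\<^sup>-\<^sup>\<beta>\<^sup>-\<^sup>1 dv = \<Gamma>(1 - \<beta>) z\<^sup>\<beta>\<close> requires.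
\<close>
section \<open>Integrals with parameters and analytic continuation\<close>

text \<open>The law of the pseudoprocess is only conditionally integrable, so Fubini does not apply
  to it in subordination or convolution. The truncations \<open>odd_partial\<close> take its place:
  they are bounded by 3 s^(-1/(2k+1)) uniformly in the truncation and in x, and this singularity at
  s = 0 is integrable against the subordinator density because a stable subordinator has all
  negative moments. After subordination the kernel is absolutely integrable and ordinary Fourier
  inversion applies. The order \<beta> (2k+1) may exceed 2, so the kernel is signed in general; its
  integrability comes from a decay estimate, not from positivity. The solution is one explicit
  function, \<open>stable_kernel\<close> with angle \<pi>\<theta>/2, and walk, equation and
  composition are each compared with it. One \<theta> serves all of them because sin (a + b) e^(i a)
  + sin (a - b) e^(-i a) = sin (2 a) e^(i b) is used twice with b = \<pi>\<theta>/2: with a =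
  \<pi>\<beta>/2 for the time scales and with a = \<pi>\<beta>(2k+1)/2 for the Feller
  symbol.\<close>

lemma measurable_cis [measurable]: "cis \<in> borel_measurable borel"
  by (intro borel_measurable_continuous_onI continuous_intros)

text \<open>In a metric space the filter \<open>at x0 within S\<close> is tested by sequences, so
  the sequential dominated convergence theorem carries over.\<close>

lemma tendsto_lebesgue_integral_within:
  fixes f :: "'a::metric_space \<Rightarrow> 'b \<Rightarrow> 'c::{banach,second_countable_topology}"
  assumes meas: "\<And>x. x \<in> S \<Longrightarrow> x \<noteq> x0 \<Longrightarrow> f x \<in> borel_measurable M"
    and l: "l \<in> borel_measurable M"
    and lim: "AE w in M. ((\<lambda>x. f x w) \<longlongrightarrow> l w) (at x0 within S)"
    and bound: "\<And>x. x \<in> S \<Longrightarrow> x \<noteq> x0 \<Longrightarrow> AE w in M. norm (f x w) \<le> g w"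
    and g: "integrable M g"
  shows "((\<lambda>x. integral\<^sup>L M (f x)) \<longlongrightarrow> integral\<^sup>L M l) (at x0 within S)"
  unfolding tendsto_at_iff_sequentially o_def
proof (intro allI impI)
  fix X :: "nat \<Rightarrow> 'a" assume X: "\<forall>i. X i \<in> S - {x0}" "X \<longlonglongrightarrow> x0"
  show "(\<lambda>i. integral\<^sup>L M (f (X i))) \<longlonglongrightarrow> integral\<^sup>L M l"
  proof (rule integral_dominated_convergence[where w=g])
    show "AE w in M. (\<lambda>i. f (X i) w) \<longlonglongrightarrow> l w"
      using lim by eventually_elim (use X in \<open>auto simp: tendsto_at_iff_sequentially o_def\<close>)
  qed (use X assms in auto)
qed

text \<open>On a convex ball the mean value inequality bounds every difference quotient by
  \<open>g\<close>, so dominated convergence applies. Stated over a field so that it serves real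
  parameters (time, space) and complex ones (Laplace variable).\<close>

lemma has_field_derivative_lebesgue_integral:
  fixes f :: "'a::{real_normed_field,banach,second_countable_topology} \<Rightarrow> 'b \<Rightarrow> 'a"
  assumes S: "open S" "x0 \<in> S"
    and int: "\<And>x. x \<in> S \<Longrightarrow> integrable M (f x)"
    and deriv: "\<And>x w. x \<in> S \<Longrightarrow> w \<in> space M \<Longrightarrow> ((\<lambda>x. f x w) has_field_derivative f' x w) (at x)"
    and bound: "\<And>x w. x \<in> S \<Longrightarrow> w \<in> space M \<Longrightarrow> norm (f' x w) \<le> g w"
    and g: "integrable M g"
  shows "((\<lambda>x. integral\<^sup>L M (f x)) has_field_derivative integral\<^sup>L M (f' x0)) (at x0)"
    and "integrable M (f' x0)"
proof -
  obtain e where e: "e > 0" "ball x0 e \<subseteq> S" using S openE by blast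
  define B where "B = ball x0 e"
  have B: "open B" "x0 \<in> B" "B \<subseteq> S" "convex B" using e by (auto simp: B_def)
  have lim: "((\<lambda>y. (f y w - f x0 w) / (y - x0)) \<longlongrightarrow> f' x0 w) (at x0 within B)" if "w \<in> space M" for w
    using deriv[OF S(2) that] B unfolding has_field_derivative_iff by (simp add: at_within_open[OF B(2,1)])
  \<comment> \<open>A sequence of difference quotients exhibits \<open>f' x0\<close> as a pointwise
    limit of measurable functions. The denominator i + 2 keeps each point strictly inside the
    ball.\<close>
  define X where "X = (\<lambda>i::nat. x0 + of_real (e / (real i + 2)))"
  have X: "X i \<in> B - {x0}" for i
  proof -
    have "e / (real i + 2) < e / 1" using e by (intro divide_strict_left_mono) auto
    moreover have "0 < e / (real i + 2)" using e by auto
    ultimately show ?thesis unfolding X_def B_def by (auto simp: dist_norm simp del: of_real_divide)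
  qed
  have Xl: "X \<longlonglongrightarrow> x0"
  proof -
    have "(\<lambda>i. e / (real i + 2)) \<longlonglongrightarrow> 0" by real_asymp
    then have "(\<lambda>i. x0 + of_real (e / (real i + 2))) \<longlonglongrightarrow> x0 + (of_real 0 :: 'a)" by (intro tendsto_intros)
    then show ?thesis by (simp add: X_def)
  qed
  have m: "f' x0 \<in> borel_measurable M"
  proof (rule borel_measurable_LIMSEQ_metric)
    show "(\<lambda>i. (f (X i) w - f x0 w) / (X i - x0)) \<longlonglongrightarrow> f' x0 w" if "w \<in> space M" for w
      using lim[OF that] X Xl unfolding tendsto_at_iff_sequentially o_def by auto
    show "(\<lambda>w. (f (X i) w - f x0 w) / (X i - x0)) \<in> borel_measurable M" for i
      using int[of "X i"] int[of x0] X[of i] B by (intro borel_measurable_divide borel_measurable_diff) auto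
  qed
  show "integrable M (f' x0)"
    by (rule Bochner_Integration.integrable_bound[OF g m]) (use bound S in \<open>auto intro!: AE_I2 intro: order_trans[OF _ abs_ge_self]\<close>)
  have "((\<lambda>y. integral\<^sup>L M (\<lambda>w. (f y w - f x0 w) / (y - x0))) \<longlongrightarrow> integral\<^sup>L M (f' x0)) (at x0 within B)"
  proof (rule tendsto_lebesgue_integral_within[OF _ m _ _ g])
    fix y assume y: "y \<in> B" "y \<noteq> x0"
    show "(\<lambda>w. (f y w - f x0 w) / (y - x0)) \<in> borel_measurable M"
      using int[of y] int[of x0] y B by (intro borel_measurable_divide borel_measurable_diff) auto
    show "AE w in M. norm ((f y w - f x0 w) / (y - x0)) \<le> g w"
    proof (rule AE_I2)
      fix w assume w: "w \<in> space M"
      have "norm (f y w - f x0 w) \<le> g w * norm (y - x0)"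
        by (rule field_differentiable_bound[OF B(4), where f'="\<lambda>x. f' x w"])
           (use deriv w bound B y in \<open>blast intro: has_field_derivative_at_within\<close>)+
      then show "norm ((f y w - f x0 w) / (y - x0)) \<le> g w"
        using y by (simp add: norm_divide divide_le_eq)
    qed
  qed (use lim in auto)
  then have "((\<lambda>y. (integral\<^sup>L M (f y) - integral\<^sup>L M (f x0)) / (y - x0)) \<longlongrightarrow> integral\<^sup>L M (f' x0)) (at x0 within B)"
  proof (rule Lim_transform_eventually)
    have "integral\<^sup>L M (\<lambda>w. (f y w - f x0 w) / (y - x0)) = (integral\<^sup>L M (f y) - integral\<^sup>L M (f x0)) / (y - x0)"
      if "y \<in> B" for y
      using int[of y] int[OF S(2)] B that by (auto simp: subset_iff)
    then show "\<forall>\<^sub>F y in at x0 within B. integral\<^sup>L M (\<lambda>w. (f y w - f x0 w) / (y - x0)) = (integral\<^sup>L M (f y) - integral\<^sup>L M (f x0)) / (y - x0)"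
      unfolding eventually_at_filter by (intro always_eventually) blast
  qed
  then show "((\<lambda>x. integral\<^sup>L M (f x)) has_field_derivative integral\<^sup>L M (f' x0)) (at x0)"
    using B unfolding has_field_derivative_iff by (simp add: at_within_open[OF B(2,1)])
qed



section \<open>Integrability of powers with exponential decay\<close>

text \<open>Improper integrals of powers and the Gamma integral are known as gauge integrals;
  nonnegativity makes them absolutely integrable, and Borel measurability descends from the
  completion to \<open>lborel\<close>.\<close>

lemma set_integrable_lborel_nonneg:
  fixes f :: "real \<Rightarrow> real"
  assumes f: "(f has_integral I) S" "\<And>x. x \<in> S \<Longrightarrow> 0 \<le> f x"
    and m: "set_borel_measurable borel S f"
  shows "set_integrable lborel S f" "(LINT x:S|lborel. f x) = I"
proof -
  have "f absolutely_integrable_on S"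
    using f by (intro nonnegative_absolutely_integrable_1) (auto simp: integrable_on_def)
  with m show 1: "set_integrable lborel S f"
    unfolding set_integrable_def set_borel_measurable_def by (subst (asm) integrable_completion) auto
  show "(LINT x:S|lborel. f x) = I"
    using set_borel_integral_eq_integral(2)[OF 1] f(1) by (simp add: integral_unique)
qed

lemma set_integrable_powr_exp_powr:
  fixes p a T :: real
  assumes "p > -1" "a > 0" "T > 0"
  shows "set_integrable lborel {0<..} (\<lambda>r. r powr p * exp (- (T * r powr a)))"
proof -
  \<comment> \<open>The surplus exponent 2 leaves r^(-2) as the majorant beyond \<open>K\<close>;
    below \<open>K\<close> the power alone is integrable because p > -1.\<close>
  have "((\<lambda>r. r powr (p + 2) * exp (- (T * r powr a))) \<longlongrightarrow> 0) at_top"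
    using assms by real_asymp
  then have "\<forall>\<^sub>F r in at_top. r powr (p + 2) * exp (- (T * r powr a)) < 1"
    by (rule order_tendstoD) simp
  then obtain R where R: "\<And>r. r \<ge> R \<Longrightarrow> r powr (p + 2) * exp (- (T * r powr a)) < 1"
    by (auto simp: eventually_at_top_linorder)
  define K where "K = max R 1"
  have K: "K > 0" by (simp add: K_def)
  have 1: "set_integrable lborel {0..K} (\<lambda>r. r powr p)"
    by (rule set_integrable_lborel_nonneg[OF has_integral_powr_from_0])
       (use assms in \<open>auto simp: K_def set_borel_measurable_def\<close>)
  have 2: "set_integrable lborel {K..} (\<lambda>r. r powr (-2))"
    by (rule set_integrable_lborel_nonneg[OF has_integral_powr_to_inf])
       (use assms in \<open>auto simp: K_def set_borel_measurable_def\<close>)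
  have 3: "set_integrable lborel {0<..K} (\<lambda>r. r powr p * exp (- (T * r powr a)))"
    by (rule set_integrable_bound[OF set_integrable_subset[OF 1]])
       (use assms in \<open>auto simp: set_borel_measurable_def intro!: AE_I2 mult_left_le\<close>)
  have 4: "set_integrable lborel {K<..} (\<lambda>r. r powr p * exp (- (T * r powr a)))"
  proof (rule set_integrable_bound[OF set_integrable_subset[OF 2]])
    show "AE r in lborel. r \<in> {K<..} \<longrightarrow> norm (r powr p * exp (- (T * r powr a))) \<le> norm (r powr (-2))"
    proof (intro AE_I2 impI)
      fix r assume r: "r \<in> {K<..}"
      have "r powr p * exp (- (T * r powr a)) = (r powr (p + 2) * exp (- (T * r powr a))) * r powr (-2)"
        using r K by (simp add: powr_add[symmetric] mult.assoc mult.left_commute)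
      also have "\<dots> \<le> 1 * r powr (-2)"
        using R[of r] r by (intro mult_right_mono) (auto simp: K_def)
      finally show "norm (r powr p * exp (- (T * r powr a))) \<le> norm (r powr (-2))" by simp
    qed
  qed (auto simp: set_borel_measurable_def)
  have "{0<..} = {0<..K} \<union> {K<..}" using K by auto
  then show ?thesis using set_integrable_Un[OF 3 4] by simp
qed

section \<open>Identity theorem on the right half plane\<close>

text \<open>The identity theorem: the positive reals accumulate at the interior point 1.\<close>

lemma eq_on_right_half_plane:
  fixes f g :: "complex \<Rightarrow> complex"
  assumes f: "f holomorphic_on {z. 0 < Re z}" and g: "g holomorphic_on {z. 0 < Re z}"
    and eq: "\<And>x::real. 0 < x \<Longrightarrow> f (of_real x) = g (of_real x)"
    and z: "0 < Re z"
  shows "f z = g z"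
proof -
  have lp: "1 islimpt (complex_of_real ` {0<..})"
    unfolding islimpt_sequential
  proof (intro exI conjI allI)
    show "complex_of_real (1 + 1 / (real n + 1)) \<in> complex_of_real ` {0<..} - {1}" for n
      by (auto simp del: of_real_add of_real_divide simp: add_pos_nonneg)
    have "(\<lambda>n. 1 + 1 / (real n + 1)) \<longlonglongrightarrow> 1" by real_asymp
    then have "(\<lambda>n. complex_of_real (1 + 1 / (real n + 1))) \<longlonglongrightarrow> of_real 1" by (rule tendsto_of_real)
    then show "(\<lambda>n. complex_of_real (1 + 1 / (real n + 1))) \<longlonglongrightarrow> 1" by simp
  qed
  have "f z - g z = 0"
  proof (rule analytic_continuation[where f="\<lambda>z. f z - g z" and S="{z. 0 < Re z}", OF _ _ _ _ _ lp])
    show "connected {z. 0 < Re z}" by (intro convex_connected convex_halfspace_Re_gt)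
    show "open {z. 0 < Re z}" by (rule open_halfspace_Re_gt)
  qed (use f g eq z in \<open>auto intro: holomorphic_intros\<close>)
  then show ?thesis by simp
qed

text \<open>A boundary point is approached from inside by z + 1/(n+1). The boundary is the case of
  interest: the Laplace variable becomes i \<xi>^(2k+1).\<close>

lemma eq_on_closed_right_half_plane:
  fixes f g :: "complex \<Rightarrow> complex"
  assumes f: "f holomorphic_on {z. 0 < Re z}" "continuous_on {z. 0 \<le> Re z} f"
    and g: "g holomorphic_on {z. 0 < Re z}" "continuous_on {z. 0 \<le> Re z} g"
    and eq: "\<And>x::real. 0 < x \<Longrightarrow> f (of_real x) = g (of_real x)"
    and z: "0 \<le> Re z"
  shows "f z = g z"
proof -
  define X where "X = (\<lambda>n. z + of_real (1 / (real n + 1)))"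
  have "(\<lambda>n. 1 / (real n + 1)) \<longlonglongrightarrow> 0" by real_asymp
  then have "X \<longlonglongrightarrow> z + of_real 0" unfolding X_def by (intro tendsto_intros)
  then have X: "X \<longlonglongrightarrow> z" by simp
  have pos: "0 < Re (X n)" for n using z by (simp add: X_def add_nonneg_pos)
  have "(\<lambda>n. f (X n)) \<longlonglongrightarrow> f z" 
    by (rule continuous_on_tendsto_compose[OF f(2) X]) (use z pos in \<open>auto intro!: always_eventually less_imp_le\<close>)
  moreover have "(\<lambda>n. g (X n)) \<longlonglongrightarrow> g z" 
    by (rule continuous_on_tendsto_compose[OF g(2) X]) (use z pos in \<open>auto intro!: always_eventually less_imp_le\<close>)
  moreover have "f (X n) = g (X n)" for n by (rule eq_on_right_half_plane[OF f(1) g(1) eq pos])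
  ultimately show ?thesis using LIMSEQ_unique by auto
qed


section \<open>Oscillatory integrals and rotation of contours\<close>

lemma has_vector_derivative_cis:
  assumes "(\<phi> has_real_derivative d) (at y within S)"
  shows "((\<lambda>y. cis (\<phi> y)) has_vector_derivative of_real d * (\<i> * cis (\<phi> y))) (at y within S)"
  using has_derivative_cis[OF assms[unfolded has_field_derivative_def]]
  unfolding has_vector_derivative_def scaleR_conv_of_real by (simp add: mult_ac)

section \<open>Van der Corput estimates\<close>

text \<open>Integration by parts against 1/\<phi>': since \<phi>' is monotone, the remaining
  integrand \<phi>''/\<phi>'^2 has constant sign and integrates to boundary values of 1/\<phi>', so
  no bound on \<phi>'' enters.\<close>

lemma van_der_Corput_first:
  fixes \<phi> \<phi>' \<phi>'' :: "real \<Rightarrow> real"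
  assumes ab: "a \<le> b" and \<mu>: "\<mu> > 0"
    and d1: "\<And>y. y \<in> {a..b} \<Longrightarrow> (\<phi> has_real_derivative \<phi>' y) (at y)"
    and d2: "\<And>y. y \<in> {a..b} \<Longrightarrow> (\<phi>' has_real_derivative \<phi>'' y) (at y)"
    and pos: "\<And>y. y \<in> {a..b} \<Longrightarrow> 0 \<le> \<phi>'' y"
    and bd: "(\<forall>y\<in>{a..b}. \<mu> \<le> \<phi>' y) \<or> (\<forall>y\<in>{a..b}. \<phi>' y \<le> - \<mu>)"
  shows "norm (integral {a..b} (\<lambda>y. cis (\<phi> y))) \<le> 2 / \<mu>"
proof (cases "a = b")
  case False
  then have ab: "a < b" using ab by simp
  have nz: "\<phi>' y \<noteq> 0" if "y \<in> {a..b}" for y using bd that \<mu> by fastforce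
  define P where "P = (\<lambda>y. integral {a..y} (\<lambda>y. cis (\<phi> y)))"
  \<comment> \<open>The correction term cancels cis \<phi> in the derivative of \<open>P\<close> and
    leaves only - (\<phi>''/\<phi>'^2) i cis \<phi>.\<close>
  define Q where "Q = (\<lambda>y. P y + (1 / \<phi>' y) *\<^sub>R (\<i> * cis (\<phi> y)))"
  have c1: "continuous_on {a..b} \<phi>" 
    using d1 by (meson DERIV_isCont continuous_at_imp_continuous_on)
  have c2: "continuous_on {a..b} \<phi>'" 
    using d2 by (meson DERIV_isCont continuous_at_imp_continuous_on)
  have cc: "continuous_on {a..b} (\<lambda>y. cis (\<phi> y))" by (intro continuous_intros c1)
  have P': "(P has_vector_derivative cis (\<phi> y)) (at y within {a..b})" if "y \<in> {a..b}" for y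
    unfolding P_def by (rule integral_has_vector_derivative[OF cc that])
  have cP: "continuous_on {a..b} P"
    using P' by (meson continuous_on_eq_continuous_within has_vector_derivative_continuous)
  have "norm (Q b - Q a) \<le> (- (1 / \<phi>' b)) - (- (1 / \<phi>' a))"
  proof (rule differentiable_bound_general[OF ab, where \<phi>="\<lambda>y. - (1 / \<phi>' y)" and \<phi>'="\<lambda>y. \<phi>'' y / (\<phi>' y)^2"
        and f'="\<lambda>y. - (\<phi>'' y / (\<phi>' y)^2) *\<^sub>R (\<i> * cis (\<phi> y))"])
    show "continuous_on {a..b} Q" unfolding Q_def
      by (intro continuous_intros cP c1 c2) (use nz in auto)
    show "continuous_on {a..b} (\<lambda>y. - (1 / \<phi>' y))"
      by (intro continuous_intros c2) (use nz in auto)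
    fix y assume y: "a < y" "y < b"
    then have yy: "y \<in> {a..b}" by auto
    have inv: "((\<lambda>y. 1 / \<phi>' y) has_real_derivative - (\<phi>'' y / (\<phi>' y)^2)) (at y)"
      using d2[OF yy] nz[OF yy] by (auto intro!: derivative_eq_intros simp: power2_eq_square field_simps)
    then show "((\<lambda>y. - (1 / \<phi>' y)) has_vector_derivative \<phi>'' y / (\<phi>' y)^2) (at y)"
      using DERIV_minus[OF inv] by (simp add: has_real_derivative_iff_has_vector_derivative)
    have "(P has_vector_derivative cis (\<phi> y)) (at y)"
      using P'[OF yy] y by (simp add: at_within_Icc_at)
    moreover have "((\<lambda>y. \<i> * cis (\<phi> y)) has_vector_derivative \<i> * (of_real (\<phi>' y) * (\<i> * cis (\<phi> y)))) (at y)"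
      by (intro has_vector_derivative_mult_right has_vector_derivative_cis d1 yy)
    ultimately have "(Q has_vector_derivative cis (\<phi> y) + ((1 / \<phi>' y) *\<^sub>R (\<i> * (of_real (\<phi>' y) * (\<i> * cis (\<phi> y))))
        + (- (\<phi>'' y / (\<phi>' y)^2)) *\<^sub>R (\<i> * cis (\<phi> y)))) (at y)"
      unfolding Q_def using inv by (intro has_vector_derivative_add has_vector_derivative_scaleR)
    also have "cis (\<phi> y) + ((1 / \<phi>' y) *\<^sub>R (\<i> * (of_real (\<phi>' y) * (\<i> * cis (\<phi> y))))
        + (- (\<phi>'' y / (\<phi>' y)^2)) *\<^sub>R (\<i> * cis (\<phi> y))) = (- (\<phi>'' y / (\<phi>' y)^2)) *\<^sub>R (\<i> * cis (\<phi> y))"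
      using nz[OF yy] by (simp add: scaleR_conv_of_real field_simps)
    finally show "(Q has_vector_derivative (- (\<phi>'' y / (\<phi>' y)^2)) *\<^sub>R (\<i> * cis (\<phi> y))) (at y)" .
    show "norm ((- (\<phi>'' y / (\<phi>' y)^2)) *\<^sub>R (\<i> * cis (\<phi> y))) \<le> \<phi>'' y / (\<phi>' y)^2"
      using pos[OF yy] by (simp add: norm_mult)
  qed
  moreover have "P b = (Q b - Q a) - (1 / \<phi>' b) *\<^sub>R (\<i> * cis (\<phi> b)) + (1 / \<phi>' a) *\<^sub>R (\<i> * cis (\<phi> a))"
    by (simp add: Q_def P_def)
  then have "norm (P b) \<le> norm (Q b - Q a) + norm ((1 / \<phi>' b) *\<^sub>R (\<i> * cis (\<phi> b))) + norm ((1 / \<phi>' a) *\<^sub>R (\<i> * cis (\<phi> a)))"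
    by (smt (verit, ccfv_threshold) norm_triangle_ineq norm_triangle_ineq4)
  \<comment> \<open>According to the sign of \<phi>', the term of one end point cancels and that of
    the other doubles, which is the origin of the constant 2.\<close>
  ultimately have le: "norm (P b) \<le> 1 / \<phi>' a - 1 / \<phi>' b + \<bar>1 / \<phi>' b\<bar> + \<bar>1 / \<phi>' a\<bar>"
    by (simp add: norm_mult)
  from bd show ?thesis
  proof
    assume *: "\<forall>y\<in>{a..b}. \<mu> \<le> \<phi>' y"
    then have "\<mu> \<le> \<phi>' a" "\<mu> \<le> \<phi>' b" using ab by auto
    then have "norm (P b) \<le> 2 * (1 / \<phi>' a)" "1 / \<phi>' a \<le> 1 / \<mu>" using le \<mu> by (auto simp: frac_le)
    then show ?thesis unfolding P_def by simp
  next
    assume *: "\<forall>y\<in>{a..b}. \<phi>' y \<le> - \<mu>"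
    then have "\<phi>' a \<le> - \<mu>" "\<phi>' b \<le> - \<mu>" using ab by auto
    then have "\<mu> \<le> - \<phi>' a" "\<mu> \<le> - \<phi>' b" by auto
    then have "norm (P b) \<le> 2 * (1 / - \<phi>' b)" "1 / - \<phi>' b \<le> 1 / \<mu>" 
      using le \<mu> by (auto simp: frac_le abs_if divide_simps simp del: divide_minus_right)
    then show ?thesis unfolding P_def by simp
  qed
qed (use \<mu> in auto)

text \<open>Since \<phi>' grows at rate at least l, on either side of its zero it reaches size sqrt
  l within distance 1 / sqrt l. That stretch is estimated by its length and the rest by the first
  test with \<mu> = sqrt l: (1 + 2) / sqrt l on each side.\<close>

lemma van_der_Corput_second:
  fixes \<phi> \<phi>' \<phi>'' :: "real \<Rightarrow> real"
  assumes ab: "a \<le> b" and l: "l > 0"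
    and d1: "\<And>y. y \<in> {a..b} \<Longrightarrow> (\<phi> has_real_derivative \<phi>' y) (at y)"
    and d2: "\<And>y. y \<in> {a..b} \<Longrightarrow> (\<phi>' has_real_derivative \<phi>'' y) (at y)"
    and pos: "\<And>y. y \<in> {a..b} \<Longrightarrow> l \<le> \<phi>'' y"
  shows "norm (integral {a..b} (\<lambda>y. cis (\<phi> y))) \<le> 6 / sqrt l"
proof -
  \<comment> \<open>This length balances the two estimates: d is the trivial bound and 2 / (l d) = 2
    d the first-derivative one.\<close>
  define d where "d = 1 / sqrt l"
  have d: "d > 0" "l * d = sqrt l" "2 / sqrt l = 2 * d"
    using l by (auto simp: d_def real_div_sqrt)
  have c1: "continuous_on {a..b} \<phi>" 
    using d1 by (meson DERIV_isCont continuous_at_imp_continuous_on)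
  have c2: "continuous_on {a..b} \<phi>'" 
    using d2 by (meson DERIV_isCont continuous_at_imp_continuous_on)
  have int: "(\<lambda>y. cis (\<phi> y)) integrable_on {a..b}"
    by (intro integrable_continuous_interval continuous_intros c1)
  have triv: "norm (integral {u..v} (\<lambda>y. cis (\<phi> y))) \<le> v - u" if "a \<le> u" "u \<le> v" "v \<le> b" for u v
  proof -
    have "continuous_on {u..v} (\<lambda>y. cis (\<phi> y))"
      by (rule continuous_on_subset[of "{a..b}"]) (use that in \<open>auto intro!: continuous_intros c1\<close>)
    from integral_bound[OF that(2) this, of 1] show ?thesis by simp
  qed
  have grow: "l * (v - u) \<le> \<phi>' v - \<phi>' u" if "a \<le> u" "u \<le> v" "v \<le> b" for u v
  proof (cases "u = v")
    case False
    then have "u < v" using that by simp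
    then have "\<exists>z>u. z < v \<and> \<phi>' v - \<phi>' u = (v - u) * \<phi>'' z"
      by (rule MVT2) (use that d2 in auto)
    then obtain w where w: "u < w" "w < v" "\<phi>' v - \<phi>' u = (v - u) * \<phi>'' w" by blast
    with pos[of w] that show ?thesis by (simp add: mult.commute mult_left_mono)
  qed simp
  have first: "norm (integral {u..v} (\<lambda>y. cis (\<phi> y))) \<le> 2 * d" 
    if "a \<le> u" "u \<le> v" "v \<le> b" "sqrt l \<le> \<phi>' u \<or> \<phi>' v \<le> - sqrt l" for u v
    unfolding d(3)[symmetric]
  proof (rule van_der_Corput_first[where \<phi>'=\<phi>' and \<phi>''=\<phi>''])
    from that(4) show "(\<forall>y\<in>{u..v}. sqrt l \<le> \<phi>' y) \<or> (\<forall>y\<in>{u..v}. \<phi>' y \<le> - sqrt l)"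
    proof
      assume *: "sqrt l \<le> \<phi>' u"
      have "sqrt l \<le> \<phi>' y" if y: "y \<in> {u..v}" for y
      proof -
        have "0 \<le> l * (y - u)" using y l by auto
        with grow[of u y] * y \<open>a \<le> u\<close> \<open>v \<le> b\<close> show ?thesis by auto
      qed
      then show ?thesis by blast
    next
      assume *: "\<phi>' v \<le> - sqrt l"
      have "\<phi>' y \<le> - sqrt l" if y: "y \<in> {u..v}" for y
      proof -
        have "0 \<le> l * (v - y)" using y l by auto
        with grow[of y v] * y \<open>a \<le> u\<close> \<open>v \<le> b\<close> show ?thesis by auto
      qed
      then show ?thesis by blast
    qed
    show "0 \<le> \<phi>'' y" if "y \<in> {u..v}" for y
      using pos[of y] that \<open>a \<le> u\<close> \<open>v \<le> b\<close> l by auto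
  qed (use that l d1 d2 in auto)
  have split: "norm (integral {u..v} (\<lambda>y. cis (\<phi> y))) \<le> norm (integral {u..w} (\<lambda>y. cis (\<phi> y))) + norm (integral {w..v} (\<lambda>y. cis (\<phi> y)))"
    if "a \<le> u" "u \<le> w" "w \<le> v" "v \<le> b" for u v w
  proof -
    have "(\<lambda>y. cis (\<phi> y)) integrable_on {u..v}"
      by (rule integrable_subinterval_real[OF int]) (use that in auto)
    from Henstock_Kurzweil_Integration.integral_combine[OF that(2,3) this] show ?thesis by (metis norm_triangle_ineq)
  qed
  have right: "norm (integral {u..b} (\<lambda>y. cis (\<phi> y))) \<le> 3 * d" if "a \<le> u" "u \<le> b" "0 \<le> \<phi>' u" for u
  proof (cases "b \<le> u + d")
    case True
    with triv[of u b] that d show ?thesis by auto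
  next
    case False
    have "sqrt l \<le> \<phi>' (u + d)" using grow[of u "u + d"] that d False by auto
    with first[of "u + d" b] triv[of u "u + d"] split[of u "u + d" b] that d False show ?thesis by auto
  qed
  have left: "norm (integral {a..v} (\<lambda>y. cis (\<phi> y))) \<le> 3 * d" if "a \<le> v" "v \<le> b" "\<phi>' v \<le> 0" for v
  proof (cases "v \<le> a + d")
    case True
    with triv[of a v] that d show ?thesis by auto
  next
    case False
    have "\<phi>' (v - d) \<le> - sqrt l" using grow[of "v - d" v] that d False by auto
    with first[of a "v - d"] triv[of "v - d" v] split[of a "v - d" v] that d False show ?thesis by auto
  qed
  have "norm (integral {a..b} (\<lambda>y. cis (\<phi> y))) \<le> 6 * d"
  proof -
    consider "0 \<le> \<phi>' a" | "\<phi>' b \<le> 0" | "\<phi>' a \<le> 0" "0 \<le> \<phi>' b" by linarith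
    then show ?thesis
    proof cases
      case 1 then show ?thesis using right[of a] ab d by auto
    next
      case 2 then show ?thesis using left[of b] ab d by auto
    next
      case 3
      then obtain c where "a \<le> c" "c \<le> b" "\<phi>' c = 0" using IVT'[of \<phi>' a 0 b] c2 ab by auto
      then show ?thesis using left[of c] right[of c] split[of a c b] ab d by auto
    qed
  qed
  then show ?thesis by (simp add: d_def)
qed

text \<open>Integration by parts moves the derivative to the weight. The unweighted primitive is
  bounded by C = 6 / sqrt l and w decreases, so the total is at most C w(b) + C (w(a) -
  w(b)).\<close>

lemma van_der_Corput_weighted:
  fixes \<phi> \<phi>' \<phi>'' w w' :: "real \<Rightarrow> real"
  assumes ab: "a \<le> b" and l: "l > 0"
    and d1: "\<And>y. y \<in> {a..b} \<Longrightarrow> (\<phi> has_real_derivative \<phi>' y) (at y)"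
    and d2: "\<And>y. y \<in> {a..b} \<Longrightarrow> (\<phi>' has_real_derivative \<phi>'' y) (at y)"
    and pos: "\<And>y. y \<in> {a..b} \<Longrightarrow> l \<le> \<phi>'' y"
    and w: "\<And>y. y \<in> {a..b} \<Longrightarrow> (w has_real_derivative w' y) (at y)"
      "\<And>y. y \<in> {a..b} \<Longrightarrow> w' y \<le> 0" "0 \<le> w b"
  shows "norm (integral {a..b} (\<lambda>y. w y *\<^sub>R cis (\<phi> y))) \<le> 6 / sqrt l * w a"
proof (cases "a = b")
  case True
  then show ?thesis using w l by simp
next
  case False
  then have ab: "a < b" using ab by simp
  define C where "C = 6 / sqrt l"
  define P where "P = (\<lambda>y. integral {a..y} (\<lambda>y. w y *\<^sub>R cis (\<phi> y)))"
  define E where "E = (\<lambda>y. integral {a..y} (\<lambda>y. cis (\<phi> y)))"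
  have E: "norm (E y) \<le> C" if "y \<in> {a..b}" for y
    unfolding E_def C_def by (rule van_der_Corput_second[where \<phi>'=\<phi>' and \<phi>''=\<phi>'']) (use that assms in auto)
  have c1: "continuous_on {a..b} \<phi>" 
    using d1 by (meson DERIV_isCont continuous_at_imp_continuous_on)
  have cw: "continuous_on {a..b} w" 
    using w by (meson DERIV_isCont continuous_at_imp_continuous_on)
  have P': "(P has_vector_derivative w y *\<^sub>R cis (\<phi> y)) (at y within {a..b})" if "y \<in> {a..b}" for y
    unfolding P_def by (rule integral_has_vector_derivative[OF _ that]) (intro continuous_intros c1 cw)
  have E': "(E has_vector_derivative cis (\<phi> y)) (at y within {a..b})" if "y \<in> {a..b}" for y
    unfolding E_def by (rule integral_has_vector_derivative[OF _ that]) (intro continuous_intros c1)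
  have cP: "continuous_on {a..b} P"
    using P' by (meson continuous_on_eq_continuous_within has_vector_derivative_continuous)
  have cE: "continuous_on {a..b} E"
    using E' by (meson continuous_on_eq_continuous_within has_vector_derivative_continuous)
  have "norm ((P b - w b *\<^sub>R E b) - (P a - w a *\<^sub>R E a)) \<le> - (C * w b) - (- (C * w a))"
  proof (rule differentiable_bound_general[OF ab, where \<phi>="\<lambda>y. - (C * w y)" and \<phi>'="\<lambda>y. - (C * w' y)"
        and f="\<lambda>y. P y - w y *\<^sub>R E y" and f'="\<lambda>y. - (w' y *\<^sub>R E y)"])
    show "continuous_on {a..b} (\<lambda>y. P y - w y *\<^sub>R E y)" "continuous_on {a..b} (\<lambda>y. - (C * w y))"
      by (intro continuous_intros cP cE cw)+
    fix y assume y: "a < y" "y < b"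
    then have yy: "y \<in> {a..b}" by auto
    have "(P has_vector_derivative w y *\<^sub>R cis (\<phi> y)) (at y)" "(E has_vector_derivative cis (\<phi> y)) (at y)"
      using P'[OF yy] E'[OF yy] y by (auto simp: at_within_Icc_at)
    then have "((\<lambda>y. P y - w y *\<^sub>R E y) has_vector_derivative w y *\<^sub>R cis (\<phi> y) - (w y *\<^sub>R cis (\<phi> y) + w' y *\<^sub>R E y)) (at y)"
      using w(1)[OF yy] by (intro has_vector_derivative_diff has_vector_derivative_scaleR)
    then show "((\<lambda>y. P y - w y *\<^sub>R E y) has_vector_derivative - (w' y *\<^sub>R E y)) (at y)" by simp
    show "((\<lambda>y. - (C * w y)) has_vector_derivative - (C * w' y)) (at y)"
      using DERIV_minus[OF DERIV_cmult[OF w(1)[OF yy], of C]] by (simp add: has_real_derivative_iff_has_vector_derivative)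
    show "norm (- (w' y *\<^sub>R E y)) \<le> - (C * w' y)"
      using mult_left_mono[OF E[OF yy], of "- w' y"] w(2)[OF yy] by (simp add: mult_ac)
  qed
  then have "norm (P b - w b *\<^sub>R E b) \<le> C * w a - C * w b" by (simp add: P_def E_def)
  moreover have "norm (P b) \<le> norm (P b - w b *\<^sub>R E b) + norm (w b *\<^sub>R E b)"
    by (metis diff_add_cancel norm_triangle_ineq)
  moreover have "norm (w b *\<^sub>R E b) \<le> w b * C"
    using mult_left_mono[OF E[of b] w(3)] w(3) ab by simp
  ultimately show ?thesis by (simp add: P_def C_def)
qed

section \<open>Rotation of rays in a sector\<close>

text \<open>A Jordan-type estimate: the speed along the arc is at most r B exp (-\<kappa> \<omega>),
  whose integral over all angles is r B / \<kappa>, whatever \<delta>. The arc vanishes if \<kappa>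
  outgrows r or if r B tends to 0; both cases occur below.\<close>

lemma arc_bound:
  fixes f P :: "complex \<Rightarrow> complex"
  assumes P: "\<And>\<omega>. 0 \<le> \<omega> \<Longrightarrow> \<omega> \<le> \<delta> \<Longrightarrow> (P has_field_derivative f (of_real r * cis \<omega>)) (at (of_real r * cis \<omega>))"
    and f: "\<And>\<omega>. 0 \<le> \<omega> \<Longrightarrow> \<omega> \<le> \<delta> \<Longrightarrow> norm (f (of_real r * cis \<omega>)) \<le> B * exp (- (\<kappa> * \<omega>))"
    and *: "0 < \<delta>" "0 < \<kappa>" "0 \<le> r"
  shows "norm (P (of_real r * cis \<delta>) - P (of_real r)) \<le> r * B / \<kappa>"
proof -
  have "0 \<le> B" using order_trans[OF norm_ge_zero f[of 0]] * by simp
  have d: "((\<lambda>\<omega>. P (of_real r * cis \<omega>)) has_vector_derivative of_real r * (\<i> * cis \<omega>) * f (of_real r * cis \<omega>)) (at \<omega>)"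
    if "0 \<le> \<omega>" "\<omega> \<le> \<delta>" for \<omega>
    using field_vector_diff_chain_at[of "\<lambda>\<omega>. of_real r * cis \<omega>" _ \<omega> P, OF has_vector_derivative_mult_right[OF has_vector_derivative_cis[OF DERIV_ident]] P[OF that]]
    by (auto simp: o_def)
  have "norm (P (of_real r * cis \<delta>) - P (of_real r * cis 0)) \<le> - (r * B / \<kappa> * exp (- (\<kappa> * \<delta>))) - (- (r * B / \<kappa> * exp (- (\<kappa> * 0))))"
  proof (rule differentiable_bound_general[OF *(1), where f="\<lambda>\<omega>. P (of_real r * cis \<omega>)"
        and \<phi>="\<lambda>\<omega>. - (r * B / \<kappa> * exp (- (\<kappa> * \<omega>)))" and \<phi>'="\<lambda>\<omega>. r * (B * exp (- (\<kappa> * \<omega>)))"])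
    show "continuous_on {0..\<delta>} (\<lambda>\<omega>. P (of_real r * cis \<omega>))"
      using d by (intro continuous_at_imp_continuous_on ballI has_vector_derivative_continuous) auto
    fix \<omega> assume "0 < \<omega>" "\<omega> < \<delta>"
    then show "((\<lambda>\<omega>. P (of_real r * cis \<omega>)) has_vector_derivative of_real r * (\<i> * cis \<omega>) * f (of_real r * cis \<omega>)) (at \<omega>)"
      by (intro d) auto
    show "norm (of_real r * (\<i> * cis \<omega>) * f (of_real r * cis \<omega>)) \<le> r * (B * exp (- (\<kappa> * \<omega>)))"
      using f[of \<omega>] \<open>0 < \<omega>\<close> \<open>\<omega> < \<delta>\<close> * by (simp add: norm_mult mult_left_mono)
    show "((\<lambda>\<omega>. - (r * B / \<kappa> * exp (- (\<kappa> * \<omega>)))) has_vector_derivative r * (B * exp (- (\<kappa> * \<omega>)))) (at \<omega>)"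
      unfolding has_real_derivative_iff_has_vector_derivative[symmetric]
      using * by (auto intro!: derivative_eq_intros simp: field_simps)
  qed (use * in \<open>auto intro!: continuous_intros\<close>)
  also have "\<dots> \<le> r * B / \<kappa>" using * \<open>0 \<le> B\<close> by simp
  finally show ?thesis by simp
qed

text \<open>Cauchy's theorem for the boundary of an annular sector, by a primitive on the convex set
  \<open>S\<close>. Cutting out a neighbourhood of 0 (a > 0) admits integrands with a branch point
  there. \<open>B\<close> and \<kappa> depend on the radius because the two arcs vanish for
  different reasons.\<close>

lemma sector_rotation:
  fixes f :: "complex \<Rightarrow> complex"
  assumes S: "convex S" "open S" "f holomorphic_on S"
    and ab: "0 \<le> a" "a \<le> b" and \<delta>: "0 < \<delta>"
    and sect: "\<And>r \<omega>. a \<le> r \<Longrightarrow> r \<le> b \<Longrightarrow> 0 \<le> \<omega> \<Longrightarrow> \<omega> \<le> \<delta> \<Longrightarrow> of_real r * cis \<omega> \<in> S"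
    and \<kappa>: "0 < \<kappa> a" "0 < \<kappa> b"
    and bd: "\<And>r \<omega>. r \<in> {a, b} \<Longrightarrow> 0 \<le> \<omega> \<Longrightarrow> \<omega> \<le> \<delta> \<Longrightarrow> norm (f (of_real r * cis \<omega>)) \<le> B r * exp (- (\<kappa> r * \<omega>))"
  shows "norm (integral {a..b} (\<lambda>r. f (of_real r)) - integral {a..b} (\<lambda>r. cis \<delta> * f (of_real r * cis \<delta>)))
           \<le> a * B a / \<kappa> a + b * B b / \<kappa> b"
proof -
  obtain P where P: "\<And>z. z \<in> S \<Longrightarrow> (P has_field_derivative f z) (at z)"
    using holomorphic_convex_primitive'[OF S] at_within_open[OF _ S(2)] by metis
  have ray: "integral {a..b} (\<lambda>r. cis \<omega> * f (of_real r * cis \<omega>)) = P (of_real b * cis \<omega>) - P (of_real a * cis \<omega>)"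
    if "0 \<le> \<omega>" "\<omega> \<le> \<delta>" for \<omega>
  proof (rule integral_unique, rule fundamental_theorem_of_calculus[OF ab(2)])
    fix r assume r: "r \<in> {a..b}"
    have "((\<lambda>r. of_real r * cis \<omega>) has_vector_derivative (of_real 1 * cis \<omega>)) (at r)"
      by (intro has_vector_derivative_mult_left has_vector_derivative_of_real) (auto intro!: derivative_eq_intros)
    from field_vector_diff_chain_at[OF this P[OF sect]] r that
    show "((\<lambda>r. P (of_real r * cis \<omega>)) has_vector_derivative cis \<omega> * f (of_real r * cis \<omega>)) (at r within {a..b})"
      by (auto simp: o_def intro: has_vector_derivative_at_within)
  qed
  have arc: "norm (P (of_real r * cis \<delta>) - P (of_real r)) \<le> r * B r / \<kappa> r" if "r \<in> {a, b}" for r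
    by (rule arc_bound[where f=f]) (use that ab \<delta> \<kappa> bd[OF that] P sect in auto)
  have "integral {a..b} (\<lambda>r. f (of_real r)) - integral {a..b} (\<lambda>r. cis \<delta> * f (of_real r * cis \<delta>))
      = (P (of_real a * cis \<delta>) - P (of_real a)) - (P (of_real b * cis \<delta>) - P (of_real b))"
    using ray[of 0] ray[of \<delta>] \<delta> by simp
  then show ?thesis
    using norm_triangle_ineq4 arc[of a] arc[of b] by (smt (verit) insertI1 insertI2)
qed

section \<open>Differentiation of transforms in the space variable\<close>

text \<open>An explicit candidate for every derivative settles all iterates of \<open>deriv\<close>
  together, so \<open>deriv\<close> is never evaluated at its default value.\<close>

lemma times_differentiable_family:
  assumes "\<And>j x. j < m \<Longrightarrow> (F j has_real_derivative F (Suc j) x) (at x)"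
  shows "\<And>j. j \<le> m \<Longrightarrow> (deriv ^^ j) (F 0) = F j" "times_differentiable m (F 0)"
proof -
  show 1: "(deriv ^^ j) (F 0) = F j" if "j \<le> m" for j
    using that
  proof (induction j)
    case (Suc j)
    then have "(deriv ^^ Suc j) (F 0) = deriv (F j)" by simp
    also have "\<dots> = F (Suc j)" using assms[of j] Suc by (intro ext DERIV_imp_deriv) auto
    finally show ?case .
  qed simp
  show "times_differentiable m (F 0)"
    unfolding times_differentiable_def using 1 assms by (auto simp: real_differentiable_def)
qed

text \<open>
  For \<open>c = - \<i>\<close> this is an inverse Fourier transform with amplitude \<open>A\<close>; for \<open>c\<close> off the imaginary axis
  it is the same integral along a rotated ray. The index \<open>j\<close> counts derivatives in \<open>x\<close>.
\<close>
definition re_transform :: "(real \<Rightarrow> complex) \<Rightarrow> complex \<Rightarrow> nat \<Rightarrow> real \<Rightarrow> real" where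
  "re_transform A c j x = (LINT r|lborel. Re (A r * (c * of_real r) ^ j * exp (c * of_real (x * r))))"

text \<open>For y within distance 1 of x the exponential is at most exp ((|x| + 1) |Re c r|), hence
  the hypotheses for every B. On the imaginary axis that factor is 1; on a rotated ray the amplitude
  has to beat it.\<close>

lemma re_transform_derivative:
  assumes int: "\<And>B. integrable lborel (\<lambda>r. norm (A r) * \<bar>r\<bar> ^ j * exp (B * \<bar>Re c * r\<bar>))"
      "\<And>B. integrable lborel (\<lambda>r. norm (A r) * \<bar>r\<bar> ^ Suc j * exp (B * \<bar>Re c * r\<bar>))"
    and A[measurable]: "A \<in> borel_measurable borel"
  shows "(re_transform A c j has_real_derivative re_transform A c (Suc j) x) (at x)"
  unfolding re_transform_def
proof (rule has_field_derivative_lebesgue_integral(1)[where S="ball x 1"])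
  have expb: "norm (exp (c * complex_of_real (y * r))) \<le> exp ((\<bar>x\<bar> + 1) * \<bar>Re c * r\<bar>)" if "y \<in> ball x 1" for y r
  proof -
    have "Re c * r * y \<le> \<bar>Re c * r\<bar> * \<bar>y\<bar>" by (metis abs_ge_self abs_mult)
    also have "\<dots> \<le> \<bar>Re c * r\<bar> * (\<bar>x\<bar> + 1)" using that by (intro mult_left_mono) (auto simp: dist_norm)
    finally show ?thesis by (simp add: norm_exp_eq_Re mult_ac)
  qed
  show "integrable lborel (\<lambda>r. Re (A r * (c * of_real r) ^ j * exp (c * of_real (y * r))))" if "y \<in> ball x 1" for y
  proof (rule Bochner_Integration.integrable_bound)
    show "integrable lborel (\<lambda>r. norm c ^ j * (norm (A r) * \<bar>r\<bar> ^ j * exp ((\<bar>x\<bar> + 1) * \<bar>Re c * r\<bar>)))"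
      using int(1) by (rule integrable_mult_right)
    show "AE r in lborel. norm (Re (A r * (c * of_real r) ^ j * exp (c * of_real (y * r))))
        \<le> norm (norm c ^ j * (norm (A r) * \<bar>r\<bar> ^ j * exp ((\<bar>x\<bar> + 1) * \<bar>Re c * r\<bar>)))"
    proof (rule AE_I2)
      fix r
      have "norm (Re (A r * (c * of_real r) ^ j * exp (c * of_real (y * r)))) \<le> norm (A r * (c * of_real r) ^ j * exp (c * of_real (y * r)))"
        unfolding real_norm_def by (rule abs_Re_le_cmod)
      also have "\<dots> = norm (A r) * (norm c * \<bar>r\<bar>) ^ j * norm (exp (c * of_real (y * r)))"
        by (simp only: norm_mult norm_power norm_of_real)
      also have "\<dots> \<le> norm (A r) * (norm c * \<bar>r\<bar>) ^ j * exp ((\<bar>x\<bar> + 1) * \<bar>Re c * r\<bar>)"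
        using expb[OF that] by (intro mult_left_mono) auto
      finally show "norm (Re (A r * (c * of_real r) ^ j * exp (c * of_real (y * r))))
        \<le> norm (norm c ^ j * (norm (A r) * \<bar>r\<bar> ^ j * exp ((\<bar>x\<bar> + 1) * \<bar>Re c * r\<bar>)))"
        by (simp add: power_mult_distrib mult_ac abs_mult)
    qed
  qed simp
  show "integrable lborel (\<lambda>r. norm c ^ Suc j * (norm (A r) * \<bar>r\<bar> ^ Suc j * exp ((\<bar>x\<bar> + 1) * \<bar>Re c * r\<bar>)))"
    using int(2) by (rule integrable_mult_right)
  show "((\<lambda>y. Re (A r * (c * of_real r) ^ j * exp (c * of_real (y * r)))) has_real_derivative
        Re (A r * (c * of_real r) ^ Suc j * exp (c * of_real (y * r)))) (at y)" for y r
  proof -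
    have "((\<lambda>z. A r * (c * of_real r) ^ j * exp (c * (z * of_real r))) has_field_derivative
        A r * (c * of_real r) ^ Suc j * exp (c * (of_real y * of_real r))) (at (of_real y))"
      by (auto intro!: derivative_eq_intros)
    from has_vector_derivative_real_field[OF this]
    have "((\<lambda>y. A r * (c * of_real r) ^ j * exp (c * (of_real y * of_real r))) has_vector_derivative
        A r * (c * of_real r) ^ Suc j * exp (c * (of_real y * of_real r))) (at y)" by simp
    from bounded_linear.has_vector_derivative[OF bounded_linear_Re this]
    show ?thesis by (simp add: has_real_derivative_iff_has_vector_derivative)
  qed
  show "norm (Re (A r * (c * of_real r) ^ Suc j * exp (c * of_real (y * r))))
        \<le> norm c ^ Suc j * (norm (A r) * \<bar>r\<bar> ^ Suc j * exp ((\<bar>x\<bar> + 1) * \<bar>Re c * r\<bar>))" if "y \<in> ball x 1" for y r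
  proof -
    have "norm (Re (A r * (c * of_real r) ^ Suc j * exp (c * of_real (y * r)))) \<le> norm (A r * (c * of_real r) ^ Suc j * exp (c * of_real (y * r)))"
      unfolding real_norm_def by (rule abs_Re_le_cmod)
    also have "\<dots> = norm (A r) * (norm c * \<bar>r\<bar>) ^ Suc j * norm (exp (c * of_real (y * r)))"
      by (simp only: norm_mult norm_power norm_of_real)
    also have "\<dots> \<le> norm (A r) * (norm c * \<bar>r\<bar>) ^ Suc j * exp ((\<bar>x\<bar> + 1) * \<bar>Re c * r\<bar>)"
      using expb[OF that] by (intro mult_left_mono) auto
    finally show ?thesis by (simp add: power_mult_distrib mult_ac del: power_Suc)
  qed
qed auto

section \<open>Fourier inversion\<close>

lemma integrable_lborel_product:
  fixes f g :: "real \<Rightarrow> real"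
  assumes f: "integrable lborel f" and g: "integrable lborel g"
  shows "integrable (lborel \<Otimes>\<^sub>M lborel) (\<lambda>(x, y). f x * g y)"
proof (rule lborel_pair.Fubini_integrable)
  have [measurable]: "f \<in> borel_measurable borel" "g \<in> borel_measurable borel" using f g by auto
  show "(\<lambda>(x, y). f x * g y) \<in> borel_measurable (lborel \<Otimes>\<^sub>M lborel)" by measurable
  show "integrable lborel (\<lambda>x. LINT y|lborel. norm (case (x, y) of (x, y) \<Rightarrow> f x * g y))"
    using integrable_mult_left[OF integrable_norm[OF f], of "LINT y|lborel. \<bar>g y\<bar>"] by (simp add: abs_mult)
  show "AE x in lborel. integrable lborel (\<lambda>y. case (x, y) of (x, y) \<Rightarrow> f x * g y)"
    using g by simp
qed

lemma integral_cis_std_normal: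
  "(LINT y|lborel. cis (t * y) * of_real (std_normal_density y)) = of_real (exp (- (t^2) / 2))"
proof -
  have "char std_normal_distribution t = (LINT y|lborel. std_normal_density y *\<^sub>R iexp (t * y))"
    unfolding char_def by (subst integral_density) auto
  then show ?thesis unfolding char_std_normal_distribution
    by (simp add: cis_conv_exp scaleR_conv_of_real mult_ac)
qed

text \<open>Gaussian summation: the factor exp (-(\<epsilon> x)^2 / 2) makes the double integral
  absolutely convergent, and Fubini turns the left side into an average of G against a normal law of
  width \<epsilon> around \<xi>. Integrability of g and boundedness of G dominate the two sides as
  \<epsilon> tends to 0.\<close>

lemma fourier_inversion:
  fixes G g :: "real \<Rightarrow> complex"
  assumes G: "integrable lborel G" "continuous_on UNIV G" "\<And>\<eta>. norm (G \<eta>) \<le> K"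
    and g: "integrable lborel g" "\<And>x. g x = (LINT \<eta>|lborel. cis (- (\<eta> * x)) * G \<eta>) / of_real (2 * pi)"
  shows "(LINT x|lborel. cis (\<xi> * x) * g x) = G \<xi>"
proof -
  note [measurable] = borel_measurable_continuous_onI[OF G(2)] borel_measurable_integrable[OF g(1)]
  define gs where "gs = (\<lambda>\<epsilon> x. cis (\<xi> * x) * (of_real (exp (- ((\<epsilon> * x)^2) / 2)) * g x))"
  have key: "(LINT x|lborel. gs \<epsilon> x) = (LINT v|lborel. G (\<xi> + \<epsilon> * v) * of_real (std_normal_density v))"
    if \<epsilon>: "\<epsilon> > 0" for \<epsilon> :: real
  proof -
    have gi: "integrable lborel (\<lambda>x. exp (- ((\<epsilon> * x)^2) / 2))"
    proof -
      have "integrable lborel (\<lambda>x. std_normal_density (0 + \<epsilon> * x))"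
        by (rule lborel_integrable_real_affine) (use \<epsilon> in auto)
      then have "integrable lborel (\<lambda>x. sqrt (2 * pi) * std_normal_density (0 + \<epsilon> * x))" by (rule integrable_mult_right)
      then show ?thesis by (simp add: std_normal_density_def)
    qed
    define H where "H = (\<lambda>x \<eta>. cis ((\<xi> - \<eta>) * x) * of_real (exp (- ((\<epsilon> * x)^2) / 2)) * G \<eta>)"
    have Hi: "integrable (lborel \<Otimes>\<^sub>M lborel) (\<lambda>(x, \<eta>). H x \<eta>)"
    proof (rule Bochner_Integration.integrable_bound)
      show "integrable (lborel \<Otimes>\<^sub>M lborel) (\<lambda>(x, \<eta>). exp (- ((\<epsilon> * x)^2) / 2) *\<^sub>R norm (G \<eta>))"
        using integrable_lborel_product[OF gi integrable_norm[OF G(1)]] by simp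
    qed (auto simp: H_def norm_mult split_beta)
    have "(LINT x|lborel. gs \<epsilon> x) = (LINT x|lborel. LINT \<eta>|lborel. H x \<eta>) / of_real (2 * pi)"
    proof -
      have "gs \<epsilon> x = (LINT \<eta>|lborel. H x \<eta>) / of_real (2 * pi)" for x
      proof -
        have "H x \<eta> = (cis (\<xi> * x) * of_real (exp (- ((\<epsilon> * x)^2) / 2))) * (cis (- (\<eta> * x)) * G \<eta>)" for \<eta>
        proof -
          have "cis ((\<xi> - \<eta>) * x) = cis (\<xi> * x) * cis (- (\<eta> * x))" by (simp add: cis_mult algebra_simps)
          then show ?thesis unfolding H_def by (simp only: mult_ac)
        qed
        then have "(LINT \<eta>|lborel. H x \<eta>) = (cis (\<xi> * x) * of_real (exp (- ((\<epsilon> * x)^2) / 2))) * (LINT \<eta>|lborel. cis (- (\<eta> * x)) * G \<eta>)"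
          by simp
        then show ?thesis by (simp add: gs_def g(2) mult_ac)
      qed
      then show ?thesis by simp
    qed
    also have "(LINT x|lborel. LINT \<eta>|lborel. H x \<eta>) = (LINT \<eta>|lborel. LINT x|lborel. H x \<eta>)"
      by (rule lborel_pair.Fubini_integral[symmetric, OF Hi])
    also have "\<dots> = (LINT \<eta>|lborel. of_real (sqrt (2 * pi) / \<epsilon> * exp (- (((\<xi> - \<eta>) / \<epsilon>)^2) / 2)) * G \<eta>)"
    proof (rule Bochner_Integration.integral_cong[OF refl])
      fix \<eta>
      have "(LINT x|lborel. cis ((\<xi> - \<eta>) * x) * of_real (exp (- ((\<epsilon> * x)^2) / 2)))
         = \<bar>1 / \<epsilon>\<bar> *\<^sub>R (LINT y|lborel. cis ((\<xi> - \<eta>) * (0 + 1 / \<epsilon> * y)) * of_real (exp (- ((\<epsilon> * (0 + 1 / \<epsilon> * y))^2) / 2)))"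
        by (rule lborel_integral_real_affine) (use \<epsilon> in auto)
      also have "(LINT y|lborel. cis ((\<xi> - \<eta>) * (0 + 1 / \<epsilon> * y)) * of_real (exp (- ((\<epsilon> * (0 + 1 / \<epsilon> * y))^2) / 2)))
          = (LINT y|lborel. of_real (sqrt (2 * pi)) * (cis ((\<xi> - \<eta>) / \<epsilon> * y) * of_real (std_normal_density y)))"
        using \<epsilon> by (intro Bochner_Integration.integral_cong) (auto simp: std_normal_density_def field_simps)
      also have "\<dots> = of_real (sqrt (2 * pi)) * of_real (exp (- (((\<xi> - \<eta>) / \<epsilon>)^2) / 2))"
        using integral_cis_std_normal[of "(\<xi> - \<eta>) / \<epsilon>"] by simp
      finally show "(LINT x|lborel. H x \<eta>) = of_real (sqrt (2 * pi) / \<epsilon> * exp (- (((\<xi> - \<eta>) / \<epsilon>)^2) / 2)) * G \<eta>"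
        using \<epsilon> by (simp add: H_def scaleR_conv_of_real)
    qed
    \<comment> \<open>The substitution \<eta> = \<xi> + \<epsilon> v moves all dependence on
      \<epsilon> into the argument of G, with a fixed normal density.\<close>
    also have "\<dots> = \<bar>\<epsilon>\<bar> *\<^sub>R (LINT v|lborel. of_real (sqrt (2 * pi) / \<epsilon> * exp (- (((\<xi> - (\<xi> + \<epsilon> * v)) / \<epsilon>)^2) / 2)) * G (\<xi> + \<epsilon> * v))"
      by (rule lborel_integral_real_affine) (use \<epsilon> in auto)
    also have "\<dots> = \<epsilon> *\<^sub>R (LINT v|lborel. of_real (2 * pi / \<epsilon>) * (G (\<xi> + \<epsilon> * v) * of_real (std_normal_density v)))"
    proof -
      have e: "of_real (sqrt (2 * pi) / \<epsilon> * exp (- (((\<xi> - (\<xi> + \<epsilon> * v)) / \<epsilon>)^2) / 2)) * G (\<xi> + \<epsilon> * v)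
          = of_real (2 * pi / \<epsilon>) * (G (\<xi> + \<epsilon> * v) * of_real (std_normal_density v))" for v
      proof -
        have "sqrt (2 * pi) / \<epsilon> * exp (- (((\<xi> - (\<xi> + \<epsilon> * v)) / \<epsilon>)^2) / 2) = 2 * pi / \<epsilon> * std_normal_density v"
          using \<epsilon> by (simp add: std_normal_density_def field_simps flip: power2_eq_square)
        then show ?thesis by (metis (no_types, lifting) mult.assoc mult.commute of_real_mult)
      qed
      show ?thesis using \<epsilon> by (simp only: e abs_of_pos)
    qed
    also have "\<dots> / of_real (2 * pi) = (LINT v|lborel. G (\<xi> + \<epsilon> * v) * of_real (std_normal_density v))"
      using \<epsilon> by (simp add: scaleR_conv_of_real)
    finally show ?thesis .
  qed
  have l1: "((\<lambda>\<epsilon>. LINT x|lborel. gs \<epsilon> x) \<longlongrightarrow> (LINT x|lborel. cis (\<xi> * x) * g x)) (at_right 0)"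
  proof (rule tendsto_lebesgue_integral_within[where g="\<lambda>x. norm (g x)"])
    have "((\<lambda>\<epsilon>. gs \<epsilon> x) \<longlongrightarrow> cis (\<xi> * x) * (of_real (exp (- ((0 * x)^2) / 2)) * g x)) (at_right 0)" for x
      unfolding gs_def by (intro tendsto_intros) auto
    then show "AE x in lborel. ((\<lambda>\<epsilon>. gs \<epsilon> x) \<longlongrightarrow> cis (\<xi> * x) * g x) (at_right 0)" by simp
  qed (use g(1) in \<open>auto simp: gs_def norm_mult intro!: mult_left_le_one_le\<close>)
  have l2: "((\<lambda>\<epsilon>. LINT v|lborel. G (\<xi> + \<epsilon> * v) * of_real (std_normal_density v)) \<longlongrightarrow> (LINT v|lborel. G \<xi> * of_real (std_normal_density v))) (at_right 0)"
  proof (rule tendsto_lebesgue_integral_within[where g="\<lambda>x. K * std_normal_density x"])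
    have "((\<lambda>\<epsilon>. G (\<xi> + \<epsilon> * v)) \<longlongrightarrow> G \<xi>) (at_right 0)" for v
    proof -
      have "isCont G \<xi>" using G(2) by (simp add: continuous_on_eq_continuous_at)
      moreover have "((\<lambda>\<epsilon>. \<xi> + \<epsilon> * v) \<longlongrightarrow> \<xi> + 0 * v) (at_right 0)" by (intro tendsto_intros)
      ultimately show ?thesis by (auto intro: isCont_tendsto_compose)
    qed
    then show "AE v in lborel. ((\<lambda>\<epsilon>. G (\<xi> + \<epsilon> * v) * of_real (std_normal_density v)) \<longlongrightarrow> G \<xi> * of_real (std_normal_density v)) (at_right 0)"
      by (intro AE_I2 tendsto_intros)
  qed (use G in \<open>auto simp: norm_mult intro!: mult_right_mono integrable_mult_right\<close>)
  have "((\<lambda>\<epsilon>. LINT x|lborel. gs \<epsilon> x) \<longlongrightarrow> (LINT v|lborel. G \<xi> * of_real (std_normal_density v))) (at_right 0)"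
    by (rule Lim_transform_eventually[OF l2]) (auto simp: key eventually_at_filter)
  from tendsto_unique[OF _ l1 this] show ?thesis by simp
qed

text \<open>The positive and negative parts have equal transforms, in particular equal mass c. If c
  > 0, division by c makes both probability densities, and Levy's uniqueness theorem for
  characteristic functions applies.\<close>

lemma fourier_eq_0_imp_AE_eq_0:
  fixes f :: "real \<Rightarrow> real"
  assumes f: "integrable lborel f" and 0: "\<And>\<xi>. fourier f \<xi> = 0"
  shows "AE x in lborel. f x = 0"
proof -
  have [measurable]: "f \<in> borel_measurable borel" using f by auto
  define p q where "p = (\<lambda>x. max 0 (f x))" and "q = (\<lambda>x. max 0 (- f x))"
  have [measurable]: "p \<in> borel_measurable borel" "q \<in> borel_measurable borel" by (auto simp: p_def q_def)
  have pq: "integrable lborel p" "integrable lborel q" "\<And>x. f x = p x - q x" "\<And>x. 0 \<le> p x" "\<And>x. 0 \<le> q x"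
    using f by (auto simp: p_def q_def)
  have eq: "(LINT x|lborel. cis (\<xi> * x) * of_real (p x)) = (LINT x|lborel. cis (\<xi> * x) * of_real (q x))" for \<xi>
  proof -
    have "integrable lborel (\<lambda>x. cis (\<xi> * x) * of_real (p x))" "integrable lborel (\<lambda>x. cis (\<xi> * x) * of_real (q x))"
      by (rule Bochner_Integration.integrable_bound[OF pq(1)], use pq in \<open>auto simp: norm_mult\<close>)
         (rule Bochner_Integration.integrable_bound[OF pq(2)], use pq in \<open>auto simp: norm_mult\<close>)
    then have "fourier f \<xi> = (LINT x|lborel. cis (\<xi> * x) * of_real (p x)) - (LINT x|lborel. cis (\<xi> * x) * of_real (q x))"
      unfolding fourier_def pq(3) by (simp add: right_diff_distrib)
    with 0 show ?thesis by simp
  qed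
  define c where "c = (LINT x|lborel. p x)"
  have c: "c = (LINT x|lborel. q x)" using eq[of 0] by (simp add: c_def)
  show ?thesis
  proof (cases "c = 0")
    case True
    then have "AE x in lborel. p x = 0" "AE x in lborel. q x = 0"
      using integral_nonneg_eq_0_iff_AE[OF pq(1)] integral_nonneg_eq_0_iff_AE[OF pq(2)] pq c by (auto simp: c_def)
    then show ?thesis by eventually_elim (simp add: pq)
  next
    case False
    then have cpos: "c > 0" using Bochner_Integration.integral_nonneg[of lborel p] pq by (auto simp: c_def less_le)
    have dist: "real_distribution (density lborel (\<lambda>x. ennreal (r x / c)))"
      if "integrable lborel r" "\<And>x. 0 \<le> r x" "c = (LINT x|lborel. r x)" for r
    proof -
      have [measurable]: "r \<in> borel_measurable borel" using that(1) by auto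
      have "emeasure (density lborel (\<lambda>x. ennreal (r x / c))) UNIV = (\<integral>\<^sup>+x. ennreal (r x / c) \<partial>lborel)"
        by (simp add: emeasure_density)
      also have "\<dots> = ennreal (LINT x|lborel. r x / c)"
        using that cpos by (intro nn_integral_eq_integral) auto
      also have "\<dots> = 1" using that(3) cpos by simp
      finally have "prob_space (density lborel (\<lambda>x. ennreal (r x / c)))" by (intro prob_spaceI) simp
      then show ?thesis by (simp add: real_distribution_def real_distribution_axioms_def)
    qed
    have ch: "char (density lborel (\<lambda>x. ennreal (r x / c))) t = (LINT x|lborel. cis (t * x) * of_real (r x)) / of_real c"
      if "integrable lborel r" "\<And>x. 0 \<le> r x" for r t
    proof -
      have [measurable]: "r \<in> borel_measurable borel" using that(1) by auto
      have "char (density lborel (\<lambda>x. ennreal (r x / c))) t = (LINT x|lborel. (r x / c) *\<^sub>R iexp (t * x))"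
        unfolding char_def using that cpos by (subst integral_density) auto
      also have "\<dots> = (LINT x|lborel. (cis (t * x) * of_real (r x)) / of_real c)"
        by (simp add: cis_conv_exp scaleR_conv_of_real mult_ac)
      finally show ?thesis by simp
    qed
    have "char (density lborel (\<lambda>x. ennreal (p x / c))) = char (density lborel (\<lambda>x. ennreal (q x / c)))"
      by (rule ext) (simp only: ch[OF pq(1) pq(4)] ch[OF pq(2) pq(5)] eq)
    then have "density lborel (\<lambda>x. ennreal (p x / c)) = density lborel (\<lambda>x. ennreal (q x / c))"
      by (intro Levy_uniqueness dist pq c) (auto simp: c_def)
    then have "AE x in lborel. ennreal (p x / c) = ennreal (q x / c)"
      by (subst (asm) sigma_finite_measure.density_unique_iff[OF sigma_finite_lborel]) auto
    then show ?thesis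
      by eventually_elim (use cpos pq in \<open>auto simp: divide_right_mono\<close>)
  qed
qed

lemma set_lebesgue_integral_eq_integral:
  fixes f :: "real \<Rightarrow> 'a::euclidean_space"
  assumes "continuous_on {a..b} f"
  shows "(LINT x:{a..b}|lborel. f x) = integral {a..b} f"
  using set_borel_integral_eq_integral(2)[OF borel_integrable_atLeastAtMost'[OF assms]] .

lemma integral_symmetric_interval:
  fixes f :: "real \<Rightarrow> 'a::euclidean_space"
  assumes f: "continuous_on UNIV f" and ab: "0 \<le> a" "a \<le> b"
  shows "integral {-b..b} f = integral {-a..a} f + integral {a..b} (\<lambda>x. f x + f (- x))"
proof -
  have i: "f integrable_on {u..v}" for u v
    by (intro integrable_continuous_interval continuous_on_subset[OF f]) auto
  have c: "continuous_on {a..b} (\<lambda>x. f (- x))"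
    using continuous_on_compose2[OF f, of "{a..b}" uminus] by (simp add: continuous_on_minus)
  have "integral {-b..b} f = integral {-b..-a} f + integral {-a..b} f"
    using Henstock_Kurzweil_Integration.integral_combine[of "-b" "-a" b f] ab i by simp
  also have "integral {-a..b} f = integral {-a..a} f + integral {a..b} f"
    using Henstock_Kurzweil_Integration.integral_combine[of "-a" a b f] ab i by simp
  also have "integral {-b..-a} f = integral {a..b} (\<lambda>x. f (- x))"
    using Henstock_Kurzweil_Integration.integral_reflect_real[of b a "\<lambda>x. f (- x)"] by simp
  finally have 1: "integral {-b..b} f = integral {a..b} (\<lambda>x. f (- x)) + (integral {-a..a} f + integral {a..b} f)" .
  have "integral {a..b} (\<lambda>x. f x + f (- x)) = integral {a..b} f + integral {a..b} (\<lambda>x. f (- x))"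
    by (intro Henstock_Kurzweil_Integration.integral_add i integrable_continuous_interval c)
  with 1 show ?thesis by simp
qed

section \<open>The pseudoprocess of odd order\<close>

text \<open>The expression under \<open>Lim\<close> in \<open>odd_order_law\<close>. Bounds on it
  uniform in \<open>R\<close> stand in for the absolute convergence that fails.\<close>

definition odd_partial :: "nat \<Rightarrow> real \<Rightarrow> real \<Rightarrow> real \<Rightarrow> real" where
  "odd_partial k x s R = 1 / (2 * pi) * (LINT \<xi>:{-R..R}|lborel. cos (\<xi> * x + s * \<xi> ^ (2 * k + 1)))"

lemma odd_partial_eq: "odd_partial k x s R = 1 / (2 * pi) * integral {-R..R} (\<lambda>\<xi>. cos (\<xi> * x + s * \<xi> ^ (2 * k + 1)))"
  unfolding odd_partial_def by (subst set_lebesgue_integral_eq_integral) (auto intro!: continuous_intros)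

text \<open>The phase is odd, so its cosine is even and the interval folds. The summand 0 fits the
  phase to the shape with linear coefficient \<open>c1\<close> and constant \<open>c0\<close> used
  in the van der Corput bounds.\<close>

lemma odd_partial_eq_half:
  assumes "0 \<le> R"
  shows "odd_partial k x s R = 1 / pi * Re (integral {0..R} (\<lambda>\<xi>. cis (s * \<xi> ^ (2 * k + 1) + x * \<xi> + 0)))"
proof -
  have "integral {-R..R} (\<lambda>\<xi>. cos (\<xi> * x + s * \<xi> ^ (2 * k + 1))) =
      integral {0..R} (\<lambda>\<xi>. cos (\<xi> * x + s * \<xi> ^ (2 * k + 1)) + cos (- \<xi> * x + s * (- \<xi>) ^ (2 * k + 1)))"
    by (subst integral_symmetric_interval[of _ 0 R]) (use assms in \<open>auto intro!: continuous_intros\<close>)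
  also have "\<dots> = integral {0..R} (\<lambda>\<xi>. 2 *\<^sub>R Re (cis (s * \<xi> ^ (2 * k + 1) + x * \<xi> + 0)))"
  proof (rule Henstock_Kurzweil_Integration.integral_cong)
    fix \<xi> :: real
    have "cos (- \<xi> * x + s * (- \<xi>) ^ (2 * k + 1)) = cos (- (\<xi> * x + s * \<xi> ^ (2 * k + 1)))"
      by (simp add: algebra_simps)
    then show "cos (\<xi> * x + s * \<xi> ^ (2 * k + 1)) + cos (- \<xi> * x + s * (- \<xi>) ^ (2 * k + 1)) = 2 *\<^sub>R Re (cis (s * \<xi> ^ (2 * k + 1) + x * \<xi> + 0))"
      by (simp only: cos_minus) (simp add: algebra_simps)
  qed
  also have "\<dots> = 2 * integral {0..R} (\<lambda>\<xi>. Re (cis (s * \<xi> ^ (2 * k + 1) + x * \<xi> + 0)))"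
    by (subst Henstock_Kurzweil_Integration.integral_cmul) simp
  also have "integral {0..R} (\<lambda>\<xi>. Re (cis (s * \<xi> ^ (2 * k + 1) + x * \<xi> + 0))) = Re (integral {0..R} (\<lambda>\<xi>. cis (s * \<xi> ^ (2 * k + 1) + x * \<xi> + 0)))"
    by (rule integral_linear[of _ _ Re, unfolded o_def]) (auto intro!: integrable_continuous_interval continuous_intros bounded_linear_Re)
  finally show ?thesis unfolding odd_partial_eq by simp
qed

text \<open>The second derivative vanishes at 0, so the lower bound s starts at y = 1, where
  (2k+1)(2k) y^(2k-1) \<ge> 1; the bounded piece [0, 1] is treated separately.\<close>

lemma odd_phase_derivatives:
  fixes s c1 c0 y :: real
  assumes "1 \<le> k"
  shows "((\<lambda>y. s * y ^ (2 * k + 1) + c1 * y + c0) has_real_derivative s * (2 * k + 1) * y ^ (2 * k) + c1) (at y)"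
    and "((\<lambda>y. s * (2 * k + 1) * y ^ (2 * k) + c1) has_real_derivative s * (2 * k + 1) * (2 * k) * y ^ (2 * k - 1)) (at y)"
    and "0 < s \<Longrightarrow> 1 \<le> y \<Longrightarrow> s \<le> s * (2 * k + 1) * (2 * k) * y ^ (2 * k - 1)"
proof -
  assume s: "0 < s" "1 \<le> y"
  have "1 * 1 * 1 \<le> real (2 * k + 1) * real (2 * k) * y ^ (2 * k - 1)"
    using s assms by (intro mult_mono) (auto simp: one_le_power)
  then have "s * 1 \<le> s * (real (2 * k + 1) * real (2 * k) * y ^ (2 * k - 1))"
    using s by (intro mult_left_mono) auto
  then show "s \<le> s * (2 * k + 1) * (2 * k) * y ^ (2 * k - 1)" by (simp add: mult_ac)
next
  have "((\<lambda>y. y ^ (2 * k + 1)) has_real_derivative real (2 * k + 1) * y ^ (2 * k)) (at y)"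
    using DERIV_pow[of "2 * k + 1" y UNIV] by simp
  note DERIV_add[OF DERIV_add[OF DERIV_cmult[OF this, of s] DERIV_cmult_Id[of c1]] DERIV_const[of c0]]
  then show "((\<lambda>y. s * y ^ (2 * k + 1) + c1 * y + c0) has_real_derivative s * (2 * k + 1) * y ^ (2 * k) + c1) (at y)"
    by (simp add: mult_ac)
  have "((\<lambda>y. y ^ (2 * k)) has_real_derivative real (2 * k) * y ^ (2 * k - 1)) (at y)"
    using DERIV_pow[of "2 * k" y UNIV] by simp
  note DERIV_add[OF DERIV_cmult[OF this, of "s * (2 * k + 1)"] DERIV_const[of c1]]
  then show "((\<lambda>y. s * (2 * k + 1) * y ^ (2 * k) + c1) has_real_derivative s * (2 * k + 1) * (2 * k) * y ^ (2 * k - 1)) (at y)"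
    by (simp add: algebra_simps)
qed

text \<open>
  Only the second derivative of the phase enters, so the bound is uniform in the linear term.
\<close>
lemma odd_phase_bound:
  assumes "1 \<le> k" "0 < s" "1 \<le> a" "a \<le> b"
  shows "norm (integral {a..b} (\<lambda>y. cis (s * y ^ (2 * k + 1) + c1 * y + c0))) \<le> 6 / sqrt s"
  by (rule van_der_Corput_second[OF assms(4,2) odd_phase_derivatives(1)[OF assms(1)] odd_phase_derivatives(2)[OF assms(1)] odd_phase_derivatives(3)[OF assms(1,2)]])
     (use assms in auto)

text \<open>The weight is the amplitude of the Dirichlet kernel away from its peak \<zeta>, and it
  decreases to the right of \<zeta>.\<close>

lemma odd_phase_bound_weighted:
  assumes "1 \<le> k" "0 < s" "1 \<le> a" "a \<le> b" "\<zeta> < a"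
  shows "norm (integral {a..b} (\<lambda>y. (1 / (y - \<zeta>)) *\<^sub>R cis (s * y ^ (2 * k + 1) + c1 * y + c0))) \<le> 6 / sqrt s * (1 / (a - \<zeta>))"
proof (rule van_der_Corput_weighted[OF assms(4,2) odd_phase_derivatives(1)[OF assms(1)] odd_phase_derivatives(2)[OF assms(1)] odd_phase_derivatives(3)[OF assms(1,2)],
    where w'="\<lambda>y. - (1 / (y - \<zeta>)^2)"])
  fix y assume "y \<in> {a..b}"
  then show "((\<lambda>y. 1 / (y - \<zeta>)) has_real_derivative - (1 / (y - \<zeta>)^2)) (at y)"
    using assms by (auto intro!: derivative_eq_intros simp: power2_eq_square)
qed (use assms in auto)

text \<open>The half-line integral is at most 1 on [0, 1] by its length and at most 6 on [1, R] by
  van der Corput; 7 / \<pi> is below 3.\<close>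

lemma odd_partial_bound_1:
  assumes "1 \<le> k"
  shows "\<bar>odd_partial k x 1 R\<bar> \<le> 3"
proof (cases "0 \<le> R")
  case False
  then show ?thesis by (simp add: odd_partial_def set_lebesgue_integral_def)
next
  case True
  let ?f = "\<lambda>\<xi>. cis (1 * \<xi> ^ (2 * k + 1) + x * \<xi> + 0)"
  have cont: "continuous_on S ?f" for S by (intro continuous_intros)
  have triv: "norm (integral {0..r} ?f) \<le> r" if "0 \<le> r" for r
    using integral_bound[OF that cont, of 1] by simp
  have "norm (integral {0..R} ?f) \<le> 7"
  proof (cases "R \<le> 1")
    case True
    then show ?thesis using triv[OF \<open>0 \<le> R\<close>] by simp
  next
    case False
    have "integral {0..R} ?f = integral {0..1} ?f + integral {1..R} ?f"
      by (rule Henstock_Kurzweil_Integration.integral_combine[OF _ _ integrable_continuous_interval[OF cont], symmetric]) (use False in auto)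
    moreover have "norm (integral {1..R} ?f) \<le> 6 / sqrt 1"
      by (rule odd_phase_bound) (use assms False in auto)
    ultimately show ?thesis using triv[of 1] norm_triangle_ineq[of "integral {0..1} ?f" "integral {1..R} ?f"] by simp
  qed
  then have "\<bar>Re (integral {0..R} ?f)\<bar> \<le> 7" using abs_Re_le_cmod order_trans by blast
  then have "\<bar>Re (integral {0..R} ?f)\<bar> / pi \<le> 7 / pi" by (intro divide_right_mono) auto
  also have "\<dots> \<le> 3" using pi_gt3 by (simp add: divide_le_eq)
  finally show ?thesis unfolding odd_partial_eq_half[OF True] by (simp add: abs_mult)
qed

text \<open>The dilation by c = s^(-1/(2k+1)) satisfies s c^(2k+1) = 1 and normalises the phase to s
  = 1.\<close>

lemma odd_partial_scaling:
  assumes "0 < s"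
  shows "odd_partial k x s R = s powr (- 1 / real (2 * k + 1)) * odd_partial k (x * s powr (- 1 / real (2 * k + 1))) 1 (R * s powr (1 / real (2 * k + 1)))"
proof -
  define c where "c = s powr (- 1 / real (2 * k + 1))"
  have c: "0 < c" "s powr (1 / real (2 * k + 1)) = 1 / c"
    using assms by (auto simp: c_def powr_minus_divide)
  have "c ^ (2 * k + 1) = c powr real (2 * k + 1)" using c(1) by (simp only: powr_realpow)
  also have "\<dots> = s powr (- 1 / real (2 * k + 1) * real (2 * k + 1))" unfolding c_def by (rule powr_powr)
  also have "- 1 / real (2 * k + 1) * real (2 * k + 1) = - 1" by (simp add: field_simps)
  finally have c3: "s * c ^ (2 * k + 1) = 1" using assms by (simp add: powr_minus_divide)
  have "(LINT \<xi>:{-R..R}|lborel. cos (\<xi> * x + s * \<xi> ^ (2 * k + 1)))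
    = (LINT \<xi>|lborel. indicator {-R..R} \<xi> *\<^sub>R cos (\<xi> * x + s * \<xi> ^ (2 * k + 1)))"
    by (simp add: set_lebesgue_integral_def)
  also have "\<dots> = \<bar>c\<bar> *\<^sub>R (LINT \<xi>|lborel. indicator {-R..R} (0 + c * \<xi>) *\<^sub>R cos ((0 + c * \<xi>) * x + s * (0 + c * \<xi>) ^ (2 * k + 1)))"
    by (rule lborel_integral_real_affine) (use c in auto)
  also have "(\<lambda>\<xi>. indicator {-R..R} (0 + c * \<xi>) *\<^sub>R cos ((0 + c * \<xi>) * x + s * (0 + c * \<xi>) ^ (2 * k + 1)))
      = (\<lambda>\<xi>. indicator {-(R / c)..R / c} \<xi> *\<^sub>R cos (\<xi> * (x * c) + 1 * \<xi> ^ (2 * k + 1)))"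
  proof
    fix \<xi>
    have "s * (c * \<xi>) ^ (2 * k + 1) = (s * c ^ (2 * k + 1)) * \<xi> ^ (2 * k + 1)" by (simp only: power_mult_distrib mult_ac)
    then have 1: "cos (c * \<xi> * x + s * (c * \<xi>) ^ (2 * k + 1)) = cos (\<xi> * (x * c) + 1 * \<xi> ^ (2 * k + 1))"
      by (simp only: c3) (simp only: mult_ac)
    have 2: "indicator {-R..R} (c * \<xi>) = (indicator {-(R / c)..R / c} \<xi> :: real)"
      using c(1) by (auto simp: indicator_def field_simps)
    show "indicator {-R..R} (0 + c * \<xi>) *\<^sub>R cos ((0 + c * \<xi>) * x + s * (0 + c * \<xi>) ^ (2 * k + 1))
      = indicator {-(R / c)..R / c} \<xi> *\<^sub>R cos (\<xi> * (x * c) + 1 * \<xi> ^ (2 * k + 1))"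
      unfolding add_0_left 1 2 ..
  qed
  finally have "odd_partial k x s R = c * odd_partial k (x * c) 1 (R / c)"
    unfolding odd_partial_def set_lebesgue_integral_def using c by simp
  then show ?thesis unfolding c_def[symmetric] c(2) by simp
qed

text \<open>The singularity at s = 0 is of the size of a negative moment of order 1/(2k+1), which
  the subordinator has.\<close>

lemma odd_partial_bound:
  assumes "1 \<le> k" "0 < s"
  shows "\<bar>odd_partial k x s R\<bar> \<le> 3 * s powr (- 1 / real (2 * k + 1))"
  unfolding odd_partial_scaling[OF assms(2)] abs_mult
  unfolding abs_of_nonneg[OF powr_ge_zero] mult.commute[of 3]
  by (rule mult_left_mono[OF odd_partial_bound_1[OF assms(1)] powr_ge_zero])

section \<open>The rotated integral, smoothness and the equation\<close>

text \<open>The direction in which z^(2k+1) is i r^(2k+1), so that exp (i s z^(2k+1)) becomes exp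
  (-s r^(2k+1)).\<close>

definition odd_ray :: "nat \<Rightarrow> complex" where
  "odd_ray k = cis (pi / (2 * (2 * k + 1)))"

text \<open>The factor \<open>odd_ray k\<close> is the Jacobian of the rotation, and 1 / \<pi> is 1
  / (2 \<pi>) doubled by folding the line.\<close>

definition odd_weight :: "nat \<Rightarrow> real \<Rightarrow> real \<Rightarrow> complex" where
  "odd_weight k s r = indicator {0<..} r *\<^sub>R (odd_ray k * of_real (exp (- (s * r ^ (2 * k + 1))) / pi))"

lemma odd_ray_power: "odd_ray k ^ (2 * k + 1) = \<i>"
proof -
  have "real (2 * k + 1) * (pi / (2 * (2 * k + 1))) = pi / 2" by (simp add: field_simps)
  then show ?thesis unfolding odd_ray_def Complex.DeMoivre by (simp only: cis_pi_half)
qed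

lemma odd_weight_measurable [measurable]: "odd_weight k s \<in> borel_measurable borel"
  unfolding odd_weight_def by measurable

text \<open>Because 2k + 1 > 1, the linear term B r is at most K + (s/2) r^(2k+1): half of the decay
  pays for it and the other half remains.\<close>

lemma set_integrable_power_exp_odd:
  fixes s B :: real
  assumes k: "1 \<le> k" and s: "0 < s"
  shows "set_integrable lborel {0<..} (\<lambda>r. r ^ j * exp (B * r) * exp (- (s * r ^ (2 * k + 1))))"
proof -
  \<comment> \<open>Beyond r = max 1 (2 |B| / s) the power dominates the linear term; K bounds B r
    below that point.\<close>
  define K where "K = \<bar>B\<bar> * max 1 (2 * \<bar>B\<bar> / s)"
  have K: "B * r \<le> K + s / 2 * r ^ (2 * k + 1)" if r: "0 < r" for r
  proof (cases "r \<le> max 1 (2 * \<bar>B\<bar> / s)")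
    case True
    have "B * r \<le> \<bar>B\<bar> * r" using r by (intro mult_right_mono) auto
    also have "\<dots> \<le> K" unfolding K_def using True by (intro mult_left_mono) auto
    finally show ?thesis using r s by (simp add: add_increasing2)
  next
    case False
    then have "1 \<le> r" "2 * \<bar>B\<bar> / s \<le> r" by auto
    have "r ^ 1 \<le> r ^ (2 * k)" using \<open>1 \<le> r\<close> k by (intro power_increasing) auto
    then have "2 * \<bar>B\<bar> / s \<le> r ^ (2 * k)" using \<open>2 * \<bar>B\<bar> / s \<le> r\<close> by simp
    then have "\<bar>B\<bar> \<le> s / 2 * r ^ (2 * k)" using s by (simp add: field_simps)
    then have "\<bar>B\<bar> * r \<le> s / 2 * r ^ (2 * k) * r" using r by (intro mult_right_mono) auto
    moreover have "B * r \<le> \<bar>B\<bar> * r" using r by (intro mult_right_mono) auto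
    moreover have "0 \<le> K" unfolding K_def by (intro mult_nonneg_nonneg) auto
    ultimately show ?thesis by (simp add: mult_ac)
  qed
  have "set_integrable lborel {0<..} (\<lambda>r. r powr real j * exp (- (s / 2 * r powr real (2 * k + 1))))"
    by (rule set_integrable_powr_exp_powr) (use s in auto)
  then have "set_integrable lborel {0<..} (\<lambda>r. exp K * (r powr real j * exp (- (s / 2 * r powr real (2 * k + 1)))))"
    by simp
  then show ?thesis
  proof (rule set_integrable_bound)
    show "AE r in lborel. r \<in> {0<..} \<longrightarrow> norm (r ^ j * exp (B * r) * exp (- (s * r ^ (2 * k + 1))))
        \<le> norm (exp K * (r powr real j * exp (- (s / 2 * r powr real (2 * k + 1)))))"
    proof (intro AE_I2 impI)
      fix r :: real assume r: "r \<in> {0<..}"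
      have "exp (B * r) * exp (- (s * r ^ (2 * k + 1))) \<le> exp K * exp (- (s / 2 * r ^ (2 * k + 1)))"
        using K[of r] r by (simp add: exp_add[symmetric])
      then have "r ^ j * (exp (B * r) * exp (- (s * r ^ (2 * k + 1)))) \<le> r ^ j * (exp K * exp (- (s / 2 * r ^ (2 * k + 1))))"
        using r by (intro mult_left_mono) auto
      then show "norm (r ^ j * exp (B * r) * exp (- (s * r ^ (2 * k + 1))))
        \<le> norm (exp K * (r powr real j * exp (- (s / 2 * r powr real (2 * k + 1)))))"
        unfolding powr_realpow[OF r[unfolded greaterThan_iff]]
        using r by (simp add: mult_ac abs_mult del: power_Suc of_nat_add of_nat_mult)
    qed
  qed (auto simp: set_borel_measurable_def)
qed

lemma norm_odd_weight: "norm (odd_weight k s r) = indicator {0<..} r * exp (- (s * r ^ (2 * k + 1))) / pi"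
  by (simp add: odd_weight_def odd_ray_def norm_mult norm_divide)

lemma odd_weight_integrable:
  assumes "1 \<le> k" "0 < s"
  shows "integrable lborel (\<lambda>r. norm (odd_weight k s r) * \<bar>r\<bar> ^ j * exp (B * \<bar>C * r\<bar>))"
proof -
  have "integrable lborel (\<lambda>r. (1 / pi) * (indicator {0<..} r *\<^sub>R (r ^ j * exp ((B * \<bar>C\<bar>) * r) * exp (- (s * r ^ (2 * k + 1))))))"
    using set_integrable_power_exp_odd[OF assms, of j "B * \<bar>C\<bar>"] unfolding set_integrable_def by (rule integrable_mult_right)
  also have "(\<lambda>r. (1 / pi) * (indicator {0<..} r *\<^sub>R (r ^ j * exp ((B * \<bar>C\<bar>) * r) * exp (- (s * r ^ (2 * k + 1))))))
     = (\<lambda>r. norm (odd_weight k s r) * \<bar>r\<bar> ^ j * exp (B * \<bar>C * r\<bar>))"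
    by (auto simp: odd_weight_def odd_ray_def indicator_def norm_mult norm_divide abs_mult fun_eq_iff)
  finally show ?thesis .
qed

lemma sin_ge_half: "t / 2 \<le> sin t" if "0 \<le> t" "t \<le> pi / 2" for t :: real
proof -
  have "\<bar>sin t - (\<Sum>m<3. sin_coeff m * t ^ m)\<bar> \<le> inverse (fact 3) * \<bar>t\<bar> ^ 3" by (rule Maclaurin_sin_bound)
  then have "\<bar>sin t - t\<bar> \<le> t ^ 3 / 6" using that by (simp add: eval_nat_numeral sin_coeff_def fact_numeral)
  then have "t - t ^ 3 / 6 \<le> sin t" by linarith
  \<comment> \<open>1.6 exceeds \<pi>/2 and 1.6^2 < 3, so the cubic term t^3 / 6 takes away at most
    t / 2.\<close>
  moreover have "t ^ 2 \<le> (1.6 :: real) ^ 2" using that pi_less_4 pi_approx by (intro power_mono) auto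
  then have "t * t ^ 2 \<le> t * 3" using that by (intro mult_left_mono) (auto simp: power2_eq_square)
  ultimately show ?thesis by (simp add: power2_eq_square power3_eq_cube)
qed

text \<open>The half line is turned to the direction \<open>odd_ray k\<close>. On the arc of radius
  R the integrand is at most exp (-\<kappa>(R) \<omega>) with \<kappa> quadratic in R, so the arc
  contributes at most R / \<kappa>(R), which tends to 0.\<close>

lemma odd_partial_tendsto:
  assumes k: "1 \<le> k" and s: "0 < s"
  shows "((\<lambda>R. odd_partial k x s R) \<longlongrightarrow> re_transform (odd_weight k s) (\<i> * odd_ray k) 0 x) at_top"
proof -
  define w where "w = odd_ray k"
  define \<delta> where "\<delta> = pi / (2 * (2 * real k + 1))"
  have w: "w = cis \<delta>" "0 < \<delta>" "real (2 * k + 1) * \<delta> = pi / 2" by (auto simp: w_def odd_ray_def \<delta>_def field_simps)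
  have wn: "w ^ (2 * k + 1) = \<i>" unfolding w_def by (rule odd_ray_power)
  define f where "f = (\<lambda>z. exp (\<i> * (z * of_real x + of_real s * z ^ (2 * k + 1))))"
  have f_real: "f (of_real r) = cis (s * r ^ (2 * k + 1) + x * r + 0)" for r
    by (simp add: f_def cis_conv_exp algebra_simps)
  have f_ray: "f (of_real r * w) = exp (\<i> * w * of_real (x * r)) * of_real (exp (- (s * r ^ (2 * k + 1))))" for r
  proof -
    have "\<i> * (of_real r * w * of_real x + of_real s * (of_real r * w) ^ (2 * k + 1))
        = \<i> * w * of_real (x * r) + of_real (- (s * r ^ (2 * k + 1)))"
      unfolding power_mult_distrib wn by (simp add: algebra_simps)
    then show ?thesis unfolding f_def by (simp only: exp_add exp_of_real)
  qed
  have n_ge: "1 \<le> real (2 * k + 1)" by simp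
  \<comment> \<open>The positive part comes from sin ((2k+1) \<omega>) \<ge> \<omega>/2 and R^(2k+1)
    \<ge> R^2, the negative part from the linear term x z of the phase. The value at 0 only has to
    be positive, as the arc of radius 0 has no length.\<close>
  define \<kappa> where "\<kappa> = (\<lambda>R::real. if R = 0 then 1 else R * (s / 2 * R - \<bar>x\<bar>))"
  have fnorm: "norm (f (of_real R * cis \<omega>)) \<le> exp (- (\<kappa> R * \<omega>))" if R: "1 \<le> R" and \<omega>: "0 \<le> \<omega>" "\<omega> \<le> \<delta>" for R \<omega>
  proof -
    have "norm (f (of_real R * cis \<omega>)) = exp (- (R * sin \<omega> * x + s * (R ^ (2 * k + 1) * sin (real (2 * k + 1) * \<omega>))))"
      unfolding f_def norm_exp_eq_Re power_mult_distrib Complex.DeMoivre by (simp flip: of_real_power)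
    moreover have "\<kappa> R * \<omega> \<le> R * sin \<omega> * x + s * (R ^ (2 * k + 1) * sin (real (2 * k + 1) * \<omega>))"
    proof -
      have nw: "real (2 * k + 1) * \<omega> \<le> pi / 2" 
        unfolding w(3)[symmetric] using \<omega>(2) by (intro mult_left_mono) auto
      have "1 * \<omega> / 2 \<le> real (2 * k + 1) * \<omega> / 2" using n_ge \<omega> by (intro divide_right_mono mult_right_mono) auto
      also have "\<dots> \<le> sin (real (2 * k + 1) * \<omega>)" using nw \<omega> by (intro sin_ge_half) auto
      finally have "\<omega> / 2 \<le> sin (real (2 * k + 1) * \<omega>)" by simp
      moreover have "R ^ 2 \<le> R ^ (2 * k + 1)" using R k by (intro power_increasing) auto
      ultimately have "R ^ 2 * (\<omega> / 2) \<le> R ^ (2 * k + 1) * sin (real (2 * k + 1) * \<omega>)"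
        using R \<omega> by (intro mult_mono) auto
      then have 1: "s * (R ^ 2 * (\<omega> / 2)) \<le> s * (R ^ (2 * k + 1) * sin (real (2 * k + 1) * \<omega>))"
        using s by (intro mult_left_mono) auto
      have "\<bar>sin \<omega>\<bar> \<le> \<omega>" using abs_sin_x_le_abs_x[of \<omega>] \<omega> by simp
      then have "\<bar>R * sin \<omega> * x\<bar> \<le> R * \<omega> * \<bar>x\<bar>" using R by (simp add: abs_mult mult_mono)
      then have "- (R * \<omega> * \<bar>x\<bar>) \<le> R * sin \<omega> * x" by (simp add: abs_le_iff)
      moreover have "\<kappa> R * \<omega> = s * (R ^ 2 * (\<omega> / 2)) - R * \<omega> * \<bar>x\<bar>"
        using R by (simp add: \<kappa>_def algebra_simps power2_eq_square)
      ultimately show ?thesis using 1 by linarith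
    qed
    ultimately show ?thesis by simp
  qed
  have ev: "\<forall>\<^sub>F R in at_top. 1 \<le> R \<and> 0 < s / 2 * R - \<bar>x\<bar>"
    using s by (intro eventually_conj eventually_ge_at_top) real_asymp
  have diff: "((\<lambda>R. integral {0..R} (\<lambda>r. f (of_real r)) - integral {0..R} (\<lambda>r. w * f (of_real r * w))) \<longlongrightarrow> 0) at_top"
  proof (rule Lim_null_comparison)
    show "\<forall>\<^sub>F R in at_top. norm (integral {0..R} (\<lambda>r. f (of_real r)) - integral {0..R} (\<lambda>r. w * f (of_real r * w))) \<le> 1 / (s / 2 * R - \<bar>x\<bar>)"
      using ev
    proof eventually_elim
      case (elim R)
      \<comment> \<open>At r = 0 the integrand is 1 throughout, and exp \<delta> compensates the
        factor exp (-\<omega>) demanded by the arc estimate.\<close>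
      define B where "B = (\<lambda>r::real. if r = 0 then exp \<delta> else 1)"
      have "norm (integral {0..R} (\<lambda>r. f (of_real r)) - integral {0..R} (\<lambda>r. cis \<delta> * f (of_real r * cis \<delta>)))
         \<le> 0 * B 0 / \<kappa> 0 + R * B R / \<kappa> R"
      proof (rule sector_rotation[where S=UNIV])
        show "f holomorphic_on UNIV" unfolding f_def by (intro holomorphic_intros)
        show "norm (f (of_real r * cis \<omega>)) \<le> B r * exp (- (\<kappa> r * \<omega>))" if "r \<in> {0, R}" "0 \<le> \<omega>" "\<omega> \<le> \<delta>" for r \<omega>
        proof (cases "r = 0")
          case True
          have "f 0 = 1" by (simp add: f_def)
          then show ?thesis using True that by (simp add: B_def \<kappa>_def exp_add[symmetric])
        next
          case False
          then show ?thesis using that fnorm[of R \<omega>] elim by (auto simp: B_def)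
        qed
      qed (use elim w in \<open>auto simp: \<kappa>_def\<close>)
      then show ?case using elim by (simp add: w B_def \<kappa>_def)
    qed
    show "((\<lambda>R. 1 / (s / 2 * R - \<bar>x\<bar>)) \<longlongrightarrow> 0) at_top" using s by real_asymp
  qed
  define g where "g = (\<lambda>r. w * f (of_real r * w))"
  have contg: "continuous_on S g" for S unfolding g_def f_ray by (intro continuous_intros)
  have gi: "integrable lborel (\<lambda>r. indicator {0<..} r *\<^sub>R g r)"
  proof (rule Bochner_Integration.integrable_bound)
    show "integrable lborel (\<lambda>r. pi * (norm (odd_weight k s r) * \<bar>r\<bar> ^ 0 * exp (\<bar>x\<bar> * \<bar>1 * r\<bar>)))"
      using odd_weight_integrable[OF k s] by (rule integrable_mult_right)
    show "AE r in lborel. norm (indicator {0<..} r *\<^sub>R g r) \<le> norm (pi * (norm (odd_weight k s r) * \<bar>r\<bar> ^ 0 * exp (\<bar>x\<bar> * \<bar>1 * r\<bar>)))"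
    proof (rule AE_I2)
      fix r :: real
      have "\<bar>Re (\<i> * w) * (x * r)\<bar> \<le> 1 * \<bar>x * r\<bar>" unfolding abs_mult[of "Re (\<i> * w)"]
        by (intro mult_right_mono) (simp_all add: w)
      from order_trans[OF abs_ge_self this] have "Re (\<i> * w) * (x * r) \<le> \<bar>x\<bar> * \<bar>r\<bar>"
        by (simp only: mult_1 abs_mult)
      then have "exp (Re (\<i> * w) * (x * r)) \<le> exp (\<bar>x\<bar> * \<bar>r\<bar>)" by (simp only: exp_le_cancel_iff)
      then show "norm (indicator {0<..} r *\<^sub>R g r) \<le> norm (pi * (norm (odd_weight k s r) * \<bar>r\<bar> ^ 0 * exp (\<bar>x\<bar> * \<bar>1 * r\<bar>)))"
        unfolding g_def f_ray norm_odd_weight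
        by (auto simp: norm_mult indicator_def w abs_mult intro!: mult_right_mono)
    qed
    show "(\<lambda>r. indicator {0<..} r *\<^sub>R g r) \<in> borel_measurable lborel"
      using borel_measurable_continuous_onI[OF contg] by simp
  qed
  have lim_g: "((\<lambda>R. integral {0..R} g) \<longlongrightarrow> (LINT r|lborel. indicator {0<..} r *\<^sub>R g r)) at_top"
  proof (rule Lim_transform_eventually)
    show "((\<lambda>R. LINT r|lborel. indicator {..R} r *\<^sub>R (indicator {0<..} r *\<^sub>R g r)) \<longlongrightarrow> (LINT r|lborel. indicator {0<..} r *\<^sub>R g r)) at_top"
      by (rule tendsto_integral_at_top[OF _ gi]) simp
    have "(LINT r|lborel. indicator {..R} r *\<^sub>R (indicator {0<..} r *\<^sub>R g r)) = integral {0..R} g" for R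
    proof -
      have "(LINT r|lborel. indicator {..R} r *\<^sub>R (indicator {0<..} r *\<^sub>R g r)) = (LINT r:{0..R}|lborel. g r)"
        unfolding set_lebesgue_integral_def
        by (rule integral_discrete_difference[of "{0}"]) (auto simp: indicator_def)
      then show ?thesis by (simp add: set_lebesgue_integral_eq_integral[OF contg])
    qed
    then show "\<forall>\<^sub>F R in at_top. (LINT r|lborel. indicator {..R} r *\<^sub>R (indicator {0<..} r *\<^sub>R g r)) = integral {0..R} g" by simp
  qed
  have "((\<lambda>R. (integral {0..R} (\<lambda>r. f (of_real r)) - integral {0..R} g) + integral {0..R} g) \<longlongrightarrow> 0 + (LINT r|lborel. indicator {0<..} r *\<^sub>R g r)) at_top"
    using diff unfolding g_def[symmetric] by (intro tendsto_add lim_g)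
  then have "((\<lambda>R. 1 / pi * Re (integral {0..R} (\<lambda>r. f (of_real r)))) \<longlongrightarrow> 1 / pi * Re (LINT r|lborel. indicator {0<..} r *\<^sub>R g r)) at_top"
    by (intro tendsto_intros) simp
  moreover have "1 / pi * Re (LINT r|lborel. indicator {0<..} r *\<^sub>R g r) = re_transform (odd_weight k s) (\<i> * odd_ray k) 0 x"
  proof -
    have "1 / pi * Re (LINT r|lborel. indicator {0<..} r *\<^sub>R g r) = (LINT r|lborel. 1 / pi * Re (indicator {0<..} r *\<^sub>R g r))"
      using integral_Re[OF gi] by simp
    also have "\<dots> = re_transform (odd_weight k s) (\<i> * odd_ray k) 0 x"
      unfolding re_transform_def g_def f_ray
      by (intro Bochner_Integration.integral_cong) (auto simp: odd_weight_def indicator_def w_def[symmetric] field_simps)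
    finally show ?thesis .
  qed
  ultimately have "((\<lambda>R. 1 / pi * Re (integral {0..R} (\<lambda>r. f (of_real r)))) \<longlongrightarrow> re_transform (odd_weight k s) (\<i> * odd_ray k) 0 x) at_top" by simp
  then show ?thesis
  proof (rule Lim_transform_eventually)
    show "\<forall>\<^sub>F R in at_top. 1 / pi * Re (integral {0..R} (\<lambda>r. f (of_real r))) = odd_partial k x s R"
      using eventually_ge_at_top[of 0] by eventually_elim (simp only: odd_partial_eq_half f_real)
  qed
qed

text \<open>The truncations converge, so the \<open>Lim\<close> in \<open>odd_order_law\<close> is a
  genuine limit and inherits their bound.\<close>

lemma odd_order_law_eq:
  assumes "1 \<le> k" "0 < s"
  shows "odd_order_law k x s = re_transform (odd_weight k s) (\<i> * odd_ray k) 0 x"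
    and "((\<lambda>R. odd_partial k x s R) \<longlongrightarrow> odd_order_law k x s) at_top"
    and "\<bar>odd_order_law k x s\<bar> \<le> 3 * s powr (- 1 / real (2 * k + 1))"
proof -
  note * = odd_partial_tendsto[OF assms, of x]
  show 1: "odd_order_law k x s = re_transform (odd_weight k s) (\<i> * odd_ray k) 0 x"
    unfolding odd_order_law_def using tendsto_Lim[OF _ *] by (simp add: odd_partial_def)
  show 2: "((\<lambda>R. odd_partial k x s R) \<longlongrightarrow> odd_order_law k x s) at_top" using * 1 by simp
  have "((\<lambda>R. \<bar>odd_partial k x s R\<bar>) \<longlongrightarrow> \<bar>odd_order_law k x s\<bar>) at_top" using 2 by (rule tendsto_rabs)
  then show "\<bar>odd_order_law k x s\<bar> \<le> 3 * s powr (- 1 / real (2 * k + 1))"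
    by (rule tendsto_upperbound[OF _ always_eventually[OF allI[OF odd_partial_bound[OF assms]]]]) simp
qed

lemma odd_order_law_derivatives:
  assumes "1 \<le> k" "0 < s"
  shows "(deriv ^^ j) (\<lambda>x. odd_order_law k x s) = re_transform (odd_weight k s) (\<i> * odd_ray k) j"
    and "times_differentiable m (\<lambda>x. odd_order_law k x s)"
proof -
  have eq: "(\<lambda>x. odd_order_law k x s) = re_transform (odd_weight k s) (\<i> * odd_ray k) 0"
    using odd_order_law_eq(1)[OF assms] by (rule ext)
  have d: "(re_transform (odd_weight k s) (\<i> * odd_ray k) j has_real_derivative re_transform (odd_weight k s) (\<i> * odd_ray k) (Suc j) x) (at x)" for j x
    by (intro re_transform_derivative odd_weight_integrable assms odd_weight_measurable)
  show "(deriv ^^ j) (\<lambda>x. odd_order_law k x s) = re_transform (odd_weight k s) (\<i> * odd_ray k) j"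
    unfolding eq by (rule times_differentiable_family(1)[where m=j]) (use d in auto)
  show "times_differentiable m (\<lambda>x. odd_order_law k x s)"
    unfolding eq by (rule times_differentiable_family(2)) (use d in auto)
qed

lemma continuous_odd_order_law:
  assumes "1 \<le> k" "0 < s"
  shows "continuous_on S (\<lambda>x. odd_order_law k x s)"
proof -
  have "(\<lambda>x. odd_order_law k x s) differentiable (at x)" for x
    using odd_order_law_derivatives(2)[OF assms, of 1] by (simp add: times_differentiable_def)
  then show ?thesis by (intro continuous_at_imp_continuous_on ballI differentiable_imp_continuous_within)
qed

text \<open>On the rotated ray a time derivative contributes -r^(2k+1), and 2k + 1 space derivatives
  contribute (c r)^(2k+1); the equation is the comparison of the two factors.\<close>

lemma odd_order_law_time_derivative:
  assumes k: "1 \<le> k" and s: "0 < s"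
  shows "((\<lambda>\<tau>. odd_order_law k x \<tau>) has_real_derivative
        (-1) ^ k * (deriv ^^ (2 * k + 1)) (\<lambda>y. odd_order_law k y s) x) (at s)"
proof -
  define c where "c = \<i> * odd_ray k"
  define F where "F = (\<lambda>\<tau> r. Re (odd_weight k \<tau> r * (c * of_real r) ^ 0 * exp (c * of_real (x * r))))"
  define F' where "F' = (\<lambda>\<tau> r. Re (- (of_real r ^ (2 * k + 1)) * odd_weight k \<tau> r * exp (c * of_real (x * r))))"
  have Rec: "\<bar>Re c\<bar> \<le> 1" using abs_Re_le_cmod[of c] by (simp add: c_def norm_mult odd_ray_def)
  have expb: "norm (exp (c * complex_of_real (x * r))) \<le> exp (\<bar>x\<bar> * \<bar>1 * r\<bar>)" for r
  proof -
    have "Re c * (x * r) \<le> \<bar>Re c\<bar> * \<bar>x * r\<bar>" by (metis abs_ge_self abs_mult)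
    also have "\<dots> \<le> 1 * \<bar>x * r\<bar>" using Rec by (intro mult_right_mono) auto
    finally show ?thesis by (simp add: norm_exp_eq_Re abs_mult)
  qed
  have mono: "norm (odd_weight k \<tau> r) \<le> norm (odd_weight k \<sigma> r)" if "\<sigma> \<le> \<tau>" for \<tau> \<sigma> r
    unfolding norm_odd_weight using that
    by (intro divide_right_mono) (auto simp: indicator_def mult_right_mono)
  have "((\<lambda>\<tau>. LINT r|lborel. F \<tau> r) has_real_derivative (LINT r|lborel. F' s r)) (at s)"
  \<comment> \<open>The weight decreases in time, so its value at s / 2 dominates on this whole
    neighbourhood of s.\<close>
  proof (rule has_field_derivative_lebesgue_integral(1)[where S="{s / 2<..}" and
        g="\<lambda>r. norm (odd_weight k (s / 2) r) * \<bar>r\<bar> ^ (2 * k + 1) * exp (\<bar>x\<bar> * \<bar>1 * r\<bar>)"])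
    fix \<tau> assume \<tau>: "\<tau> \<in> {s / 2<..}"
    show "integrable lborel (F \<tau>)"
    proof (rule Bochner_Integration.integrable_bound)
      show "integrable lborel (\<lambda>r. norm (odd_weight k \<tau> r) * \<bar>r\<bar> ^ 0 * exp (\<bar>x\<bar> * \<bar>1 * r\<bar>))"
        by (rule odd_weight_integrable) (use k s \<tau> in auto)
      show "AE r in lborel. norm (F \<tau> r) \<le> norm (norm (odd_weight k \<tau> r) * \<bar>r\<bar> ^ 0 * exp (\<bar>x\<bar> * \<bar>1 * r\<bar>))"
      proof (rule AE_I2)
        fix r :: real
        have "norm (F \<tau> r) \<le> norm (odd_weight k \<tau> r * (c * of_real r) ^ 0 * exp (c * of_real (x * r)))"
          unfolding F_def real_norm_def by (rule abs_Re_le_cmod)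
        also have "\<dots> \<le> norm (odd_weight k \<tau> r) * exp (\<bar>x\<bar> * \<bar>1 * r\<bar>)"
          unfolding norm_mult using expb[of r] by (simp add: mult_left_mono)
        finally show "norm (F \<tau> r) \<le> norm (norm (odd_weight k \<tau> r) * \<bar>r\<bar> ^ 0 * exp (\<bar>x\<bar> * \<bar>1 * r\<bar>))" by simp
      qed
    qed (simp add: F_def)
    fix r :: real
    show "((\<lambda>\<tau>. F \<tau> r) has_real_derivative F' \<tau> r) (at \<tau>)"
    proof (cases "0 < r")
      case True
      have "F \<tau> r = exp (- (\<tau> * r ^ (2 * k + 1))) * Re (odd_ray k / of_real pi * exp (c * of_real (x * r)))" for \<tau>
        unfolding F_def odd_weight_def using True by (simp add: field_simps)
      moreover have "F' \<tau> r = - (r ^ (2 * k + 1)) * exp (- (\<tau> * r ^ (2 * k + 1))) * Re (odd_ray k / of_real pi * exp (c * of_real (x * r)))" for \<tau>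
      proof -
        have "- (of_real r ^ (2 * k + 1)) * odd_weight k \<tau> r * exp (c * of_real (x * r))
          = of_real (- (r ^ (2 * k + 1)) * exp (- (\<tau> * r ^ (2 * k + 1)))) * (odd_ray k / of_real pi * exp (c * of_real (x * r)))"
          unfolding odd_weight_def using True by (simp add: field_simps)
        moreover have "Re (of_real a * z) = a * Re z" for a z by simp
        ultimately show ?thesis unfolding F'_def by (simp only:)
      qed
      ultimately show ?thesis by (auto intro!: derivative_eq_intros)
    qed (simp add: F_def F'_def odd_weight_def)
    show "norm (F' \<tau> r) \<le> norm (odd_weight k (s / 2) r) * \<bar>r\<bar> ^ (2 * k + 1) * exp (\<bar>x\<bar> * \<bar>1 * r\<bar>)"
    proof -
      have "norm (F' \<tau> r) \<le> norm (- (of_real r ^ (2 * k + 1)) * odd_weight k \<tau> r * exp (c * of_real (x * r)))"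
        unfolding F'_def real_norm_def by (rule abs_Re_le_cmod)
      also have "\<dots> = \<bar>r\<bar> ^ (2 * k + 1) * norm (odd_weight k \<tau> r) * norm (exp (c * of_real (x * r)))"
        by (simp only: norm_mult norm_minus_cancel norm_power norm_of_real)
      also have "\<dots> \<le> \<bar>r\<bar> ^ (2 * k + 1) * norm (odd_weight k (s / 2) r) * exp (\<bar>x\<bar> * \<bar>1 * r\<bar>)"
        using expb[of r] mono[of "s / 2" \<tau> r] \<tau> by (intro mult_mono mult_left_mono) auto
      finally show ?thesis by (simp only: mult_ac)
    qed
  next
    show "integrable lborel (\<lambda>r. norm (odd_weight k (s / 2) r) * \<bar>r\<bar> ^ (2 * k + 1) * exp (\<bar>x\<bar> * \<bar>1 * r\<bar>))"
      by (rule odd_weight_integrable) (use k s in auto)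
  qed (use s in auto)
  moreover have "(LINT r|lborel. F' s r) = (-1) ^ k * re_transform (odd_weight k s) c (2 * k + 1) x"
  proof -
    \<comment> \<open>The factor i^(2k+1) = (-1)^k i of the transform meets the i to which the ray
      is raised, and i^2 = -1.\<close>
    have "c ^ (2 * k + 1) = - ((-1) ^ k)"
    proof -
      have "\<i> ^ (2 * k + 1) = (-1) ^ k * \<i>" by (simp add: power_mult)
      then show ?thesis unfolding c_def power_mult_distrib odd_ray_power by (simp only: mult.assoc) simp
    qed
    then have "F' s r = (-1) ^ k * Re (odd_weight k s r * (c * of_real r) ^ (2 * k + 1) * exp (c * of_real (x * r)))" for r
      unfolding F'_def power_mult_distrib by (cases "even k") (simp_all add: algebra_simps)
    then show ?thesis unfolding re_transform_def by simp
  qed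
  moreover have ev: "\<forall>\<^sub>F \<tau> in nhds s. (LINT r|lborel. F \<tau> r) = odd_order_law k x \<tau>"
    using eventually_nhds_in_open[of "{0<..}" s] s
    by (auto elim!: eventually_mono simp: odd_order_law_eq(1)[OF k] re_transform_def F_def c_def)
  ultimately show ?thesis
    unfolding odd_order_law_derivatives(1)[OF k s] c_def[symmetric]
    using DERIV_cong_ev[OF refl ev refl] by simp
qed

section \<open>Dirichlet kernel and improper Fourier transform\<close>

text \<open>For an amplitude with continuous derivative one integration by parts already gains a
  factor 1 / R.\<close>

lemma riemann_lebesgue_sin:
  fixes H H' :: "real \<Rightarrow> complex"
  assumes ab: "a \<le> b"
    and H: "\<And>y. y \<in> {a..b} \<Longrightarrow> (H has_vector_derivative H' y) (at y)"
    and H': "continuous_on {a..b} H'"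
  shows "((\<lambda>R. integral {a..b} (\<lambda>y. sin (R * (y - \<zeta>)) *\<^sub>R H y)) \<longlongrightarrow> 0) at_top"
proof -
  obtain M where M: "\<And>y. y \<in> {a..b} \<Longrightarrow> norm (H' y) \<le> M"
    using compact_imp_bounded[OF compact_continuous_image[OF H' compact_Icc]]
    unfolding bounded_iff by blast
  have cH: "continuous_on {a..b} H"
    using H by (intro continuous_at_imp_continuous_on ballI has_vector_derivative_continuous) auto
  show ?thesis
  proof (rule Lim_null_comparison)
    show "((\<lambda>R. (norm (H b) + norm (H a) + M * (b - a)) / R) \<longlongrightarrow> 0) at_top" by real_asymp
    show "\<forall>\<^sub>F R in at_top. norm (integral {a..b} (\<lambda>y. sin (R * (y - \<zeta>)) *\<^sub>R H y)) \<le> (norm (H b) + norm (H a) + M * (b - a)) / R"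
      using eventually_gt_at_top[of 0]
    proof eventually_elim
      case (elim R)
      define F where "F = (\<lambda>y. (- cos (R * (y - \<zeta>)) / R) *\<^sub>R H y)"
      define f where "f = (\<lambda>y. sin (R * (y - \<zeta>)) *\<^sub>R H y)"
      define g where "g = (\<lambda>y. (- cos (R * (y - \<zeta>)) / R) *\<^sub>R H' y)"
      have fi: "f integrable_on {a..b}" and gi: "g integrable_on {a..b}"
        unfolding f_def g_def using elim by (auto intro!: integrable_continuous_interval continuous_intros cH H')
      have "((\<lambda>y. g y + f y) has_integral (F b - F a)) {a..b}"
      proof (rule fundamental_theorem_of_calculus[OF ab])
        fix y assume y: "y \<in> {a..b}"
        have "((\<lambda>y. - cos (R * (y - \<zeta>)) / R) has_real_derivative sin (R * (y - \<zeta>))) (at y)"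
          using elim by (auto intro!: derivative_eq_intros)
        from has_vector_derivative_scaleR[OF this H[OF y]]
        show "(F has_vector_derivative g y + f y) (at y within {a..b})"
          unfolding F_def g_def f_def by (rule has_vector_derivative_at_within)
      qed
      then have "integral {a..b} (\<lambda>y. g y + f y) = F b - F a" by (rule integral_unique)
      then have "integral {a..b} f = F b - F a - integral {a..b} g"
        using Henstock_Kurzweil_Integration.integral_add[OF gi fi] by (simp add: algebra_simps)
      moreover have "norm (F b) \<le> norm (H b) / R" "norm (F a) \<le> norm (H a) / R"
        using elim by (auto simp: F_def divide_right_mono mult_left_le_one_le)
      moreover have "norm (integral {a..b} g) \<le> M / R * (b - a)"
      proof (rule integral_bound[OF ab])
        show "continuous_on {a..b} g" unfolding g_def using elim by (auto intro!: continuous_intros H')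
        fix y assume "y \<in> {a..b}"
        have "norm (g y) = \<bar>cos (R * (y - \<zeta>))\<bar> * norm (H' y) / R" using elim by (simp add: g_def)
        also have "\<dots> \<le> 1 * M / R" using M[OF \<open>y \<in> {a..b}\<close>] elim by (intro divide_right_mono mult_mono) auto
        finally show "norm (g y) \<le> M / R" by simp
      qed
      ultimately have "norm (integral {a..b} f) \<le> norm (H b) / R + norm (H a) / R + M / R * (b - a)"
        using norm_triangle_ineq4[of "F b - F a" "integral {a..b} g"] norm_triangle_ineq4[of "F b" "F a"] by simp
      also have "\<dots> = (norm (H b) + norm (H a) + M * (b - a)) / R" by (simp add: add_divide_distrib)
      finally show ?case unfolding f_def .
    qed
  qed
qed

text \<open>This is sin (R y) / y; writing it with \<open>sinc\<close> makes it continuous at 0 with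
  the right value R.\<close>

definition dirichlet_kernel :: "real \<Rightarrow> real \<Rightarrow> real" where
  "dirichlet_kernel R y = R * sinc (R * y)"

lemma dirichlet_kernel_eq: "y \<noteq> 0 \<Longrightarrow> dirichlet_kernel R y = sin (R * y) / y"
  by (simp add: dirichlet_kernel_def)

lemma dirichlet_kernel_mult: "dirichlet_kernel R y * y = sin (R * y)"
  by (simp add: dirichlet_kernel_def)

lemma dirichlet_kernel_even: "dirichlet_kernel R (- y) = dirichlet_kernel R y"
  by (simp add: dirichlet_kernel_def)

lemma continuous_dirichlet_kernel [continuous_intros]:
  "continuous_on S f \<Longrightarrow> continuous_on S (\<lambda>x. dirichlet_kernel R (f x))"
  unfolding dirichlet_kernel_def by (intro continuous_intros)

lemma integral_cis_symmetric:
  assumes "0 \<le> R"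
  shows "integral {-R..R} (\<lambda>x. cis (c * x)) = of_real (2 * dirichlet_kernel R c)"
proof (cases "c = 0")
  case True
  then show ?thesis using assms by (simp add: dirichlet_kernel_def scaleR_conv_of_real)
next
  case False
  have "((\<lambda>x. cis (c * x)) has_integral (cis (c * R) / (\<i> * of_real c) - cis (c * - R) / (\<i> * of_real c))) {-R..R}"
  proof (rule fundamental_theorem_of_calculus)
    fix x
    have "((\<lambda>x. c * x) has_real_derivative c) (at x within {-R..R})" by (auto intro!: derivative_eq_intros)
    from has_vector_derivative_divide[OF has_vector_derivative_cis[OF this], of "\<i> * of_real c"]
    show "((\<lambda>x. cis (c * x) / (\<i> * of_real c)) has_vector_derivative cis (c * x)) (at x within {-R..R})"
      using False by simp
  qed (use assms in simp)
  then have "integral {-R..R} (\<lambda>x. cis (c * x)) = (cis (c * R) - cis (- (c * R))) / (\<i> * of_real c)"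
    by (simp add: integral_unique diff_divide_distrib)
  also have "cis (c * R) - cis (- (c * R)) = of_real (2 * sin (R * c)) * \<i>"
    by (simp add: complex_eq_iff mult.commute)
  also have "\<dots> / (\<i> * of_real c) = of_real (2 * dirichlet_kernel R c)"
    using False by (simp add: dirichlet_kernel_eq field_simps)
  finally show ?thesis .
qed

text \<open>The imaginary part is odd and integrates to 0. The minus sign is that of the inversion
  kernel and of the transform cis (-(s \<eta>^(2k+1))).\<close>

lemma odd_partial_eq_complex:
  assumes "0 \<le> A"
  shows "of_real (odd_partial k x s A) = integral {-A..A} (\<lambda>\<eta>. cis (- (\<eta> * x + s * \<eta> ^ (2 * k + 1)))) / of_real (2 * pi)"
proof -
  let ?\<theta> = "\<lambda>\<eta>. \<eta> * x + s * \<eta> ^ (2 * k + 1)"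
  have odd: "?\<theta> (- \<eta>) = - ?\<theta> \<eta>" for \<eta> by (simp add: algebra_simps)
  have "complex_of_real (integral {-A..A} (\<lambda>\<eta>. cos (?\<theta> \<eta>))) = integral {-A..A} (\<lambda>\<eta>. of_real (cos (?\<theta> \<eta>)))"
    by (rule integral_linear[of _ _ complex_of_real, unfolded o_def, symmetric])
       (auto intro!: integrable_continuous_interval continuous_intros bounded_linear_of_real)
  also have "\<dots> = integral {0..A} (\<lambda>\<eta>. of_real (cos (?\<theta> \<eta>)) + of_real (cos (?\<theta> (- \<eta>))))"
    by (subst integral_symmetric_interval[of _ 0 A]) (use assms in \<open>auto intro!: continuous_intros\<close>)
  also have "\<dots> = integral {0..A} (\<lambda>\<eta>. cis (- ?\<theta> \<eta>) + cis (- ?\<theta> (- \<eta>)))"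
  proof (rule Henstock_Kurzweil_Integration.integral_cong)
    have "complex_of_real (cos t) + of_real (cos (- t)) = cis (- t) + cis (- (- t))" for t by (simp add: complex_eq_iff)
    then show "complex_of_real (cos (?\<theta> \<eta>)) + of_real (cos (?\<theta> (- \<eta>))) = cis (- ?\<theta> \<eta>) + cis (- ?\<theta> (- \<eta>))" for \<eta>
      unfolding odd .
  qed
  also have "\<dots> = integral {-A..A} (\<lambda>\<eta>. cis (- ?\<theta> \<eta>))"
    by (subst integral_symmetric_interval[of _ 0 A]) (use assms in \<open>auto intro!: continuous_intros\<close>)
  finally show ?thesis unfolding odd_partial_eq by simp
qed

text \<open>Both ranges are compact and the integrand is continuous, so the order may be exchanged
  before any limit is taken. It is used with p a character for the improper transform and with p a
  test function for the initial datum.\<close>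

lemma integral_odd_partial_swap:
  assumes "0 \<le> A" "continuous_on {-R..R} p"
  shows "integral {-R..R} (\<lambda>x. p x * of_real (odd_partial k x s A))
    = integral {-A..A} (\<lambda>\<eta>. cis (- (s * \<eta> ^ (2 * k + 1))) * integral {-R..R} (\<lambda>x. p x * cis (- (\<eta> * x)))) / of_real (2 * pi)"
proof -
  have cp: "continuous_on (cbox (-R, -A) (R, A)) (\<lambda>z. p (fst z))"
    by (rule continuous_on_compose2[OF assms(2)]) (auto intro!: continuous_intros simp: cbox_Pair_eq)
  have "integral {-R..R} (\<lambda>x. p x * of_real (odd_partial k x s A))
    = integral (cbox (-R) R) (\<lambda>x. integral (cbox (-A) A) (\<lambda>\<eta>. p x * cis (- (\<eta> * x + s * \<eta> ^ (2 * k + 1))) / of_real (2 * pi)))"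
    unfolding odd_partial_eq_complex[OF assms(1)] box_real
    by (intro Henstock_Kurzweil_Integration.integral_cong) simp
  also have "\<dots> = integral (cbox (-A) A) (\<lambda>\<eta>. integral (cbox (-R) R) (\<lambda>x. p x * cis (- (\<eta> * x + s * \<eta> ^ (2 * k + 1))) / of_real (2 * pi)))"
    by (rule integral_swap_continuous) (auto intro!: continuous_intros cp simp: split_beta)
  also have "\<dots> = integral {-A..A} (\<lambda>\<eta>. cis (- (s * \<eta> ^ (2 * k + 1))) * integral {-R..R} (\<lambda>x. p x * cis (- (\<eta> * x))) / of_real (2 * pi))"
    unfolding box_real
  proof (rule Henstock_Kurzweil_Integration.integral_cong)
    fix \<eta> :: real
    have "p x * cis (- (\<eta> * x + s * \<eta> ^ (2 * k + 1))) = cis (- (s * \<eta> ^ (2 * k + 1))) * (p x * cis (- (\<eta> * x)))" for x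
    proof -
      have "cis (- (\<eta> * x + s * \<eta> ^ (2 * k + 1))) = cis (- (s * \<eta> ^ (2 * k + 1))) * cis (- (\<eta> * x))"
        by (simp add: cis_mult algebra_simps)
      then show ?thesis by (simp only: mult_ac)
    qed
    then show "integral {-R..R} (\<lambda>x. p x * cis (- (\<eta> * x + s * \<eta> ^ (2 * k + 1))) / of_real (2 * pi))
      = cis (- (s * \<eta> ^ (2 * k + 1))) * integral {-R..R} (\<lambda>x. p x * cis (- (\<eta> * x))) / of_real (2 * pi)"
      by (simp only: integral_divide integral_mult_right)
  qed
  finally show ?thesis by (simp only: integral_divide)
qed

text \<open>Writing the sine as a difference of exponentials shifts only the linear coefficient of
  the phase, by R and -R. The weighted van der Corput bound does not see that coefficient, so the
  estimate is uniform in R.\<close>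

lemma odd_tail_half_bound:
  assumes "1 \<le> k" "0 < s" "1 \<le> B" "B \<le> A" "\<zeta> < B"
  shows "norm (integral {B..A} (\<lambda>y. of_real (dirichlet_kernel R (y - \<zeta>)) * cis (s * y ^ (2 * k + 1)))) \<le> 6 / sqrt s * (1 / (B - \<zeta>))"
proof -
  let ?P = "\<lambda>c y. (1 / (y - \<zeta>)) *\<^sub>R cis (s * y ^ (2 * k + 1) + c * y + (- (c * \<zeta>)))"
  have i: "?P c integrable_on {B..A}" for c
    by (intro integrable_continuous_interval continuous_intros) (use assms in auto)
  have "integral {B..A} (\<lambda>y. of_real (dirichlet_kernel R (y - \<zeta>)) * cis (s * y ^ (2 * k + 1)))
      = integral {B..A} (\<lambda>y. (?P R y - ?P (- R) y) / (2 * \<i>))"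
  proof (rule Henstock_Kurzweil_Integration.integral_cong)
    fix y assume "y \<in> {B..A}"
    then have y: "y - \<zeta> \<noteq> 0" using assms by auto
    have "cis (s * y ^ (2 * k + 1) + R * y + (- (R * \<zeta>))) = cis (s * y ^ (2 * k + 1)) * cis (R * (y - \<zeta>))"
      "cis (s * y ^ (2 * k + 1) + (- R) * y + (- ((- R) * \<zeta>))) = cis (s * y ^ (2 * k + 1)) * cis (- (R * (y - \<zeta>)))"
      by (simp_all add: cis_mult algebra_simps)
    then have "?P R y - ?P (- R) y = (1 / (y - \<zeta>)) *\<^sub>R (cis (s * y ^ (2 * k + 1)) * (cis (R * (y - \<zeta>)) - cis (- (R * (y - \<zeta>)))))"
      by (simp only: scaleR_diff_right right_diff_distrib)
    also have "cis (R * (y - \<zeta>)) - cis (- (R * (y - \<zeta>))) = of_real (sin (R * (y - \<zeta>))) * (2 * \<i>)"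
      by (simp add: complex_eq_iff)
    finally have e: "?P R y - ?P (- R) y = (1 / (y - \<zeta>)) *\<^sub>R (cis (s * y ^ (2 * k + 1)) * (of_real (sin (R * (y - \<zeta>))) * (2 * \<i>)))" .
    show "of_real (dirichlet_kernel R (y - \<zeta>)) * cis (s * y ^ (2 * k + 1)) = (?P R y - ?P (- R) y) / (2 * \<i>)"
      unfolding dirichlet_kernel_eq[OF y] e by (subst eq_divide_eq) (simp add: scaleR_conv_of_real mult_ac)
  qed
  also have "\<dots> = (integral {B..A} (?P R) - integral {B..A} (?P (- R))) / (2 * \<i>)"
    by (simp only: integral_divide Henstock_Kurzweil_Integration.integral_diff[OF i i])
  finally have "norm (integral {B..A} (\<lambda>y. of_real (dirichlet_kernel R (y - \<zeta>)) * cis (s * y ^ (2 * k + 1))))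
      = norm (integral {B..A} (?P R) - integral {B..A} (?P (- R))) / 2"
    by (simp add: norm_divide norm_mult)
  also have "\<dots> \<le> (6 / sqrt s * (1 / (B - \<zeta>)) + 6 / sqrt s * (1 / (B - \<zeta>))) / 2"
    by (intro divide_right_mono order_trans[OF norm_triangle_ineq4] add_mono odd_phase_bound_weighted assms) auto
  finally show ?thesis by simp
qed

text \<open>The right tail is a conjugate of the half-line integral, and reflection turns the left
  tail into one with -\<zeta>. The bound is independent of both R and A and small for large
  B.\<close>

lemma odd_tail_bound:
  assumes k: "1 \<le> k" and s: "0 < s" and AB: "\<bar>\<zeta>\<bar> + 1 \<le> B" "B \<le> A"
  defines "K \<equiv> (\<lambda>R y. cis (- (s * y ^ (2 * k + 1))) * of_real (dirichlet_kernel R (y - \<zeta>)))"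
  shows "norm (integral {-A..A} (K R) - integral {-B..B} (K R)) \<le> 12 / sqrt s * (1 / (B - \<bar>\<zeta>\<bar>))"
proof -
  have cK: "continuous_on S (K R)" for S unfolding K_def by (intro continuous_intros)
  have c1: "continuous_on S (\<lambda>y. K R (- y))" for S unfolding K_def by (intro continuous_intros)
  have "integral {-A..A} (K R) - integral {-B..B} (K R) = integral {B..A} (\<lambda>y. K R y + K R (- y))"
    by (subst integral_symmetric_interval[of _ B A]) (use AB cK in auto)
  also have "\<dots> = integral {B..A} (K R) + integral {B..A} (\<lambda>y. K R (- y))"
    by (intro Henstock_Kurzweil_Integration.integral_add integrable_continuous_interval cK c1)
  also have "integral {B..A} (K R) = cnj (integral {B..A} (\<lambda>y. of_real (dirichlet_kernel R (y - \<zeta>)) * cis (s * y ^ (2 * k + 1))))"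
    unfolding integral_cnj by (intro Henstock_Kurzweil_Integration.integral_cong) (simp add: K_def cis_cnj mult.commute)
  also have "integral {B..A} (\<lambda>y. K R (- y)) = integral {B..A} (\<lambda>y. of_real (dirichlet_kernel R (y - (- \<zeta>))) * cis (s * y ^ (2 * k + 1)))"
  proof (intro Henstock_Kurzweil_Integration.integral_cong)
    fix y
    have "dirichlet_kernel R (- y - \<zeta>) = dirichlet_kernel R (y - (- \<zeta>))"
      using dirichlet_kernel_even[of R "y + \<zeta>"] by simp
    then show "K R (- y) = of_real (dirichlet_kernel R (y - (- \<zeta>))) * cis (s * y ^ (2 * k + 1))"
      unfolding K_def by simp
  qed
  finally have "norm (integral {-A..A} (K R) - integral {-B..B} (K R)) \<le> 6 / sqrt s * (1 / (B - \<zeta>)) + 6 / sqrt s * (1 / (B - (- \<zeta>)))"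
    by (simp only:) (intro order_trans[OF norm_triangle_ineq] add_mono, unfold complex_mod_cnj,
      (rule odd_tail_half_bound; use k s AB in auto)+)
  also have "\<dots> \<le> 6 / sqrt s * (1 / (B - \<bar>\<zeta>\<bar>)) + 6 / sqrt s * (1 / (B - \<bar>\<zeta>\<bar>))"
    using AB s by (intro add_mono mult_left_mono divide_left_mono mult_pos_pos) auto
  finally show ?thesis by simp
qed

text \<open>Split F(y) = F(\<xi>) + (y - \<xi>) H(y). The constant part integrates to two sine
  integrals with limit \<pi>/2 each; in the rest the factor y - \<xi> cancels the kernel's
  denominator and the Riemann-Lebesgue lemma applies.\<close>

lemma odd_dirichlet_limit:
  assumes B: "\<bar>\<xi>\<bar> < B"
  shows "((\<lambda>R. integral {-B..B} (\<lambda>y. cis (- (s * y ^ (2 * k + 1))) * of_real (dirichlet_kernel R (y - \<xi>)))) \<longlongrightarrow>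
    of_real pi * cis (- (s * \<xi> ^ (2 * k + 1)))) at_top"
proof -
  define F where "F = (\<lambda>z::complex. exp (- (\<i> * of_real s * z ^ (2 * k + 1))))"
  have F: "F (of_real y) = cis (- (s * y ^ (2 * k + 1)))" for y
    by (simp add: F_def cis_conv_exp mult_ac)
  \<comment> \<open>The divided difference is entire, its singularity at \<xi> being removable; this
    supplies the continuous derivative that the Riemann-Lebesgue lemma asks for.\<close>
  define H where "H = (\<lambda>z. if z = of_real \<xi> then deriv F (of_real \<xi>) else (F z - F (of_real \<xi>)) / (z - of_real \<xi>))"
  have holH: "H holomorphic_on UNIV"
    unfolding H_def by (rule pole_lemma_open) (auto simp: F_def intro!: holomorphic_intros)
  have FH: "F (of_real y) = F (of_real \<xi>) + of_real (y - \<xi>) * H (of_real y)" for y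
    by (simp add: H_def)
  have H': "((\<lambda>y. H (of_real y)) has_vector_derivative deriv H (of_real y)) (at y)" for y
    using has_vector_derivative_real_field[OF holomorphic_derivI[OF holH open_UNIV, of "of_real y"]] by simp
  have cH': "continuous_on S (\<lambda>y. deriv H (complex_of_real y))" for S
    by (rule continuous_on_compose2[OF holomorphic_on_imp_continuous_on[OF holomorphic_deriv[OF holH open_UNIV]]])
       (auto intro!: continuous_intros)
  have cH: "continuous_on S (\<lambda>y. H (complex_of_real y))" for S
    by (rule continuous_on_compose2[OF holomorphic_on_imp_continuous_on[OF holH]]) (auto intro!: continuous_intros)
  have l1: "((\<lambda>R. integral {-B..B} (\<lambda>y. sin (R * (y - \<xi>)) *\<^sub>R H (of_real y))) \<longlongrightarrow> 0) at_top"
    by (rule riemann_lebesgue_sin[OF _ H' cH']) (use B in auto)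
  have dk: "integral {-B..B} (\<lambda>y. dirichlet_kernel R (y - \<xi>)) = Si (R * (B - \<xi>)) + Si (R * (B + \<xi>))" if R: "0 < R" for R
  proof -
    have "((\<lambda>y. dirichlet_kernel R (y - \<xi>)) has_integral (Si (R * (B - \<xi>)) - Si (R * (- B - \<xi>)))) {-B..B}"
    proof (rule fundamental_theorem_of_calculus)
      fix y
      have "((\<lambda>y. R * (y - \<xi>)) has_real_derivative R) (at y within {-B..B})" by (auto intro!: derivative_eq_intros)
      from DERIV_chain2[OF DERIV_Si this]
      show "((\<lambda>y. Si (R * (y - \<xi>))) has_vector_derivative dirichlet_kernel R (y - \<xi>)) (at y within {-B..B})"
        by (simp only: dirichlet_kernel_def has_real_derivative_iff_has_vector_derivative mult.commute)
    qed (use B in auto)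
    moreover have "Si (R * (- B - \<xi>)) = - Si (R * (B + \<xi>))"
    proof -
      have "0 \<le> R * (B + \<xi>)" using R B by (intro mult_nonneg_nonneg) auto
      moreover have "R * (- B - \<xi>) = - (R * (B + \<xi>))" by (simp add: algebra_simps)
      ultimately show ?thesis using Si_neg by (simp only:)
    qed
    ultimately show ?thesis by (simp add: integral_unique)
  qed
  have l2: "((\<lambda>R. Si (R * (B - \<xi>)) + Si (R * (B + \<xi>))) \<longlongrightarrow> pi / 2 + pi / 2) at_top"
  proof (intro tendsto_add filterlim_compose[OF Si_at_top])
    show "filterlim (\<lambda>R. R * (B - \<xi>)) at_top at_top" "filterlim (\<lambda>R. R * (B + \<xi>)) at_top at_top"
      using B by (auto intro!: filterlim_at_top_mult_tendsto_pos[OF tendsto_const _ filterlim_ident] simp: mult.commute)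
  qed
  have "((\<lambda>R. F (of_real \<xi>) * of_real (Si (R * (B - \<xi>)) + Si (R * (B + \<xi>))) + integral {-B..B} (\<lambda>y. sin (R * (y - \<xi>)) *\<^sub>R H (of_real y)))
      \<longlongrightarrow> F (of_real \<xi>) * of_real (pi / 2 + pi / 2) + 0) at_top"
    by (intro tendsto_intros l1 l2)
  then have "((\<lambda>R. F (of_real \<xi>) * of_real (Si (R * (B - \<xi>)) + Si (R * (B + \<xi>))) + integral {-B..B} (\<lambda>y. sin (R * (y - \<xi>)) *\<^sub>R H (of_real y)))
      \<longlongrightarrow> of_real pi * cis (- (s * \<xi> ^ (2 * k + 1)))) at_top"
    by (simp add: F mult.commute)
  then show ?thesis
  proof (rule Lim_transform_eventually)
    show "\<forall>\<^sub>F R in at_top. F (of_real \<xi>) * of_real (Si (R * (B - \<xi>)) + Si (R * (B + \<xi>))) + integral {-B..B} (\<lambda>y. sin (R * (y - \<xi>)) *\<^sub>R H (of_real y))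
       = integral {-B..B} (\<lambda>y. cis (- (s * y ^ (2 * k + 1))) * of_real (dirichlet_kernel R (y - \<xi>)))"
      using eventually_gt_at_top[of 0]
    proof eventually_elim
      case (elim R)
      have "integral {-B..B} (\<lambda>y. cis (- (s * y ^ (2 * k + 1))) * of_real (dirichlet_kernel R (y - \<xi>)))
         = integral {-B..B} (\<lambda>y. F (of_real \<xi>) * of_real (dirichlet_kernel R (y - \<xi>)) + sin (R * (y - \<xi>)) *\<^sub>R H (of_real y))"
      proof (rule Henstock_Kurzweil_Integration.integral_cong)
        fix y
        show "cis (- (s * y ^ (2 * k + 1))) * of_real (dirichlet_kernel R (y - \<xi>)) = F (of_real \<xi>) * of_real (dirichlet_kernel R (y - \<xi>)) + sin (R * (y - \<xi>)) *\<^sub>R H (of_real y)"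
          unfolding F[symmetric] FH[of y] dirichlet_kernel_mult[of R "y - \<xi>", symmetric]
          by (simp add: scaleR_conv_of_real algebra_simps)
      qed
      also have "\<dots> = integral {-B..B} (\<lambda>y. F (of_real \<xi>) * of_real (dirichlet_kernel R (y - \<xi>))) + integral {-B..B} (\<lambda>y. sin (R * (y - \<xi>)) *\<^sub>R H (of_real y))"
        by (intro Henstock_Kurzweil_Integration.integral_add integrable_continuous_interval continuous_intros cH)
      also have "integral {-B..B} (\<lambda>y. F (of_real \<xi>) * of_real (dirichlet_kernel R (y - \<xi>))) = F (of_real \<xi>) * of_real (integral {-B..B} (\<lambda>y. dirichlet_kernel R (y - \<xi>)))"
        by (subst integral_linear[of _ _ complex_of_real, unfolded o_def, symmetric])
           (auto intro!: integrable_continuous_interval continuous_intros bounded_linear_of_real)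
      finally show ?case by (simp only: dk[OF elim])
    qed
  qed
qed

text \<open>Two limits have to be interchanged: A, which defines the law, and R, which defines its
  improper transform. \<open>T A R\<close> is the doubly truncated quantity. Its tail in A is small
  uniformly in R, so A may be stopped at a fixed B while R tends to infinity.\<close>

lemma odd_order_law_improper_fourier:
  assumes k: "1 \<le> k" and s: "0 < s"
  shows "has_improper_fourier (\<lambda>x. odd_order_law k x s) \<xi> (cis (- (s * \<xi> ^ (2 * k + 1))))"
proof -
  define T where "T = (\<lambda>A R. integral {-A..A} (\<lambda>y. cis (- (s * y ^ (2 * k + 1))) * of_real (dirichlet_kernel R (y - \<xi>))) / of_real pi)"
  define D where "D = (\<lambda>R. LINT x:{-R..R}|lborel. cis (\<xi> * x) * complex_of_real (odd_order_law k x s))"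
  define C where "C = 12 / sqrt s / pi"
  have C: "C > 0" using s by (simp add: C_def)
  have [measurable]: "(\<lambda>x. odd_order_law k x s) \<in> borel_measurable borel"
    by (intro borel_measurable_continuous_onI continuous_odd_order_law k s)
  have T_eq: "(LINT x:{-R..R}|lborel. cis (\<xi> * x) * complex_of_real (odd_partial k x s A)) = T A R" if "0 \<le> A" "0 \<le> R" for A R
  proof -
    have contp: "continuous_on {-R..R} (\<lambda>x. complex_of_real (odd_partial k x s A))"
    proof -
      have "continuous_on {-R..R} (\<lambda>x. integral (cbox (-A) A) (\<lambda>\<eta>. cis (- (\<eta> * x + s * \<eta> ^ (2 * k + 1)))))"
        by (rule integral_continuous_on_param) (auto simp: split_beta intro!: continuous_intros)
      then show ?thesis unfolding odd_partial_eq_complex[OF that(1)] box_real by (intro continuous_intros) auto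
    qed
    have "(LINT x:{-R..R}|lborel. cis (\<xi> * x) * complex_of_real (odd_partial k x s A))
       = integral {-R..R} (\<lambda>x. cis (\<xi> * x) * complex_of_real (odd_partial k x s A))"
      by (intro set_lebesgue_integral_eq_integral continuous_intros contp)
    also have "\<dots> = integral {-A..A} (\<lambda>\<eta>. cis (- (s * \<eta> ^ (2 * k + 1))) * integral {-R..R} (\<lambda>x. cis (\<xi> * x) * cis (- (\<eta> * x)))) / of_real (2 * pi)"
      by (rule integral_odd_partial_swap[OF that(1)]) (intro continuous_intros)
    also have "\<dots> = integral {-A..A} (\<lambda>\<eta>. 2 * (cis (- (s * \<eta> ^ (2 * k + 1))) * of_real (dirichlet_kernel R (\<eta> - \<xi>)))) / of_real (2 * pi)"
    proof (intro arg_cong2[where f="(/)"] refl Henstock_Kurzweil_Integration.integral_cong)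
      fix \<eta>
      have "cis (\<xi> * x) * cis (- (\<eta> * x)) = cis ((\<xi> - \<eta>) * x)" for x by (simp add: cis_mult algebra_simps)
      then have "integral {-R..R} (\<lambda>x. cis (\<xi> * x) * cis (- (\<eta> * x))) = of_real (2 * dirichlet_kernel R (\<eta> - \<xi>))"
        using integral_cis_symmetric[OF that(2), of "\<xi> - \<eta>"] dirichlet_kernel_even[of R "\<eta> - \<xi>"] by simp
      then show "cis (- (s * \<eta> ^ (2 * k + 1))) * integral {-R..R} (\<lambda>x. cis (\<xi> * x) * cis (- (\<eta> * x)))
        = 2 * (cis (- (s * \<eta> ^ (2 * k + 1))) * of_real (dirichlet_kernel R (\<eta> - \<xi>)))"
        by (simp only: of_real_mult of_real_numeral mult_ac)
    qed
    finally show ?thesis unfolding T_def integral_mult_right by simp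
  qed
  have T_D: "((\<lambda>A. T A R) \<longlongrightarrow> D R) at_top" if R: "0 \<le> R" for R
  proof -
    have "((\<lambda>A. LINT x:{-R..R}|lborel. cis (\<xi> * x) * complex_of_real (odd_partial k x s A)) \<longlongrightarrow> D R) at_top"
      unfolding D_def set_lebesgue_integral_def
    proof (rule integral_dominated_convergence_at_top[where w="\<lambda>x. indicator {-R..R} x * (3 * s powr (- 1 / real (2 * k + 1)))"])
      show "\<forall>\<^sub>F A in at_top. AE x in lborel. norm (indicator {-R..R} x *\<^sub>R (cis (\<xi> * x) * complex_of_real (odd_partial k x s A)))
          \<le> indicator {-R..R} x * (3 * s powr (- 1 / real (2 * k + 1)))"
      proof (intro always_eventually allI AE_I2)
        fix A x :: real
        show "norm (indicator {-R..R} x *\<^sub>R (cis (\<xi> * x) * complex_of_real (odd_partial k x s A)))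
          \<le> indicator {-R..R} x * (3 * s powr (- 1 / real (2 * k + 1)))"
          unfolding norm_scaleR norm_mult norm_cis norm_of_real mult_1
          using mult_left_mono[OF odd_partial_bound[OF k s, of x A], of "indicator {-R..R} x"] by simp
      qed
      show "AE x in lborel. ((\<lambda>A. indicator {-R..R} x *\<^sub>R (cis (\<xi> * x) * complex_of_real (odd_partial k x s A))) \<longlongrightarrow>
          indicator {-R..R} x *\<^sub>R (cis (\<xi> * x) * complex_of_real (odd_order_law k x s))) at_top"
        by (intro AE_I2 tendsto_intros odd_order_law_eq(2) k s)
      show "integrable lborel (\<lambda>x. indicator {-R..R} x * (3 * s powr (- 1 / real (2 * k + 1))))"
        using borel_integrable_atLeastAtMost'[of "-R" R "\<lambda>_. 3 * s powr (- 1 / real (2 * k + 1))", OF continuous_on_const]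
        unfolding set_integrable_def by simp
      show "(\<lambda>x. indicator {-R..R} x *\<^sub>R (cis (\<xi> * x) * complex_of_real (odd_partial k x s A))) \<in> borel_measurable lborel" for A
        unfolding odd_partial_def set_lebesgue_integral_def by measurable
    qed auto
    then show ?thesis
      by (rule Lim_transform_eventually, intro eventually_mono[OF eventually_ge_at_top[of 0]]) (simp only: T_eq R)
  qed
  have tail: "norm (D R - T B R) \<le> C / (B - \<bar>\<xi>\<bar>)" if "0 \<le> R" "\<bar>\<xi>\<bar> + 1 \<le> B" for B R
  proof (rule tendsto_upperbound)
    show "((\<lambda>A. norm (T A R - T B R)) \<longlongrightarrow> norm (D R - T B R)) at_top" by (intro tendsto_intros T_D that)
    show "\<forall>\<^sub>F A in at_top. norm (T A R - T B R) \<le> C / (B - \<bar>\<xi>\<bar>)"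
      using eventually_ge_at_top[of B]
    proof eventually_elim
      case (elim A)
      from divide_right_mono[OF odd_tail_bound[OF k s that(2) elim, of R], of pi]
      have "norm (T A R - T B R) \<le> 12 / sqrt s * (1 / (B - \<bar>\<xi>\<bar>)) / pi"
        unfolding T_def diff_divide_distrib[symmetric] norm_divide by simp
      then show ?case by (simp add: C_def mult_ac)
    qed
  qed simp
  have "((\<lambda>R. D R) \<longlongrightarrow> cis (- (s * \<xi> ^ (2 * k + 1)))) at_top"
  proof (rule tendstoI)
    fix e :: real assume e: "0 < e"
    \<comment> \<open>Chosen so that the tail bound C / (B - |\<xi>|) is below e / 2.\<close>
    define B where "B = \<bar>\<xi>\<bar> + 1 + 2 * C / e"
    have B: "\<bar>\<xi>\<bar> + 1 \<le> B" using C e by (simp add: B_def)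
    have "C / (B - \<bar>\<xi>\<bar>) < e / 2" using C e by (simp add: B_def field_simps add_pos_pos)
    have "((\<lambda>R. T B R) \<longlongrightarrow> of_real pi * cis (- (s * \<xi> ^ (2 * k + 1))) / of_real pi) at_top"
      unfolding T_def by (intro tendsto_intros odd_dirichlet_limit) (use B in auto)
    then have "\<forall>\<^sub>F R in at_top. dist (T B R) (cis (- (s * \<xi> ^ (2 * k + 1)))) < e / 2"
      using e by (intro tendstoD) auto
    then show "\<forall>\<^sub>F R in at_top. dist (D R) (cis (- (s * \<xi> ^ (2 * k + 1)))) < e"
      using eventually_ge_at_top[of 0]
    proof eventually_elim
      case (elim R)
      have "dist (D R) (T B R) < e / 2"
        unfolding dist_norm by (rule order.strict_trans1[OF tail[OF elim(2) B] \<open>C / (B - \<bar>\<xi>\<bar>) < e / 2\<close>])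
      with elim(1) show ?case using dist_triangle[of "D R" "cis (- (s * \<xi> ^ (2 * k + 1)))" "T B R"] by simp
    qed
  qed
  then show ?thesis unfolding has_improper_fourier_def D_def .
qed


section \<open>The initial datum of the pseudoprocess\<close>

lemma integrable_inverse_one_plus_square: "integrable lborel (\<lambda>x::real. 1 / (1 + x\<^sup>2))"
proof -
  have 1: "set_integrable lborel {0<..} (\<lambda>x::real. 1 / (1 + x\<^sup>2))"
    using integrable_I0i_1_div_plus_square
    by (simp add: interval_lebesgue_integrable_def zero_ereal_def)
  then have "integrable lborel (\<lambda>x. indicator {0<..} (0 + (-1) * x) *\<^sub>R (1 / (1 + (0 + (-1) * x)\<^sup>2)) :: real)"
    unfolding set_integrable_def by (rule lborel_integrable_real_affine) simp
  with 1 have "integrable lborel (\<lambda>x. indicator {0<..} x *\<^sub>R (1 / (1 + x\<^sup>2)) + indicator {0<..} (0 + (-1) * x) *\<^sub>R (1 / (1 + (0 + (-1) * x)\<^sup>2)) :: real)"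
    unfolding set_integrable_def by (rule Bochner_Integration.integrable_add)
  then show ?thesis
    by (subst integrable_discrete_difference[where X="{0}"]) (auto simp: indicator_def)
qed

lemma lebesgue_integral_compact_support:
  fixes f :: "real \<Rightarrow> 'a::euclidean_space"
  assumes "continuous_on {-R..R} f" "\<And>x. R < \<bar>x\<bar> \<Longrightarrow> f x = 0"
  shows "(LINT x|lborel. f x) = integral {-R..R} f" "integrable lborel f"
proof -
  have eq: "(\<lambda>x. indicator {-R..R} x *\<^sub>R f x) = f"
    using assms(2) by (auto simp: fun_eq_iff indicator_def)
  show "(LINT x|lborel. f x) = integral {-R..R} f"
    using set_lebesgue_integral_eq_integral[OF assms(1)] by (simp add: set_lebesgue_integral_def eq)
  show "integrable lborel f"
    using borel_integrable_atLeastAtMost'[OF assms(1)] by (simp add: set_integrable_def eq)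
qed

text \<open>Two integrations by parts give \<xi>^2 times the transform as minus the transform of the
  second derivative, hence decay like 1 / (1 + \<xi>^2). Then the inversion theorem at 0 gives the
  value of the integral.\<close>

lemma test_function_fourier_integrable:
  assumes t: "test_function \<phi>"
  defines "g \<equiv> \<lambda>\<xi>. (LINT x|lborel. cis (- (x * \<xi>)) * of_real (\<phi> x)) / of_real (2 * pi)"
  shows "integrable lborel g" "continuous_on UNIV \<phi>"
    and "(LINT \<xi>|lborel. g \<xi>) = of_real (\<phi> 0)"
    and "\<exists>R\<ge>0. \<forall>x. R < \<bar>x\<bar> \<longrightarrow> \<phi> x = 0"
proof -
  obtain R0 where R0: "\<And>x. R0 < \<bar>x\<bar> \<Longrightarrow> \<phi> x = 0" using t by (auto simp: test_function_def)
  \<comment> \<open>Enlarging R0 by 1 makes \<phi> vanish in a neighbourhood of the end points, so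
    that its derivative vanishes there as well.\<close>
  define R where "R = \<bar>R0\<bar> + 1"
  have R: "0 \<le> R" "\<And>x. R \<le> \<bar>x\<bar> \<Longrightarrow> \<phi> x = 0" using R0 by (auto simp: R_def)
  then show "\<exists>R\<ge>0. \<forall>x. R < \<bar>x\<bar> \<longrightarrow> \<phi> x = 0" by (intro exI[of _ R]) auto
  have diff: "(deriv ^^ j) \<phi> differentiable (at x)" for j x
    using t unfolding test_function_def times_differentiable_def by blast
  have d: "((deriv ^^ j) \<phi> has_real_derivative (deriv ^^ Suc j) \<phi> x) (at x)" for j x
    using diff[of j x] DERIV_imp_deriv[of "(deriv ^^ j) \<phi>"] unfolding real_differentiable_def by auto
  have cont: "continuous_on S ((deriv ^^ j) \<phi>)" for j S
    using diff by (intro continuous_at_imp_continuous_on ballI differentiable_imp_continuous_within) auto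
  show c0: "continuous_on UNIV \<phi>" using cont[of UNIV 0] by simp
  then have c0S: "continuous_on S \<phi>" for S using continuous_on_subset by blast
  have d0: "deriv \<phi> x = 0" if "R \<le> \<bar>x\<bar>" for x
  proof -
    have "\<forall>\<^sub>F y in nhds x. R0 < \<bar>y\<bar>"
      using that by (intro eventually_nhds_in_open[of "{y. R0 < \<bar>y\<bar>}" x, simplified] open_Collect_less continuous_intros) (auto simp: R_def)
    then have "\<forall>\<^sub>F y in nhds x. \<phi> y = (\<lambda>_. 0) y" by eventually_elim (use R0 in auto)
    then have "deriv \<phi> x = deriv (\<lambda>_. 0 :: real) x" by (rule deriv_cong_ev) simp
    then show ?thesis by simp
  qed
  define I where "I = (\<lambda>\<xi>. integral {-R..R} (\<lambda>x. cis (- (x * \<xi>)) * of_real (\<phi> x)))"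
  define I2 where "I2 = (\<lambda>\<xi>. integral {-R..R} (\<lambda>x. cis (- (x * \<xi>)) * of_real ((deriv ^^ 2) \<phi> x)))"
  have g_eq: "g \<xi> = I \<xi> / of_real (2 * pi)" for \<xi>
    unfolding g_def I_def
    by (subst lebesgue_integral_compact_support(1)[of R]) (use R in \<open>auto intro!: continuous_intros c0S\<close>)
  have parts: "I2 \<xi> = - (of_real (\<xi>\<^sup>2) * I \<xi>)" for \<xi>
  proof -
    \<comment> \<open>Both integrations by parts in one primitive: its derivative is cis (-x \<xi>)
      (\<phi>'' + \<xi>^2 \<phi>), the mixed terms in \<phi>' cancelling.\<close>
    define F where "F = (\<lambda>x. cis (- (x * \<xi>)) * (of_real (deriv \<phi> x) + \<i> * of_real \<xi> * of_real (\<phi> x)))"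
    have "((\<lambda>x. cis (- (x * \<xi>)) * of_real ((deriv ^^ 2) \<phi> x) + of_real (\<xi>\<^sup>2) * (cis (- (x * \<xi>)) * of_real (\<phi> x))) has_integral (F R - F (- R))) {-R..R}"
    proof (rule fundamental_theorem_of_calculus)
      fix x
      have "((\<lambda>x. - (x * \<xi>)) has_real_derivative - \<xi>) (at x)" by (auto intro!: derivative_eq_intros)
      note 1 = has_vector_derivative_cis[OF this]
      have "(deriv \<phi> has_real_derivative (deriv ^^ 2) \<phi> x) (at x)" using d[of 1 x] by (simp add: numeral_2_eq_2)
      moreover have "(\<phi> has_real_derivative deriv \<phi> x) (at x)" using d[of 0 x] by simp
      ultimately have "((\<lambda>x. complex_of_real (deriv \<phi> x) + \<i> * of_real \<xi> * of_real (\<phi> x)) has_vector_derivative of_real ((deriv ^^ 2) \<phi> x) + \<i> * of_real \<xi> * of_real (deriv \<phi> x)) (at x)"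
        by (intro has_vector_derivative_add has_vector_derivative_mult_right has_vector_derivative_of_real)
           (auto simp: has_real_derivative_iff_has_vector_derivative)
      note * = has_vector_derivative_mult[OF 1 this]
      show "(F has_vector_derivative cis (- (x * \<xi>)) * of_real ((deriv ^^ 2) \<phi> x) + of_real (\<xi>\<^sup>2) * (cis (- (x * \<xi>)) * of_real (\<phi> x))) (at x within {-R..R})"
      proof -
        have alg: "c * (p + \<i> * y * q) + (- y) * (\<i> * c) * (q + \<i> * y * r) = c * p + y\<^sup>2 * (c * r)" for c p q r y :: complex
        proof -
          have "\<i> * \<i> = (-1 :: complex)" by simp
          then show ?thesis by algebra
        qed
        show ?thesis
          using *[unfolded of_real_minus alg] unfolding F_def of_real_power by (rule has_vector_derivative_at_within)
      qed
    qed (use R in auto)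
    then have "integral {-R..R} (\<lambda>x. cis (- (x * \<xi>)) * of_real ((deriv ^^ 2) \<phi> x) + of_real (\<xi>\<^sup>2) * (cis (- (x * \<xi>)) * of_real (\<phi> x))) = F R - F (- R)"
      by (rule integral_unique)
    moreover have "F R = 0" "F (- R) = 0" using R d0 by (auto simp: F_def)
    moreover have "integral {-R..R} (\<lambda>x. cis (- (x * \<xi>)) * of_real ((deriv ^^ 2) \<phi> x) + of_real (\<xi>\<^sup>2) * (cis (- (x * \<xi>)) * of_real (\<phi> x))) = I2 \<xi> + of_real (\<xi>\<^sup>2) * I \<xi>"
      unfolding I_def I2_def integral_mult_right[symmetric]
      by (intro Henstock_Kurzweil_Integration.integral_add integrable_continuous_interval continuous_intros cont c0S)
    ultimately show ?thesis by (simp add: eq_neg_iff_add_eq_0)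
  qed
  have bdd: "\<exists>K. \<forall>x\<in>{-R..R}. \<bar>f x\<bar> \<le> K" if "continuous_on {-R..R} f" for f :: "real \<Rightarrow> real"
    using compact_imp_bounded[OF compact_continuous_image[OF that compact_Icc]] unfolding bounded_iff by auto
  obtain K0 where K0: "\<And>x. x \<in> {-R..R} \<Longrightarrow> \<bar>\<phi> x\<bar> \<le> K0" using bdd[OF c0S] by blast
  obtain K2 where K2: "\<And>x. x \<in> {-R..R} \<Longrightarrow> \<bar>(deriv ^^ 2) \<phi> x\<bar> \<le> K2" using bdd[OF cont] by blast
  have I: "norm (I \<xi>) \<le> K0 * (R - - R)" for \<xi>
    unfolding I_def using R K0 by (intro integral_bound) (auto intro!: continuous_intros c0S simp: norm_mult)
  have I2: "norm (I2 \<xi>) \<le> K2 * (R - - R)" for \<xi>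
    unfolding I2_def using R K2 by (intro integral_bound) (auto intro!: continuous_intros cont simp: norm_mult)
  have decay: "norm (g \<xi>) \<le> (K0 + K2) * (2 * R) / (2 * pi) * (1 / (1 + \<xi>\<^sup>2))" for \<xi>
  proof -
    have "norm (I2 \<xi>) = \<xi>\<^sup>2 * norm (I \<xi>)" unfolding parts by (simp add: norm_mult norm_power)
    then have "(1 + \<xi>\<^sup>2) * norm (I \<xi>) \<le> (K0 + K2) * (2 * R)" using I[of \<xi>] I2[of \<xi>] by (simp add: algebra_simps)
    then have "norm (I \<xi>) \<le> (K0 + K2) * (2 * R) / (1 + \<xi>\<^sup>2)" 
      by (simp add: pos_le_divide_eq add_pos_nonneg mult.commute)
    then have "norm (I \<xi>) / (2 * pi) \<le> (K0 + K2) * (2 * R) / (1 + \<xi>\<^sup>2) / (2 * pi)" by (rule divide_right_mono) simp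
    then show ?thesis by (simp add: g_eq norm_divide norm_mult mult_ac)
  qed
  have [measurable]: "\<phi> \<in> borel_measurable borel" by (rule borel_measurable_continuous_onI[OF c0])
  show gi: "integrable lborel g"
  proof (rule Bochner_Integration.integrable_bound[OF integrable_mult_right[OF integrable_inverse_one_plus_square]])
    show "g \<in> borel_measurable lborel" unfolding g_def by measurable
    show "AE \<xi> in lborel. norm (g \<xi>) \<le> norm ((K0 + K2) * (2 * R) / (2 * pi) * (1 / (1 + \<xi>\<^sup>2)))"
      using decay by (intro AE_I2) (metis abs_ge_self order_trans real_norm_def)
  qed
  have "(LINT x|lborel. cis (0 * x) * g x) = complex_of_real (\<phi> 0)"
  proof (rule fourier_inversion[where K=K0])
    show "integrable lborel (\<lambda>x. complex_of_real (\<phi> x))"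
      by (rule lebesgue_integral_compact_support(2)[of R]) (use R in \<open>auto intro!: continuous_intros c0S\<close>)
    show "norm (complex_of_real (\<phi> x)) \<le> K0" for x
      using K0[of x] R(2)[of x] order_trans[OF abs_ge_zero K0[of 0]] R(1) by (cases "x \<in> {-R..R}") auto
    show "g x = (LINT \<eta>|lborel. cis (- (\<eta> * x)) * complex_of_real (\<phi> \<eta>)) / of_real (2 * pi)" for x
      unfolding g_def ..
  qed (intro continuous_intros c0S gi)+
  then show "(LINT \<xi>|lborel. g \<xi>) = of_real (\<phi> 0)" by simp
qed

text \<open>Parseval moves the problem to the frequency side, where \<integral> cis (-s
  \<xi>^(2k+1)) g(\<xi>) d\<xi> is dominated by |g| as s tends to 0. Parseval itself is obtained
  through the truncations, since the law is not absolutely integrable.\<close>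

lemma odd_order_law_initial:
  assumes k: "1 \<le> k" and t: "test_function \<phi>"
  shows "((\<lambda>s. LINT x|lborel. \<phi> x * odd_order_law k x s) \<longlongrightarrow> \<phi> 0) (at_right 0)"
proof -
  define g where "g = (\<lambda>\<xi>. (LINT x|lborel. cis (- (x * \<xi>)) * of_real (\<phi> x)) / of_real (2 * pi))"
  note g = test_function_fourier_integrable[OF t, folded g_def]
  obtain R where R: "0 \<le> R" "\<And>x. R < \<bar>x\<bar> \<Longrightarrow> \<phi> x = 0" using g(4) by blast
  have c0S: "continuous_on S \<phi>" for S using g(2) continuous_on_subset by blast
  have [measurable]: "\<phi> \<in> borel_measurable borel" "g \<in> borel_measurable borel"
    using borel_measurable_continuous_onI[OF g(2)] g(1) by auto
  have phi: "integrable lborel \<phi>" by (rule lebesgue_integral_compact_support(2)[OF c0S R(2)])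
  have key: "complex_of_real (LINT x|lborel. \<phi> x * odd_order_law k x s) = (LINT \<xi>|lborel. cis (- (s * \<xi> ^ (2 * k + 1))) * g \<xi>)"
    if s: "0 < s" for s
  proof -
    have [measurable]: "(\<lambda>x. odd_order_law k x s) \<in> borel_measurable borel"
      by (intro borel_measurable_continuous_onI continuous_odd_order_law k s)
    have eq: "(LINT x|lborel. of_real (\<phi> x) * complex_of_real (odd_partial k x s A)) =
        (LINT \<xi>|lborel. indicator {-A..A} \<xi> *\<^sub>R (cis (- (s * \<xi> ^ (2 * k + 1))) * g \<xi>))" if A: "0 \<le> A" for A
    proof -
      have cpart: "continuous_on {-R..R} (\<lambda>x. complex_of_real (odd_partial k x s A))"
      proof -
        have "continuous_on {-R..R} (\<lambda>x. integral (cbox (-A) A) (\<lambda>\<eta>. cis (- (\<eta> * x + s * \<eta> ^ (2 * k + 1)))))"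
          by (rule integral_continuous_on_param) (auto simp: split_beta intro!: continuous_intros)
        then show ?thesis unfolding odd_partial_eq_complex[OF A] box_real by (intro continuous_intros) auto
      qed
      have inner: "integral {-R..R} (\<lambda>x. complex_of_real (\<phi> x) * cis (- (\<eta> * x))) = of_real (2 * pi) * g \<eta>" for \<eta>
        unfolding g_def
        by (subst lebesgue_integral_compact_support(1)[of R]) (use R in \<open>auto intro!: continuous_intros c0S simp: mult.commute\<close>)
      have cg: "continuous_on {-A..A} g"
      proof -
        have "continuous_on {-A..A} (\<lambda>\<eta>. integral (cbox (-R) R) (\<lambda>x. complex_of_real (\<phi> x) * cis (- (\<eta> * x))) / of_real (2 * pi))"
          by (intro continuous_intros integral_continuous_on_param)
             (auto simp: split_beta intro!: continuous_intros continuous_on_compose2[OF g(2)])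
        then show ?thesis unfolding box_real inner by simp
      qed
      have "(LINT x|lborel. of_real (\<phi> x) * complex_of_real (odd_partial k x s A)) = integral {-R..R} (\<lambda>x. of_real (\<phi> x) * complex_of_real (odd_partial k x s A))"
        by (rule lebesgue_integral_compact_support(1)) (use R in \<open>auto intro!: continuous_intros c0S cpart\<close>)
      also have "\<dots> = integral {-A..A} (\<lambda>\<eta>. cis (- (s * \<eta> ^ (2 * k + 1))) * integral {-R..R} (\<lambda>x. of_real (\<phi> x) * cis (- (\<eta> * x)))) / of_real (2 * pi)"
        by (rule integral_odd_partial_swap[OF A]) (intro continuous_intros c0S)
      also have "\<dots> = integral {-A..A} (\<lambda>\<eta>. cis (- (s * \<eta> ^ (2 * k + 1))) * g \<eta>)"
        unfolding inner integral_divide[symmetric] by simp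
      also have "\<dots> = (LINT \<xi>:{-A..A}|lborel. cis (- (s * \<xi> ^ (2 * k + 1))) * g \<xi>)"
        by (rule set_lebesgue_integral_eq_integral[symmetric]) (intro continuous_intros cg)
      finally show ?thesis unfolding set_lebesgue_integral_def .
    qed
    have l1: "((\<lambda>A. LINT x|lborel. of_real (\<phi> x) * complex_of_real (odd_partial k x s A)) \<longlongrightarrow> (LINT x|lborel. of_real (\<phi> x) * complex_of_real (odd_order_law k x s))) at_top"
    proof (rule integral_dominated_convergence_at_top[where w="\<lambda>x. \<bar>\<phi> x\<bar> * (3 * s powr (- 1 / real (2 * k + 1)))"])
      show "\<forall>\<^sub>F A in at_top. AE x in lborel. norm (of_real (\<phi> x) * complex_of_real (odd_partial k x s A)) \<le> \<bar>\<phi> x\<bar> * (3 * s powr (- 1 / real (2 * k + 1)))"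
        unfolding norm_mult norm_of_real
        by (intro always_eventually allI AE_I2 mult_left_mono odd_partial_bound k s abs_ge_zero)
      show "AE x in lborel. ((\<lambda>A. of_real (\<phi> x) * complex_of_real (odd_partial k x s A)) \<longlongrightarrow> of_real (\<phi> x) * complex_of_real (odd_order_law k x s)) at_top"
        by (intro AE_I2 tendsto_intros odd_order_law_eq(2) k s)
      show "(\<lambda>x. of_real (\<phi> x) * complex_of_real (odd_partial k x s A)) \<in> borel_measurable lborel" for A
        unfolding odd_partial_def set_lebesgue_integral_def by measurable
      show "integrable lborel (\<lambda>x. \<bar>\<phi> x\<bar> * (3 * s powr (- 1 / real (2 * k + 1))))"
        using phi by (intro integrable_mult_left integrable_abs)
    qed simp
    have l2: "((\<lambda>A. LINT \<xi>|lborel. indicator {-A..A} \<xi> *\<^sub>R (cis (- (s * \<xi> ^ (2 * k + 1))) * g \<xi>)) \<longlongrightarrow> (LINT \<xi>|lborel. cis (- (s * \<xi> ^ (2 * k + 1))) * g \<xi>)) at_top"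
    proof (rule integral_dominated_convergence_at_top[where w="\<lambda>x. norm (g x)"])
      show "AE \<xi> in lborel. ((\<lambda>A. indicator {-A..A} \<xi> *\<^sub>R (cis (- (s * \<xi> ^ (2 * k + 1))) * g \<xi>)) \<longlongrightarrow> cis (- (s * \<xi> ^ (2 * k + 1))) * g \<xi>) at_top"
      proof (rule AE_I2, rule tendsto_eventually)
        fix \<xi> :: real
        show "\<forall>\<^sub>F A in at_top. indicator {-A..A} \<xi> *\<^sub>R (cis (- (s * \<xi> ^ (2 * k + 1))) * g \<xi>) = cis (- (s * \<xi> ^ (2 * k + 1))) * g \<xi>"
          using eventually_ge_at_top[of "\<bar>\<xi>\<bar>"] by eventually_elim (auto simp: indicator_def)
      qed
    qed (use g(1) in \<open>auto simp: norm_mult indicator_def\<close>)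
    have "((\<lambda>A. LINT x|lborel. of_real (\<phi> x) * complex_of_real (odd_partial k x s A)) \<longlongrightarrow> (LINT \<xi>|lborel. cis (- (s * \<xi> ^ (2 * k + 1))) * g \<xi>)) at_top"
      by (rule Lim_transform_eventually[OF l2], rule eventually_mono[OF eventually_ge_at_top[of 0]]) (simp only: eq)
    from tendsto_unique[OF _ l1 this]
    have "(LINT x|lborel. complex_of_real (\<phi> x * odd_order_law k x s)) = (LINT \<xi>|lborel. cis (- (s * \<xi> ^ (2 * k + 1))) * g \<xi>)" by simp
    then show ?thesis by (simp only: integral_complex_of_real)
  qed
  have "((\<lambda>s. LINT \<xi>|lborel. cis (- (s * \<xi> ^ (2 * k + 1))) * g \<xi>) \<longlongrightarrow> (LINT \<xi>|lborel. g \<xi>)) (at_right 0)"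
  proof (rule tendsto_lebesgue_integral_within[where g="\<lambda>x. norm (g x)"])
    have "((\<lambda>s. cis (- (s * \<xi> ^ (2 * k + 1))) * g \<xi>) \<longlongrightarrow> cis (- (0 * \<xi> ^ (2 * k + 1))) * g \<xi>) (at_right 0)" for \<xi>
      by (intro tendsto_intros tendsto_cis)
    then show "AE \<xi> in lborel. ((\<lambda>s. cis (- (s * \<xi> ^ (2 * k + 1))) * g \<xi>) \<longlongrightarrow> g \<xi>) (at_right 0)" by simp
  qed (use g(1) in \<open>auto simp: norm_mult\<close>)
  then have "((\<lambda>s. complex_of_real (LINT x|lborel. \<phi> x * odd_order_law k x s)) \<longlongrightarrow> of_real (\<phi> 0)) (at_right 0)"
    unfolding g(3) by (rule Lim_transform_eventually) (auto simp: key eventually_at_filter)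
  from tendsto_Re[OF this] show ?thesis by simp
qed

theorem odd_order_fundamental_solution:
  assumes "1 \<le> k"
  shows "odd_order_fundamental_solution k (odd_order_law k)"
  unfolding odd_order_fundamental_solution_def
  using odd_order_law_derivatives(2)[OF assms] odd_order_law_time_derivative[OF assms]
    odd_order_law_initial[OF assms] odd_order_law_improper_fourier[OF assms] by blast

section \<open>Stable kernels\<close>

lemma powr_polar:
  assumes "0 < r" "- pi < t" "t \<le> pi"
  shows "(of_real r * cis t) powr (of_real a) = of_real (r powr a) * cis (a * t)"
proof -
  have "of_real r * cis t = exp (of_real (ln r) + \<i> * of_real t)"
    using assms by (simp add: exp_add cis_conv_exp exp_of_real)
  then have "Ln (of_real r * cis t) = of_real (ln r) + \<i> * of_real t"
    using assms by (simp only:) (rule Ln_exp, auto)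
  then show ?thesis
    using assms by (simp add: powr_def exp_add[symmetric] cis_conv_exp algebra_simps flip: exp_of_real)
qed

lemma norm_powr_of_real:
  fixes z :: complex
  assumes "z \<noteq> 0"
  shows "norm (z powr of_real a) = norm z powr a"
  using assms by (simp add: powr_def norm_exp_eq_Re)

text \<open>The constant b covers two cases: b = 0 gives minus a Laplace transform, and b = 1 the
  integral of 1 - exp (-z v) against a density too singular at 0 to be integrable.\<close>

lemma laplace_has_field_derivative:
  fixes k :: "real \<Rightarrow> real" and b z0 :: complex
  assumes supp: "\<And>v. v < 0 \<Longrightarrow> k v = 0"
    and int: "\<And>z. 0 < Re z \<Longrightarrow> integrable lborel (\<lambda>v. of_real (k v) * (b - exp (- (z * of_real v))))"
    and int': "\<And>a. 0 < a \<Longrightarrow> integrable lborel (\<lambda>v. k v * v * exp (- (a * v)))"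
    and z0: "0 < Re z0"
  shows "((\<lambda>z. LINT v|lborel. of_real (k v) * (b - exp (- (z * of_real v)))) has_field_derivative
      (LINT v|lborel. of_real (k v * v) * exp (- (z0 * of_real v)))) (at z0)"
proof -
  define a where "a = Re z0 / 2"
  have a: "0 < a" "a < Re z0" using z0 by (auto simp: a_def)
  show ?thesis
  proof (rule has_field_derivative_lebesgue_integral(1)[where S="{z. a < Re z}" and g="\<lambda>v. norm (k v * v * exp (- (a * v)))"])
    show "open {z. a < Re z}" by (rule open_halfspace_Re_gt)
    show "integrable lborel (\<lambda>v. norm (k v * v * exp (- (a * v))))" by (rule integrable_norm[OF int'[OF a(1)]])
    fix z v assume z: "z \<in> {z. a < Re z}"
    show "((\<lambda>z. of_real (k v) * (b - exp (- (z * of_real v)))) has_field_derivative of_real (k v * v) * exp (- (z * of_real v))) (at z)"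
      by (auto intro!: derivative_eq_intros)
    show "norm (of_real (k v * v) * exp (- (z * of_real v))) \<le> norm (k v * v * exp (- (a * v)))"
    proof (cases "v < 0")
      case False
      then have "exp (- (Re z * v)) \<le> exp (- (a * v))" using z by (simp add: mult_right_mono)
      then show ?thesis by (simp add: norm_mult norm_exp_eq_Re abs_mult mult_left_mono)
    qed (simp add: supp)
  qed (use a int in auto)
qed

lemma laplace_holomorphic:
  fixes k :: "real \<Rightarrow> real" and b :: complex
  assumes "\<And>v. v < 0 \<Longrightarrow> k v = 0"
    and "\<And>z. 0 < Re z \<Longrightarrow> integrable lborel (\<lambda>v. of_real (k v) * (b - exp (- (z * of_real v))))"
    and "\<And>a. 0 < a \<Longrightarrow> integrable lborel (\<lambda>v. k v * v * exp (- (a * v)))"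
  shows "(\<lambda>z. LINT v|lborel. of_real (k v) * (b - exp (- (z * of_real v)))) holomorphic_on {z. 0 < Re z}"
  unfolding holomorphic_on_open[OF open_halfspace_Re_gt]
  using laplace_has_field_derivative[of k b, OF assms] by blast

text \<open>For real z this is the rescaled Gamma integral; both sides are holomorphic on the half
  plane, so the identity extends.\<close>

lemma gamma_laplace:
  fixes s :: real and z :: complex
  assumes s: "0 < s" and z: "0 < Re z"
  shows "integrable lborel (\<lambda>v. of_real (indicator {0<..} v * v powr (s - 1)) * exp (- (z * of_real v)))"
    and "(LINT v|lborel. of_real (indicator {0<..} v * v powr (s - 1)) * exp (- (z * of_real v))) = of_real (Gamma s) * z powr (- of_real s)"
proof -
  let ?k = "\<lambda>v::real. indicator {0<..} v * v powr (s - 1) :: real"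
  have expo: "integrable lborel (\<lambda>v. indicator {0<..} v * (v powr p * exp (- (a * v))))" if "-1 < p" "0 < a" for p a :: real
  proof -
    have "set_integrable lborel {0<..} (\<lambda>v. v powr p * exp (- (a * v powr 1)))"
      by (rule set_integrable_powr_exp_powr) (use that in auto)
    then show ?thesis unfolding set_integrable_def
      by (rule Bochner_Integration.integrable_cong[THEN iffD1, rotated 2]) (auto simp: indicator_def)
  qed
  have int: "integrable lborel (\<lambda>v. of_real (?k v) * exp (- (z * of_real v)))" if "0 < Re z" for z
  proof (rule Bochner_Integration.integrable_bound[OF expo[of "s - 1" "Re z"]])
    show "AE v in lborel. norm (of_real (?k v) * exp (- (z * of_real v))) \<le> norm (indicator {0<..} v * (v powr (s - 1) * exp (- (Re z * v))))"
      by (intro AE_I2) (simp add: norm_mult norm_exp_eq_Re)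
  qed (use s that in auto)
  then show "integrable lborel (\<lambda>v. of_real (?k v) * exp (- (z * of_real v)))" using z .
  have "(\<lambda>z. LINT v|lborel. of_real (?k v) * (0 - exp (- (z * of_real v)))) holomorphic_on {z. 0 < Re z}"
  proof (rule laplace_holomorphic)
    show "integrable lborel (\<lambda>v. of_real (?k v) * (0 - exp (- (z * of_real v))))" if "0 < Re z" for z
      using integrable_minus[OF int[OF that]] by simp
    show "integrable lborel (\<lambda>v. ?k v * v * exp (- (a * v)))" if "0 < a" for a
    proof -
      have "(\<lambda>v. ?k v * v * exp (- (a * v))) = (\<lambda>v. indicator {0<..} v * (v powr s * exp (- (a * v))))"
        by (auto simp: fun_eq_iff indicator_def powr_diff)
      then show ?thesis using expo[of s a] s that by simp
    qed
  qed auto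
  then have "(\<lambda>z. - (LINT v|lborel. of_real (?k v) * (0 - exp (- (z * of_real v))))) holomorphic_on {z. 0 < Re z}"
    by (rule holomorphic_on_minus)
  then have hol: "(\<lambda>z. LINT v|lborel. of_real (?k v) * exp (- (z * of_real v))) holomorphic_on {z. 0 < Re z}"
    by simp
  show "(LINT v|lborel. of_real (?k v) * exp (- (z * of_real v))) = of_real (Gamma s) * z powr (- of_real s)"
  proof (rule eq_on_right_half_plane[OF hol _ _ z])
    show "(\<lambda>z. of_real (Gamma s) * z powr (- of_real s)) holomorphic_on {z. 0 < Re z}"
      by (intro holomorphic_intros) (auto simp: complex_nonpos_Reals_iff)
    fix x :: real assume x: "0 < x"
    have "(LINT v|lborel. ?k v * exp (- (x * v))) = \<bar>1 / x\<bar> *\<^sub>R (LINT v|lborel. ?k (0 + 1 / x * v) * exp (- (x * (0 + 1 / x * v))))"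
      by (rule lborel_integral_real_affine) (use x in auto)
    also have "(\<lambda>v. ?k (0 + 1 / x * v) * exp (- (x * (0 + 1 / x * v)))) = (\<lambda>v. x powr (1 - s) * (?k v * exp (- v)))"
      using x by (auto simp: fun_eq_iff indicator_def powr_divide powr_diff zero_less_divide_iff field_simps)
    also have "(LINT v|lborel. x powr (1 - s) * (?k v * exp (- v))) = x powr (1 - s) * Gamma s"
    proof -
      have "(LINT v:{0..}|lborel. v powr (s - 1) / exp v) = Gamma s"
        by (rule set_integrable_lborel_nonneg(2)[OF Gamma_integral_real[OF s]]) (auto simp: set_borel_measurable_def)
      also have "(LINT v:{0..}|lborel. v powr (s - 1) / exp v) = (LINT v|lborel. ?k v * exp (- v))"
        unfolding set_lebesgue_integral_def by (intro Bochner_Integration.integral_cong) (auto simp: indicator_def exp_minus divide_inverse)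
      finally show ?thesis by simp
    qed
    finally have "(LINT v|lborel. ?k v * exp (- (x * v))) = Gamma s * x powr (- s)"
      using x by (simp add: powr_diff powr_minus_divide)
    moreover have "complex_of_real x powr (- of_real s) = of_real (x powr (- s))"
      using x powr_of_real[of x "- s"] by simp
    moreover have "(LINT v|lborel. of_real (?k v) * exp (- (of_real x * of_real v))) = complex_of_real (LINT v|lborel. ?k v * exp (- (x * v)))"
      unfolding integral_complex_of_real[symmetric] by (intro Bochner_Integration.integral_cong) (simp_all flip: exp_of_real)
    ultimately show "(LINT v|lborel. of_real (?k v) * exp (- (of_real x * of_real v))) = of_real (Gamma s) * complex_of_real x powr (- of_real s)"
      by simp
  qed
qed

section \<open>Stable transforms and their kernels\<close>

text \<open>The angle \<kappa> = \<pi>\<theta>/2 gives minus the Feller symbol of order \<alpha>;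
  \<kappa> = \<pi>\<beta>/2 with \<alpha> = \<beta> (2k+1) gives (i \<xi>^(2k+1))^\<beta>, the
  exponent of the subordinated pseudoprocess.\<close>

definition stable_exponent :: "real \<Rightarrow> real \<Rightarrow> real \<Rightarrow> complex" where
  "stable_exponent \<alpha> \<kappa> \<xi> = of_real (\<bar>\<xi>\<bar> powr \<alpha>) * cis (\<kappa> * sgn \<xi>)"

definition stable_transform :: "real \<Rightarrow> real \<Rightarrow> real \<Rightarrow> real \<Rightarrow> complex" where
  "stable_transform \<alpha> \<kappa> T \<xi> = exp (- (of_real T * stable_exponent \<alpha> \<kappa> \<xi>))"

text \<open>The inverse Fourier transform of \<open>stable_transform\<close>; the real part loses
  nothing because the transform is Hermitian. Using \<open>re_transform\<close> makes its
  differentiation lemma available.\<close>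

definition stable_kernel :: "real \<Rightarrow> real \<Rightarrow> real \<Rightarrow> real \<Rightarrow> real" where
  "stable_kernel \<alpha> \<kappa> T = re_transform (\<lambda>\<xi>. stable_transform \<alpha> \<kappa> T \<xi> / of_real (2 * pi)) (- \<i>) 0"

lemma stable_transform_measurable [measurable]:
  "stable_exponent \<alpha> \<kappa> \<in> borel_measurable borel" "stable_transform \<alpha> \<kappa> T \<in> borel_measurable borel"
  unfolding stable_transform_def[abs_def] stable_exponent_def[abs_def] by measurable

lemma norm_stable_transform: "norm (stable_transform \<alpha> \<kappa> T \<xi>) = exp (- (T * cos \<kappa> * \<bar>\<xi>\<bar> powr \<alpha>))"
  by (cases "\<xi> > 0"; cases "\<xi> < 0") (auto simp: stable_transform_def stable_exponent_def norm_exp_eq_Re mult_ac)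

lemma stable_exponent_minus: "stable_exponent \<alpha> \<kappa> (- \<xi>) = cnj (stable_exponent \<alpha> \<kappa> \<xi>)"
  by (simp add: stable_exponent_def cis_cnj)

lemma stable_transform_minus: "stable_transform \<alpha> \<kappa> T (- \<xi>) = cnj (stable_transform \<alpha> \<kappa> T \<xi>)"
  by (simp add: stable_transform_def stable_exponent_minus exp_cnj)

lemma stable_transform_reflect: "stable_transform \<alpha> \<kappa> T (- \<xi>) = stable_transform \<alpha> (- \<kappa>) T \<xi>"
  by (simp add: stable_transform_def stable_exponent_def)

lemma continuous_stable_exponent:
  assumes "0 < \<alpha>"
  shows "continuous_on S (stable_exponent \<alpha> \<kappa>)"
proof (intro continuous_at_imp_continuous_on ballI)
  fix \<xi> :: real
  show "isCont (stable_exponent \<alpha> \<kappa>) \<xi>"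
  proof (cases "\<xi> = 0")
    case False
    then show ?thesis unfolding stable_exponent_def[abs_def] isCont_def
      by (intro tendsto_intros) auto
  next
    case True
    have "((\<lambda>x. stable_exponent \<alpha> \<kappa> x) \<longlongrightarrow> 0) (at 0)"
    proof (rule Lim_null_comparison)
      show "\<forall>\<^sub>F x in at 0. norm (stable_exponent \<alpha> \<kappa> x) \<le> \<bar>x\<bar> powr \<alpha>"
        by (intro always_eventually allI) (simp add: stable_exponent_def norm_mult)
      have "((\<lambda>x. \<bar>x\<bar> powr \<alpha>) \<longlongrightarrow> \<bar>0 :: real\<bar> powr \<alpha>) (at 0)"
        by (rule tendsto_powr2) (use assms in \<open>auto intro!: tendsto_eq_intros\<close>)
      then show "((\<lambda>x::real. \<bar>x\<bar> powr \<alpha>) \<longlongrightarrow> 0) (at 0)" by simp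
    qed
    moreover have "stable_exponent \<alpha> \<kappa> 0 = 0" by (simp add: stable_exponent_def)
    ultimately show ?thesis using True by (simp add: isCont_def)
  qed
qed

lemma continuous_stable_transform:
  assumes "0 < \<alpha>"
  shows "continuous_on S (stable_transform \<alpha> \<kappa> T)"
  unfolding stable_transform_def[abs_def] by (intro continuous_intros continuous_stable_exponent assms)

lemma integrable_powr_exp_abs:
  fixes p \<alpha> T :: real
  assumes "-1 < p" "0 < \<alpha>" "0 < T"
  shows "integrable lborel (\<lambda>\<xi>. \<bar>\<xi>\<bar> powr p * exp (- (T * \<bar>\<xi>\<bar> powr \<alpha>)))"
proof -
  let ?f = "\<lambda>r::real. indicator {0<..} r *\<^sub>R (r powr p * exp (- (T * r powr \<alpha>)))"
  have 1: "integrable lborel ?f"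
    using set_integrable_powr_exp_powr[OF assms] unfolding set_integrable_def .
  then have "integrable lborel (\<lambda>r. ?f (0 + (-1) * r))" by (rule lborel_integrable_real_affine) simp
  with 1 have "integrable lborel (\<lambda>r. ?f r + ?f (0 + (-1) * r))" by (rule Bochner_Integration.integrable_add)
  also have "(\<lambda>r. ?f r + ?f (0 + (-1) * r)) = (\<lambda>\<xi>. \<bar>\<xi>\<bar> powr p * exp (- (T * \<bar>\<xi>\<bar> powr \<alpha>)))"
    by (auto simp: fun_eq_iff indicator_def)
  finally show ?thesis .
qed

lemma cos_pos_of_abs_less: "\<bar>\<kappa>\<bar> < pi / 2 \<Longrightarrow> 0 < cos \<kappa>"
  by (rule cos_gt_zero_pi) auto

lemma integrable_powr_stable_transform:
  assumes "-1 < p" "0 < \<alpha>" "\<bar>\<kappa>\<bar> < pi / 2" "0 < T"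
  shows "integrable lborel (\<lambda>\<xi>. \<bar>\<xi>\<bar> powr p * norm (stable_transform \<alpha> \<kappa> T \<xi>))"
  unfolding norm_stable_transform using assms cos_pos_of_abs_less by (intro integrable_powr_exp_abs) auto

lemma integrable_stable_transform:
  assumes "0 < \<alpha>" "\<bar>\<kappa>\<bar> < pi / 2" "0 < T"
  shows "integrable lborel (stable_transform \<alpha> \<kappa> T)"
proof (rule Bochner_Integration.integrable_bound[OF integrable_powr_stable_transform[OF _ assms, of 0]])
  show "AE \<xi> in lborel. norm (stable_transform \<alpha> \<kappa> T \<xi>) \<le> norm (\<bar>\<xi>\<bar> powr 0 * norm (stable_transform \<alpha> \<kappa> T \<xi>))"
    using AE_lborel_singleton[of "0::real"] by eventually_elim simp
qed auto

lemma exp_minus_ii: "exp (- \<i> * of_real y) = cis (- y)"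
  by (simp add: cis_conv_exp)

text \<open>Reflecting the variable shows that the complex integral equals its own
  conjugate.\<close>

lemma stable_kernel_eq_complex:
  assumes "0 < \<alpha>" "\<bar>\<kappa>\<bar> < pi / 2" "0 < T"
  shows "of_real (stable_kernel \<alpha> \<kappa> T x) = (LINT \<eta>|lborel. cis (- (\<eta> * x)) * stable_transform \<alpha> \<kappa> T \<eta>) / of_real (2 * pi)"
proof -
  let ?f = "\<lambda>\<eta>. cis (- (\<eta> * x)) * stable_transform \<alpha> \<kappa> T \<eta>"
  have int: "integrable lborel ?f"
    by (rule Bochner_Integration.integrable_bound[OF integrable_stable_transform[OF assms]]) (auto simp: norm_mult)
  have "(LINT \<eta>|lborel. ?f \<eta>) = \<bar>-1\<bar> *\<^sub>R (LINT \<eta>|lborel. ?f (0 + (-1) * \<eta>))"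
    by (rule lborel_integral_real_affine) simp
  also have "\<dots> = (LINT \<eta>|lborel. cnj (?f \<eta>))"
    by (simp add: stable_transform_minus cis_cnj)
  also have "\<dots> = cnj (LINT \<eta>|lborel. ?f \<eta>)"
    by (rule integral_bounded_linear[OF bounded_linear_cnj int])
  finally have "Im (LINT \<eta>|lborel. ?f \<eta>) = 0" by (simp add: complex_eq_iff)
  then have "(LINT \<eta>|lborel. ?f \<eta>) = of_real (Re (LINT \<eta>|lborel. ?f \<eta>))" by (simp add: complex_eq_iff)
  also have "Re (LINT \<eta>|lborel. ?f \<eta>) = (LINT \<eta>|lborel. Re (?f \<eta>))" using integral_Re[OF int] by simp
  also have "\<dots> = (LINT \<eta>|lborel. 2 * pi * Re (stable_transform \<alpha> \<kappa> T \<eta> / of_real (2 * pi) * (- \<i> * of_real \<eta>) ^ 0 * exp (- \<i> * of_real (x * \<eta>))))"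
    unfolding exp_minus_ii by (intro Bochner_Integration.integral_cong) (simp_all add: field_simps)
  also have "\<dots> = 2 * pi * stable_kernel \<alpha> \<kappa> T x"
    unfolding stable_kernel_def re_transform_def by (rule integral_mult_right_zero)
  finally show ?thesis by simp
qed

lemma stable_kernel_reflect: "stable_kernel \<alpha> \<kappa> T (- x) = stable_kernel \<alpha> (- \<kappa>) T x"
proof -
  let ?f = "\<lambda>r. Re (stable_transform \<alpha> \<kappa> T r / of_real (2 * pi) * (- \<i> * of_real r) ^ 0 * exp (- \<i> * of_real ((- x) * r)))"
  have "stable_kernel \<alpha> \<kappa> T (- x) = \<bar>-1\<bar> *\<^sub>R (LINT r|lborel. ?f (0 + (-1) * r))"
    unfolding stable_kernel_def re_transform_def by (rule lborel_integral_real_affine) simp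
  then show ?thesis
    unfolding stable_kernel_def re_transform_def by (simp add: stable_transform_reflect)
qed

lemma stable_kernel_scaling:
  assumes "0 < \<alpha>" "0 < T"
  shows "stable_kernel \<alpha> \<kappa> T x = T powr (- 1 / \<alpha>) * stable_kernel \<alpha> \<kappa> 1 (T powr (- 1 / \<alpha>) * x)"
proof -
  define c where "c = T powr (- 1 / \<alpha>)"
  have "c powr \<alpha> = T powr (- 1 / \<alpha> * \<alpha>)" unfolding c_def by (rule powr_powr)
  then have c: "0 < c" "T * c powr \<alpha> = 1" using assms by (auto simp: c_def powr_minus_divide)
  have tr: "stable_transform \<alpha> \<kappa> T (c * r) = stable_transform \<alpha> \<kappa> 1 r" for r
  proof -
    have "T * (\<bar>c * r\<bar> powr \<alpha>) = (T * c powr \<alpha>) * \<bar>r\<bar> powr \<alpha>" using c(1) by (simp add: abs_mult powr_mult)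
    then have "of_real T * stable_exponent \<alpha> \<kappa> (c * r) = of_real 1 * stable_exponent \<alpha> \<kappa> r"
      unfolding stable_exponent_def mult.assoc[symmetric] of_real_mult[symmetric] using c by (simp add: sgn_mult)
    then show ?thesis by (simp only: stable_transform_def)
  qed
  let ?f = "\<lambda>r. Re (stable_transform \<alpha> \<kappa> T r / of_real (2 * pi) * (- \<i> * of_real r) ^ 0 * exp (- \<i> * of_real (x * r)))"
  have "stable_kernel \<alpha> \<kappa> T x = \<bar>c\<bar> *\<^sub>R (LINT r|lborel. ?f (0 + c * r))"
    unfolding stable_kernel_def re_transform_def by (rule lborel_integral_real_affine) (use c in simp)
  also have "\<dots> = c * stable_kernel \<alpha> \<kappa> 1 (c * x)"
    unfolding stable_kernel_def re_transform_def add_0_left tr using c by (simp add: mult_ac)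
  finally show ?thesis by (simp add: c_def)
qed


text \<open>
  Turning the ray of integration towards the decay of the exponential in \<open>x\<close> and subtracting the
  constant term of the amplitude exposes the contribution of order \<open>\<bar>\<xi>\<bar> powr \<alpha>\<close> near the origin.
\<close>
lemma stable_kernel_decay_neg:
  assumes st: "0 < \<alpha>" "\<bar>\<kappa>\<bar> < pi / 2" "0 < T"
  obtains C where "\<And>x. x < 0 \<Longrightarrow> \<bar>stable_kernel \<alpha> \<kappa> T x\<bar> \<le> C * \<bar>x\<bar> powr (- (\<alpha> + 1))"
proof -
  \<comment> \<open>Half of the remaining gap keeps |\<kappa>| + \<alpha> \<delta> below \<pi>/2, so
    the amplitude decays on every ray of the sector; the cap 1 keeps the sector in the right half
    plane.\<close>
  define \<delta> where "\<delta> = min 1 ((pi / 2 - \<bar>\<kappa>\<bar>) / (2 * \<alpha>))"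
  have "\<delta> \<le> (pi / 2 - \<bar>\<kappa>\<bar>) / (2 * \<alpha>)" by (simp add: \<delta>_def)
  then have "\<alpha> * \<delta> \<le> (pi / 2 - \<bar>\<kappa>\<bar>) / 2" using st by (simp add: field_simps)
  then have \<delta>: "0 < \<delta>" "\<delta> \<le> 1" "\<bar>\<kappa>\<bar> + \<alpha> * \<delta> < pi / 2" using st by (auto simp: \<delta>_def)
  define m where "m = cos (\<bar>\<kappa>\<bar> + \<alpha> * \<delta>)"
  have m: "0 < m" 
  proof -
    have "0 \<le> \<alpha> * \<delta>" using st \<delta> by simp
    then have "- (pi / 2) < \<bar>\<kappa>\<bar> + \<alpha> * \<delta>" using pi_gt_zero by linarith
    then show ?thesis unfolding m_def using \<delta>(3) by (rule cos_gt_zero_pi)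
  qed
  have cosm: "m \<le> cos (\<kappa> + \<alpha> * \<omega>)" if "0 \<le> \<omega>" "\<omega> \<le> \<delta>" for \<omega>
  proof -
    have "\<alpha> * \<omega> \<le> \<alpha> * \<delta>" using that st by (intro mult_left_mono) auto
    moreover have "0 \<le> \<alpha> * \<omega>" using that st by simp
    ultimately have "\<bar>\<kappa> + \<alpha> * \<omega>\<bar> \<le> \<bar>\<kappa>\<bar> + \<alpha> * \<delta>" by linarith
    then have "m \<le> cos \<bar>\<kappa> + \<alpha> * \<omega>\<bar>" unfolding m_def using \<delta>(3) by (intro cos_monotone_0_pi_le) auto
    then show ?thesis by simp
  qed
  define c where "c = of_real T * cis \<kappa>"
  define c' where "c' = of_real T * cis (\<kappa> + \<alpha> * \<delta>)"
  define w where "w = cis \<delta>"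
  have sind: "0 < sin \<delta>" using \<delta> pi_gt3 by (intro sin_gt_zero) auto
  have "\<bar>stable_kernel \<alpha> \<kappa> T x\<bar> \<le> T * Gamma (\<alpha> + 1) * sin \<delta> powr (- (\<alpha> + 1)) / pi * \<bar>x\<bar> powr (- (\<alpha> + 1))" if x: "x < 0" for x
  proof -
    define y where "y = - x"
    have y: "0 < y" using x by (simp add: y_def)
    define f where "f = (\<lambda>z. exp (\<i> * of_real y * z - c * z powr of_real \<alpha>))"
    have fpol: "f (of_real r * cis \<omega>) = exp (\<i> * of_real (y * r) * cis \<omega> - of_real (T * r powr \<alpha>) * cis (\<kappa> + \<alpha> * \<omega>))"
      if "0 < r" "0 \<le> \<omega>" "\<omega> \<le> \<delta>" for r \<omega>
    proof -
      have "(of_real r * cis \<omega>) powr of_real \<alpha> = of_real (r powr \<alpha>) * cis (\<alpha> * \<omega>)"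
        by (rule powr_polar) (use that \<delta> pi_gt3 in auto)
      moreover have "cis (\<kappa> + \<alpha> * \<omega>) = cis \<kappa> * cis (\<alpha> * \<omega>)" by (simp add: cis_mult)
      ultimately show ?thesis unfolding f_def c_def by (simp add: mult_ac)
    qed
    have fnorm: "norm (f (of_real r * cis \<omega>)) \<le> exp (- (T * m * r powr \<alpha>))"
      if "0 < r" "0 \<le> \<omega>" "\<omega> \<le> \<delta>" for r \<omega>
    proof -
      have "0 \<le> y * r * sin \<omega>" using that y \<delta> pi_gt3 by (intro mult_nonneg_nonneg sin_ge_zero) auto
      moreover have "T * r powr \<alpha> * m \<le> T * r powr \<alpha> * cos (\<kappa> + \<alpha> * \<omega>)"
        using cosm[OF that(2,3)] st by (intro mult_left_mono) auto
      ultimately show ?thesis unfolding fpol[OF that] by (simp add: norm_exp_eq_Re mult_ac)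
    qed
    have f1: "f (of_real r) = cis (y * r) * exp (- (of_real (T * r powr \<alpha>) * cis \<kappa>))" if "0 < r" for r
      using fpol[OF that, of 0] \<delta> by (simp add: exp_add[symmetric] cis_conv_exp)
    have bint: "integrable lborel (\<lambda>r. indicator {0<..} r * exp (- (T * m * r powr \<alpha>)))"
    proof -
      have "set_integrable lborel {0<..} (\<lambda>r. r powr 0 * exp (- (T * m * r powr \<alpha>)))"
        by (rule set_integrable_powr_exp_powr) (use st m in auto)
      then show ?thesis unfolding set_integrable_def
        by (rule Bochner_Integration.integrable_cong[THEN iffD1, rotated 2]) (auto simp: indicator_def)
    qed
    have cont: "continuous_on {0<..} (\<lambda>r. f (of_real r * cis \<omega>))" if "0 \<le> \<omega>" "\<omega> \<le> \<delta>" for \<omega>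
    proof -
      have "continuous_on {0<..} (\<lambda>r. exp (\<i> * of_real (y * r) * cis \<omega> - of_real (T * r powr \<alpha>) * cis (\<kappa> + \<alpha> * \<omega>)))"
        by (intro continuous_intros) auto
      then show ?thesis
        by (rule continuous_on_cong[THEN iffD1, OF refl, rotated]) (simp add: fpol that)
    qed
    have meas: "(\<lambda>r. indicator {0<..} r *\<^sub>R f (of_real r * cis \<omega>)) \<in> borel_measurable lborel" if "0 \<le> \<omega>" "\<omega> \<le> \<delta>" for \<omega>
      using borel_measurable_continuous_on_indicator[OF _ cont[OF that]] by simp
    have fint: "integrable lborel (\<lambda>r. indicator {0<..} r *\<^sub>R f (of_real r * cis \<omega>))" if "0 \<le> \<omega>" "\<omega> \<le> \<delta>" for \<omega>
      by (rule Bochner_Integration.integrable_bound[OF bint meas[OF that]])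
         (use fnorm that in \<open>auto simp: indicator_def\<close>)
    define J where "J = (\<lambda>\<omega>. LINT r|lborel. indicator {0<..} r *\<^sub>R f (of_real r * cis \<omega>))"
    \<comment> \<open>The power has a branch point at 0, so the rotation is made on [1/(n+1), n+1]
      and both ends are removed in the limit.\<close>
    have lim: "(\<lambda>n. integral {1 / (real n + 1)..real n + 1} (\<lambda>r. f (of_real r * cis \<omega>))) \<longlonglongrightarrow> J \<omega>"
      if \<omega>: "0 \<le> \<omega>" "\<omega> \<le> \<delta>" for \<omega>
    proof -
      have "(\<lambda>n. LINT r|lborel. indicator {1 / (real n + 1)..real n + 1} r *\<^sub>R (indicator {0<..} r *\<^sub>R f (of_real r * cis \<omega>))) \<longlonglongrightarrow> J \<omega>"
        unfolding J_def
      proof (rule integral_dominated_convergence[OF meas[OF that] _ bint])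
        show "AE r in lborel. (\<lambda>n. indicator {1 / (real n + 1)..real n + 1} r *\<^sub>R (indicator {0<..} r *\<^sub>R f (of_real r * cis \<omega>))) \<longlonglongrightarrow> indicator {0<..} r *\<^sub>R f (of_real r * cis \<omega>)"
        proof (intro AE_I2 tendsto_eventually)
          fix r :: real
          show "\<forall>\<^sub>F n in sequentially. indicator {1 / (real n + 1)..real n + 1} r *\<^sub>R (indicator {0<..} r *\<^sub>R f (of_real r * cis \<omega>)) = indicator {0<..} r *\<^sub>R f (of_real r * cis \<omega>)"
          proof (cases "0 < r")
            case True
            have "\<forall>\<^sub>F n in sequentially. 1 / (real n + 1) < r" by (rule order_tendstoD(2)[of _ 0]) (real_asymp, fact True)
            moreover have "\<forall>\<^sub>F n in sequentially. r < real n + 1" by real_asymp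
            ultimately show ?thesis by eventually_elim (simp add: indicator_def)
          qed simp
        qed
        show "AE r in lborel. norm (indicator {1 / (real n + 1)..real n + 1} r *\<^sub>R (indicator {0<..} r *\<^sub>R f (of_real r * cis \<omega>))) \<le> indicator {0<..} r * exp (- (T * m * r powr \<alpha>))" for n
          using fnorm \<omega> by (intro AE_I2) (auto simp: indicator_def)
        show "(\<lambda>r. indicator {1 / (real n + 1)..real n + 1} r *\<^sub>R (indicator {0<..} r *\<^sub>R f (of_real r * cis \<omega>))) \<in> borel_measurable lborel" for n
          using meas[OF \<omega>] by measurable
      qed
      moreover have "(LINT r|lborel. indicator {1 / (real n + 1)..real n + 1} r *\<^sub>R (indicator {0<..} r *\<^sub>R f (of_real r * cis \<omega>)))
          = integral {1 / (real n + 1)..real n + 1} (\<lambda>r. f (of_real r * cis \<omega>))" for n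
      proof -
        have sub: "{1 / (real n + 1)..real n + 1} \<subseteq> {0<..}" by (auto intro: less_le_trans[of 0 "1 / (real n + 1)"])
        have "(LINT r|lborel. indicator {1 / (real n + 1)..real n + 1} r *\<^sub>R (indicator {0<..} r *\<^sub>R f (of_real r * cis \<omega>)))
           = (LINT r:{1 / (real n + 1)..real n + 1}|lborel. f (of_real r * cis \<omega>))"
          unfolding set_lebesgue_integral_def using sub by (intro Bochner_Integration.integral_cong) (auto simp: indicator_def)
        also have "\<dots> = integral {1 / (real n + 1)..real n + 1} (\<lambda>r. f (of_real r * cis \<omega>))"
          by (rule set_lebesgue_integral_eq_integral[OF continuous_on_subset[OF cont[OF \<omega>] sub]])
        finally show ?thesis .
      qed
      ultimately show ?thesis by simp
    qed
    have rot: "J 0 = w * J \<delta>"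
    proof -
      have "(\<lambda>n. integral {1 / (real n + 1)..real n + 1} (\<lambda>r. f (of_real r)) - integral {1 / (real n + 1)..real n + 1} (\<lambda>r. w * f (of_real r * w))) \<longlonglongrightarrow> J 0 - w * J \<delta>"
        using tendsto_diff[OF lim[of 0] tendsto_mult_left[OF lim[of \<delta>], of w]] \<delta>
        by (simp add: w_def integral_mult_right)
      moreover have "(\<lambda>n. integral {1 / (real n + 1)..real n + 1} (\<lambda>r. f (of_real r)) - integral {1 / (real n + 1)..real n + 1} (\<lambda>r. w * f (of_real r * w))) \<longlonglongrightarrow> 0"
      proof (rule Lim_null_comparison)
        \<comment> \<open>With \<kappa> = 1 in the arc estimate, exp \<delta> pays for exp
          (-\<omega>). The inner arc vanishes with its radius, the outer one through the decay in
          r.\<close>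
        define B where "B = (\<lambda>r. exp \<delta> * exp (- (T * m * r powr \<alpha>)))"
        show "\<forall>\<^sub>F n in sequentially. norm (integral {1 / (real n + 1)..real n + 1} (\<lambda>r. f (of_real r)) - integral {1 / (real n + 1)..real n + 1} (\<lambda>r. w * f (of_real r * w)))
            \<le> 1 / (real n + 1) * B (1 / (real n + 1)) / 1 + (real n + 1) * B (real n + 1) / 1"
          unfolding w_def
        proof (intro always_eventually allI sector_rotation[where S="{z. 0 < Re z}"])
          fix n :: nat
          show "f holomorphic_on {z. 0 < Re z}" unfolding f_def
            by (intro holomorphic_intros) (auto simp: complex_nonpos_Reals_iff)
          have pos: "0 < 1 / (real n + 1)" by simp
          show "1 / (real n + 1) \<le> real n + 1"
            by (rule order_trans[of _ 1]) auto
          show "of_real r * cis \<omega> \<in> {z. 0 < Re z}" if "1 / (real n + 1) \<le> r" "0 \<le> \<omega>" "\<omega> \<le> \<delta>" for r \<omega>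
          proof -
            have "0 < r" using pos that(1) by linarith
            moreover have "0 < cos \<omega>" using that \<delta> pi_gt3 by (intro cos_gt_zero_pi) auto
            ultimately show ?thesis by simp
          qed
          show "norm (f (of_real r * cis \<omega>)) \<le> B r * exp (- (1 * \<omega>))"
            if "r \<in> {1 / (real n + 1), real n + 1}" "0 \<le> \<omega>" "\<omega> \<le> \<delta>" for r \<omega>
          proof -
            have "0 < r" using that(1) by auto
            from fnorm[OF this that(2,3)] have "norm (f (of_real r * cis \<omega>)) \<le> 1 * exp (- (T * m * r powr \<alpha>))" by simp
            also have "\<dots> \<le> exp (\<delta> - \<omega>) * exp (- (T * m * r powr \<alpha>))" using that by (intro mult_right_mono) auto
            finally show ?thesis by (simp add: B_def exp_diff exp_minus field_simps)
          qed
          show "convex {z. 0 < Re z}" by (rule convex_halfspace_Re_gt)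
          show "open {z. 0 < Re z}" by (rule open_halfspace_Re_gt)
        qed (use \<delta> in auto)
        have "0 < T * m" using st m by simp
        show "(\<lambda>n. 1 / (real n + 1) * B (1 / (real n + 1)) / 1 + (real n + 1) * B (real n + 1) / 1) \<longlonglongrightarrow> 0"
        proof -
          have "(\<lambda>n. 1 / (real n + 1) * (exp \<delta> * exp (- (c * (1 / (real n + 1)) powr a))) / 1 +
              (real n + 1) * (exp \<delta> * exp (- (c * (real n + 1) powr a))) / 1) \<longlonglongrightarrow> 0" if "0 < c" "0 < a" for a c :: real
            using that by real_asymp
          then show ?thesis unfolding B_def using \<open>0 < T * m\<close> st(1) by blast
        qed
      qed
      ultimately show ?thesis using LIMSEQ_unique by fastforce
    qed
    define q where "q = - (\<i> * of_real y * w)"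
    have q: "0 < Re q" "Re q = y * sin \<delta>" using y sind by (auto simp: q_def w_def)
    have g1: "integrable lborel (\<lambda>r. of_real (indicator {0<..} r * r powr (1 - 1)) * exp (- (q * of_real r)))"
       "(LINT r|lborel. of_real (indicator {0<..} r * r powr (1 - 1)) * exp (- (q * of_real r))) = of_real (Gamma 1) * q powr (- of_real 1)"
      by (rule gamma_laplace; use q in auto)+
    let ?e = "\<lambda>r. indicator {0<..} r *\<^sub>R exp (- (q * of_real r))"
    have e: "(\<lambda>r. of_real (indicator {0<..} r * r powr (1 - 1)) * exp (- (q * of_real r))) = ?e"
      by (auto simp: fun_eq_iff indicator_def)
    \<comment> \<open>The constant term of the amplitude would contribute order 1 / |x|, too slow
      for integrability, but w / q = i / y is purely imaginary and drops out.\<close>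
    have "Re (w * (LINT r|lborel. ?e r)) = Re (\<i> / of_real y)"
    proof -
      have "q \<noteq> 0" using q by auto
      then have "w * (LINT r|lborel. ?e r) = w / q" using g1(2) unfolding e by (simp add: powr_minus divide_inverse)
      also have "\<dots> = \<i> / of_real y" using y by (simp add: q_def w_def field_simps)
      finally show ?thesis by simp
    qed
    then have Re0: "Re (w * (LINT r|lborel. ?e r)) = 0" by simp
    have kern: "pi * stable_kernel \<alpha> \<kappa> T x = Re (J 0)"
    proof -
      let ?g = "\<lambda>r. Re (stable_transform \<alpha> \<kappa> T r / of_real (2 * pi) * (- \<i> * of_real r) ^ 0 * exp (- \<i> * of_real (x * r)))"
      let ?h = "\<lambda>r. Re (indicator {0<..} r *\<^sub>R f (of_real r * cis 0))"
      have hi: "integrable lborel ?h" using fint[of 0] \<delta> by (intro integrable_Re) auto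
      have h0: "(LINT r|lborel. ?h r) = Re (J 0)" unfolding J_def using fint[of 0] \<delta> by (intro integral_Re) auto
      have "2 * pi * stable_kernel \<alpha> \<kappa> T x = (LINT r|lborel. 2 * pi * ?g r)"
        unfolding stable_kernel_def re_transform_def by (rule integral_mult_right_zero[symmetric])
      also have "\<dots> = (LINT r|lborel. ?h r + ?h (0 + (-1) * r))"
      proof (rule integral_discrete_difference[of "{0}"])
        fix r :: real assume r: "r \<notin> {0}"
        have "2 * pi * ?g r = Re (stable_transform \<alpha> \<kappa> T r * cis (y * r))"
          unfolding exp_minus_ii by (simp add: y_def field_simps)
        moreover have "Re (stable_transform \<alpha> \<kappa> T r * cis (y * r)) = ?h r" if "0 < r"
          using that f1[OF that] by (simp add: stable_transform_def stable_exponent_def mult_ac)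
        moreover have "Re (stable_transform \<alpha> \<kappa> T r * cis (y * r)) = ?h (0 + (-1) * r)" if "r < 0"
        proof -
          have "stable_transform \<alpha> \<kappa> T r * cis (y * r) = cnj (stable_transform \<alpha> \<kappa> T (- r) * cis (y * (- r)))"
            using stable_transform_minus[of \<alpha> \<kappa> T "- r"] by (simp add: cis_cnj)
          also have "Re \<dots> = Re (stable_transform \<alpha> \<kappa> T (- r) * cis (y * (- r)))" by (rule cnj.sel(1))
          finally show ?thesis using that f1[of "- r"] by (simp add: stable_transform_def stable_exponent_def mult_ac)
        qed
        ultimately show "2 * pi * ?g r = ?h r + ?h (0 + (-1) * r)" using r by (cases "0 < r") auto
      qed (auto intro: countable_finite)
      also have "\<dots> = (LINT r|lborel. ?h r) + (LINT r|lborel. ?h (0 + (-1) * r))"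
        by (rule Bochner_Integration.integral_add[OF hi lborel_integrable_real_affine[OF hi]]) simp
      also have "(LINT r|lborel. ?h (0 + (-1) * r)) = (LINT r|lborel. ?h r)"
        using lborel_integral_real_affine[of "-1" ?h 0] by simp
      finally show ?thesis using h0 by simp
    qed
    have Jd: "J \<delta> = (LINT r|lborel. indicator {0<..} r *\<^sub>R (exp (- (q * of_real r)) * exp (- (of_real (r powr \<alpha>) * c'))))"
      unfolding J_def
    proof (intro Bochner_Integration.integral_cong refl)
      fix r :: real
      show "indicator {0<..} r *\<^sub>R f (of_real r * cis \<delta>) = indicator {0<..} r *\<^sub>R (exp (- (q * of_real r)) * exp (- (of_real (r powr \<alpha>) * c')))"
        using fpol[of r \<delta>] \<delta> by (auto simp: indicator_def q_def w_def c'_def exp_add[symmetric] algebra_simps)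
    qed
    have Rec': "0 \<le> Re c'" using cosm[of \<delta>] \<delta> m st by (simp add: c'_def)
    have "J \<delta> - (LINT r|lborel. ?e r) = (LINT r|lborel. indicator {0<..} r *\<^sub>R (exp (- (q * of_real r)) * exp (- (of_real (r powr \<alpha>) * c'))) - ?e r)"
      unfolding Jd
    proof (rule Bochner_Integration.integral_diff[symmetric])
      show "integrable lborel ?e" using g1(1) unfolding e .
      have "(\<lambda>r. indicator {0<..} r *\<^sub>R f (of_real r * cis \<delta>)) = (\<lambda>r. indicator {0<..} r *\<^sub>R (exp (- (q * of_real r)) * exp (- (of_real (r powr \<alpha>) * c'))))"
        using fpol[of _ \<delta>] \<delta> by (auto simp: fun_eq_iff indicator_def q_def w_def c'_def exp_add[symmetric] algebra_simps)
      then show "integrable lborel (\<lambda>r. indicator {0<..} r *\<^sub>R (exp (- (q * of_real r)) * exp (- (of_real (r powr \<alpha>) * c'))))"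
        using fint[of \<delta>] \<delta> by simp
    qed
    also have "norm \<dots> \<le> (LINT r|lborel. T * (indicator {0<..} r * r powr (\<alpha> + 1 - 1) * exp (- (Re q * r))))"
    proof (rule order_trans[OF integral_norm_bound], rule Bochner_Integration.integral_mono')
      have "integrable lborel (\<lambda>r. of_real (indicator {0<..} r * r powr (\<alpha> + 1 - 1)) * exp (- (complex_of_real (Re q) * of_real r)))"
        by (rule gamma_laplace) (use st q in auto)
      from integrable_norm[OF this] show "integrable lborel (\<lambda>r. T * (indicator {0<..} r * r powr (\<alpha> + 1 - 1) * exp (- (Re q * r))))"
        by (intro integrable_mult_right) (simp add: norm_mult norm_exp_eq_Re)
    next
      fix r :: real
      show "norm (indicator {0<..} r *\<^sub>R (exp (- (q * of_real r)) * exp (- (of_real (r powr \<alpha>) * c'))) - ?e r)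
         \<le> T * (indicator {0<..} r * r powr (\<alpha> + 1 - 1) * exp (- (Re q * r)))"
      proof (cases "0 < r")
        case True
        \<comment> \<open>On the left half plane exp is a contraction, so |exp (-u) - 1| \<le> |u|.
          The resulting factor r^\<alpha> becomes |x|^(-\<alpha>-1) through the Gamma
          integral.\<close>
        have "norm (exp (- (of_real (r powr \<alpha>) * c')) - exp 0) \<le> 1 * norm (- (of_real (r powr \<alpha>) * c') - 0)"
          by (rule field_differentiable_bound[of "{z. Re z \<le> 0}" exp exp])
             (use Rec' in \<open>auto simp: convex_halfspace_Re_le norm_exp_eq_Re intro: DERIV_exp has_field_derivative_at_within\<close>)
        also have "\<dots> = T * r powr \<alpha>" using st by (simp add: c'_def norm_mult)
        finally have *: "norm (exp (- (of_real (r powr \<alpha>) * c')) - 1) \<le> T * r powr \<alpha>" by simp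
        have "norm (exp (- (q * of_real r)) * exp (- (of_real (r powr \<alpha>) * c')) - exp (- (q * of_real r)))
            = exp (- (Re q * r)) * norm (exp (- (of_real (r powr \<alpha>) * c')) - 1)"
        proof -
          have "exp (- (q * of_real r)) * exp (- (of_real (r powr \<alpha>) * c')) - exp (- (q * of_real r)) = exp (- (q * of_real r)) * (exp (- (of_real (r powr \<alpha>) * c')) - 1)"
            by (simp add: right_diff_distrib)
          then show ?thesis by (simp only: norm_mult) (simp add: norm_exp_eq_Re)
        qed
        also have "\<dots> \<le> exp (- (Re q * r)) * (T * r powr \<alpha>)" by (rule mult_left_mono[OF *]) simp
        finally show ?thesis using True by (simp add: mult_ac)
      qed simp
    qed (use st in auto)
    also have "(LINT r|lborel. T * (indicator {0<..} r * r powr (\<alpha> + 1 - 1) * exp (- (Re q * r)))) = T * (Gamma (\<alpha> + 1) * Re q powr (- (\<alpha> + 1)))"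
    proof -
      have "complex_of_real (LINT r|lborel. indicator {0<..} r * r powr (\<alpha> + 1 - 1) * exp (- (Re q * r)))
        = (LINT r|lborel. of_real (indicator {0<..} r * r powr (\<alpha> + 1 - 1)) * exp (- (complex_of_real (Re q) * of_real r)))"
        unfolding integral_complex_of_real[symmetric] by (intro Bochner_Integration.integral_cong) (simp_all flip: exp_of_real)
      also have "\<dots> = of_real (Gamma (\<alpha> + 1)) * complex_of_real (Re q) powr (- of_real (\<alpha> + 1))"
        by (rule gamma_laplace) (use st q in auto)
      also have "\<dots> = of_real (Gamma (\<alpha> + 1) * Re q powr (- (\<alpha> + 1)))"
        using powr_of_real[of "Re q" "- (\<alpha> + 1)"] q by simp
      finally show ?thesis by (simp only: of_real_eq_iff integral_mult_right_zero)
    qed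
    finally have bound: "norm (J \<delta> - (LINT r|lborel. ?e r)) \<le> T * (Gamma (\<alpha> + 1) * (y * sin \<delta>) powr (- (\<alpha> + 1)))"
      by (simp only: q(2))
    have "pi * stable_kernel \<alpha> \<kappa> T x = Re (w * (J \<delta> - (LINT r|lborel. ?e r)))"
      unfolding kern rot right_diff_distrib minus_complex.sel Re0 by simp
    then have "\<bar>pi * stable_kernel \<alpha> \<kappa> T x\<bar> \<le> norm (w * (J \<delta> - (LINT r|lborel. ?e r)))" by (simp only: abs_Re_le_cmod)
    also have "\<dots> = norm (J \<delta> - (LINT r|lborel. ?e r))" by (simp add: norm_mult w_def)
    finally have "pi * \<bar>stable_kernel \<alpha> \<kappa> T x\<bar> \<le> T * (Gamma (\<alpha> + 1) * (y * sin \<delta>) powr (- (\<alpha> + 1)))"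
      using bound by (simp add: abs_mult)
    moreover have "(y * sin \<delta>) powr (- (\<alpha> + 1)) = \<bar>x\<bar> powr (- (\<alpha> + 1)) * sin \<delta> powr (- (\<alpha> + 1))"
      using x sind by (simp only: y_def) (subst powr_mult, auto)
    ultimately show ?thesis by (simp only:) (simp add: field_simps)
  qed
  then show ?thesis by (rule that)
qed

section \<open>Integrability, transform and evolution of the kernels\<close>

lemma stable_kernel_bounded:
  assumes st: "0 < \<alpha>" "\<bar>\<kappa>\<bar> < pi / 2" "0 < T"
  obtains K where "\<And>x. \<bar>stable_kernel \<alpha> \<kappa> T x\<bar> \<le> K"
proof
  fix x
  have "\<bar>stable_kernel \<alpha> \<kappa> T x\<bar> = norm (LINT \<eta>|lborel. cis (- (\<eta> * x)) * stable_transform \<alpha> \<kappa> T \<eta>) / (2 * pi)"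
    using arg_cong[OF stable_kernel_eq_complex[OF st, of x], of norm] by (simp add: norm_divide norm_mult)
  also have "\<dots> \<le> (LINT \<eta>|lborel. norm (cis (- (\<eta> * x)) * stable_transform \<alpha> \<kappa> T \<eta>)) / (2 * pi)"
    by (intro divide_right_mono integral_norm_bound) auto
  finally show "\<bar>stable_kernel \<alpha> \<kappa> T x\<bar> \<le> (LINT \<eta>|lborel. norm (stable_transform \<alpha> \<kappa> T \<eta>)) / (2 * pi)" by (simp add: norm_mult)
qed

lemma stable_kernel_measurable [measurable]: "stable_kernel \<alpha> \<kappa> T \<in> borel_measurable borel"
  unfolding stable_kernel_def re_transform_def by measurable

text \<open>On the negative half line boundedness serves near 0 and the decay of order
  |x|^(-\<alpha>-1) serves beyond -1. The positive half line is the reflected kernel with angle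
  -\<kappa>.\<close>

lemma integrable_stable_kernel:
  assumes st: "0 < \<alpha>" "\<bar>\<kappa>\<bar> < pi / 2" "0 < T"
  shows "integrable lborel (stable_kernel \<alpha> \<kappa> T)"
proof -
  have half: "set_integrable lborel {..<0} (stable_kernel \<alpha> \<kappa> T)" if k: "\<bar>\<kappa>\<bar> < pi / 2" for \<kappa>
  proof -
    obtain K where K: "\<And>x. \<bar>stable_kernel \<alpha> \<kappa> T x\<bar> \<le> K" using stable_kernel_bounded[OF st(1) k st(3)] by blast
    obtain C where C: "\<And>x. x < 0 \<Longrightarrow> \<bar>stable_kernel \<alpha> \<kappa> T x\<bar> \<le> C * \<bar>x\<bar> powr (- (\<alpha> + 1))"
      using stable_kernel_decay_neg[OF st(1) k st(3)] by blast
    have 1: "set_integrable lborel {1..} (\<lambda>x. x powr (- (\<alpha> + 1)))"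
      by (rule set_integrable_lborel_nonneg[OF has_integral_powr_to_inf]) (use st in \<open>auto simp: set_borel_measurable_def\<close>)
    have 2: "integrable lborel (\<lambda>x. indicator {1..} (0 + (-1) * x) *\<^sub>R ((0 + (-1) * x) powr (- (\<alpha> + 1))) :: real)"
      using 1 unfolding set_integrable_def by (rule lborel_integrable_real_affine) simp
    have 3: "integrable lborel (\<lambda>x::real. indicator {-1..0} x *\<^sub>R K)"
      using borel_integrable_atLeastAtMost'[of "-1" 0 "\<lambda>_. K", OF continuous_on_const] unfolding set_integrable_def .
    show ?thesis unfolding set_integrable_def
    proof (rule Bochner_Integration.integrable_bound[OF Bochner_Integration.integrable_add[OF integrable_mult_right[OF 2, of C] 3]])
      show "AE x in lborel. norm (indicator {..<0} x *\<^sub>R stable_kernel \<alpha> \<kappa> T x)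
         \<le> norm (C * (indicator {1..} (0 + (-1) * x) *\<^sub>R ((0 + (-1) * x) powr (- (\<alpha> + 1)))) + indicator {-1..0} x *\<^sub>R K)"
      proof (rule AE_I2)
        fix x :: real
        consider "0 \<le> x" | "x < 0" "-1 < x" | "x \<le> -1" "x < 0" by linarith
        then show "norm (indicator {..<0} x *\<^sub>R stable_kernel \<alpha> \<kappa> T x)
         \<le> norm (C * (indicator {1..} (0 + (-1) * x) *\<^sub>R ((0 + (-1) * x) powr (- (\<alpha> + 1)))) + indicator {-1..0} x *\<^sub>R K)"
        proof cases
          case 2
          then show ?thesis using order_trans[OF K[of x] abs_ge_self[of K]] by (simp add: indicator_def)
        next
          case 3
          have "\<bar>stable_kernel \<alpha> \<kappa> T x\<bar> \<le> C * (- x) powr (- (\<alpha> + 1))" "0 \<le> K" using C[of x] 3 order_trans[OF abs_ge_zero K] by auto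
          then show ?thesis using 3 by (auto simp: indicator_def)
        qed (simp add: indicator_def)
      qed
    qed simp
  qed
  have "integrable lborel (\<lambda>x. indicator {..<0} (0 + (-1) * x) *\<^sub>R stable_kernel \<alpha> (- \<kappa>) T (0 + (-1) * x))"
    using half[of "- \<kappa>"] st unfolding set_integrable_def by (intro lborel_integrable_real_affine) auto
  then have "set_integrable lborel {0<..} (stable_kernel \<alpha> \<kappa> T)"
    unfolding set_integrable_def by (rule Bochner_Integration.integrable_cong[THEN iffD1, rotated 2]) (auto simp: indicator_def stable_kernel_reflect)
  then have "set_integrable lborel ({..<0} \<union> {0<..}) (stable_kernel \<alpha> \<kappa> T)"
    using half[OF st(2)] by (intro set_integrable_Un) auto
  then show ?thesis unfolding set_integrable_def
    by (subst integrable_discrete_difference[where X="{0}"]) (auto simp: indicator_def)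
qed

lemma fourier_stable_kernel:
  assumes st: "0 < \<alpha>" "\<bar>\<kappa>\<bar> < pi / 2" "0 < T"
  shows "fourier (stable_kernel \<alpha> \<kappa> T) \<xi> = stable_transform \<alpha> \<kappa> T \<xi>"
  unfolding fourier_def
proof (rule fourier_inversion[where K=1])
  show "norm (stable_transform \<alpha> \<kappa> T \<eta>) \<le> 1" for \<eta>
    unfolding norm_stable_transform using cos_pos_of_abs_less[OF st(2)] st by simp
  show "integrable lborel (\<lambda>x. complex_of_real (stable_kernel \<alpha> \<kappa> T x))"
    using integrable_stable_kernel[OF st] by (rule integrable_of_real)
qed (rule integrable_stable_transform[OF st] continuous_stable_transform[OF st(1)] stable_kernel_eq_complex[OF st])+

lemma integrable_re_transform:
  assumes [measurable]: "A \<in> borel_measurable borel" and A: "integrable lborel (\<lambda>r. norm (A r) * \<bar>r\<bar> ^ j)"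
  shows "integrable lborel (\<lambda>r. Re (A r * (- \<i> * of_real r) ^ j * exp (- \<i> * of_real (x * r))))"
proof (rule Bochner_Integration.integrable_bound[OF A])
  have "\<bar>Re (A r * (- \<i> * of_real r) ^ j * exp (- \<i> * of_real (x * r)))\<bar> \<le> norm (A r) * \<bar>r\<bar> ^ j" for r
  proof -
    have "\<bar>Re (A r * (- \<i> * of_real r) ^ j * exp (- \<i> * of_real (x * r)))\<bar> \<le> norm (A r * (- \<i> * of_real r) ^ j * exp (- \<i> * of_real (x * r)))"
      by (rule abs_Re_le_cmod)
    then show ?thesis unfolding exp_minus_ii by (simp add: norm_mult norm_power)
  qed
  then show "AE r in lborel. norm (Re (A r * (- \<i> * of_real r) ^ j * exp (- \<i> * of_real (x * r)))) \<le> norm (norm (A r) * \<bar>r\<bar> ^ j)"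
    by (intro AE_I2) simp
qed simp

lemma stable_kernel_time_derivative:
  assumes st: "0 < \<alpha>" "\<bar>\<kappa>\<bar> < pi / 2" "0 < T"
  shows "((\<lambda>\<tau>. stable_kernel \<alpha> \<kappa> \<tau> x) has_real_derivative
     re_transform (\<lambda>\<xi>. - stable_exponent \<alpha> \<kappa> \<xi> * stable_transform \<alpha> \<kappa> T \<xi> / of_real (2 * pi)) (- \<i>) 0 x) (at T)"
  unfolding stable_kernel_def re_transform_def
proof (rule has_field_derivative_lebesgue_integral(1)[where S="{T / 2<..}" and
      g="\<lambda>r. \<bar>r\<bar> powr \<alpha> * norm (stable_transform \<alpha> \<kappa> (T / 2) r) * (1 / (2 * pi))"])
  have "0 < T / 2" "-1 < \<alpha>" using st by auto
  then show "integrable lborel (\<lambda>r. \<bar>r\<bar> powr \<alpha> * norm (stable_transform \<alpha> \<kappa> (T / 2) r) * (1 / (2 * pi)))"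
    by (intro integrable_mult_left integrable_powr_stable_transform st)
  fix \<tau> assume "\<tau> \<in> {T / 2<..}"
  then have \<tau>: "T / 2 < \<tau>" "0 < \<tau>" using st by auto
  show "integrable lborel (\<lambda>r. Re (stable_transform \<alpha> \<kappa> \<tau> r / of_real (2 * pi) * (- \<i> * of_real r) ^ 0 * exp (- \<i> * of_real (x * r))))"
    using integrable_norm[OF integrable_stable_transform[OF st(1,2) \<tau>(2)]]
    by (intro integrable_re_transform) (simp_all add: norm_divide)
  fix r :: real
  have "((\<lambda>z. exp (- (z * stable_exponent \<alpha> \<kappa> r)) / of_real (2 * pi) * (- \<i> * of_real r) ^ 0 * exp (- \<i> * of_real (x * r))) has_field_derivative
      - stable_exponent \<alpha> \<kappa> r * exp (- (of_real \<tau> * stable_exponent \<alpha> \<kappa> r)) / of_real (2 * pi) * (- \<i> * of_real r) ^ 0 * exp (- \<i> * of_real (x * r))) (at (of_real \<tau>))"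
    by (auto intro!: derivative_eq_intros)
  from bounded_linear.has_vector_derivative[OF bounded_linear_Re has_vector_derivative_real_field[OF this]]
  show "((\<lambda>\<tau>. Re (stable_transform \<alpha> \<kappa> \<tau> r / of_real (2 * pi) * (- \<i> * of_real r) ^ 0 * exp (- \<i> * of_real (x * r)))) has_real_derivative
      Re (- stable_exponent \<alpha> \<kappa> r * stable_transform \<alpha> \<kappa> \<tau> r / of_real (2 * pi) * (- \<i> * of_real r) ^ 0 * exp (- \<i> * of_real (x * r)))) (at \<tau>)"
    unfolding has_real_derivative_iff_has_vector_derivative stable_transform_def by simp
  have "norm (stable_transform \<alpha> \<kappa> \<tau> r) \<le> norm (stable_transform \<alpha> \<kappa> (T / 2) r)"
  proof -
    have "T / 2 * cos \<kappa> * \<bar>r\<bar> powr \<alpha> \<le> \<tau> * cos \<kappa> * \<bar>r\<bar> powr \<alpha>"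
      using \<tau> cos_pos_of_abs_less[OF st(2)] by (intro mult_right_mono) auto
    then show ?thesis unfolding norm_stable_transform by (simp only: exp_le_cancel_iff neg_le_iff_le)
  qed
  then have *: "\<bar>r\<bar> powr \<alpha> * norm (stable_transform \<alpha> \<kappa> \<tau> r) \<le> \<bar>r\<bar> powr \<alpha> * norm (stable_transform \<alpha> \<kappa> (T / 2) r)"
    by (rule mult_left_mono) simp
  have "norm (Re (- stable_exponent \<alpha> \<kappa> r * stable_transform \<alpha> \<kappa> \<tau> r / of_real (2 * pi) * (- \<i> * of_real r) ^ 0 * exp (- \<i> * of_real (x * r))))
     \<le> norm (- stable_exponent \<alpha> \<kappa> r * stable_transform \<alpha> \<kappa> \<tau> r / of_real (2 * pi) * (- \<i> * of_real r) ^ 0 * exp (- \<i> * of_real (x * r)))"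
    unfolding real_norm_def by (rule abs_Re_le_cmod)
  also have "\<dots> = \<bar>r\<bar> powr \<alpha> * norm (stable_transform \<alpha> \<kappa> \<tau> r) * (1 / (2 * pi))"
    unfolding exp_minus_ii by (simp add: norm_mult norm_divide stable_exponent_def)
  also have "\<dots> \<le> \<bar>r\<bar> powr \<alpha> * norm (stable_transform \<alpha> \<kappa> (T / 2) r) * (1 / (2 * pi))"
    using * by (rule mult_right_mono) simp
  finally show "norm (Re (- stable_exponent \<alpha> \<kappa> r * stable_transform \<alpha> \<kappa> \<tau> r / of_real (2 * pi) * (- \<i> * of_real r) ^ 0 * exp (- \<i> * of_real (x * r))))
     \<le> \<bar>r\<bar> powr \<alpha> * norm (stable_transform \<alpha> \<kappa> (T / 2) r) * (1 / (2 * pi))" .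
qed (use st in auto)

text \<open>Scaling makes the kernels an approximate identity of width T^(1/\<alpha>). The mass 1 is
  the transform at 0, and absolute integrability replaces positivity in the dominated
  convergence.\<close>

lemma stable_kernel_initial:
  assumes st: "0 < \<alpha>" "\<bar>\<kappa>\<bar> < pi / 2"
    and \<phi>: "continuous_on UNIV \<phi>" "bounded (range \<phi>)"
  shows "((\<lambda>T. LINT x|lborel. \<phi> x * stable_kernel \<alpha> \<kappa> T x) \<longlongrightarrow> \<phi> 0) (at_right 0)"
proof -
  have K: "integrable lborel (stable_kernel \<alpha> \<kappa> 1)" using integrable_stable_kernel st by simp
  obtain M where M: "\<And>x. \<bar>\<phi> x\<bar> \<le> M" using \<phi>(2) by (auto simp: bounded_iff)
  note [measurable] = borel_measurable_continuous_onI[OF \<phi>(1)]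
  have "complex_of_real (LINT x|lborel. stable_kernel \<alpha> \<kappa> 1 x) = fourier (stable_kernel \<alpha> \<kappa> 1) 0"
    by (simp add: fourier_def)
  also have "\<dots> = 1" using fourier_stable_kernel[OF st, of 1] by (simp add: stable_transform_def stable_exponent_def)
  finally have one: "(LINT x|lborel. stable_kernel \<alpha> \<kappa> 1 x) = 1" by (simp only: of_real_eq_1_iff)
  have "((\<lambda>T. LINT y|lborel. \<phi> (T powr (1 / \<alpha>) * y) * stable_kernel \<alpha> \<kappa> 1 y) \<longlongrightarrow> (LINT y|lborel. \<phi> 0 * stable_kernel \<alpha> \<kappa> 1 y)) (at_right 0)"
  proof (rule tendsto_lebesgue_integral_within[where g="\<lambda>y. M * \<bar>stable_kernel \<alpha> \<kappa> 1 y\<bar>"])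
    have "((\<lambda>T. \<phi> (T powr (1 / \<alpha>) * y)) \<longlongrightarrow> \<phi> 0) (at_right 0)" for y
    proof -
      have "((\<lambda>T. T powr (1 / \<alpha>) * y) \<longlongrightarrow> 0) (at_right 0)"
      proof -
        have "((\<lambda>T. T powr (1 / \<alpha>)) \<longlongrightarrow> 0) (at_right 0)" using st(1) by real_asymp
        from tendsto_mult_right[OF this, of y] show ?thesis by (simp add: mult.commute)
      qed
      moreover have "isCont \<phi> 0" using \<phi>(1) by (simp add: continuous_on_eq_continuous_at)
      ultimately show ?thesis by (auto intro: isCont_tendsto_compose)
    qed
    then show "AE y in lborel. ((\<lambda>T. \<phi> (T powr (1 / \<alpha>) * y) * stable_kernel \<alpha> \<kappa> 1 y) \<longlongrightarrow> \<phi> 0 * stable_kernel \<alpha> \<kappa> 1 y) (at_right 0)"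
      by (intro AE_I2 tendsto_intros)
  qed (use M K in \<open>auto simp: abs_mult intro!: mult_right_mono\<close>)
  then have "((\<lambda>T. LINT y|lborel. \<phi> (T powr (1 / \<alpha>) * y) * stable_kernel \<alpha> \<kappa> 1 y) \<longlongrightarrow> \<phi> 0) (at_right 0)"
    using one by simp
  then show ?thesis
  proof (rule Lim_transform_eventually)
    have "(LINT y|lborel. \<phi> (T powr (1 / \<alpha>) * y) * stable_kernel \<alpha> \<kappa> 1 y) = (LINT x|lborel. \<phi> x * stable_kernel \<alpha> \<kappa> T x)" if T: "0 < T" for T
    proof -
      define c where "c = T powr (1 / \<alpha>)"
      have c: "0 < c" "T powr (- 1 / \<alpha>) = 1 / c" using T by (auto simp: c_def powr_minus_divide)
      have "(LINT x|lborel. \<phi> x * stable_kernel \<alpha> \<kappa> T x) = \<bar>c\<bar> *\<^sub>R (LINT y|lborel. \<phi> (0 + c * y) * stable_kernel \<alpha> \<kappa> T (0 + c * y))"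
        by (rule lborel_integral_real_affine) (use c in simp)
      also have "\<dots> = (LINT y|lborel. \<phi> (c * y) * stable_kernel \<alpha> \<kappa> 1 y)"
        using stable_kernel_scaling[OF st(1) T, of \<kappa>] c by simp
      finally show ?thesis by (simp add: c_def)
    qed
    then show "\<forall>\<^sub>F T in at_right 0. (LINT y|lborel. \<phi> (T powr (1 / \<alpha>) * y) * stable_kernel \<alpha> \<kappa> 1 y) = (LINT x|lborel. \<phi> x * stable_kernel \<alpha> \<kappa> T x)"
      by (auto simp: eventually_at_filter)
  qed
qed

section \<open>Weyl derivatives of stable kernels\<close>

text \<open>
  The boundary value of \<open>(\<mp> \<i> \<xi>) powr (\<rho> - 1)\<close>; the sign \<open>\<sigma> = 1\<close> belongs to the left, \<open>\<sigma> = - 1\<close> to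
  the right Weyl derivative.
\<close>
definition weyl_weight :: "real \<Rightarrow> real \<Rightarrow> real \<Rightarrow> complex" where
  "weyl_weight \<sigma> \<rho> \<xi> = of_real (\<bar>\<xi>\<bar> powr (\<rho> - 1)) * cis ((\<rho> - 1) * (- (pi / 2 * \<sigma> * sgn \<xi>)))"

lemma weyl_weight_measurable [measurable]: "weyl_weight \<sigma> \<rho> \<in> borel_measurable borel"
  unfolding weyl_weight_def[abs_def] by measurable

lemma weyl_weight_eq:
  assumes "\<sigma> \<in> {1, -1}" "\<xi> \<noteq> 0"
  shows "(- (\<i> * of_real (\<sigma> * \<xi>))) powr (- of_real (1 - \<rho>)) = weyl_weight \<sigma> \<rho> \<xi>"
proof -
  have s: "\<sigma> * sgn \<xi> = 1 \<or> \<sigma> * sgn \<xi> = -1" using assms by (auto simp: sgn_real_def)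
  have "- (\<i> * of_real (\<sigma> * \<xi>)) = of_real \<bar>\<xi>\<bar> * cis (- (pi / 2 * \<sigma> * sgn \<xi>))"
    using assms by (auto simp: complex_eq_iff sgn_real_def)
  moreover have "(of_real \<bar>\<xi>\<bar> * cis (- (pi / 2 * \<sigma> * sgn \<xi>))) powr (of_real (\<rho> - 1)) = weyl_weight \<sigma> \<rho> \<xi>"
    unfolding weyl_weight_def by (rule powr_polar) (use assms s pi_gt_zero order_trans[of "- (pi / 2)" 0 pi] in \<open>auto simp: mult.assoc\<close>)
  moreover have "- of_real (1 - \<rho>) = (of_real (\<rho> - 1) :: complex)" by simp
  ultimately show ?thesis by (simp only:)
qed

text \<open>v^(-\<rho>) is not integrable at infinity, so the inversion formula cannot be inserted
  and swapped directly. With the factor exp (-\<epsilon> v) the inner integral is a Gamma integral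
  at z = \<epsilon> - i \<sigma> \<xi>, and its boundary value for \<epsilon> = 0 is the fractional
  symbol.\<close>

lemma weyl_integral_stable_kernel:
  fixes x :: real
  assumes st: "0 < \<alpha>" "\<bar>\<kappa>\<bar> < pi / 2" "0 < T" and \<rho>: "0 < \<rho>" "\<rho> < 1" and \<sigma>: "\<sigma> \<in> {1, -1}"
  defines "F \<equiv> \<lambda>v. indicator {0<..} v * (stable_kernel \<alpha> \<kappa> T (x - \<sigma> * v) * v powr (- \<rho>))"
  shows "integrable lborel F"
    and "integral\<^sup>L lborel F = re_transform (\<lambda>\<xi>. of_real (Gamma (1 - \<rho>)) * weyl_weight \<sigma> \<rho> \<xi> * (stable_transform \<alpha> \<kappa> T \<xi> / of_real (2 * pi))) (- \<i>) 0 x"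
proof -
  obtain K where K: "\<And>x. \<bar>stable_kernel \<alpha> \<kappa> T x\<bar> \<le> K" using stable_kernel_bounded[OF st] by blast
  have "integrable lborel (\<lambda>v. stable_kernel \<alpha> \<kappa> T (x + (- \<sigma>) * v))"
    by (rule lborel_integrable_real_affine[OF integrable_stable_kernel[OF st]]) (use \<sigma> in auto)
  then have 1: "integrable lborel (\<lambda>v. \<bar>stable_kernel \<alpha> \<kappa> T (x - \<sigma> * v)\<bar>)" by simp
  have "set_integrable lborel {0..1} (\<lambda>r. r powr (- \<rho>))"
    by (rule set_integrable_lborel_nonneg[OF has_integral_powr_from_0]) (use \<rho> in \<open>auto simp: set_borel_measurable_def\<close>)
  then have 2: "integrable lborel (\<lambda>r::real. K * (indicator {0..1} r *\<^sub>R r powr (- \<rho>)))"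
    unfolding set_integrable_def by (rule integrable_mult_right)
  show Fi: "integrable lborel F"
  proof (rule Bochner_Integration.integrable_bound[OF Bochner_Integration.integrable_add[OF 1 2]])
    show "F \<in> borel_measurable lborel" unfolding F_def by measurable
    show "AE v in lborel. norm (F v) \<le> norm (\<bar>stable_kernel \<alpha> \<kappa> T (x - \<sigma> * v)\<bar> + K * (indicator {0..1} v *\<^sub>R v powr (- \<rho>)))"
    proof (rule AE_I2)
      fix v :: real
      consider "v \<le> 0" | "0 < v" "v \<le> 1" | "1 < v" by linarith
      then show "norm (F v) \<le> norm (\<bar>stable_kernel \<alpha> \<kappa> T (x - \<sigma> * v)\<bar> + K * (indicator {0..1} v *\<^sub>R v powr (- \<rho>)))"
      proof cases
        case 1 then show ?thesis by (simp add: F_def)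
      next
        case 2
        have "norm (F v) \<le> K * v powr (- \<rho>)" using 2 K by (simp add: F_def abs_mult mult_right_mono)
        then show ?thesis using 2 by simp
      next
        case 3
        have "v powr (- \<rho>) \<le> v powr 0" using 3 \<rho> by (intro powr_mono) auto
        then have "v powr (- \<rho>) \<le> 1" using 3 by simp
        then show ?thesis using 3 by (simp add: F_def abs_mult mult_left_le)
      qed
    qed
  qed
  define A where "A = (\<lambda>\<xi>. stable_transform \<alpha> \<kappa> T \<xi> / of_real (2 * pi))"
  have [measurable]: "A \<in> borel_measurable borel" unfolding A_def by measurable
  have Ai: "integrable lborel A" unfolding A_def using integrable_stable_transform[OF st] by simp
  have f_eq: "stable_kernel \<alpha> \<kappa> T y = (LINT \<xi>|lborel. Re (A \<xi> * exp (- \<i> * of_real (y * \<xi>))))" for y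
    unfolding stable_kernel_def re_transform_def A_def by simp
  define Z where "Z = (\<lambda>\<epsilon> \<xi>. (of_real \<epsilon> - \<i> * of_real (\<sigma> * \<xi>)) powr (- complex_of_real (1 - \<rho>)))"
  have key: "(LINT v|lborel. F v * exp (- (\<epsilon> * v))) = (LINT \<xi>|lborel. Re (A \<xi> * exp (- \<i> * of_real (x * \<xi>)) * (of_real (Gamma (1 - \<rho>)) * Z \<epsilon> \<xi>)))"
    if \<epsilon>: "0 < \<epsilon>" for \<epsilon> :: real
  proof -
    let ?k = "\<lambda>v::real. indicator {0<..} v * v powr ((1 - \<rho>) - 1) :: real"
    define H where "H = (\<lambda>v \<xi>. (?k v * exp (- (\<epsilon> * v))) * Re (A \<xi> * exp (- \<i> * of_real ((x - \<sigma> * v) * \<xi>))))"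
    have ki: "integrable lborel (\<lambda>v. ?k v * exp (- (\<epsilon> * v)))"
    proof -
      have "integrable lborel (\<lambda>v. of_real (?k v) * exp (- (complex_of_real \<epsilon> * of_real v)))"
        by (rule gamma_laplace) (use \<rho> \<epsilon> in auto)
      from integrable_norm[OF this] show ?thesis by (simp add: norm_mult norm_exp_eq_Re)
    qed
    have Hi: "integrable (lborel \<Otimes>\<^sub>M lborel) (\<lambda>(v, \<xi>). H v \<xi>)"
    proof (rule Bochner_Integration.integrable_bound[OF integrable_lborel_product[OF ki integrable_norm[OF Ai]]])
      have "\<bar>H v \<xi>\<bar> \<le> \<bar>?k v * exp (- (\<epsilon> * v)) * norm (A \<xi>)\<bar>" for v \<xi>
      proof -
        have "\<bar>Re (A \<xi> * exp (- \<i> * of_real ((x - \<sigma> * v) * \<xi>)))\<bar> \<le> norm (A \<xi> * exp (- \<i> * of_real ((x - \<sigma> * v) * \<xi>)))"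
          by (rule abs_Re_le_cmod)
        also have "\<dots> = norm (A \<xi>)" unfolding exp_minus_ii by (simp add: norm_mult)
        finally show ?thesis unfolding H_def abs_mult by (simp add: mult_left_mono)
      qed
      then show "AE z in lborel \<Otimes>\<^sub>M lborel. norm (case z of (v, \<xi>) \<Rightarrow> H v \<xi>) \<le> norm (case z of (v, \<xi>) \<Rightarrow> ?k v * exp (- (\<epsilon> * v)) * norm (A \<xi>))"
        by (intro AE_I2) (auto simp: split_beta)
      show "(\<lambda>(v, \<xi>). H v \<xi>) \<in> borel_measurable (lborel \<Otimes>\<^sub>M lborel)" unfolding H_def by measurable
    qed
    have "F v * exp (- (\<epsilon> * v)) = (LINT \<xi>|lborel. H v \<xi>)" for v
      unfolding H_def F_def f_eq by (simp add: mult_ac)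
    then have "(LINT v|lborel. F v * exp (- (\<epsilon> * v))) = (LINT v|lborel. LINT \<xi>|lborel. H v \<xi>)" by simp
    also have "\<dots> = (LINT \<xi>|lborel. LINT v|lborel. H v \<xi>)"
      by (rule lborel_pair.Fubini_integral[symmetric, OF Hi])
    also have "\<dots> = (LINT \<xi>|lborel. Re (A \<xi> * exp (- \<i> * of_real (x * \<xi>)) * (of_real (Gamma (1 - \<rho>)) * Z \<epsilon> \<xi>)))"
    proof (rule Bochner_Integration.integral_cong[OF refl])
      fix \<xi> :: real
      let ?z = "of_real \<epsilon> - \<i> * of_real (\<sigma> * \<xi>)"
      have g: "integrable lborel (\<lambda>v. of_real (?k v) * exp (- (?z * of_real v)))"
        "(LINT v|lborel. of_real (?k v) * exp (- (?z * of_real v))) = of_real (Gamma (1 - \<rho>)) * Z \<epsilon> \<xi>"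
        unfolding Z_def by (rule gamma_laplace; use \<rho> \<epsilon> in simp)+
      have "H v \<xi> = Re (A \<xi> * exp (- \<i> * of_real (x * \<xi>)) * (of_real (?k v) * exp (- (?z * of_real v))))" for v
      proof -
        have e: "exp (- \<i> * of_real (x * \<xi>)) * exp (- (?z * of_real v)) = of_real (exp (- (\<epsilon> * v))) * exp (- \<i> * of_real ((x - \<sigma> * v) * \<xi>))"
          unfolding exp_of_real[symmetric] exp_add[symmetric] by (rule arg_cong[where f=exp]) (simp add: algebra_simps)
        have "A \<xi> * exp (- \<i> * of_real (x * \<xi>)) * (of_real (?k v) * exp (- (?z * of_real v)))
          = of_real (?k v) * A \<xi> * (exp (- \<i> * of_real (x * \<xi>)) * exp (- (?z * of_real v)))" by (simp only: mult_ac)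
        also have "\<dots> = of_real (?k v * exp (- (\<epsilon> * v))) * (A \<xi> * exp (- \<i> * of_real ((x - \<sigma> * v) * \<xi>)))"
          unfolding e by (simp only: of_real_mult mult_ac)
        finally show ?thesis unfolding H_def by (simp only:) simp
      qed
      then have "(LINT v|lborel. H v \<xi>) = (LINT v|lborel. Re (A \<xi> * exp (- \<i> * of_real (x * \<xi>)) * (of_real (?k v) * exp (- (?z * of_real v)))))"
        by simp
      also have "\<dots> = Re (LINT v|lborel. A \<xi> * exp (- \<i> * of_real (x * \<xi>)) * (of_real (?k v) * exp (- (?z * of_real v))))"
        by (rule integral_Re[OF integrable_mult_right[OF g(1)]])
      finally show "(LINT v|lborel. H v \<xi>) = Re (A \<xi> * exp (- \<i> * of_real (x * \<xi>)) * (of_real (Gamma (1 - \<rho>)) * Z \<epsilon> \<xi>))"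
        by (simp only: integral_mult_right_zero g(2))
    qed
    finally show ?thesis .
  qed
  have l1: "((\<lambda>\<epsilon>. LINT v|lborel. F v * exp (- (\<epsilon> * v))) \<longlongrightarrow> integral\<^sup>L lborel F) (at_right 0)"
  proof (rule tendsto_lebesgue_integral_within[where g="\<lambda>v. norm (F v)"])
    have "((\<lambda>\<epsilon>. F v * exp (- (\<epsilon> * v))) \<longlongrightarrow> F v * exp (- (0 * v))) (at_right 0)" for v by (intro tendsto_intros)
    then show "AE v in lborel. ((\<lambda>\<epsilon>. F v * exp (- (\<epsilon> * v))) \<longlongrightarrow> F v) (at_right 0)" by simp
    show "AE v in lborel. norm (F v * exp (- (\<epsilon> * v))) \<le> norm (F v)" if "\<epsilon> \<in> {0<..}" for \<epsilon> :: real
    proof (rule AE_I2)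
      fix v show "norm (F v * exp (- (\<epsilon> * v))) \<le> norm (F v)"
      proof (cases "0 < v")
        case True
        then show ?thesis unfolding norm_mult using that by (intro mult_left_le) auto
      qed (simp add: F_def)
    qed
  qed (use Fi in auto)
  have l2: "((\<lambda>\<epsilon>. LINT \<xi>|lborel. Re (A \<xi> * exp (- \<i> * of_real (x * \<xi>)) * (of_real (Gamma (1 - \<rho>)) * Z \<epsilon> \<xi>)))
      \<longlongrightarrow> (LINT \<xi>|lborel. Re (A \<xi> * exp (- \<i> * of_real (x * \<xi>)) * (of_real (Gamma (1 - \<rho>)) * weyl_weight \<sigma> \<rho> \<xi>)))) (at_right 0)"
  proof (rule tendsto_lebesgue_integral_within[where g="\<lambda>\<xi>. \<bar>Gamma (1 - \<rho>)\<bar> / (2 * pi) * (\<bar>\<xi>\<bar> powr (\<rho> - 1) * norm (stable_transform \<alpha> \<kappa> T \<xi>))"])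
    show "integrable lborel (\<lambda>\<xi>. \<bar>Gamma (1 - \<rho>)\<bar> / (2 * pi) * (\<bar>\<xi>\<bar> powr (\<rho> - 1) * norm (stable_transform \<alpha> \<kappa> T \<xi>)))"
      by (intro integrable_mult_right integrable_powr_stable_transform st) (use \<rho> in auto)
    show "AE \<xi> in lborel. ((\<lambda>\<epsilon>. Re (A \<xi> * exp (- \<i> * of_real (x * \<xi>)) * (of_real (Gamma (1 - \<rho>)) * Z \<epsilon> \<xi>)))
        \<longlongrightarrow> Re (A \<xi> * exp (- \<i> * of_real (x * \<xi>)) * (of_real (Gamma (1 - \<rho>)) * weyl_weight \<sigma> \<rho> \<xi>))) (at_right 0)"
      using AE_lborel_singleton[of "0::real"]
    proof eventually_elim
      case (elim \<xi>)
      have "((\<lambda>\<epsilon>. Z \<epsilon> \<xi>) \<longlongrightarrow> (of_real 0 - \<i> * of_real (\<sigma> * \<xi>)) powr (- complex_of_real (1 - \<rho>))) (at_right 0)"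
        unfolding Z_def by (intro tendsto_intros) (use elim \<sigma> in \<open>auto simp: complex_nonpos_Reals_iff\<close>)
      then have "((\<lambda>\<epsilon>. Z \<epsilon> \<xi>) \<longlongrightarrow> weyl_weight \<sigma> \<rho> \<xi>) (at_right 0)"
        using weyl_weight_eq[OF \<sigma> elim, of \<rho>] by simp
      then show ?case by (intro tendsto_intros)
    qed
    show "AE \<xi> in lborel. norm (Re (A \<xi> * exp (- \<i> * of_real (x * \<xi>)) * (of_real (Gamma (1 - \<rho>)) * Z \<epsilon> \<xi>)))
        \<le> \<bar>Gamma (1 - \<rho>)\<bar> / (2 * pi) * (\<bar>\<xi>\<bar> powr (\<rho> - 1) * norm (stable_transform \<alpha> \<kappa> T \<xi>))" if "\<epsilon> \<in> {0<..}" for \<epsilon>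
      using AE_lborel_singleton[of "0::real"]
    proof eventually_elim
      case (elim \<xi>)
      let ?z = "of_real \<epsilon> - \<i> * of_real (\<sigma> * \<xi>)"
      \<comment> \<open>The exponent \<rho> - 1 is negative, so this gives the majorant
        |\<xi>|^(\<rho>-1) independent of \<epsilon>; it is integrable at 0 because \<rho> >
        0.\<close>
      have z: "\<bar>\<xi>\<bar> \<le> norm ?z" using abs_Im_le_cmod[of ?z] \<sigma> by auto
      then have "norm (Z \<epsilon> \<xi>) = norm ?z powr (- (1 - \<rho>))"
        unfolding Z_def using norm_powr_of_real[of ?z "- (1 - \<rho>)"] elim by force
      also have "\<dots> \<le> \<bar>\<xi>\<bar> powr (\<rho> - 1)" using z \<rho> elim by (simp add: powr_mono2')
      finally have Z: "norm (Z \<epsilon> \<xi>) \<le> \<bar>\<xi>\<bar> powr (\<rho> - 1)" .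
      have "norm (Re (A \<xi> * exp (- \<i> * of_real (x * \<xi>)) * (of_real (Gamma (1 - \<rho>)) * Z \<epsilon> \<xi>)))
        \<le> norm (A \<xi> * exp (- \<i> * of_real (x * \<xi>)) * (of_real (Gamma (1 - \<rho>)) * Z \<epsilon> \<xi>))"
        unfolding real_norm_def by (rule abs_Re_le_cmod)
      also have "\<dots> = \<bar>Gamma (1 - \<rho>)\<bar> / (2 * pi) * (norm (Z \<epsilon> \<xi>) * norm (stable_transform \<alpha> \<kappa> T \<xi>))"
        unfolding exp_minus_ii A_def by (simp add: norm_mult norm_divide)
      also have "\<dots> \<le> \<bar>Gamma (1 - \<rho>)\<bar> / (2 * pi) * (\<bar>\<xi>\<bar> powr (\<rho> - 1) * norm (stable_transform \<alpha> \<kappa> T \<xi>))"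
        using Z by (intro mult_left_mono mult_right_mono) auto
      finally show ?case .
    qed
  qed (auto simp: Z_def)
  have "((\<lambda>\<epsilon>. LINT v|lborel. F v * exp (- (\<epsilon> * v))) \<longlongrightarrow> (LINT \<xi>|lborel. Re (A \<xi> * exp (- \<i> * of_real (x * \<xi>)) * (of_real (Gamma (1 - \<rho>)) * weyl_weight \<sigma> \<rho> \<xi>)))) (at_right 0)"
    by (rule Lim_transform_eventually[OF l2]) (auto simp: key eventually_at_filter)
  from tendsto_unique[OF _ l1 this]
  have "integral\<^sup>L lborel F = (LINT \<xi>|lborel. Re (A \<xi> * exp (- \<i> * of_real (x * \<xi>)) * (of_real (Gamma (1 - \<rho>)) * weyl_weight \<sigma> \<rho> \<xi>)))"
    by simp
  also have "\<dots> = re_transform (\<lambda>\<xi>. of_real (Gamma (1 - \<rho>)) * weyl_weight \<sigma> \<rho> \<xi> * A \<xi>) (- \<i>) 0 x"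
    unfolding re_transform_def by (intro Bochner_Integration.integral_cong refl arg_cong[where f=Re]) (simp only: power_0 mult_1_right mult_1_left mult_ac)
  finally show "integral\<^sup>L lborel F = re_transform (\<lambda>\<xi>. of_real (Gamma (1 - \<rho>)) * weyl_weight \<sigma> \<rho> \<xi> * (stable_transform \<alpha> \<kappa> T \<xi> / of_real (2 * pi))) (- \<i>) 0 x"
    unfolding A_def .
qed


lemma re_transform_linear:
  assumes [measurable]: "A \<in> borel_measurable borel" "B \<in> borel_measurable borel"
    and A: "integrable lborel (\<lambda>r. norm (A r))" and B: "integrable lborel (\<lambda>r. norm (B r))"
  shows "re_transform (\<lambda>r. of_real a * A r + of_real b * B r) (- \<i>) 0 x = a * re_transform A (- \<i>) 0 x + b * re_transform B (- \<i>) 0 x"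
proof -
  have iA: "integrable lborel (\<lambda>r. Re (A r * (- \<i> * of_real r) ^ 0 * exp (- \<i> * of_real (x * r))))"
    by (rule integrable_re_transform) (use A in auto)
  have iB: "integrable lborel (\<lambda>r. Re (B r * (- \<i> * of_real r) ^ 0 * exp (- \<i> * of_real (x * r))))"
    by (rule integrable_re_transform) (use B in auto)
  have "re_transform (\<lambda>r. of_real a * A r + of_real b * B r) (- \<i>) 0 x =
    (LINT r|lborel. a * Re (A r * (- \<i> * of_real r) ^ 0 * exp (- \<i> * of_real (x * r))) + b * Re (B r * (- \<i> * of_real r) ^ 0 * exp (- \<i> * of_real (x * r))))"
    unfolding re_transform_def by (intro Bochner_Integration.integral_cong) (simp_all add: algebra_simps)
  also have "\<dots> = a * re_transform A (- \<i>) 0 x + b * re_transform B (- \<i>) 0 x"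
    unfolding re_transform_def
    by (simp only: Bochner_Integration.integral_add[OF integrable_mult_right[OF iA] integrable_mult_right[OF iB]] integral_mult_right_zero)
  finally show ?thesis .
qed

definition weyl_transform :: "real \<Rightarrow> real \<Rightarrow> real \<Rightarrow> real \<Rightarrow> real \<Rightarrow> real \<Rightarrow> complex" where
  "weyl_transform \<alpha> \<kappa> T \<sigma> \<rho> \<xi> = of_real (Gamma (1 - \<rho>)) * weyl_weight \<sigma> \<rho> \<xi> * (stable_transform \<alpha> \<kappa> T \<xi> / of_real (2 * pi))"

lemma weyl_transform_measurable [measurable]: "weyl_transform \<alpha> \<kappa> T \<sigma> \<rho> \<in> borel_measurable borel"
  unfolding weyl_transform_def[abs_def] by measurable

lemma integrable_weyl_transform:
  assumes st: "0 < \<alpha>" "\<bar>\<kappa>\<bar> < pi / 2" "0 < T" and \<rho>: "0 < \<rho>"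
  shows "integrable lborel (\<lambda>\<xi>. norm (weyl_transform \<alpha> \<kappa> T \<sigma> \<rho> \<xi>) * \<bar>\<xi>\<bar> ^ j)"
proof -
  have "integrable lborel (\<lambda>\<xi>. \<bar>Gamma (1 - \<rho>)\<bar> / (2 * pi) * (\<bar>\<xi>\<bar> powr (\<rho> - 1 + j) * norm (stable_transform \<alpha> \<kappa> T \<xi>)))"
    by (intro integrable_mult_right integrable_powr_stable_transform st) (use \<rho> in auto)
  also have "(\<lambda>\<xi>. \<bar>Gamma (1 - \<rho>)\<bar> / (2 * pi) * (\<bar>\<xi>\<bar> powr (\<rho> - 1 + j) * norm (stable_transform \<alpha> \<kappa> T \<xi>)))
     = (\<lambda>\<xi>. norm (weyl_transform \<alpha> \<kappa> T \<sigma> \<rho> \<xi>) * \<bar>\<xi>\<bar> ^ j)"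
  proof
    fix \<xi> :: real
    have "\<bar>\<xi>\<bar> powr (\<rho> - 1 + j) = \<bar>\<xi>\<bar> powr (\<rho> - 1) * \<bar>\<xi>\<bar> ^ j"
      by (cases "\<xi> = 0") (simp_all add: powr_add powr_realpow)
    then show "\<bar>Gamma (1 - \<rho>)\<bar> / (2 * pi) * (\<bar>\<xi>\<bar> powr (\<rho> - 1 + j) * norm (stable_transform \<alpha> \<kappa> T \<xi>))
       = norm (weyl_transform \<alpha> \<kappa> T \<sigma> \<rho> \<xi>) * \<bar>\<xi>\<bar> ^ j"
      by (simp add: weyl_transform_def weyl_weight_def norm_mult norm_divide)
  qed
  finally show ?thesis .
qed

lemma weyl_order_bounds:
  assumes g: "0 < g" "g \<notin> \<nat>"
  shows "0 < g + 1 - real (weyl_order g)" "g + 1 - real (weyl_order g) < 1"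
proof -
  have "g \<noteq> of_int \<lceil>g\<rceil>"
  proof
    assume "g = of_int \<lceil>g\<rceil>"
    then have "g = of_nat (nat \<lceil>g\<rceil>)" using g by simp
    then have "g \<in> \<nat>" by (metis of_nat_in_Nats)
    with g show False by simp
  qed
  then have "g < of_int \<lceil>g\<rceil>" using le_of_int_ceiling[of g] by linarith
  moreover have "real (weyl_order g) = of_int \<lceil>g\<rceil>" using g by (simp add: weyl_order_def)
  moreover have "of_int \<lceil>g\<rceil> < g + 1" by linarith
  ultimately show "0 < g + 1 - real (weyl_order g)" "g + 1 - real (weyl_order g) < 1" by linarith+
qed

text \<open>The m outer derivatives raise the order of the symbol from \<rho> - 1 to g. In the right
  derivative the sign (-1)^m turns the factors -i \<xi> into i \<xi>, matching the branch of the
  fractional part.\<close>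

lemma weyl_transform_power:
  fixes m :: nat and \<rho> g :: real
  assumes \<rho>: "\<rho> < 1" "g = \<rho> - 1 + m"
  shows "weyl_transform \<alpha> \<kappa> T 1 \<rho> \<xi> * (- \<i> * of_real \<xi>) ^ m = of_real (Gamma (1 - \<rho>)) * (weyl_symbol_plus g \<xi> * (stable_transform \<alpha> \<kappa> T \<xi> / of_real (2 * pi)))"
    and "(-1) ^ m * (weyl_transform \<alpha> \<kappa> T (-1) \<rho> \<xi> * (- \<i> * of_real \<xi>) ^ m) = of_real (Gamma (1 - \<rho>)) * (weyl_symbol_minus g \<xi> * (stable_transform \<alpha> \<kappa> T \<xi> / of_real (2 * pi)))"
proof -
  have polar: "weyl_weight \<sigma> \<rho> \<xi> * (- (\<i> * of_real (\<sigma> * \<xi>))) ^ m = of_real (\<bar>\<xi>\<bar> powr g) * cis (- (pi * g / 2 * \<sigma> * sgn \<xi>))"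
    if "\<sigma> \<in> {1, -1}" for \<sigma>
  proof (cases "\<xi> = 0")
    case False
    have e: "- (\<i> * of_real (\<sigma> * \<xi>)) = of_real \<bar>\<xi>\<bar> * cis (- (pi / 2 * \<sigma> * sgn \<xi>))"
      using that False by (auto simp: complex_eq_iff sgn_real_def)
    have "weyl_weight \<sigma> \<rho> \<xi> * (- (\<i> * of_real (\<sigma> * \<xi>))) ^ m = of_real (\<bar>\<xi>\<bar> powr (\<rho> - 1) * \<bar>\<xi>\<bar> ^ m) * 
        (cis ((\<rho> - 1) * (- (pi / 2 * \<sigma> * sgn \<xi>))) * cis (real m * (- (pi / 2 * \<sigma> * sgn \<xi>))))"
      unfolding e weyl_weight_def power_mult_distrib Complex.DeMoivre by simp
    also have "cis ((\<rho> - 1) * (- (pi / 2 * \<sigma> * sgn \<xi>))) * cis (real m * (- (pi / 2 * \<sigma> * sgn \<xi>))) = cis (- (pi * g / 2 * \<sigma> * sgn \<xi>))"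
      unfolding cis_mult by (rule arg_cong[where f=cis]) (simp add: \<rho> field_simps)
    also have "\<bar>\<xi>\<bar> powr (\<rho> - 1) * \<bar>\<xi>\<bar> ^ m = \<bar>\<xi>\<bar> powr g"
      using False by (simp add: \<rho> powr_add powr_realpow)
    finally show ?thesis .
  qed (simp add: weyl_weight_def)
  show "weyl_transform \<alpha> \<kappa> T 1 \<rho> \<xi> * (- \<i> * of_real \<xi>) ^ m = of_real (Gamma (1 - \<rho>)) * (weyl_symbol_plus g \<xi> * (stable_transform \<alpha> \<kappa> T \<xi> / of_real (2 * pi)))"
  proof -
    have e: "weyl_weight 1 \<rho> \<xi> * (- \<i> * of_real \<xi>) ^ m = weyl_symbol_plus g \<xi>"
      using polar[of 1] by (simp add: weyl_symbol_plus_def)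
    show ?thesis unfolding weyl_transform_def e[symmetric] by (simp only: mult_ac)
  qed
  show "(-1) ^ m * (weyl_transform \<alpha> \<kappa> T (-1) \<rho> \<xi> * (- \<i> * of_real \<xi>) ^ m) = of_real (Gamma (1 - \<rho>)) * (weyl_symbol_minus g \<xi> * (stable_transform \<alpha> \<kappa> T \<xi> / of_real (2 * pi)))"
  proof -
    have "(-1) ^ m * (- \<i> * of_real \<xi>) ^ m = (- (\<i> * complex_of_real ((-1) * \<xi>))) ^ m"
      unfolding power_mult_distrib[symmetric] by simp
    then have e: "weyl_weight (-1) \<rho> \<xi> * ((-1) ^ m * (- \<i> * of_real \<xi>) ^ m) = weyl_symbol_minus g \<xi>"
      using polar[of "-1"] by (simp add: weyl_symbol_minus_def)
    show ?thesis unfolding weyl_transform_def e[symmetric] by (simp only: mult_ac)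
  qed
qed

text \<open>The substitutions y = x - v and y = x + v turn the Weyl integrals into the one-sided
  integral with \<sigma> = 1 and \<sigma> = -1. Differentiating under the transform m times and
  cancelling Gamma (m - g) = Gamma (1 - \<rho>) leaves the symbols.\<close>

lemma weyl_stable_kernel:
  assumes st: "0 < \<alpha>" "\<bar>\<kappa>\<bar> < pi / 2" "0 < T" and g: "0 < g" "g \<notin> \<nat>"
  shows "weyl_differentiable g (stable_kernel \<alpha> \<kappa> T)"
    and "weyl_deriv_plus g (stable_kernel \<alpha> \<kappa> T) x = re_transform (\<lambda>\<xi>. weyl_symbol_plus g \<xi> * (stable_transform \<alpha> \<kappa> T \<xi> / of_real (2 * pi))) (- \<i>) 0 x"
    and "weyl_deriv_minus g (stable_kernel \<alpha> \<kappa> T) x = re_transform (\<lambda>\<xi>. weyl_symbol_minus g \<xi> * (stable_transform \<alpha> \<kappa> T \<xi> / of_real (2 * pi))) (- \<i>) 0 x"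
proof -
  define m where "m = weyl_order g"
  define \<rho> where "\<rho> = g + 1 - real m"
  have \<rho>: "0 < \<rho>" "\<rho> < 1" using weyl_order_bounds[OF g] by (auto simp: \<rho>_def m_def)
  have gm: "g = \<rho> - 1 + real m" "real m - g = 1 - \<rho>" by (auto simp: \<rho>_def)
  have gr: "g + 1 - real (weyl_order g) = \<rho>" by (simp add: \<rho>_def m_def)
  let ?f = "stable_kernel \<alpha> \<kappa> T"
  let ?F = "\<lambda>\<sigma> x v. indicator {0<..} v * (?f (x - \<sigma> * v) * v powr (- \<rho>))"
  let ?W = "\<lambda>\<sigma>. weyl_transform \<alpha> \<kappa> T \<sigma> \<rho>"
  have F: "integrable lborel (?F \<sigma> x)" "integral\<^sup>L lborel (?F \<sigma> x) = re_transform (?W \<sigma>) (- \<i>) 0 x"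
    if "\<sigma> \<in> {1, -1}" for \<sigma> x
    using weyl_integral_stable_kernel[OF st \<rho> that, of x] by (simp_all add: weyl_transform_def[abs_def])
  have plus_eq: "?F 1 x (x + (-1) * y) = indicator {..<x} y *\<^sub>R weyl_integrand_plus g ?f x y" for x y
    by (auto simp: weyl_integrand_plus_def indicator_def powr_minus_divide gr)
  have minus_eq: "?F (-1) x (- x + 1 * y) = indicator {x<..} y *\<^sub>R weyl_integrand_minus g ?f x y" for x y
    by (auto simp: weyl_integrand_minus_def indicator_def powr_minus_divide gr)
  have ip: "set_integrable lborel {..<x} (weyl_integrand_plus g ?f x)" for x
    unfolding set_integrable_def plus_eq[symmetric] by (rule lborel_integrable_real_affine[OF F(1)]) auto
  have im: "set_integrable lborel {x<..} (weyl_integrand_minus g ?f x)" for x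
    unfolding set_integrable_def minus_eq[symmetric] by (rule lborel_integrable_real_affine[OF F(1)]) auto
  have wp: "weyl_integral_plus g ?f = re_transform (?W 1) (- \<i>) 0"
  proof
    fix x
    have "weyl_integral_plus g ?f x = (LINT y|lborel. ?F 1 x (x + (-1) * y))"
      unfolding weyl_integral_plus_def set_lebesgue_integral_def plus_eq ..
    also have "\<dots> = integral\<^sup>L lborel (?F 1 x)" using lborel_integral_real_affine[of "-1" "?F 1 x" x] by simp
    finally show "weyl_integral_plus g ?f x = re_transform (?W 1) (- \<i>) 0 x" using F(2)[of 1 x] by simp
  qed
  have wm: "weyl_integral_minus g ?f = re_transform (?W (-1)) (- \<i>) 0"
  proof
    fix x
    have "weyl_integral_minus g ?f x = (LINT y|lborel. ?F (-1) x (- x + 1 * y))"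
      unfolding weyl_integral_minus_def set_lebesgue_integral_def minus_eq ..
    also have "\<dots> = integral\<^sup>L lborel (?F (-1) x)" using lborel_integral_real_affine[of 1 "?F (-1) x" "- x"] by simp
    finally show "weyl_integral_minus g ?f x = re_transform (?W (-1)) (- \<i>) 0 x" using F(2)[of "-1" x] by simp
  qed
  have d: "(re_transform (?W \<sigma>) (- \<i>) j has_real_derivative re_transform (?W \<sigma>) (- \<i>) (Suc j) x) (at x)" for \<sigma> j x
  proof (rule re_transform_derivative)
    show "integrable lborel (\<lambda>r. norm (?W \<sigma> r) * \<bar>r\<bar> ^ j * exp (B * \<bar>Re (- \<i>) * r\<bar>))" for B
      using integrable_weyl_transform[OF st \<rho>(1), of \<sigma> j] by simp
    show "integrable lborel (\<lambda>r. norm (?W \<sigma> r) * \<bar>r\<bar> ^ Suc j * exp (B * \<bar>Re (- \<i>) * r\<bar>))" for B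
      using integrable_weyl_transform[OF st \<rho>(1), of \<sigma> "Suc j"] by simp
  qed simp
  have fam: "(deriv ^^ m) (re_transform (?W \<sigma>) (- \<i>) 0) = re_transform (?W \<sigma>) (- \<i>) m"
    "times_differentiable m (re_transform (?W \<sigma>) (- \<i>) 0)" for \<sigma>
    using times_differentiable_family[where F="re_transform (?W \<sigma>) (- \<i>)" and m=m] d by auto
  show "weyl_differentiable g ?f"
    unfolding weyl_differentiable_def wp wm m_def[symmetric] using ip im fam(2) by blast
  have "0 < Gamma (1 - \<rho>)" by (rule Gamma_real_pos) (use \<rho> in simp)
  then have Gpos: "Gamma (1 - \<rho>) \<noteq> 0" by linarith
  have "1 / Gamma (1 - \<rho>) * re_transform (?W 1) (- \<i>) m x = re_transform (\<lambda>\<xi>. weyl_symbol_plus g \<xi> * (stable_transform \<alpha> \<kappa> T \<xi> / of_real (2 * pi))) (- \<i>) 0 x"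
    unfolding re_transform_def integral_mult_right_zero[symmetric] weyl_transform_power(1)[OF \<rho>(2) gm(1)]
    using Gpos by (intro Bochner_Integration.integral_cong) (simp_all add: field_simps)
  then show "weyl_deriv_plus g ?f x = re_transform (\<lambda>\<xi>. weyl_symbol_plus g \<xi> * (stable_transform \<alpha> \<kappa> T \<xi> / of_real (2 * pi))) (- \<i>) 0 x"
    unfolding weyl_deriv_plus_def wp m_def[symmetric] gm(2) fam(1) .
  have "(-1) ^ m / Gamma (1 - \<rho>) * Re (?W (-1) r * (- \<i> * of_real r) ^ m * exp (- \<i> * of_real (x * r)))
     = Re (weyl_symbol_minus g r * (stable_transform \<alpha> \<kappa> T r / of_real (2 * pi)) * (- \<i> * of_real r) ^ 0 * exp (- \<i> * of_real (x * r)))" for r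
  proof -
    have R: "a * Re z = Re (of_real a * z)" for a z by simp
    have "(-1) ^ m / Gamma (1 - \<rho>) * Re (?W (-1) r * (- \<i> * of_real r) ^ m * exp (- \<i> * of_real (x * r)))
       = Re (of_real (1 / Gamma (1 - \<rho>)) * (((-1) ^ m * (?W (-1) r * (- \<i> * of_real r) ^ m)) * exp (- \<i> * of_real (x * r))))"
      unfolding R by (rule arg_cong[where f=Re]) (simp add: mult_ac)
    also have "\<dots> = Re (weyl_symbol_minus g r * (stable_transform \<alpha> \<kappa> T r / of_real (2 * pi)) * (- \<i> * of_real r) ^ 0 * exp (- \<i> * of_real (x * r)))"
      unfolding weyl_transform_power(2)[OF \<rho>(2) gm(1)] using Gpos by (intro arg_cong[where f=Re]) (simp add: field_simps)
    finally show ?thesis .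
  qed
  then have "(-1) ^ m / Gamma (1 - \<rho>) * re_transform (?W (-1)) (- \<i>) m x = re_transform (\<lambda>\<xi>. weyl_symbol_minus g \<xi> * (stable_transform \<alpha> \<kappa> T \<xi> / of_real (2 * pi))) (- \<i>) 0 x"
    unfolding re_transform_def integral_mult_right_zero[symmetric] by (simp only:)
  then show "weyl_deriv_minus g ?f x = re_transform (\<lambda>\<xi>. weyl_symbol_minus g \<xi> * (stable_transform \<alpha> \<kappa> T \<xi> / of_real (2 * pi))) (- \<i>) 0 x"
    unfolding weyl_deriv_minus_def wm m_def[symmetric] gm(2) fam(1) .
qed

section \<open>The Feller symbol and the Cauchy problem\<close>

text \<open>The two Weyl coefficients are those that combine e^(-i a) and e^(i a) into the single
  phase e^(i b), with a = \<pi> g / 2 and b = \<pi>\<theta>/2; the order g disappears from the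
  angle.\<close>

lemma feller_symbol_eq:
  assumes "sin (pi * g) \<noteq> 0"
  shows "feller_symbol g \<theta> \<xi> = - stable_exponent g (pi * \<theta> / 2) \<xi>"
proof -
  define a b where "a = pi * g / 2" and "b = pi * \<theta> / 2"
  have ab: "pi / 2 * (g - \<theta>) = a - b" "pi / 2 * (g + \<theta>) = a + b" "pi * g = 2 * a"
    by (simp_all add: a_def b_def field_simps)
  have h: "2 * a / 2 = a" by simp
  have s: "sin (2 * a) \<noteq> 0" using assms ab by simp
  have 1: "of_real (sin (a - b) / sin (2 * a)) * cis (- (a * t)) + of_real (sin (a + b) / sin (2 * a)) * cis (a * t) = cis (b * t)"
    if "t = 1 \<or> t = -1" for t
  proof -
    have "of_real (sin (a - b)) * cis (- (a * t)) + of_real (sin (a + b)) * cis (a * t) = of_real (sin (2 * a)) * cis (b * t)"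
      using that unfolding sin_double by (auto simp: complex_eq_iff sin_add sin_diff algebra_simps)
    then have "(of_real (sin (a - b)) * cis (- (a * t)) + of_real (sin (a + b)) * cis (a * t)) / of_real (sin (2 * a)) = cis (b * t)"
      using s by simp
    then show ?thesis by (simp add: add_divide_distrib)
  qed
  show ?thesis
  proof (cases "\<xi> = 0")
    case False
    then have "sgn \<xi> = 1 \<or> sgn \<xi> = -1" by (auto simp: sgn_real_def)
    from 1[OF this]
    have "of_real (\<bar>\<xi>\<bar> powr g) * (of_real (sin (a - b) / sin (2 * a)) * cis (- (a * sgn \<xi>)) + of_real (sin (a + b) / sin (2 * a)) * cis (a * sgn \<xi>))
       = of_real (\<bar>\<xi>\<bar> powr g) * cis (b * sgn \<xi>)" by simp
    then show ?thesis
      unfolding feller_symbol_def weyl_symbol_plus_def weyl_symbol_minus_def stable_exponent_def ab h b_def[symmetric]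
      by (simp only: ring_distribs mult_ac)
  qed (simp add: feller_symbol_def weyl_symbol_plus_def weyl_symbol_minus_def stable_exponent_def)
qed

lemma feller_deriv_stable_kernel:
  assumes st: "0 < g" "\<bar>\<theta>\<bar> < 1" "0 < T" and g: "g \<notin> \<nat>" "sin (pi * g) \<noteq> 0"
  shows "((\<lambda>\<tau>. stable_kernel g (pi * \<theta> / 2) \<tau> x) has_real_derivative
     feller_deriv g \<theta> (stable_kernel g (pi * \<theta> / 2) T) x) (at T)"
proof -
  define \<kappa> where "\<kappa> = pi * \<theta> / 2"
  have \<kappa>: "\<bar>\<kappa>\<bar> < pi / 2" using st by (simp add: \<kappa>_def abs_mult)
  note W = weyl_stable_kernel[OF st(1) \<kappa> st(3) st(1) g(1)]
  let ?G = "\<lambda>\<xi>. stable_transform g \<kappa> T \<xi> / of_real (2 * pi)"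
  have mp: "(\<lambda>\<xi>. weyl_symbol_plus g \<xi> * ?G \<xi>) \<in> borel_measurable borel" "(\<lambda>\<xi>. weyl_symbol_minus g \<xi> * ?G \<xi>) \<in> borel_measurable borel"
    unfolding weyl_symbol_plus_def weyl_symbol_minus_def by measurable
  have "integrable lborel (\<lambda>\<xi>. \<bar>\<xi>\<bar> powr g * norm (stable_transform g \<kappa> T \<xi>) * (1 / (2 * pi)))"
    by (intro integrable_mult_left integrable_powr_stable_transform \<kappa>) (use st in auto)
  then have i: "integrable lborel (\<lambda>\<xi>. norm (weyl_symbol_plus g \<xi> * ?G \<xi>))" "integrable lborel (\<lambda>\<xi>. norm (weyl_symbol_minus g \<xi> * ?G \<xi>))"
    by (simp_all add: weyl_symbol_plus_def weyl_symbol_minus_def norm_mult norm_divide)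
  define a b where "a = - (sin (pi / 2 * (g - \<theta>)) / sin (pi * g))" and "b = - (sin (pi / 2 * (g + \<theta>)) / sin (pi * g))"
  have "feller_deriv g \<theta> (stable_kernel g \<kappa> T) x = a * weyl_deriv_plus g (stable_kernel g \<kappa> T) x + b * weyl_deriv_minus g (stable_kernel g \<kappa> T) x"
    by (simp add: feller_deriv_def a_def b_def algebra_simps)
  also have "\<dots> = re_transform (\<lambda>\<xi>. of_real a * (weyl_symbol_plus g \<xi> * ?G \<xi>) + of_real b * (weyl_symbol_minus g \<xi> * ?G \<xi>)) (- \<i>) 0 x"
    unfolding W by (rule re_transform_linear[OF mp i, symmetric])
  also have "(\<lambda>\<xi>. of_real a * (weyl_symbol_plus g \<xi> * ?G \<xi>) + of_real b * (weyl_symbol_minus g \<xi> * ?G \<xi>)) = (\<lambda>\<xi>. - stable_exponent g \<kappa> \<xi> * stable_transform g \<kappa> T \<xi> / of_real (2 * pi))"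
  proof
    fix \<xi>
    have "of_real a * (weyl_symbol_plus g \<xi> * ?G \<xi>) + of_real b * (weyl_symbol_minus g \<xi> * ?G \<xi>) = feller_symbol g \<theta> \<xi> * ?G \<xi>"
    proof -
      have "- p * (u * w) + - q * (v * w) = - (p * u + q * v) * w" for p q u v w :: complex
        by (simp add: algebra_simps)
      then show ?thesis unfolding feller_symbol_def a_def b_def of_real_minus .
    qed
    then show "of_real a * (weyl_symbol_plus g \<xi> * ?G \<xi>) + of_real b * (weyl_symbol_minus g \<xi> * ?G \<xi>) = - stable_exponent g \<kappa> \<xi> * stable_transform g \<kappa> T \<xi> / of_real (2 * pi)"
      by (simp add: feller_symbol_eq[OF g(2)] \<kappa>_def)
  qed
  finally show ?thesis
    using stable_kernel_time_derivative[OF st(1) \<kappa> st(3), of x] unfolding \<kappa>_def by simp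
qed

lemma sin_pi_mult_ne_0:
  assumes "0 < g" "g \<notin> \<nat>"
  shows "sin (pi * g) \<noteq> 0"
proof
  assume "sin (pi * g) = 0"
  then obtain i where "pi * g = of_int i * pi" by (auto simp: sin_zero_iff_int2)
  then have "g = of_int i" by simp
  with assms(1) have "g = of_nat (nat i)" by simp
  with assms(2) show False by (metis of_nat_in_Nats)
qed

theorem feller_cauchy_solution_stable_kernel:
  assumes "0 < g" "g \<notin> \<nat>" "\<bar>\<theta>\<bar> < 1"
  shows "feller_cauchy_solution g \<theta> (\<lambda>x t. stable_kernel g (pi * \<theta> / 2) t x)"
    and "feller_cauchy_solution_fourier g \<theta> (\<lambda>x t. stable_kernel g (pi * \<theta> / 2) t x)"
proof -
  have \<kappa>: "\<bar>pi * \<theta> / 2\<bar> < pi / 2" using assms by (simp add: abs_mult)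
  note s = sin_pi_mult_ne_0[OF assms(1,2)]
  show "feller_cauchy_solution g \<theta> (\<lambda>x t. stable_kernel g (pi * \<theta> / 2) t x)"
    unfolding feller_cauchy_solution_def
    using weyl_stable_kernel(1)[OF assms(1) \<kappa> _ assms(1,2)] feller_deriv_stable_kernel[OF assms(1,3) _ assms(2) s]
      stable_kernel_initial[OF assms(1) \<kappa>] by (simp add: eta_contract_eq)
  have deriv: "((\<lambda>\<tau>. stable_transform g (pi * \<theta> / 2) \<tau> \<xi>) has_vector_derivative
      feller_symbol g \<theta> \<xi> * stable_transform g (pi * \<theta> / 2) t \<xi>) (at t)" for t \<xi>
  proof -
    have "((\<lambda>z. exp (- (z * stable_exponent g (pi * \<theta> / 2) \<xi>))) has_field_derivative
      - stable_exponent g (pi * \<theta> / 2) \<xi> * exp (- (of_real t * stable_exponent g (pi * \<theta> / 2) \<xi>))) (at (of_real t))"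
      by (auto intro!: derivative_eq_intros)
    from has_vector_derivative_real_field[OF this] show ?thesis
      unfolding feller_symbol_eq[OF s] stable_transform_def by simp
  qed
  show "feller_cauchy_solution_fourier g \<theta> (\<lambda>x t. stable_kernel g (pi * \<theta> / 2) t x)"
    unfolding feller_cauchy_solution_fourier_def
  proof (intro conjI allI impI)
    fix t \<xi> :: real assume t: "0 < t"
    show "integrable lborel (stable_kernel g (pi * \<theta> / 2) t)" by (rule integrable_stable_kernel[OF assms(1) \<kappa> t])
    show "((\<lambda>\<tau>. fourier (stable_kernel g (pi * \<theta> / 2) \<tau>) \<xi>) has_vector_derivative
       feller_symbol g \<theta> \<xi> * fourier (stable_kernel g (pi * \<theta> / 2) t) \<xi>) (at t)"
      unfolding fourier_stable_kernel[OF assms(1) \<kappa> t]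
      by (rule has_vector_derivative_transform_within_open[OF deriv, of "{0<..}"])
         (use t fourier_stable_kernel[OF assms(1) \<kappa>] in auto)
  next
    fix \<xi>
    have "((\<lambda>t. stable_transform g (pi * \<theta> / 2) t \<xi>) \<longlongrightarrow> exp (- (of_real 0 * stable_exponent g (pi * \<theta> / 2) \<xi>))) (at_right 0)"
      unfolding stable_transform_def by (intro tendsto_intros)
    then have "((\<lambda>t. stable_transform g (pi * \<theta> / 2) t \<xi>) \<longlongrightarrow> 1) (at_right 0)" by simp
    then show "((\<lambda>t. fourier (stable_kernel g (pi * \<theta> / 2) t) \<xi>) \<longlongrightarrow> 1) (at_right 0)"
      by (rule Lim_transform_eventually) (auto simp: eventually_at_filter fourier_stable_kernel[OF assms(1) \<kappa>])
  qed
qed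

section \<open>Composition with stable subordinators\<close>

text \<open>The only point of the closed half plane on the branch cut is 0, where the norm |z|^b
  settles continuity.\<close>

lemma continuous_on_powr_half_plane:
  assumes "0 < b"
  shows "continuous_on {z. 0 \<le> Re z} (\<lambda>z. z powr (complex_of_real b))"
  unfolding continuous_on_def
proof
  fix z :: complex assume z: "z \<in> {z. 0 \<le> Re z}"
  show "((\<lambda>z. z powr of_real b) \<longlongrightarrow> z powr of_real b) (at z within {z. 0 \<le> Re z})"
  proof (cases "z = 0")
    case False
    then have "z \<notin> \<real>\<^sub>\<le>\<^sub>0" using z by (auto simp: complex_nonpos_Reals_iff complex_eq_iff)
    then show ?thesis by (intro tendsto_intros) auto
  next
    case True
    have "((\<lambda>z. z powr complex_of_real b) \<longlongrightarrow> 0) (at 0 within {z. 0 \<le> Re z})"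
    proof (rule Lim_null_comparison)
      show "\<forall>\<^sub>F z in at 0 within {z. 0 \<le> Re z}. norm (z powr complex_of_real b) \<le> norm z powr b"
        by (auto simp: eventually_at_filter norm_powr_of_real)
      have "((\<lambda>z. norm z powr b) \<longlongrightarrow> norm (0::complex) powr b) (at 0 within {z. 0 \<le> Re z})"
        by (rule tendsto_powr2) (use assms in \<open>auto intro!: tendsto_norm_zero tendsto_ident_at always_eventually\<close>)
      then show "((\<lambda>z. norm z powr b) \<longlongrightarrow> 0) (at (0::complex) within {z. 0 \<le> Re z})" by simp
    qed
    then show ?thesis using True by simp
  qed
qed

lemma continuous_on_laplace:
  fixes k :: "real \<Rightarrow> real"
  assumes k: "integrable lborel k" "\<And>v. v < 0 \<Longrightarrow> k v = 0"
  shows "continuous_on {z. 0 \<le> Re z} (\<lambda>z. LINT v|lborel. of_real (k v) * exp (- (z * of_real v)))"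
  unfolding continuous_on_def
proof
  fix z :: complex assume z: "z \<in> {z. 0 \<le> Re z}"
  have [measurable]: "k \<in> borel_measurable borel" using k(1) by auto
  show "((\<lambda>z. LINT v|lborel. of_real (k v) * exp (- (z * of_real v))) \<longlongrightarrow> (LINT v|lborel. of_real (k v) * exp (- (z * of_real v)))) (at z within {z. 0 \<le> Re z})"
  proof (rule tendsto_lebesgue_integral_within[where g="\<lambda>v. \<bar>k v\<bar>"])
    show "AE v in lborel. ((\<lambda>z. of_real (k v) * exp (- (z * of_real v))) \<longlongrightarrow> of_real (k v) * exp (- (z * of_real v))) (at z within {z. 0 \<le> Re z})"
      by (intro AE_I2 tendsto_intros)
    show "AE v in lborel. norm (of_real (k v) * exp (- (y * of_real v))) \<le> \<bar>k v\<bar>" if "y \<in> {z. 0 \<le> Re z}" for y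
    proof (rule AE_I2)
      fix v show "norm (of_real (k v) * exp (- (y * of_real v))) \<le> \<bar>k v\<bar>"
      proof (cases "v < 0")
        case False
        then have "0 \<le> Re y * v" using that by simp
        then show ?thesis by (simp add: norm_mult norm_exp_eq_Re mult_left_le)
      qed (simp add: k)
    qed
  qed (use k in auto)
qed

text \<open>The definition gives the Laplace transform for real arguments; it extends to the
  interior by analyticity and to the imaginary axis by continuity. The negative moments come from
  integrating the transform against \<mu>^(a-1).\<close>

lemma stable_subordinator_laplace:
  assumes \<beta>: "0 < \<beta>" and h: "stable_subordinator_density \<beta> h" and T: "0 < T"
  defines "k \<equiv> \<lambda>s. indicator {0..} s * h s T"
  shows "integrable lborel k" "\<And>s. 0 \<le> k s"
    and "0 \<le> Re z \<Longrightarrow> (LINT v|lborel. of_real (k v) * exp (- (z * of_real v))) = exp (- (of_real T * z powr of_real \<beta>))"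
    and "0 < a \<Longrightarrow> integrable lborel (\<lambda>s. indicator {0<..} s * s powr (- a) * h s T)"
proof -
  have H: "\<And>s. 0 \<le> s \<Longrightarrow> 0 \<le> h s T" "\<And>\<mu>. 0 \<le> \<mu> \<Longrightarrow> set_integrable lborel {0..} (\<lambda>s. exp (- (\<mu> * s)) * h s T)"
    "\<And>\<mu>. 0 \<le> \<mu> \<Longrightarrow> (LINT s:{0..}|lborel. exp (- (\<mu> * s)) * h s T) = exp (- (T * \<mu> powr \<beta>))"
    using h T unfolding stable_subordinator_density_def by blast+
  have keq: "indicator {0..} s *\<^sub>R (exp (- (\<mu> * s)) * h s T) = k s * exp (- (\<mu> * s))" for s \<mu>
    by (simp add: k_def)
  have Hk: "integrable lborel (\<lambda>s. k s * exp (- (\<mu> * s)))" "(LINT s|lborel. k s * exp (- (\<mu> * s))) = exp (- (T * \<mu> powr \<beta>))" if "0 \<le> \<mu>" for \<mu>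
    using H(2,3)[OF that] unfolding set_integrable_def set_lebesgue_integral_def keq by auto
  show ki: "integrable lborel k" using Hk(1)[of 0] by simp
  show k0: "\<And>s. 0 \<le> k s" using H(1) by (simp add: k_def indicator_def)
  have [measurable]: "k \<in> borel_measurable borel" using ki by auto
  have supp: "\<And>v. v < 0 \<Longrightarrow> k v = 0" by (simp add: k_def)
  have int: "integrable lborel (\<lambda>v. of_real (k v) * exp (- (z * of_real v)))" if "0 \<le> Re z" for z
  proof (rule Bochner_Integration.integrable_bound[OF ki])
    show "AE v in lborel. norm (of_real (k v) * exp (- (z * of_real v))) \<le> norm (k v)"
    proof (rule AE_I2)
      fix v show "norm (of_real (k v) * exp (- (z * of_real v))) \<le> norm (k v)"
      proof (cases "v < 0")
        case False
        then have "0 \<le> Re z * v" using that by simp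
        then show ?thesis by (simp add: norm_mult norm_exp_eq_Re mult_left_le)
      qed (simp add: supp)
    qed
  qed simp
  have "(\<lambda>z. LINT v|lborel. of_real (k v) * (0 - exp (- (z * of_real v)))) holomorphic_on {z. 0 < Re z}"
  proof (rule laplace_holomorphic[OF supp])
    show "integrable lborel (\<lambda>v. of_real (k v) * (0 - exp (- (z * of_real v))))" if "0 < Re z" for z
      using integrable_minus[OF int[of z]] that by simp
    show "integrable lborel (\<lambda>v. k v * v * exp (- (a * v)))" if a: "0 < a" for a
    proof (rule Bochner_Integration.integrable_bound[OF integrable_mult_right[OF ki, of "1 / a"]])
      show "AE v in lborel. norm (k v * v * exp (- (a * v))) \<le> norm (1 / a * k v)"
      proof (rule AE_I2)
        fix v show "norm (k v * v * exp (- (a * v))) \<le> norm (1 / a * k v)"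
        proof (cases "v < 0")
          case False
          have "a * v \<le> exp (a * v)" using exp_ge_add_one_self[of "a * v"] by linarith
          then have "v * exp (- (a * v)) \<le> 1 / a" using a by (simp add: exp_minus field_simps)
          from mult_left_mono[OF this k0[of v]] show ?thesis using False a k0[of v] by (simp add: abs_mult mult_ac)
        qed (simp add: supp)
      qed
    qed simp
  qed
  then have "(\<lambda>z. - (LINT v|lborel. of_real (k v) * (0 - exp (- (z * of_real v))))) holomorphic_on {z. 0 < Re z}"
    by (rule holomorphic_on_minus)
  then have hol: "(\<lambda>z. LINT v|lborel. of_real (k v) * exp (- (z * of_real v))) holomorphic_on {z. 0 < Re z}" by simp
  show "(LINT v|lborel. of_real (k v) * exp (- (z * of_real v))) = exp (- (of_real T * z powr of_real \<beta>))" if "0 \<le> Re z"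
  proof (rule eq_on_closed_right_half_plane[OF hol continuous_on_laplace[OF ki supp] _ _ _ that])
    show "(\<lambda>z. exp (- (of_real T * z powr of_real \<beta>))) holomorphic_on {z. 0 < Re z}"
      by (intro holomorphic_intros) (auto simp: complex_nonpos_Reals_iff)
    show "continuous_on {z. 0 \<le> Re z} (\<lambda>z. exp (- (of_real T * z powr of_real \<beta>)))"
      by (intro continuous_intros continuous_on_powr_half_plane \<beta>)
    fix x :: real assume x: "0 < x"
    have "(LINT v|lborel. of_real (k v) * exp (- (of_real x * of_real v))) = complex_of_real (LINT s|lborel. k s * exp (- (x * s)))"
      unfolding integral_complex_of_real[symmetric] by (intro Bochner_Integration.integral_cong) (simp_all flip: exp_of_real)
    also have "\<dots> = of_real (exp (- (T * x powr \<beta>)))" using Hk(2)[of x] x by simp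
    also have "\<dots> = exp (- (of_real T * complex_of_real x powr of_real \<beta>))"
      using powr_of_real[of x \<beta>] x by (simp flip: exp_of_real)
    finally show "(LINT v|lborel. of_real (k v) * exp (- (of_real x * of_real v))) = exp (- (of_real T * complex_of_real x powr of_real \<beta>))" .
  qed
  show "integrable lborel (\<lambda>s. indicator {0<..} s * s powr (- a) * h s T)" if a: "0 < a"
  proof -
    \<comment> \<open>Integrating first in s gives \<mu>^(a-1) exp (-T \<mu>^\<beta>), which is
      integrable; integrating first in \<mu> gives Gamma a times s^(-a) against the density.\<close>
    let ?f = "\<lambda>\<mu> s. (indicator {0<..} \<mu> * \<mu> powr (a - 1)) * (k s * exp (- (\<mu> * s)))"
    have "integrable (lborel \<Otimes>\<^sub>M lborel) (\<lambda>(\<mu>, s). ?f \<mu> s)"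
    proof (rule lborel_pair.Fubini_integrable)
      show "(\<lambda>(\<mu>, s). ?f \<mu> s) \<in> borel_measurable (lborel \<Otimes>\<^sub>M lborel)" by measurable
      have "set_integrable lborel {0<..} (\<lambda>r. r powr (a - 1) * exp (- (T * r powr \<beta>)))"
        by (rule set_integrable_powr_exp_powr) (use a \<beta> T in auto)
      then have "integrable lborel (\<lambda>\<mu>. indicator {0<..} \<mu> * \<mu> powr (a - 1) * exp (- (T * \<mu> powr \<beta>)))"
        unfolding set_integrable_def by (simp add: mult.assoc)
      also have "(\<lambda>\<mu>. indicator {0<..} \<mu> * \<mu> powr (a - 1) * exp (- (T * \<mu> powr \<beta>))) = (\<lambda>\<mu>. LINT s|lborel. norm (case (\<mu>, s) of (\<mu>, s) \<Rightarrow> ?f \<mu> s))"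
      proof
        fix \<mu> :: real
        have "norm (case (\<mu>, s) of (\<mu>, s) \<Rightarrow> ?f \<mu> s) = ?f \<mu> s" for s using k0 by (simp add: abs_mult)
        then have "(LINT s|lborel. norm (case (\<mu>, s) of (\<mu>, s) \<Rightarrow> ?f \<mu> s)) = (indicator {0<..} \<mu> * \<mu> powr (a - 1)) * (LINT s|lborel. k s * exp (- (\<mu> * s)))"
          by (simp only: integral_mult_right_zero)
        then show "indicator {0<..} \<mu> * \<mu> powr (a - 1) * exp (- (T * \<mu> powr \<beta>)) = (LINT s|lborel. norm (case (\<mu>, s) of (\<mu>, s) \<Rightarrow> ?f \<mu> s))"
          using Hk(2)[of \<mu>] by (cases "0 < \<mu>") auto
      qed
      finally show "integrable lborel (\<lambda>\<mu>. LINT s|lborel. norm (case (\<mu>, s) of (\<mu>, s) \<Rightarrow> ?f \<mu> s))" .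
      show "AE \<mu> in lborel. integrable lborel (\<lambda>s. case (\<mu>, s) of (\<mu>, s) \<Rightarrow> ?f \<mu> s)"
      proof (rule AE_I2)
        fix \<mu> :: real
        show "integrable lborel (\<lambda>s. case (\<mu>, s) of (\<mu>, s) \<Rightarrow> ?f \<mu> s)"
          using integrable_mult_right[OF Hk(1)[of \<mu>], of "indicator {0<..} \<mu> * \<mu> powr (a - 1)"] by (cases "0 < \<mu>") auto
      qed
    qed
    then have i: "integrable lborel (\<lambda>s. LINT \<mu>|lborel. ?f \<mu> s)" by (rule lborel_pair.integrable_snd)
    have "AE s in lborel. (LINT \<mu>|lborel. ?f \<mu> s) = Gamma a * (indicator {0<..} s * s powr (- a) * k s)"
      using AE_lborel_singleton[of "0::real"]
    proof eventually_elim
      case (elim s)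
      show ?case
      proof (cases "0 < s")
        case True
        have "complex_of_real (LINT \<mu>|lborel. (indicator {0<..} \<mu> * \<mu> powr (a - 1)) * exp (- (s * \<mu>)))
          = (LINT \<mu>|lborel. of_real (indicator {0<..} \<mu> * \<mu> powr (a - 1)) * exp (- (of_real s * of_real \<mu>)))"
          unfolding integral_complex_of_real[symmetric] by (intro Bochner_Integration.integral_cong) (simp_all flip: exp_of_real)
        also have "\<dots> = of_real (Gamma a) * complex_of_real s powr (- of_real a)"
          by (rule gamma_laplace(2)) (use a True in auto)
        also have "\<dots> = of_real (Gamma a * s powr (- a))"
          using powr_of_real[of s "- a"] True by simp
        finally have g: "(LINT \<mu>|lborel. (indicator {0<..} \<mu> * \<mu> powr (a - 1)) * exp (- (s * \<mu>))) = Gamma a * s powr (- a)"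
          by (simp only: of_real_eq_iff)
        have "?f \<mu> s = k s * ((indicator {0<..} \<mu> * \<mu> powr (a - 1)) * exp (- (s * \<mu>)))" for \<mu>
          by (simp only: mult_ac)
        then have "(LINT \<mu>|lborel. ?f \<mu> s) = k s * (Gamma a * s powr (- a))" by (simp only: integral_mult_right_zero g)
        then show ?thesis using True by simp
      qed (use elim in \<open>simp add: supp\<close>)
    qed
    then have "integrable lborel (\<lambda>s. Gamma a * (indicator {0<..} s * s powr (- a) * k s))"
      using i by (subst (asm) integrable_cong_AE) (auto dest: borel_measurable_integrable)
    then have "integrable lborel (\<lambda>s. 1 / Gamma a * (Gamma a * (indicator {0<..} s * s powr (- a) * k s)))"
      by (rule integrable_mult_right)
    moreover have "0 < Gamma a" using a by (rule Gamma_real_pos)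
    ultimately show ?thesis
      by (elim Bochner_Integration.integrable_cong[THEN iffD1, rotated 2]) (auto simp: k_def indicator_def)
  qed
qed

text \<open>For odd exponent i \<xi>^(2k+1) lies on the imaginary axis on the side of sgn \<xi>, so
  the principal power has angle \<beta> \<pi>/2 sgn \<xi>.\<close>

lemma stable_exponent_odd_power:
  assumes "0 < \<beta>" "\<beta> < 1"
  shows "(\<i> * of_real (\<xi> ^ (2 * k + 1))) powr of_real \<beta> = stable_exponent (\<beta> * real (2 * k + 1)) (pi * \<beta> / 2) \<xi>"
proof (cases "\<xi> = 0")
  case False
  have s: "sgn \<xi> = 1 \<or> sgn \<xi> = -1" using False by (auto simp: sgn_real_def)
  have "\<xi> ^ (2 * k + 1) = sgn \<xi> * \<bar>\<xi>\<bar> ^ (2 * k + 1)"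
    using s by (cases "0 < \<xi>") (use False in auto)
  then have "\<i> * of_real (\<xi> ^ (2 * k + 1)) = of_real (\<bar>\<xi>\<bar> ^ (2 * k + 1)) * cis (pi / 2 * sgn \<xi>)"
    using s by (auto simp: complex_eq_iff)
  moreover have "(of_real (\<bar>\<xi>\<bar> ^ (2 * k + 1)) * cis (pi / 2 * sgn \<xi>)) powr of_real \<beta> = of_real ((\<bar>\<xi>\<bar> ^ (2 * k + 1)) powr \<beta>) * cis (\<beta> * (pi / 2 * sgn \<xi>))"
    by (rule powr_polar) (use False s pi_gt_zero order_trans[of "- (pi / 2)" 0 pi] in auto)
  moreover have "(\<bar>\<xi>\<bar> ^ (2 * k + 1)) powr \<beta> = \<bar>\<xi>\<bar> powr (\<beta> * real (2 * k + 1))"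
    using False by (simp add: powr_realpow[symmetric] powr_powr mult.commute del: power_Suc)
  ultimately show ?thesis unfolding stable_exponent_def by (simp only:) (simp add: mult_ac)
qed (simp add: stable_exponent_def)

section \<open>Subordinated laws, time scales and the composition\<close>

text \<open>For a fixed truncation the frequency range is bounded and Fubini applies; the s-integral
  is then the Laplace transform at i \<xi>^(2k+1). Removing the truncation is dominated in s by 3
  s^(-1/(2k+1)) times the density, a negative moment, and in \<xi> by the integrable stable
  transform.\<close>

lemma subordinated_law_eq:
  assumes \<beta>: "0 < \<beta>" "\<beta> < 1" and k: "1 \<le> k" and h: "stable_subordinator_density \<beta> h" and T: "0 < T"
  shows "subordinated_law k h x T = stable_kernel (\<beta> * real (2 * k + 1)) (pi * \<beta> / 2) T x"
proof -
  define \<alpha> where "\<alpha> = \<beta> * real (2 * k + 1)"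
  define \<kappa> where "\<kappa> = pi * \<beta> / 2"
  have st: "0 < \<alpha>" "\<bar>\<kappa>\<bar> < pi / 2" "0 < T" using \<beta> T by (auto simp: \<alpha>_def \<kappa>_def abs_mult)
  define m where "m = (\<lambda>s. indicator {0..} s * h s T)"
  note L = stable_subordinator_laplace[OF \<beta>(1) h T, folded m_def]
  have [measurable]: "m \<in> borel_measurable borel" using L(1) by auto
  let ?p = "1 / real (2 * k + 1)"
  have "integrable lborel (\<lambda>s. 3 * (indicator {0<..} s * s powr (- ?p) * h s T))"
    by (rule integrable_mult_right[OF L(4)]) simp
  then have dom: "integrable lborel (\<lambda>s. 3 * (indicator {0<..} s * s powr (- 1 / real (2 * k + 1)) * h s T))"
    by simp
  have mh: "(\<lambda>s. indicator {0<..} s * h s T) \<in> borel_measurable borel"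
  proof -
    have "(\<lambda>s. indicator {0<..} s * h s T) = (\<lambda>s. indicator {0<..} s * m s)" by (auto simp: m_def indicator_def)
    then show ?thesis by simp
  qed
  have hpos: "0 \<le> h s T" if "0 < s" for s using L(2)[of s] that by (simp add: m_def)
  have mo: "(\<lambda>s. odd_partial k x s R) \<in> borel_measurable borel" for R
    unfolding odd_partial_def set_lebesgue_integral_def by measurable
  let ?g = "\<lambda>R s. indicator {0<..} s * (odd_partial k x s R * h s T)"
  have g_eq: "?g R s = odd_partial k x s R * (indicator {0<..} s * h s T)" for R s by simp
  have l1: "(\<lambda>n. LINT s|lborel. ?g (real n) s) \<longlonglongrightarrow> subordinated_law k h x T"
    unfolding subordinated_law_def set_lebesgue_integral_def
  proof (rule integral_dominated_convergence[OF _ _ dom])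
    show mg: "?g (real n) \<in> borel_measurable lborel" for n
      unfolding g_eq using mo mh by measurable
    show lim: "AE s in lborel. (\<lambda>n. ?g (real n) s) \<longlonglongrightarrow> indicator {0<..} s *\<^sub>R (odd_order_law k x s * h s T)"
    proof (rule AE_I2)
      fix s :: real
      show "(\<lambda>n. ?g (real n) s) \<longlonglongrightarrow> indicator {0<..} s *\<^sub>R (odd_order_law k x s * h s T)"
      proof (cases "0 < s")
        case True
        have "(\<lambda>n. odd_partial k x s (real n)) \<longlonglongrightarrow> odd_order_law k x s"
          by (rule filterlim_compose[OF odd_order_law_eq(2)[OF k True] filterlim_real_sequentially])
        then show ?thesis using True by (auto intro!: tendsto_intros)
      qed simp
    qed
    \<comment> \<open>Measurability in s of the limiting law is inherited from the
      truncations.\<close>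
    show "(\<lambda>s. indicator {0<..} s *\<^sub>R (odd_order_law k x s * h s T)) \<in> borel_measurable lborel"
    proof (rule borel_measurable_LIMSEQ_metric)
      show "?g (real n) \<in> borel_measurable lborel" for n by (rule mg)
      fix s :: real
      show "(\<lambda>n. ?g (real n) s) \<longlonglongrightarrow> indicator {0<..} s *\<^sub>R (odd_order_law k x s * h s T)"
      proof (cases "0 < s")
        case True
        have "(\<lambda>n. odd_partial k x s (real n)) \<longlonglongrightarrow> odd_order_law k x s"
          by (rule filterlim_compose[OF odd_order_law_eq(2)[OF k True] filterlim_real_sequentially])
        then show ?thesis using True by (auto intro!: tendsto_intros)
      qed simp
    qed
    show "AE s in lborel. norm (?g (real n) s) \<le> 3 * (indicator {0<..} s * s powr (- 1 / real (2 * k + 1)) * h s T)" for n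
    proof (rule AE_I2)
      fix s :: real
      show "norm (?g (real n) s) \<le> 3 * (indicator {0<..} s * s powr (- 1 / real (2 * k + 1)) * h s T)"
      proof (cases "0 < s")
        case True
        from mult_right_mono[OF odd_partial_bound[OF k True, of x "real n"] hpos[OF True]] hpos[OF True] True
        show ?thesis by (simp add: abs_mult mult_ac)
      qed simp
    qed
  qed
  have P: "(LINT s|lborel. ?g R s) = (LINT \<xi>|lborel. indicator {-R..R} \<xi> *\<^sub>R Re (stable_transform \<alpha> \<kappa> T \<xi> / of_real (2 * pi) * (- \<i> * of_real \<xi>) ^ 0 * exp (- \<i> * of_real (x * \<xi>))))" for R
  proof -
    define H where "H = (\<lambda>s \<xi>. m s * (indicator {-R..R} \<xi> * (cos (\<xi> * x + s * \<xi> ^ (2 * k + 1)) / (2 * pi))))"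
    have ii: "integrable lborel (\<lambda>\<xi>. indicator {-R..R} \<xi> * (1 / (2 * pi)))"
      using borel_integrable_atLeastAtMost'[of "-R" R "\<lambda>_. 1 / (2 * pi)", OF continuous_on_const] unfolding set_integrable_def by simp
    have Hi: "integrable (lborel \<Otimes>\<^sub>M lborel) (\<lambda>(s, \<xi>). H s \<xi>)"
    proof (rule Bochner_Integration.integrable_bound[OF integrable_lborel_product[OF L(1) ii]])
      have "\<bar>H s \<xi>\<bar> \<le> \<bar>m s * (indicator {-R..R} \<xi> * (1 / (2 * pi)))\<bar>" for s \<xi>
        unfolding H_def abs_mult by (intro mult_left_mono) (auto simp: divide_right_mono)
      then show "AE z in lborel \<Otimes>\<^sub>M lborel. norm (case z of (s, \<xi>) \<Rightarrow> H s \<xi>) \<le> norm (case z of (s, \<xi>) \<Rightarrow> m s * (indicator {-R..R} \<xi> * (1 / (2 * pi))))"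
        by (intro AE_I2) (auto simp: split_beta)
      show "(\<lambda>(s, \<xi>). H s \<xi>) \<in> borel_measurable (lborel \<Otimes>\<^sub>M lborel)" unfolding H_def by measurable
    qed
    have "(LINT s|lborel. ?g R s) = (LINT s|lborel. LINT \<xi>|lborel. H s \<xi>)"
    proof (rule integral_discrete_difference[of "{0}"])
      fix s :: real assume "s \<notin> {0}"
      have "(LINT \<xi>|lborel. H s \<xi>) = m s * odd_partial k x s R"
        unfolding H_def odd_partial_def set_lebesgue_integral_def by simp
      then show "?g R s = (LINT \<xi>|lborel. H s \<xi>)" using \<open>s \<notin> {0}\<close> by (auto simp: m_def indicator_def)
    qed (auto intro: countable_finite)
    also have "\<dots> = (LINT \<xi>|lborel. LINT s|lborel. H s \<xi>)"
      by (rule lborel_pair.Fubini_integral[symmetric, OF Hi])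
    also have "\<dots> = (LINT \<xi>|lborel. indicator {-R..R} \<xi> *\<^sub>R Re (stable_transform \<alpha> \<kappa> T \<xi> / of_real (2 * pi) * (- \<i> * of_real \<xi>) ^ 0 * exp (- \<i> * of_real (x * \<xi>))))"
    proof (rule Bochner_Integration.integral_cong[OF refl])
      fix \<xi> :: real
      let ?z = "\<i> * of_real (\<xi> ^ (2 * k + 1))"
      have l: "(LINT s|lborel. of_real (m s) * exp (- (?z * of_real s))) = stable_transform \<alpha> \<kappa> T \<xi>"
        using stable_subordinator_laplace(3)[OF \<beta>(1) h T, of ?z]
        unfolding m_def stable_transform_def stable_exponent_odd_power[OF \<beta>] \<alpha>_def \<kappa>_def by simp
      have i: "integrable lborel (\<lambda>s. of_real (m s) * exp (- (?z * of_real s)))"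
        by (rule Bochner_Integration.integrable_bound[OF L(1)]) (auto simp: norm_mult norm_exp_eq_Re)
      have "m s * cos (\<xi> * x + s * \<xi> ^ (2 * k + 1)) = Re (exp (- \<i> * of_real (x * \<xi>)) * (of_real (m s) * exp (- (?z * of_real s))))" for s
      proof -
        have e: "exp (- \<i> * of_real (x * \<xi>)) * exp (- (?z * of_real s)) = cis (- (\<xi> * x + s * \<xi> ^ (2 * k + 1)))"
          unfolding cis_conv_exp exp_add[symmetric] by (rule arg_cong[where f=exp]) (simp add: algebra_simps)
        have "exp (- \<i> * of_real (x * \<xi>)) * (of_real (m s) * exp (- (?z * of_real s))) = of_real (m s) * (exp (- \<i> * of_real (x * \<xi>)) * exp (- (?z * of_real s)))"
          by (simp only: mult_ac)
        then show ?thesis unfolding e by (simp only: Re_complex_of_real Im_complex_of_real times_complex.sel cis.sel cos_minus)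
      qed
      then have "(LINT s|lborel. m s * cos (\<xi> * x + s * \<xi> ^ (2 * k + 1))) = Re (LINT s|lborel. exp (- \<i> * of_real (x * \<xi>)) * (of_real (m s) * exp (- (?z * of_real s))))"
        using integral_Re[OF integrable_mult_right[OF i, of "exp (- \<i> * of_real (x * \<xi>))"]] by (simp only:)
      also have "\<dots> = Re (exp (- \<i> * of_real (x * \<xi>)) * stable_transform \<alpha> \<kappa> T \<xi>)"
        by (simp only: integral_mult_right_zero l)
      finally have r: "(LINT s|lborel. m s * cos (\<xi> * x + s * \<xi> ^ (2 * k + 1))) = Re (exp (- \<i> * of_real (x * \<xi>)) * stable_transform \<alpha> \<kappa> T \<xi>)" .
      have "H s \<xi> = (indicator {-R..R} \<xi> / (2 * pi)) * (m s * cos (\<xi> * x + s * \<xi> ^ (2 * k + 1)))" for s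
        unfolding H_def by simp
      then have "(LINT s|lborel. H s \<xi>) = (indicator {-R..R} \<xi> / (2 * pi)) * Re (exp (- \<i> * of_real (x * \<xi>)) * stable_transform \<alpha> \<kappa> T \<xi>)"
        by (simp only: integral_mult_right_zero r)
      then show "(LINT s|lborel. H s \<xi>) = indicator {-R..R} \<xi> *\<^sub>R Re (stable_transform \<alpha> \<kappa> T \<xi> / of_real (2 * pi) * (- \<i> * of_real \<xi>) ^ 0 * exp (- \<i> * of_real (x * \<xi>)))"
        unfolding exp_minus_ii by (simp add: field_simps)
    qed
    finally show ?thesis .
  qed
  let ?S = "\<lambda>\<xi>. Re (stable_transform \<alpha> \<kappa> T \<xi> / of_real (2 * pi) * (- \<i> * of_real \<xi>) ^ 0 * exp (- \<i> * of_real (x * \<xi>)))"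
  have Si: "integrable lborel ?S"
    using integrable_norm[OF integrable_stable_transform[OF st]] by (intro integrable_re_transform) (simp_all add: norm_divide)
  have l2: "(\<lambda>n. LINT \<xi>|lborel. indicator {-real n..real n} \<xi> *\<^sub>R ?S \<xi>) \<longlonglongrightarrow> (LINT \<xi>|lborel. ?S \<xi>)"
  proof (rule integral_dominated_convergence[OF _ _ integrable_norm[OF Si]])
    show "AE \<xi> in lborel. (\<lambda>n. indicator {-real n..real n} \<xi> *\<^sub>R ?S \<xi>) \<longlonglongrightarrow> ?S \<xi>"
    proof (rule AE_I2, rule tendsto_eventually)
      fix \<xi> :: real
      have "\<forall>\<^sub>F n in sequentially. \<bar>\<xi>\<bar> \<le> real n" using filterlim_real_sequentially by (auto simp: filterlim_at_top)
      then show "\<forall>\<^sub>F n in sequentially. indicator {-real n..real n} \<xi> *\<^sub>R ?S \<xi> = ?S \<xi>"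
        by eventually_elim (auto simp: indicator_def)
    qed
    show "AE \<xi> in lborel. norm (indicator {-real n..real n} \<xi> *\<^sub>R ?S \<xi>) \<le> norm (?S \<xi>)" for n
      by (intro AE_I2) (simp add: indicator_def)
  qed (use Si in auto)
  have "subordinated_law k h x T = (LINT \<xi>|lborel. ?S \<xi>)"
    using LIMSEQ_unique[OF l1 l2[folded P]] .
  then show ?thesis unfolding stable_kernel_def re_transform_def \<alpha>_def \<kappa>_def .
qed

lemma sin_pi_mult_pos:
  assumes "0 < \<beta>" "\<beta> < 1"
  shows "0 < sin (pi * \<beta>)"
proof (rule sin_gt_zero)
  have "pi * \<beta> < pi * 1" using assms by (intro mult_strict_left_mono) auto
  then show "pi * \<beta> < pi" by simp
qed (use assms in simp)

lemma time_scale_pos: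
  assumes "0 < \<beta>" "\<beta> < 1" "- \<beta> < \<theta>" "\<theta> < \<beta>"
  shows "0 < time_scale \<beta> \<theta>"
proof -
  have "0 < sin (pi / 2 * (\<beta> + \<theta>))"
  proof (rule sin_gt_zero)
    have "pi / 2 * (\<beta> + \<theta>) < pi / 2 * 2" using assms by (intro mult_strict_left_mono) auto
    then show "pi / 2 * (\<beta> + \<theta>) < pi" by simp
  qed (use assms in simp)
  moreover have "0 < sin (pi * \<beta>)" by (rule sin_pi_mult_pos) (use assms in auto)
  ultimately show ?thesis by (simp add: time_scale_def)
qed

text \<open>The scale has period 4 in \<eta>, so the conclusion depends on a bound for \<eta>. With
  |\<eta>| \<le> 2, an \<eta> \<ge> \<beta> puts \<pi>/2 (\<eta> - \<beta>) into [0, \<pi>], where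
  the sine is nonnegative and the scale therefore not positive.\<close>

lemma time_scale_pos_imp:
  assumes \<beta>: "0 < \<beta>" "\<beta> < 1" and \<eta>: "\<bar>\<eta>\<bar> \<le> 2" "0 < time_scale \<beta> (- \<eta>)"
  shows "\<eta> < \<beta>"
proof (rule ccontr)
  assume "\<not> \<eta> < \<beta>"
  then have "0 \<le> \<eta> - \<beta>" "\<eta> - \<beta> \<le> 2" using \<eta>(1) \<beta> by auto
  then have "0 \<le> pi / 2 * (\<eta> - \<beta>)" "pi / 2 * (\<eta> - \<beta>) \<le> pi / 2 * 2" by (auto intro: mult_left_mono)
  then have "0 \<le> sin (pi / 2 * (\<eta> - \<beta>))" by (intro sin_ge_zero) auto
  moreover have "pi / 2 * (\<beta> + - \<eta>) = - (pi / 2 * (\<eta> - \<beta>))" by (simp add: right_diff_distrib)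
  ultimately have "sin (pi / 2 * (\<beta> + - \<eta>)) \<le> 0" by (simp only: sin_minus)
  moreover have "0 < sin (pi * \<beta>)" by (rule sin_pi_mult_pos) (use \<beta> in auto)
  ultimately have "time_scale \<beta> (- \<eta>) \<le> 0" unfolding time_scale_def by (intro divide_nonpos_pos) auto
  with \<eta>(2) show False by simp
qed

text \<open>The same addition identity as for the Feller symbol, now with a = \<pi>\<beta>/2. The
  angle b = \<pi>\<theta>/2 comes out unchanged although the order of the symbol is \<beta>
  (2k+1).\<close>

lemma stable_transform_time_scale:
  assumes "sin (pi * \<beta>) \<noteq> 0"
  shows "stable_transform \<alpha> (pi * \<beta> / 2) (time_scale \<beta> \<theta> * t) \<xi> * stable_transform \<alpha> (- (pi * \<beta> / 2)) (time_scale \<beta> (- \<theta>) * t) \<xi>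
     = stable_transform \<alpha> (pi * \<theta> / 2) t \<xi>"
proof -
  define a b where "a = pi * \<beta> / 2" and "b = pi * \<theta> / 2"
  have ab: "pi / 2 * (\<beta> + \<theta>) = a + b" "pi / 2 * (\<beta> + - \<theta>) = a - b" "pi * \<beta> = 2 * a"
    by (simp_all add: a_def b_def field_simps)
  have 1: "of_real (sin (a + b) / sin (2 * a)) * cis (a * s) + of_real (sin (a - b) / sin (2 * a)) * cis (- a * s) = cis (b * s)"
    if "s = 1 \<or> s = -1" for s
  proof -
    have "of_real (sin (a + b)) * cis (a * s) + of_real (sin (a - b)) * cis (- a * s) = of_real (sin (2 * a)) * cis (b * s)"
      using that unfolding sin_double by (auto simp: complex_eq_iff sin_add sin_diff algebra_simps)
    then have "(of_real (sin (a + b)) * cis (a * s) + of_real (sin (a - b)) * cis (- a * s)) / of_real (sin (2 * a)) = cis (b * s)"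
      using assms ab by simp
    then show ?thesis by (simp add: add_divide_distrib)
  qed
  have "of_real (time_scale \<beta> \<theta>) * stable_exponent \<alpha> a \<xi> + of_real (time_scale \<beta> (- \<theta>)) * stable_exponent \<alpha> (- a) \<xi> = stable_exponent \<alpha> b \<xi>"
  proof (cases "\<xi> = 0")
    case False
    then have "sgn \<xi> = 1 \<or> sgn \<xi> = -1" by (auto simp: sgn_real_def)
    from arg_cong[OF 1[OF this], of "(*) (of_real (\<bar>\<xi>\<bar> powr \<alpha>))"] show ?thesis
      unfolding time_scale_def stable_exponent_def ab by (simp only: ring_distribs mult_ac)
  qed (simp add: stable_exponent_def)
  then have "of_real t * (of_real (time_scale \<beta> \<theta>) * stable_exponent \<alpha> a \<xi> + of_real (time_scale \<beta> (- \<theta>)) * stable_exponent \<alpha> (- a) \<xi>) = of_real t * stable_exponent \<alpha> b \<xi>"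
    by simp
  then show ?thesis
    unfolding stable_transform_def a_def[symmetric] b_def[symmetric] exp_add[symmetric]
    by (intro arg_cong[where f=exp]) (simp add: algebra_simps)
qed

text \<open>Only the first kernel is replaced by its inversion integral; the second is integrable,
  so Fubini applies and the inner integral is its transform at -\<xi>, which carries the angle
  -\<kappa>. The time-scale identity merges the two factors.\<close>

lemma composition_law_eq:
  assumes \<beta>: "0 < \<beta>" "\<beta> < 1" and \<theta>: "- \<beta> < \<theta>" "\<theta> < \<beta>" and k: "1 \<le> k" and h: "stable_subordinator_density \<beta> h" and t: "0 < t"
  shows "composition_law k \<beta> \<theta> h x t = stable_kernel (\<beta> * real (2 * k + 1)) (pi * \<theta> / 2) t x"
proof -
  define \<alpha> where "\<alpha> = \<beta> * real (2 * k + 1)"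
  define \<kappa> where "\<kappa> = pi * \<beta> / 2"
  have st: "0 < \<alpha>" "\<bar>\<kappa>\<bar> < pi / 2" using \<beta> by (auto simp: \<alpha>_def \<kappa>_def abs_mult)
  define S T where "S = time_scale \<beta> \<theta> * t" and "T = time_scale \<beta> (- \<theta>) * t"
  have ST: "0 < S" "0 < T" using time_scale_pos[OF \<beta>, of \<theta>] time_scale_pos[OF \<beta>, of "- \<theta>"] \<theta> t by (auto simp: S_def T_def)
  have "0 < sin (pi * \<beta>)" by (rule sin_pi_mult_pos) (use \<beta> in auto)
  then have s: "sin (pi * \<beta>) \<noteq> 0" by simp
  let ?q = "stable_kernel \<alpha> \<kappa> T"
  define A where "A = (\<lambda>\<xi>. stable_transform \<alpha> \<kappa> S \<xi> / of_real (2 * pi))"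
  have [measurable]: "A \<in> borel_measurable borel" unfolding A_def by measurable
  have Ai: "integrable lborel A" unfolding A_def using integrable_stable_transform[OF st ST(1)] by simp
  have qi: "integrable lborel ?q" by (rule integrable_stable_kernel[OF st ST(2)])
  define H where "H = (\<lambda>y \<xi>. ?q y * Re (A \<xi> * exp (- \<i> * of_real ((x + y) * \<xi>))))"
  have Hi: "integrable (lborel \<Otimes>\<^sub>M lborel) (\<lambda>(y, \<xi>). H y \<xi>)"
  proof (rule Bochner_Integration.integrable_bound[OF integrable_lborel_product[OF qi integrable_norm[OF Ai]]])
    have "\<bar>H y \<xi>\<bar> \<le> \<bar>?q y * norm (A \<xi>)\<bar>" for y \<xi>
    proof -
      have "\<bar>Re (A \<xi> * exp (- \<i> * of_real ((x + y) * \<xi>)))\<bar> \<le> norm (A \<xi> * exp (- \<i> * of_real ((x + y) * \<xi>)))"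
        by (rule abs_Re_le_cmod)
      also have "\<dots> = norm (A \<xi>)" unfolding exp_minus_ii by (simp add: norm_mult)
      finally show ?thesis unfolding H_def abs_mult by (simp add: mult_left_mono)
    qed
    then show "AE z in lborel \<Otimes>\<^sub>M lborel. norm (case z of (y, \<xi>) \<Rightarrow> H y \<xi>) \<le> norm (case z of (y, \<xi>) \<Rightarrow> ?q y * norm (A \<xi>))"
      by (intro AE_I2) (auto simp: split_beta)
    show "(\<lambda>(y, \<xi>). H y \<xi>) \<in> borel_measurable (lborel \<Otimes>\<^sub>M lborel)" unfolding H_def by measurable
  qed
  have "composition_law k \<beta> \<theta> h x t = (LINT y|lborel. stable_kernel \<alpha> \<kappa> S (x + y) * ?q y)"
    unfolding composition_law_def difference_law_def S_def[symmetric] T_def[symmetric]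
      subordinated_law_eq[OF \<beta> k h ST(1)] subordinated_law_eq[OF \<beta> k h ST(2)] \<alpha>_def \<kappa>_def ..
  also have "\<dots> = (LINT y|lborel. LINT \<xi>|lborel. H y \<xi>)"
    unfolding H_def stable_kernel_def[of \<alpha> \<kappa> S] re_transform_def A_def by (simp add: mult.commute)
  also have "\<dots> = (LINT \<xi>|lborel. LINT y|lborel. H y \<xi>)"
    by (rule lborel_pair.Fubini_integral[symmetric, OF Hi])
  also have "\<dots> = (LINT \<xi>|lborel. Re (stable_transform \<alpha> (pi * \<theta> / 2) t \<xi> / of_real (2 * pi) * (- \<i> * of_real \<xi>) ^ 0 * exp (- \<i> * of_real (x * \<xi>))))"
  proof (rule Bochner_Integration.integral_cong[OF refl])
    fix \<xi> :: real
    have f: "(LINT y|lborel. cis ((- \<xi>) * y) * of_real (?q y)) = stable_transform \<alpha> (- \<kappa>) T \<xi>"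
      using fourier_stable_kernel[OF st ST(2), of "- \<xi>"] unfolding fourier_def by (simp only: stable_transform_reflect)
    have i: "integrable lborel (\<lambda>y. cis ((- \<xi>) * y) * of_real (?q y))"
      by (rule Bochner_Integration.integrable_bound[OF qi]) (auto simp: norm_mult)
    have "H y \<xi> = Re (A \<xi> * exp (- \<i> * of_real (x * \<xi>)) * (cis ((- \<xi>) * y) * of_real (?q y)))" for y
    proof -
      have e: "exp (- \<i> * of_real (x * \<xi>)) * cis ((- \<xi>) * y) = exp (- \<i> * of_real ((x + y) * \<xi>))"
        unfolding exp_minus_ii cis_mult by (rule arg_cong[where f=cis]) (simp add: algebra_simps)
      have "A \<xi> * exp (- \<i> * of_real (x * \<xi>)) * (cis ((- \<xi>) * y) * of_real (?q y)) = of_real (?q y) * (A \<xi> * (exp (- \<i> * of_real (x * \<xi>)) * cis ((- \<xi>) * y)))"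
        by (simp only: mult_ac)
      then show ?thesis unfolding e H_def by (simp only:) simp
    qed
    then have "(LINT y|lborel. H y \<xi>) = Re (LINT y|lborel. A \<xi> * exp (- \<i> * of_real (x * \<xi>)) * (cis ((- \<xi>) * y) * of_real (?q y)))"
      using integral_Re[OF integrable_mult_right[OF i, of "A \<xi> * exp (- \<i> * of_real (x * \<xi>))"]] by (simp only:)
    also have "\<dots> = Re (A \<xi> * exp (- \<i> * of_real (x * \<xi>)) * stable_transform \<alpha> (- \<kappa>) T \<xi>)"
      by (simp only: integral_mult_right_zero f)
    also have "A \<xi> * exp (- \<i> * of_real (x * \<xi>)) * stable_transform \<alpha> (- \<kappa>) T \<xi> = stable_transform \<alpha> (pi * \<theta> / 2) t \<xi> / of_real (2 * pi) * (- \<i> * of_real \<xi>) ^ 0 * exp (- \<i> * of_real (x * \<xi>))"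
      unfolding A_def stable_transform_time_scale[OF s, of \<alpha> \<theta> t \<xi>, symmetric] \<kappa>_def[symmetric] S_def[symmetric] T_def[symmetric] by simp
    finally show "(LINT y|lborel. H y \<xi>) = Re (stable_transform \<alpha> (pi * \<theta> / 2) t \<xi> / of_real (2 * pi) * (- \<i> * of_real \<xi>) ^ 0 * exp (- \<i> * of_real (x * \<xi>)))" .
  qed
  finally show ?thesis unfolding stable_kernel_def re_transform_def \<alpha>_def .
qed

section \<open>Pseudo random walks\<close>

text \<open>The Levy density of the stable subordinator without the factor 1 / Gamma (1 - \<beta>),
  which enters as the Poisson rate.\<close>

definition levy_density :: "real \<Rightarrow> real \<Rightarrow> real" where
  "levy_density \<beta> v = indicator {0<..} v * (\<beta> * v powr (- \<beta> - 1))"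

lemma levy_density_measurable [measurable]: "levy_density \<beta> \<in> borel_measurable borel"
  unfolding levy_density_def[abs_def] by measurable

text \<open>1 - exp (-z v) is at most |z| v near 0 and at most 2 beyond 1; the first bound uses
  \<beta> < 1, the second \<beta> > 0. Uniformity for |z| \<le> R serves the passage to the
  boundary.\<close>

lemma levy_integral_dominated:
  assumes \<beta>: "0 < \<beta>" "\<beta> < 1"
  shows "\<exists>g. integrable lborel g \<and> (\<forall>z v. 0 \<le> Re z \<longrightarrow> norm z \<le> R \<longrightarrow> norm (of_real (levy_density \<beta> v) * (1 - exp (- (z * of_real v)))) \<le> g v)"
proof -
  define g where "g = (\<lambda>v::real. \<bar>R\<bar> * \<beta> * (indicator {0..1} v *\<^sub>R v powr (- \<beta>)) + 2 * \<beta> * (indicator {1..} v *\<^sub>R v powr (- \<beta> - 1)))"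
  have "set_integrable lborel {0..1} (\<lambda>v::real. v powr (- \<beta>))"
    by (rule set_integrable_lborel_nonneg[OF has_integral_powr_from_0]) (use \<beta> in \<open>auto simp: set_borel_measurable_def\<close>)
  moreover have "set_integrable lborel {1..} (\<lambda>v::real. v powr (- \<beta> - 1))"
    by (rule set_integrable_lborel_nonneg[OF has_integral_powr_to_inf]) (use \<beta> in \<open>auto simp: set_borel_measurable_def\<close>)
  ultimately have "integrable lborel g"
    unfolding g_def set_integrable_def by (intro Bochner_Integration.integrable_add integrable_mult_right)
  moreover have "norm (of_real (levy_density \<beta> v) * (1 - exp (- (z * of_real v)))) \<le> g v"
    if z: "0 \<le> Re z" "norm z \<le> R" for z v
  proof (cases "0 < v")
    case False
    then have "levy_density \<beta> v = 0" by (simp add: levy_density_def)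
    moreover have "0 \<le> g v" using \<beta> by (simp add: g_def)
    ultimately show ?thesis by simp
  next
    case True
    have ld: "levy_density \<beta> v = \<beta> * v powr (- \<beta> - 1)" using True by (simp add: levy_density_def)
    have Re: "0 \<le> Re z * v" using z True by simp
    show ?thesis
    proof (cases "v \<le> 1")
      case le: True
      have "norm (exp (- (z * of_real v)) - exp 0) \<le> 1 * norm (- (z * of_real v) - 0)"
        by (rule field_differentiable_bound[of "{z. Re z \<le> 0}" exp exp])
           (use Re in \<open>auto simp: convex_halfspace_Re_le norm_exp_eq_Re intro: DERIV_exp has_field_derivative_at_within\<close>)
      then have "norm (1 - exp (- (z * of_real v))) \<le> norm z * v" using True by (simp add: norm_minus_commute norm_mult)
      also have "\<dots> \<le> \<bar>R\<bar> * v" using z True by (intro mult_right_mono) auto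
      finally have "norm (of_real (levy_density \<beta> v) * (1 - exp (- (z * of_real v)))) \<le> \<beta> * v powr (- \<beta> - 1) * (\<bar>R\<bar> * v)"
        unfolding norm_mult norm_of_real ld using \<beta> by (simp add: abs_mult mult_left_mono)
      also have "\<dots> = \<bar>R\<bar> * \<beta> * v powr (- \<beta>)"
        using True by (simp add: powr_diff)
      also have "\<dots> \<le> g v" using True le \<beta> by (simp add: g_def)
      finally show ?thesis .
    next
      case False
      have "norm (1 - exp (- (z * of_real v))) \<le> norm (1::complex) + norm (exp (- (z * of_real v)))" by (rule norm_triangle_ineq4)
      also have "\<dots> \<le> 2" using Re by (simp add: norm_exp_eq_Re)
      finally have "norm (of_real (levy_density \<beta> v) * (1 - exp (- (z * of_real v)))) \<le> \<beta> * v powr (- \<beta> - 1) * 2"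
        unfolding norm_mult norm_of_real ld using \<beta> by (simp add: abs_mult mult_left_mono)
      also have "\<dots> \<le> g v" using False \<beta> by (simp add: g_def)
      finally show ?thesis .
    qed
  qed
  ultimately show ?thesis by blast
qed

lemma levy_integrable:
  assumes "0 < \<beta>" "\<beta> < 1" "0 \<le> Re z"
  shows "integrable lborel (\<lambda>v. of_real (levy_density \<beta> v) * (1 - exp (- (z * of_real v))))"
proof -
  obtain g where g: "integrable lborel g" "\<And>v. norm (of_real (levy_density \<beta> v) * (1 - exp (- (z * of_real v)))) \<le> g v"
    using levy_integral_dominated[OF assms(1,2), of "norm z"] assms(3) by blast
  show ?thesis
    by (rule Bochner_Integration.integrable_bound[OF g(1)]) (use g(2) in \<open>auto intro!: AE_I2 order_trans[OF _ abs_ge_self]\<close>)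
qed

lemma levy_integral_tendsto:
  assumes \<beta>: "0 < \<beta>" "\<beta> < 1" and Z: "Z \<longlonglongrightarrow> z" "\<And>n. 0 \<le> Re (Z n)" "\<And>n. norm (Z n) \<le> R"
  shows "(\<lambda>n. LINT v|lborel. of_real (levy_density \<beta> v) * (1 - exp (- (Z n * of_real v)))) \<longlonglongrightarrow> (LINT v|lborel. of_real (levy_density \<beta> v) * (1 - exp (- (z * of_real v))))"
proof -
  obtain g where g: "integrable lborel g" "\<And>z v. 0 \<le> Re z \<Longrightarrow> norm z \<le> R \<Longrightarrow> norm (of_real (levy_density \<beta> v) * (1 - exp (- (z * of_real v)))) \<le> g v"
    using levy_integral_dominated[OF \<beta>, of R] by blast
  show ?thesis
  proof (rule integral_dominated_convergence[OF _ _ g(1)])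
    show "AE v in lborel. (\<lambda>n. of_real (levy_density \<beta> v) * (1 - exp (- (Z n * of_real v)))) \<longlonglongrightarrow> of_real (levy_density \<beta> v) * (1 - exp (- (z * of_real v)))"
      by (intro AE_I2 tendsto_intros Z(1))
    show "AE v in lborel. norm (of_real (levy_density \<beta> v) * (1 - exp (- (Z n * of_real v)))) \<le> g v" for n
      using g(2) Z(2,3) by (intro AE_I2) auto
  qed auto
qed

text \<open>Differentiation in z removes the singularity at 0 and leaves a Gamma integral, so both
  sides have equal derivatives on the open half plane. Their constant difference is evaluated at the
  boundary point 0, where both vanish.\<close>

lemma levy_integral:
  assumes \<beta>: "0 < \<beta>" "\<beta> < 1" and z: "0 \<le> Re z"
  shows "(LINT v|lborel. of_real (levy_density \<beta> v) * (1 - exp (- (z * of_real v)))) = of_real (Gamma (1 - \<beta>)) * z powr of_real \<beta>"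
proof -
  define \<Phi> where "\<Phi> = (\<lambda>z::complex. LINT v|lborel. of_real (levy_density \<beta> v) * (1 - exp (- (z * of_real v))))"
  have e: "levy_density \<beta> v * v = \<beta> * (indicator {0<..} v * v powr ((1 - \<beta>) - 1))" for v
    by (simp add: levy_density_def powr_diff indicator_def)
  have D\<Phi>: "(\<Phi> has_field_derivative of_real (\<beta> * Gamma (1 - \<beta>)) * z powr (of_real \<beta> - 1)) (at z)" if z: "0 < Re z" for z
  proof -
    have "(\<Phi> has_field_derivative (LINT v|lborel. of_real (levy_density \<beta> v * v) * exp (- (z * of_real v)))) (at z)"
      unfolding \<Phi>_def
    proof (rule laplace_has_field_derivative[OF _ levy_integrable[OF \<beta>] _ z])
      fix a :: real assume a: "0 < a"
      have "integrable lborel (\<lambda>v. of_real (indicator {0<..} v * v powr ((1 - \<beta>) - 1)) * exp (- (complex_of_real a * of_real v)))"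
        by (rule gamma_laplace) (use \<beta> a in auto)
      from integrable_mult_right[OF integrable_norm[OF this], of \<beta>]
      show "integrable lborel (\<lambda>v. levy_density \<beta> v * v * exp (- (a * v)))"
        unfolding e by (simp add: norm_mult norm_exp_eq_Re mult_ac)
    qed (auto simp: levy_density_def)
    also have "(LINT v|lborel. of_real (levy_density \<beta> v * v) * exp (- (z * of_real v)))
       = of_real \<beta> * (LINT v|lborel. of_real (indicator {0<..} v * v powr ((1 - \<beta>) - 1)) * exp (- (z * of_real v)))"
      unfolding e by (simp only: of_real_mult[of \<beta>] mult.assoc integral_mult_right_zero)
    also have "\<dots> = of_real (\<beta> * Gamma (1 - \<beta>)) * z powr (of_real \<beta> - 1)"
    proof -
      have "(LINT v|lborel. of_real (indicator {0<..} v * v powr ((1 - \<beta>) - 1)) * exp (- (z * of_real v))) = of_real (Gamma (1 - \<beta>)) * z powr (- of_real (1 - \<beta>))"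
        by (rule gamma_laplace(2)) (use \<beta> z in auto)
      moreover have "- of_real (1 - \<beta>) = (of_real \<beta> - 1 :: complex)" by simp
      ultimately show ?thesis by (simp only: of_real_mult mult.assoc)
    qed
    finally show ?thesis .
  qed
  define D where "D = (\<lambda>z. \<Phi> z - of_real (Gamma (1 - \<beta>)) * z powr of_real \<beta>)"
  have "\<exists>c. \<forall>z\<in>{z. 0 < Re z}. D z = c"
  proof (rule has_field_derivative_zero_constant)
    show "convex {z. 0 < Re z}" by (rule convex_halfspace_Re_gt)
    fix z :: complex assume "z \<in> {z. 0 < Re z}"
    then have z: "0 < Re z" by simp
    then have "z \<notin> \<real>\<^sub>\<le>\<^sub>0" by (auto simp: complex_nonpos_Reals_iff)
    note d = DERIV_diff[OF D\<Phi>[OF z] DERIV_cmult[OF has_field_derivative_powr[OF this, of "of_real \<beta>"], of "of_real (Gamma (1 - \<beta>))"]]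
    have eq: "of_real (\<beta> * Gamma (1 - \<beta>)) * z powr (of_real \<beta> - 1) - of_real (Gamma (1 - \<beta>)) * (of_real \<beta> * z powr (of_real \<beta> - 1)) = 0"
      by (simp only: of_real_mult mult_ac diff_self)
    show "(D has_field_derivative 0) (at z within {z. 0 < Re z})"
      unfolding D_def by (rule has_field_derivative_at_within[OF d[unfolded eq]])
  qed
  then obtain c where c: "\<And>z. 0 < Re z \<Longrightarrow> D z = c" by auto
  have lim: "D z = c" if z: "0 \<le> Re z" for z
  proof -
    define Z where "Z = (\<lambda>n. z + of_real (1 / (real n + 1)))"
    have "(\<lambda>n. 1 / (real n + 1)) \<longlonglongrightarrow> 0" by real_asymp
    then have "Z \<longlonglongrightarrow> z + of_real 0" unfolding Z_def by (intro tendsto_intros)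
    then have Z: "Z \<longlonglongrightarrow> z" by simp
    have pos: "0 < Re (Z n)" for n using z by (simp add: Z_def add_nonneg_pos)
    have nb: "norm (Z n) \<le> norm z + 1" for n
    proof -
      have "norm (Z n) \<le> norm z + norm (complex_of_real (1 / (real n + 1)))" unfolding Z_def by (rule norm_triangle_ineq)
      also have "norm (complex_of_real (1 / (real n + 1))) = 1 / (real n + 1)" unfolding norm_of_real by simp
      also have "\<dots> \<le> 1" by simp
      finally show ?thesis by simp
    qed
    have "(\<lambda>n. \<Phi> (Z n)) \<longlonglongrightarrow> \<Phi> z"
      unfolding \<Phi>_def by (rule levy_integral_tendsto[OF \<beta> Z less_imp_le[OF pos] nb])
    moreover have "(\<lambda>n. Z n powr of_real \<beta>) \<longlonglongrightarrow> z powr of_real \<beta>"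
      by (rule continuous_on_tendsto_compose[OF continuous_on_powr_half_plane[OF \<beta>(1)] Z])
         (use z pos in \<open>auto intro!: always_eventually less_imp_le\<close>)
    ultimately have "(\<lambda>n. D (Z n)) \<longlonglongrightarrow> D z" unfolding D_def by (intro tendsto_diff tendsto_mult_left)
    then show ?thesis using c[OF pos] by (simp add: LIMSEQ_const_iff)
  qed
  have "c = 0" using lim[of 0] by (simp add: D_def \<Phi>_def)
  then show ?thesis using lim[OF z] by (simp add: D_def \<Phi>_def)
qed

section \<open>Pareto jumps\<close>

text \<open>The Pareto law with tail (\<delta>/w)^\<beta>, written as the Levy density cut off at
  \<delta> and rescaled, so that letting \<delta> tend to 0 restores the full Levy density.\<close>

definition pareto_density :: "real \<Rightarrow> real \<Rightarrow> real \<Rightarrow> real" where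
  "pareto_density \<beta> \<delta> v = \<delta> powr \<beta> * (indicator {\<delta><..} v * levy_density \<beta> v)"

lemma pareto_density_measurable [measurable]: "pareto_density \<beta> \<delta> \<in> borel_measurable borel"
  unfolding pareto_density_def[abs_def] by measurable

lemma pareto_density_nonneg: "0 < \<beta> \<Longrightarrow> 0 \<le> pareto_density \<beta> \<delta> v"
  by (simp add: pareto_density_def levy_density_def)

lemma pareto_tail:
  assumes \<beta>: "0 < \<beta>" and \<delta>: "0 < \<delta>" "\<delta> \<le> w"
  shows "integrable lborel (\<lambda>v. indicator {w<..} v * pareto_density \<beta> \<delta> v)"
    and "(LINT v|lborel. indicator {w<..} v * pareto_density \<beta> \<delta> v) = (\<delta> / w) powr \<beta>"
proof -
  have "((\<lambda>v. v powr (- \<beta> - 1)) has_integral - (w powr (- \<beta> - 1 + 1)) / (- \<beta> - 1 + 1)) {w..}"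
    by (rule has_integral_powr_to_inf) (use \<beta> \<delta> in auto)
  from has_integral_mult_right[OF this, of "\<delta> powr \<beta> * \<beta>"]
  have "((\<lambda>v. \<delta> powr \<beta> * \<beta> * v powr (- \<beta> - 1)) has_integral (\<delta> / w) powr \<beta>) {w..}"
    using \<beta> \<delta> by (simp add: powr_divide powr_minus_divide)
  note * = set_integrable_lborel_nonneg[OF this]
  have i: "set_integrable lborel {w..} (\<lambda>v. \<delta> powr \<beta> * \<beta> * v powr (- \<beta> - 1))"
    "(LINT v:{w..}|lborel. \<delta> powr \<beta> * \<beta> * v powr (- \<beta> - 1)) = (\<delta> / w) powr \<beta>"
    by (rule *; use \<beta> \<delta> in \<open>auto simp: set_borel_measurable_def\<close>)+
  have eq: "v \<notin> {w} \<Longrightarrow> indicator {w<..} v * pareto_density \<beta> \<delta> v = indicator {w..} v *\<^sub>R (\<delta> powr \<beta> * \<beta> * v powr (- \<beta> - 1))" for v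
    using \<delta> by (auto simp: pareto_density_def levy_density_def indicator_def)
  show "integrable lborel (\<lambda>v. indicator {w<..} v * pareto_density \<beta> \<delta> v)"
    using i(1) unfolding set_integrable_def
    by (subst integrable_discrete_difference[where X="{w}"]) (auto simp: eq)
  show "(LINT v|lborel. indicator {w<..} v * pareto_density \<beta> \<delta> v) = (\<delta> / w) powr \<beta>"
    unfolding i(2)[symmetric] set_lebesgue_integral_def
    by (rule integral_discrete_difference[where X="{w}"]) (auto simp: eq)
qed

lemma pareto_integral:
  assumes \<beta>: "0 < \<beta>" and \<delta>: "0 < \<delta>"
  shows "integrable lborel (pareto_density \<beta> \<delta>)" "(LINT v|lborel. pareto_density \<beta> \<delta> v) = 1"
proof -
  have "(\<lambda>v. indicator {\<delta><..} v * pareto_density \<beta> \<delta> v) = pareto_density \<beta> \<delta>"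
    by (auto simp: fun_eq_iff pareto_density_def indicator_def)
  with pareto_tail[OF \<beta> \<delta>, of \<delta>] \<delta> show "integrable lborel (pareto_density \<beta> \<delta>)" "(LINT v|lborel. pareto_density \<beta> \<delta> v) = 1"
    by auto
qed

lemma distr_power_tail:
  assumes M: "prob_space M" and \<beta>: "0 < \<beta>" and \<delta>: "0 < \<delta>" and V: "has_power_tail M \<delta> \<beta> V"
  shows "distr M borel V = density lborel (\<lambda>v. ennreal (pareto_density \<beta> \<delta> v))"
proof -
  interpret prob_space M by fact
  let ?P = "density lborel (\<lambda>v. ennreal (pareto_density \<beta> \<delta> v))"
  have [measurable]: "V \<in> borel_measurable M" using V by (simp add: has_power_tail_def)
  have tail: "emeasure ?P {w<..} = ennreal ((\<delta> / w) powr \<beta>)" if "\<delta> \<le> w" for w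
  proof -
    have "emeasure ?P {w<..} = (\<integral>\<^sup>+v. ennreal (indicator {w<..} v * pareto_density \<beta> \<delta> v) \<partial>lborel)"
      by (subst emeasure_density) (auto intro!: nn_integral_cong simp: indicator_def)
    also have "\<dots> = ennreal ((\<delta> / w) powr \<beta>)"
      unfolding pareto_tail(2)[OF \<beta> \<delta> that, symmetric]
      by (rule nn_integral_eq_integral[OF pareto_tail(1)[OF \<beta> \<delta> that]]) (use pareto_density_nonneg[OF \<beta>] in auto)
    finally show ?thesis .
  qed
  have "emeasure ?P UNIV = (\<integral>\<^sup>+v. ennreal (pareto_density \<beta> \<delta> v) \<partial>lborel)"
    by (subst emeasure_density) auto
  also have "\<dots> = 1"
    using nn_integral_eq_integral[OF pareto_integral(1)[OF \<beta> \<delta>]] pareto_density_nonneg[OF \<beta>] pareto_integral(2)[OF \<beta> \<delta>] by simp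
  finally have P: "prob_space ?P" by (intro prob_spaceI) simp
  interpret P: prob_space ?P by fact
  have rd: "real_distribution ?P" using P by (simp add: real_distribution_def real_distribution_axioms_def)
  have rv: "real_distribution (distr M borel V)" by simp
  interpret RP: real_distribution ?P by fact
  interpret RV: real_distribution "distr M borel V" by fact
  have compl: "measure Q {..w} = 1 - measure Q {w<..}" if "real_distribution Q" for Q w
  proof -
    interpret Q: real_distribution Q by fact
    have "{w<..} = space Q - {..w}" by auto
    then show ?thesis using Q.prob_compl[of "{..w}"] by simp
  qed
  have gt: "measure (distr M borel V) {w<..} = (\<delta> / w) powr \<beta>" "measure ?P {w<..} = (\<delta> / w) powr \<beta>" if "\<delta> < w" for w
  proof -
    have "measure (distr M borel V) {w<..} = measure M {\<omega>\<in>space M. w < V \<omega>}"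
      by (subst measure_distr) (auto intro!: arg_cong[where f="measure M"])
    then show "measure (distr M borel V) {w<..} = (\<delta> / w) powr \<beta>" using V that by (simp add: has_power_tail_def)
    show "measure ?P {w<..} = (\<delta> / w) powr \<beta>" using tail[of w] that by (simp add: measure_def)
  qed
  have lt: "measure (distr M borel V) {w<..} = 1" "measure ?P {w<..} = 1" if "w < \<delta>" for w
  proof -
    have "measure (distr M borel V) {w<..} = measure M {\<omega>\<in>space M. w < V \<omega>}"
      by (subst measure_distr) (auto intro!: arg_cong[where f="measure M"])
    then show "measure (distr M borel V) {w<..} = 1" using V that by (simp add: has_power_tail_def)
    have "1 = measure ?P {\<delta><..}" using tail[of \<delta>] \<delta> by (simp add: measure_def)
    also have "\<dots> \<le> measure ?P {w<..}" using that by (intro P.finite_measure_mono) auto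
    finally show "measure ?P {w<..} = 1" using P.prob_le_1[of "{w<..}"] by linarith
  qed
  have ne: "cdf (distr M borel V) w = cdf ?P w" if "w \<noteq> \<delta>" for w
    unfolding cdf_def compl[OF rv] compl[OF rd] using gt[of w] lt[of w] that by (cases "w < \<delta>") auto
  \<comment> \<open>The tail condition says nothing at the threshold itself; right continuity
    supplies the value there.\<close>
  have "cdf (distr M borel V) \<delta> = cdf ?P \<delta>"
  proof (rule tendsto_unique)
    show "((\<lambda>w. cdf (distr M borel V) w) \<longlongrightarrow> cdf (distr M borel V) \<delta>) (at_right \<delta>)"
      using RV.cdf_is_right_cont[of \<delta>] by (simp add: continuous_within)
    have "((\<lambda>w. cdf ?P w) \<longlongrightarrow> cdf ?P \<delta>) (at_right \<delta>)"
      using RP.cdf_is_right_cont[of \<delta>] by (simp add: continuous_within)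
    then show "((\<lambda>w. cdf (distr M borel V) w) \<longlongrightarrow> cdf ?P \<delta>) (at_right \<delta>)"
      by (rule Lim_transform_eventually) (auto simp: eventually_at_filter ne)
  qed simp
  then have "cdf (distr M borel V) = cdf ?P" using ne by (intro ext) metis
  then show ?thesis by (intro cdf_unique rv rd)
qed

text \<open>An odd power is increasing on the whole line, so tail events translate through
  \<open>root n\<close> also for negative w. The index drops from n \<beta> to \<beta>, which lies
  in the range of the Levy integral.\<close>

lemma has_power_tail_odd_power:
  assumes n: "odd n" and X: "has_power_tail M \<gamma> (real n * \<beta>) X" and \<gamma>: "0 < \<gamma>"
  shows "has_power_tail M (\<gamma> ^ n) \<beta> (\<lambda>\<omega>. X \<omega> ^ n)"
proof -
  have root: "w < x ^ n \<longleftrightarrow> root n w < x" for w x :: real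
  proof -
    have "root n w < x \<longleftrightarrow> root n w < root n (x ^ n)" using n by (simp add: odd_real_root_power_cancel)
    also have "\<dots> \<longleftrightarrow> w < x ^ n" using n by (intro real_root_less_iff) (auto elim: oddE)
    finally show ?thesis by simp
  qed
  have n0: "0 < n" using n by (auto elim: oddE)
  have [measurable]: "X \<in> borel_measurable M" using X by (simp add: has_power_tail_def)
  show ?thesis unfolding has_power_tail_def
  proof (intro conjI allI impI)
    fix w assume w: "\<gamma> ^ n < w"
    then have w0: "0 < w" using \<gamma> zero_less_power[of \<gamma> n] by linarith
    have "\<gamma> < root n w" using w root[of "\<gamma> ^ n" "root n w"] n0 \<gamma> w0 by (simp add: real_root_power_cancel)
    then have "measure M {\<omega>\<in>space M. root n w < X \<omega>} = (\<gamma> / root n w) powr (real n * \<beta>)"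
      using X by (simp add: has_power_tail_def)
    also have "\<dots> = (\<gamma> ^ n / w) powr \<beta>"
    proof -
      have "(\<gamma> / root n w) powr (real n * \<beta>) = ((\<gamma> / root n w) powr real n) powr \<beta>" by (simp add: powr_powr)
      also have "(\<gamma> / root n w) powr real n = (\<gamma> / root n w) ^ n" using \<gamma> w0 n0 by (intro powr_realpow) simp
      also have "\<dots> = \<gamma> ^ n / w" using n0 w0 by (simp add: power_divide)
      finally show ?thesis .
    qed
    finally show "measure M {\<omega>\<in>space M. w < X \<omega> ^ n} = (\<gamma> ^ n / w) powr \<beta>" unfolding root .
  next
    fix w assume w: "w < \<gamma> ^ n"
    then have "root n w < \<gamma>" unfolding root .
    then show "measure M {\<omega>\<in>space M. w < X \<omega> ^ n} = 1" unfolding root using X by (simp add: has_power_tail_def)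
  qed simp
qed

definition pareto_char :: "real \<Rightarrow> real \<Rightarrow> real \<Rightarrow> complex" where
  "pareto_char \<beta> \<mu> \<delta> = (LINT v|lborel. pareto_density \<beta> \<delta> v *\<^sub>R cis (- (\<mu> * v)))"

lemma expectation_cis_power_tail:
  assumes M: "prob_space M" and \<beta>: "0 < \<beta>" and \<delta>: "0 < \<delta>" and V: "has_power_tail M \<delta> \<beta> V"
  shows "(LINT \<omega>|M. cis (- (\<mu> * V \<omega>))) = pareto_char \<beta> \<mu> \<delta>"
proof -
  have [measurable]: "V \<in> borel_measurable M" using V by (simp add: has_power_tail_def)
  have "(LINT \<omega>|M. cis (- (\<mu> * V \<omega>))) = (LINT v|distr M borel V. cis (- (\<mu> * v)))"
    by (rule integral_distr[symmetric]) auto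
  also have "\<dots> = pareto_char \<beta> \<mu> \<delta>"
    unfolding distr_power_tail[OF M \<beta> \<delta> V] pareto_char_def
    using pareto_density_nonneg[OF \<beta>] by (intro integral_density) auto
  finally show ?thesis .
qed

text \<open>Since the Pareto density has mass 1, the deficit 1 - \<open>pareto_char\<close> is
  \<delta>^\<beta> times the truncated Levy integral at z = i \<mu>. The factor \<delta>^(-\<beta>)
  exposes it, and the truncation is removed by dominated convergence.\<close>

lemma pareto_char_limit:
  assumes \<beta>: "0 < \<beta>" "\<beta> < 1"
  shows "((\<lambda>\<delta>. (1 - pareto_char \<beta> \<mu> \<delta>) * of_real (\<delta> powr (- \<beta>))) \<longlongrightarrow> of_real (Gamma (1 - \<beta>)) * (\<i> * of_real \<mu>) powr of_real \<beta>) (at_right 0)"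
proof -
  let ?f = "\<lambda>v. of_real (levy_density \<beta> v) * (1 - exp (- ((\<i> * of_real \<mu>) * of_real v)))"
  have i: "integrable lborel ?f" by (rule levy_integrable[OF \<beta>]) simp
  have "((\<lambda>\<delta>. LINT v|lborel. indicator {\<delta><..} v *\<^sub>R ?f v) \<longlongrightarrow> (LINT v|lborel. ?f v)) (at_right 0)"
  proof (rule tendsto_lebesgue_integral_within[where g="\<lambda>v. norm (?f v)"])
    show "AE v in lborel. ((\<lambda>\<delta>. indicator {\<delta><..} v *\<^sub>R ?f v) \<longlongrightarrow> ?f v) (at_right 0)"
    proof (rule AE_I2, rule tendsto_eventually)
      fix v :: real
      show "\<forall>\<^sub>F \<delta> in at_right 0. indicator {\<delta><..} v *\<^sub>R ?f v = ?f v"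
      proof (cases "0 < v")
        case True
        then have "\<forall>\<^sub>F \<delta> in at_right 0. \<delta> < v" by (intro order_tendstoD(2)[OF tendsto_ident_at])
        then show ?thesis by eventually_elim (simp add: indicator_def)
      qed (simp add: levy_density_def)
    qed
    show "AE v in lborel. norm (indicator {\<delta><..} v *\<^sub>R ?f v) \<le> norm (?f v)" for \<delta>
      by (intro AE_I2) (simp add: indicator_def)
  qed (use i in auto)
  then have "((\<lambda>\<delta>. LINT v|lborel. indicator {\<delta><..} v *\<^sub>R ?f v) \<longlongrightarrow> of_real (Gamma (1 - \<beta>)) * (\<i> * of_real \<mu>) powr of_real \<beta>) (at_right 0)"
    using levy_integral[OF \<beta>, of "\<i> * of_real \<mu>"] by simp
  then show ?thesis
  proof (rule Lim_transform_eventually)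
    have "(LINT v|lborel. indicator {\<delta><..} v *\<^sub>R ?f v) = (1 - pareto_char \<beta> \<mu> \<delta>) * of_real (\<delta> powr (- \<beta>))" if \<delta>: "0 < \<delta>" for \<delta>
    proof -
      have ic: "integrable lborel (\<lambda>v. pareto_density \<beta> \<delta> v *\<^sub>R cis (- (\<mu> * v)))"
        by (rule Bochner_Integration.integrable_bound[OF pareto_integral(1)[OF \<beta>(1) \<delta>]]) auto
      have "1 - pareto_char \<beta> \<mu> \<delta> = (LINT v|lborel. complex_of_real (pareto_density \<beta> \<delta> v)) - pareto_char \<beta> \<mu> \<delta>"
        using pareto_integral(2)[OF \<beta>(1) \<delta>] by simp
      also have "\<dots> = (LINT v|lborel. complex_of_real (pareto_density \<beta> \<delta> v) - pareto_density \<beta> \<delta> v *\<^sub>R cis (- (\<mu> * v)))"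
        unfolding pareto_char_def
        by (rule Bochner_Integration.integral_diff[symmetric, OF integrable_of_real[OF pareto_integral(1)[OF \<beta>(1) \<delta>]] ic])
      also have "\<dots> = (LINT v|lborel. of_real (\<delta> powr \<beta>) * (indicator {\<delta><..} v *\<^sub>R ?f v))"
        by (intro Bochner_Integration.integral_cong) (auto simp: pareto_density_def indicator_def cis_conv_exp scaleR_conv_of_real right_diff_distrib mult_ac)
      also have "\<dots> = of_real (\<delta> powr \<beta>) * (LINT v|lborel. indicator {\<delta><..} v *\<^sub>R ?f v)"
        by (rule integral_mult_right_zero)
      finally have "(1 - pareto_char \<beta> \<mu> \<delta>) * of_real (\<delta> powr (- \<beta>)) = (LINT v|lborel. indicator {\<delta><..} v *\<^sub>R ?f v) * (of_real (\<delta> powr \<beta>) * of_real (\<delta> powr (- \<beta>)))"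
        by (simp only: mult_ac)
      also have "complex_of_real (\<delta> powr \<beta>) * of_real (\<delta> powr (- \<beta>)) = 1"
        using \<delta> by (simp add: powr_add[symmetric] flip: of_real_mult)
      finally show ?thesis by simp
    qed
    then show "\<forall>\<^sub>F \<delta> in at_right 0. (LINT v|lborel. indicator {\<delta><..} v *\<^sub>R ?f v) = (1 - pareto_char \<beta> \<mu> \<delta>) * of_real (\<delta> powr (- \<beta>))"
      by (auto simp: eventually_at_filter)
  qed
qed

section \<open>Random sums with Poisson many terms\<close>

text \<open>The exponent is Suc n because the sums start at j = 0 and have N + 1 terms; this is the
  source of the extra factor \<psi>, which tends to 1 in the limit.\<close>

lemma poisson_generating_function:
  fixes \<psi> :: complex
  assumes "0 < l"
  shows "(\<lambda>n. of_real (pmf (poisson_pmf l) n) * \<psi> ^ Suc n) sums (\<psi> * exp (of_real l * (\<psi> - 1)))"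
proof -
  have "(\<lambda>n. (of_real l * \<psi>) ^ n /\<^sub>R fact n) sums exp (of_real l * \<psi>)" by (rule exp_converges)
  from sums_mult[OF this, of "\<psi> * exp (- of_real l)"]
  have "(\<lambda>n. \<psi> * exp (- of_real l) * ((of_real l * \<psi>) ^ n /\<^sub>R fact n)) sums (\<psi> * exp (- of_real l) * exp (of_real l * \<psi>))" .
  also have "(\<lambda>n. \<psi> * exp (- of_real l) * ((of_real l * \<psi>) ^ n /\<^sub>R fact n)) = (\<lambda>n. of_real (pmf (poisson_pmf l) n) * \<psi> ^ Suc n)"
    using assms by (auto simp: fun_eq_iff scaleR_conv_of_real power_mult_distrib field_simps exp_of_real[symmetric])
  also have "\<psi> * exp (- of_real l) * exp (of_real l * \<psi>) = \<psi> * exp (of_real l * (\<psi> - 1))"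
    by (simp add: mult.assoc exp_add[symmetric] algebra_simps)
  finally show ?thesis .
qed

text \<open>Conditioning on an integer-valued variable as a convergent series; the partial sums are
  integrals over {N < K} and are dominated by |F|.\<close>

lemma sums_integral_level_sets:
  fixes F :: "'w \<Rightarrow> complex" and N :: "'w \<Rightarrow> nat"
  assumes N[measurable]: "N \<in> measurable M (count_space UNIV)" and F: "integrable M F"
  shows "(\<lambda>n. LINT \<omega>|M. indicator {n} (N \<omega>) *\<^sub>R F \<omega>) sums (LINT \<omega>|M. F \<omega>)"
  unfolding sums_def
proof -
  have i: "integrable M (\<lambda>\<omega>. indicator {n} (N \<omega>) *\<^sub>R F \<omega>)" for n
    by (rule Bochner_Integration.integrable_bound[OF F]) (use F in \<open>auto simp: indicator_def\<close>)
  have "(\<lambda>K. LINT \<omega>|M. indicator {..<K} (N \<omega>) *\<^sub>R F \<omega>) \<longlonglongrightarrow> (LINT \<omega>|M. F \<omega>)"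
  proof (rule integral_dominated_convergence[where w="\<lambda>\<omega>. norm (F \<omega>)"])
    show "AE \<omega> in M. (\<lambda>K. indicator {..<K} (N \<omega>) *\<^sub>R F \<omega>) \<longlonglongrightarrow> F \<omega>"
    proof (rule AE_I2, rule tendsto_eventually)
      fix \<omega>
      show "\<forall>\<^sub>F K in sequentially. indicator {..<K} (N \<omega>) *\<^sub>R F \<omega> = F \<omega>"
        using eventually_gt_at_top[of "N \<omega>"] by eventually_elim simp
    qed
    show "AE \<omega> in M. norm (indicator {..<K} (N \<omega>) *\<^sub>R F \<omega>) \<le> norm (F \<omega>)" for K
      by (intro AE_I2) (simp add: indicator_def)
    have "(\<lambda>\<omega>. indicator {..<K} (N \<omega>) :: real) \<in> borel_measurable M" for K
      by (rule measurable_compose[OF N]) simp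
    then show "(\<lambda>\<omega>. indicator {..<K} (N \<omega>) *\<^sub>R F \<omega>) \<in> borel_measurable M" for K
      using F by (intro borel_measurable_scaleR) auto
  qed (use F in auto)
  moreover have "(LINT \<omega>|M. indicator {..<K} (N \<omega>) *\<^sub>R F \<omega>) = (\<Sum>n<K. LINT \<omega>|M. indicator {n} (N \<omega>) *\<^sub>R F \<omega>)" for K
  proof -
    have "indicator {..<K} (N \<omega>) *\<^sub>R F \<omega> = (\<Sum>n<K. indicator {n} (N \<omega>) *\<^sub>R F \<omega>)" for \<omega>
      by (simp add: scaleR_sum_left[symmetric] indicator_def sum.delta)
    then show ?thesis by (simp only:) (rule Bochner_Integration.integral_sum, rule i)
  qed
  ultimately show "(\<lambda>K. \<Sum>n<K. LINT \<omega>|M. indicator {n} (N \<omega>) *\<^sub>R F \<omega>) \<longlonglongrightarrow> (LINT \<omega>|M. F \<omega>)" by simp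
qed


lemma poisson_process_distr:
  assumes N: "homogeneous_poisson_process M r N" and t: "0 < t"
  shows "N t \<in> measurable M (count_space UNIV)"
    and "distr M (count_space UNIV) (N t) = measure_pmf (poisson_pmf (r * t))"
proof -
  show "N t \<in> measurable M (count_space UNIV)"
    using N t by (simp add: homogeneous_poisson_process_def)
  have "distr M (count_space UNIV) (\<lambda>\<omega>. N t \<omega> - N 0 \<omega>) = measure_pmf (poisson_pmf (r * (t - 0)))"
    using N t unfolding homogeneous_poisson_process_def by blast
  moreover have "distr M (count_space UNIV) (\<lambda>\<omega>. N t \<omega> - N 0 \<omega>) = distr M (count_space UNIV) (N t)"
    using N by (intro distr_cong) (auto simp: homogeneous_poisson_process_def)
  ultimately show "distr M (count_space UNIV) (N t) = measure_pmf (poisson_pmf (r * t))" by simp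
qed

text \<open>
  Conditioning on the values \<open>n\<close>, \<open>m\<close> of the two counts, the transform of the walk is a finite
  product of independent factors.
\<close>
lemma pseudo_walk_fourier_eq:
  assumes M: "prob_space M"
    and NX: "NX t \<in> measurable M (count_space UNIV)" "distr M (count_space UNIV) (NX t) = measure_pmf (poisson_pmf l)"
    and NY: "NY t \<in> measurable M (count_space UNIV)" "distr M (count_space UNIV) (NY t) = measure_pmf (poisson_pmf l)"
    and t: "0 \<le> t" and l: "0 < l"
    and X: "\<And>j. X j \<in> borel_measurable M" and Y: "\<And>j. Y j \<in> borel_measurable M"
    and indep: "prob_space.indep_sets M (source_events M NX NY X Y) UNIV"
    and \<phi>: "\<phi> \<in> borel_measurable borel" "\<And>x. norm (\<phi> x) \<le> 1"
    and EX: "\<And>j. (LINT \<omega>|M. \<phi> (\<xi> * (a * X j \<omega>))) = \<psi>X"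
    and EY: "\<And>j. (LINT \<omega>|M. \<phi> (\<xi> * (- (b * Y j \<omega>)))) = \<psi>Y"
  shows "pseudo_walk_fourier M \<phi> a b (NX t) (NY t) X Y \<xi> = (\<psi>X * exp (of_real l * (\<psi>X - 1))) * (\<psi>Y * exp (of_real l * (\<psi>Y - 1)))"
proof -
  interpret prob_space M by fact
  note [measurable] = NX(1) NY(1) X Y \<phi>(1)
  define f where "f = (\<lambda>j \<omega>. \<phi> (\<xi> * (a * X j \<omega>)))"
  define g where "g = (\<lambda>j \<omega>. \<phi> (\<xi> * (- (b * Y j \<omega>))))"
  have [measurable]: "\<And>j. f j \<in> borel_measurable M" "\<And>j. g j \<in> borel_measurable M"
    unfolding f_def g_def by measurable
  have f1: "norm (f j \<omega>) \<le> 1" and g1: "norm (g j \<omega>) \<le> 1" for j \<omega> by (simp_all add: f_def g_def \<phi>(2))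
  have prod1: "norm (\<Prod>j\<in>A. h j) \<le> 1" if "\<And>j. norm (h j) \<le> 1" for A :: "nat set" and h :: "nat \<Rightarrow> complex"
    unfolding prod_norm[symmetric] using that by (intro prod_le_1) auto
  have bdd: "integrable M F" if "F \<in> borel_measurable M" "\<And>\<omega>. norm (F \<omega>) \<le> 1" for F :: "_ \<Rightarrow> complex"
    by (rule integrable_const_bound[where B=1]) (use that in auto)
  have mulb: "norm (u * v) \<le> 1" if "norm u \<le> 1" "norm v \<le> 1" for u v :: complex
    unfolding norm_mult using that by (intro mult_le_one) auto
  have [measurable]: "(\<lambda>\<omega>. \<Prod>j\<le>NX t \<omega>. f j \<omega>) \<in> borel_measurable M" "(\<lambda>\<omega>. \<Prod>j\<le>NY t \<omega>. g j \<omega>) \<in> borel_measurable M"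
    by (rule measurable_compose_countable[OF _ NX(1)], measurable)
  have ind: "(\<lambda>\<omega>. indicator {n} (NX t \<omega>) :: complex) \<in> borel_measurable M" "(\<lambda>\<omega>. indicator {n} (NY t \<omega>) :: complex) \<in> borel_measurable M" for n
    by (rule measurable_compose[OF NX(1)], simp) (rule measurable_compose[OF NY(1)], simp)
  have Eind: "(LINT \<omega>|M. indicator {n} (N \<omega>) :: complex) = of_real (pmf (poisson_pmf l) n)"
    if "N \<in> measurable M (count_space UNIV)" "distr M (count_space UNIV) N = measure_pmf (poisson_pmf l)" for N n
  proof -
    have "(LINT \<omega>|M. indicator {n} (N \<omega>) :: complex) = (LINT k|distr M (count_space UNIV) N. indicator {n} k)"
      by (rule integral_distr[symmetric, OF that(1)]) simp
    also have "\<dots> = (LINT k|measure_pmf (poisson_pmf l). of_real (indicator {n} k))"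
      unfolding that(2) by (intro Bochner_Integration.integral_cong) (auto simp: indicator_def)
    also have "\<dots> = of_real (pmf (poisson_pmf l) n)"
      unfolding integral_complex_of_real by (simp add: measure_pmf_single)
    finally show ?thesis .
  qed
  have fact: "(LINT \<omega>|M. indicator {n} (NX t \<omega>) * indicator {m} (NY t \<omega>) * ((\<Prod>j\<le>n. f j \<omega>) * (\<Prod>j\<le>m. g j \<omega>)))
      = of_real (pmf (poisson_pmf l) n) * of_real (pmf (poisson_pmf l) m) * (\<psi>X ^ Suc n * \<psi>Y ^ Suc m)" for n m
  proof -
    \<comment> \<open>One variable for each source of randomness. The preimages under Z i lie in the
      event family of the source i, so the assumed independence of these families passes to the
      factors.\<close>
    define Z :: "source \<Rightarrow> _ \<Rightarrow> complex" where
      "Z = (\<lambda>i \<omega>. case_source (indicator {n} (NX t \<omega>)) (indicator {m} (NY t \<omega>)) (\<lambda>j. f j \<omega>) (\<lambda>j. g j \<omega>) i)"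
    define I where "I = insert CountX (insert CountY (JumpX ` {..n} \<union> JumpY ` {..m}))"
    have Zm: "Z i \<in> borel_measurable M" for i
      using ind by (cases i) (simp_all add: Z_def)
    have Zi: "integrable M (Z i)" for i
      by (rule bdd[OF Zm]) (cases i; simp add: Z_def f1 g1 indicator_def)
    have "indep_vars (\<lambda>_. borel) Z I"
      unfolding indep_vars_def2
    proof (intro conjI ballI Zm indep_sets_mono[OF indep])
      fix i
      show "{Z i -` A \<inter> space M |A. A \<in> sets borel} \<subseteq> source_events M NX NY X Y i"
      proof (cases i)
        case CountX
        have "Z i -` A \<inter> space M \<in> source_events M NX NY X Y CountX" for A
        proof -
          have "Z i -` A \<inter> space M = NX t -` {k. (indicator {n} k :: complex) \<in> A} \<inter> space M" by (auto simp: Z_def CountX)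
          then have "Z i -` A \<inter> space M \<in> {NX t -` A \<inter> space M | t A. 0 \<le> t}" using t by blast
          then show ?thesis unfolding source_events.simps by (rule sigma_sets.Basic)
        qed
        then show ?thesis using CountX by auto
      next
        case CountY
        have "Z i -` A \<inter> space M \<in> source_events M NX NY X Y CountY" for A
        proof -
          have "Z i -` A \<inter> space M = NY t -` {k. (indicator {m} k :: complex) \<in> A} \<inter> space M" by (auto simp: Z_def CountY)
          then have "Z i -` A \<inter> space M \<in> {NY t -` A \<inter> space M | t A. 0 \<le> t}" using t by blast
          then show ?thesis unfolding source_events.simps by (rule sigma_sets.Basic)
        qed
        then show ?thesis using CountY by auto
      next
        case (JumpX j)
        have "Z i -` A \<inter> space M \<in> source_events M NX NY X Y (JumpX j)" if "A \<in> sets borel" for A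
        proof -
          have "(\<lambda>x. \<phi> (\<xi> * (a * x))) -` A \<inter> space borel \<in> sets borel" using that by (intro measurable_sets[of _ borel borel]) simp_all
          moreover have "Z i -` A \<inter> space M = X j -` ((\<lambda>x. \<phi> (\<xi> * (a * x))) -` A \<inter> space borel) \<inter> space M" by (auto simp: Z_def JumpX f_def)
          ultimately show ?thesis by auto
        qed
        then show ?thesis using JumpX by auto
      next
        case (JumpY j)
        have "Z i -` A \<inter> space M \<in> source_events M NX NY X Y (JumpY j)" if "A \<in> sets borel" for A
        proof -
          have "(\<lambda>x. \<phi> (\<xi> * (- (b * x)))) -` A \<inter> space borel \<in> sets borel" using that by (intro measurable_sets[of _ borel borel]) simp_all
          moreover have "Z i -` A \<inter> space M = Y j -` ((\<lambda>x. \<phi> (\<xi> * (- (b * x)))) -` A \<inter> space borel) \<inter> space M" by (auto simp: Z_def JumpY g_def)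
          ultimately show ?thesis by auto
        qed
        then show ?thesis using JumpY by auto
      qed
    qed simp
    then have "(LINT \<omega>|M. (\<Prod>i\<in>I. Z i \<omega>)) = (\<Prod>i\<in>I. LINT \<omega>|M. Z i \<omega>)"
      by (intro indep_vars_lebesgue_integral Zi) (auto simp: I_def)
    moreover have "(\<Prod>i\<in>I. h i) = h CountX * (h CountY * ((\<Prod>j\<le>n. h (JumpX j)) * (\<Prod>j\<le>m. h (JumpY j))))" for h :: "source \<Rightarrow> complex"
    proof -
      have "(\<Prod>i\<in>JumpX ` {..n} \<union> JumpY ` {..m}. h i) = (\<Prod>i\<in>JumpX ` {..n}. h i) * (\<Prod>i\<in>JumpY ` {..m}. h i)"
        by (rule prod.union_disjoint) auto
      moreover have "(\<Prod>i\<in>JumpX ` {..n}. h i) = (\<Prod>j\<le>n. h (JumpX j))" "(\<Prod>i\<in>JumpY ` {..m}. h i) = (\<Prod>j\<le>m. h (JumpY j))"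
        by (simp_all add: prod.reindex inj_on_def)
      moreover have "(\<Prod>i\<in>I. h i) = h CountX * (h CountY * (\<Prod>i\<in>JumpX ` {..n} \<union> JumpY ` {..m}. h i))"
        unfolding I_def by (subst prod.insert, simp, force, subst prod.insert, auto)
      ultimately show ?thesis by (simp only:)
    qed
    ultimately have "(LINT \<omega>|M. Z CountX \<omega> * (Z CountY \<omega> * ((\<Prod>j\<le>n. Z (JumpX j) \<omega>) * (\<Prod>j\<le>m. Z (JumpY j) \<omega>))))
      = (LINT \<omega>|M. Z CountX \<omega>) * ((LINT \<omega>|M. Z CountY \<omega>) * ((\<Prod>j\<le>n. LINT \<omega>|M. Z (JumpX j) \<omega>) * (\<Prod>j\<le>m. LINT \<omega>|M. Z (JumpY j) \<omega>)))"
      by (simp only:)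
    moreover have "(LINT \<omega>|M. Z (JumpX j) \<omega>) = \<psi>X" "(LINT \<omega>|M. Z (JumpY j) \<omega>) = \<psi>Y" for j
      using EX[of j] EY[of j] by (simp_all add: Z_def f_def g_def)
    moreover have "(LINT \<omega>|M. Z CountX \<omega>) = of_real (pmf (poisson_pmf l) n)" "(LINT \<omega>|M. Z CountY \<omega>) = of_real (pmf (poisson_pmf l) m)"
      using Eind[OF NX, of n] Eind[OF NY, of m] by (simp_all add: Z_def)
    ultimately have "(LINT \<omega>|M. Z CountX \<omega> * (Z CountY \<omega> * ((\<Prod>j\<le>n. Z (JumpX j) \<omega>) * (\<Prod>j\<le>m. Z (JumpY j) \<omega>))))
      = of_real (pmf (poisson_pmf l) n) * (of_real (pmf (poisson_pmf l) m) * (\<psi>X ^ Suc n * \<psi>Y ^ Suc m))"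
      by (simp only: prod_constant card_atMost)
    then show ?thesis unfolding Z_def by (simp only: source.case mult.assoc)
  qed
  let ?F = "\<lambda>\<omega>. (\<Prod>j\<le>NX t \<omega>. f j \<omega>) * (\<Prod>j\<le>NY t \<omega>. g j \<omega>)"
  \<comment> \<open>The counts are summed out one at a time, the second with the first fixed, so
    that only single series and one generating function at a time occur.\<close>
  have inner: "(LINT \<omega>|M. indicator {n} (NX t \<omega>) *\<^sub>R ?F \<omega>) = of_real (pmf (poisson_pmf l) n) * \<psi>X ^ Suc n * (\<psi>Y * exp (of_real l * (\<psi>Y - 1)))" for n
  proof -
    let ?G = "\<lambda>\<omega>. indicator {n} (NX t \<omega>) * ((\<Prod>j\<le>n. f j \<omega>) * (\<Prod>j\<le>NY t \<omega>. g j \<omega>)) :: complex"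
    have "integrable M ?G"
    proof (rule bdd)
      show "?G \<in> borel_measurable M" using ind(1)[of n] by measurable
      show "norm (?G \<omega>) \<le> 1" for \<omega> by (intro mulb prod1 f1 g1) (simp add: indicator_def)
    qed
    from sums_integral_level_sets[OF NY(1) this]
    have "(\<lambda>m. LINT \<omega>|M. indicator {m} (NY t \<omega>) *\<^sub>R ?G \<omega>) sums (LINT \<omega>|M. ?G \<omega>)" .
    moreover have "(LINT \<omega>|M. indicator {m} (NY t \<omega>) *\<^sub>R ?G \<omega>) = of_real (pmf (poisson_pmf l) n) * \<psi>X ^ Suc n * (of_real (pmf (poisson_pmf l) m) * \<psi>Y ^ Suc m)" for m
    proof -
      have "(LINT \<omega>|M. indicator {m} (NY t \<omega>) *\<^sub>R ?G \<omega>) = (LINT \<omega>|M. indicator {n} (NX t \<omega>) * indicator {m} (NY t \<omega>) * ((\<Prod>j\<le>n. f j \<omega>) * (\<Prod>j\<le>m. g j \<omega>)))"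
        by (intro Bochner_Integration.integral_cong) (auto simp: indicator_def)
      then show ?thesis unfolding fact by (simp only: mult_ac)
    qed
    ultimately have "(\<lambda>m. of_real (pmf (poisson_pmf l) n) * \<psi>X ^ Suc n * (of_real (pmf (poisson_pmf l) m) * \<psi>Y ^ Suc m)) sums (LINT \<omega>|M. ?G \<omega>)"
      by (simp only:)
    from sums_unique2[OF this sums_mult[OF poisson_generating_function[OF l]]]
    have "(LINT \<omega>|M. ?G \<omega>) = of_real (pmf (poisson_pmf l) n) * \<psi>X ^ Suc n * (\<psi>Y * exp (of_real l * (\<psi>Y - 1)))" .
    moreover have "(LINT \<omega>|M. indicator {n} (NX t \<omega>) *\<^sub>R ?F \<omega>) = (LINT \<omega>|M. ?G \<omega>)"
      by (intro Bochner_Integration.integral_cong) (auto simp: indicator_def)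
    ultimately show ?thesis by simp
  qed
  have Fi: "integrable M ?F"
  proof (rule bdd)
    show "norm (?F \<omega>) \<le> 1" for \<omega> by (intro mulb prod1 f1 g1)
  qed measurable
  from sums_integral_level_sets[OF NX(1) Fi]
  have "(\<lambda>n. (\<psi>Y * exp (of_real l * (\<psi>Y - 1))) * (of_real (pmf (poisson_pmf l) n) * \<psi>X ^ Suc n)) sums (LINT \<omega>|M. ?F \<omega>)"
    unfolding inner by (simp only: mult_ac)
  from sums_unique2[OF this sums_mult[OF poisson_generating_function[OF l]]]
  have "(LINT \<omega>|M. ?F \<omega>) = (\<psi>Y * exp (of_real l * (\<psi>Y - 1))) * (\<psi>X * exp (of_real l * (\<psi>X - 1)))" .
  then show ?thesis unfolding pseudo_walk_fourier_def f_def g_def by (simp only: mult_ac)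
qed

section \<open>The limit of the pseudo random walk\<close>

lemma improper_fourier_odd_order_law:
  assumes "1 \<le> k"
  shows "improper_fourier (\<lambda>x. odd_order_law k x 1) = (\<lambda>x. cis (- (x ^ (2 * k + 1))))"
proof
  fix x
  from odd_order_law_improper_fourier[OF assms, of 1 x]
  show "improper_fourier (\<lambda>x. odd_order_law k x 1) x = cis (- (x ^ (2 * k + 1)))"
    unfolding has_improper_fourier_def improper_fourier_def by (intro tendsto_Lim) auto
qed

text \<open>The reason for the exponent 1/\<alpha> in the walk: a scale c^(1/\<alpha>) multiplies
  the exponent by c. A subtracted sum in addition reverses the angle.\<close>

lemma stable_exponent_mult:
  assumes "0 < a"
  shows "stable_exponent \<alpha> \<kappa> (\<xi> * a) = of_real (a powr \<alpha>) * stable_exponent \<alpha> \<kappa> \<xi>"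
    and "stable_exponent \<alpha> \<kappa> (\<xi> * - a) = of_real (a powr \<alpha>) * stable_exponent \<alpha> (- \<kappa>) \<xi>"
  using assms by (simp_all add: stable_exponent_def abs_mult powr_mult sgn_mult mult_ac)

text \<open>With \<delta> = \<gamma>^n the Poisson parameter is t \<delta>^(-\<beta>) / Gamma (1 -
  \<beta>), exactly the growth at which the deficit of the Pareto transform has a finite limit;
  Gamma (1 - \<beta>) cancels.\<close>

lemma compound_poisson_limit:
  assumes \<beta>: "0 < \<beta>" "\<beta> < 1" and n: "0 < n"
  shows "((\<lambda>\<gamma>. pareto_char \<beta> \<mu> (\<gamma> ^ n) * exp (of_real (1 / Gamma (1 - \<beta>) * (t * \<gamma> powr (- (real n * \<beta>)))) * (pareto_char \<beta> \<mu> (\<gamma> ^ n) - 1)))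
     \<longlongrightarrow> exp (- (of_real t * (\<i> * of_real \<mu>) powr of_real \<beta>))) (at_right 0)"
proof -
  define G where "G = Gamma (1 - \<beta>)"
  have "0 < G" unfolding G_def by (rule Gamma_real_pos) (use \<beta> in simp)
  then have G: "G \<noteq> 0" by simp
  define L where "L = (\<i> * of_real \<mu>) powr of_real \<beta>"
  have fl: "filterlim (\<lambda>\<gamma>::real. \<gamma> ^ n) (at_right 0) (at_right 0)"
    unfolding filterlim_at
  proof
    have "((\<lambda>\<gamma>::real. \<gamma> ^ n) \<longlongrightarrow> 0 ^ n) (at_right 0)" by (intro tendsto_intros)
    then show "((\<lambda>\<gamma>::real. \<gamma> ^ n) \<longlongrightarrow> 0) (at_right 0)" using n by simp
    show "\<forall>\<^sub>F \<gamma> in at_right (0::real). \<gamma> ^ n \<in> {0<..} \<and> \<gamma> ^ n \<noteq> 0" by (auto simp: eventually_at_filter)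
  qed
  have l: "((\<lambda>\<gamma>. (1 - pareto_char \<beta> \<mu> (\<gamma> ^ n)) * of_real ((\<gamma> ^ n) powr (- \<beta>))) \<longlongrightarrow> of_real G * L) (at_right 0)"
    unfolding G_def L_def by (rule filterlim_compose[OF pareto_char_limit[OF \<beta>] fl])
  have z: "((\<lambda>\<gamma>. complex_of_real ((\<gamma> ^ n) powr \<beta>)) \<longlongrightarrow> 0) (at_right 0)"
  proof -
    have "((\<lambda>d::real. d powr \<beta>) \<longlongrightarrow> 0) (at_right 0)" using \<beta>(1) by real_asymp
    from tendsto_of_real[OF filterlim_compose[OF this fl]] show ?thesis by simp
  qed
  \<comment> \<open>The rate of convergence also yields plain convergence of the transform to 1: the
    deficit is its rescaled limit times \<delta>^\<beta>, which tends to 0.\<close>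
  have "((\<lambda>\<gamma>. 1 - ((1 - pareto_char \<beta> \<mu> (\<gamma> ^ n)) * of_real ((\<gamma> ^ n) powr (- \<beta>))) * of_real ((\<gamma> ^ n) powr \<beta>)) \<longlongrightarrow> 1 - (of_real G * L) * 0) (at_right 0)"
    by (intro tendsto_intros l z)
  then have "((\<lambda>\<gamma>. 1 - ((1 - pareto_char \<beta> \<mu> (\<gamma> ^ n)) * of_real ((\<gamma> ^ n) powr (- \<beta>))) * of_real ((\<gamma> ^ n) powr \<beta>)) \<longlongrightarrow> 1) (at_right 0)"
    by simp
  then have one: "((\<lambda>\<gamma>. pareto_char \<beta> \<mu> (\<gamma> ^ n)) \<longlongrightarrow> 1) (at_right 0)"
  proof (rule Lim_transform_eventually)
    have "1 - ((1 - p) * of_real (d powr (- \<beta>))) * of_real (d powr \<beta>) = p" if "0 < d" for p :: complex and d :: real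
    proof -
      have "complex_of_real (d powr (- \<beta>)) * of_real (d powr \<beta>) = 1"
        using that by (simp add: powr_add[symmetric] flip: of_real_mult)
      then show ?thesis by (simp only: mult.assoc) simp
    qed
    then show "\<forall>\<^sub>F \<gamma> in at_right 0. 1 - ((1 - pareto_char \<beta> \<mu> (\<gamma> ^ n)) * of_real ((\<gamma> ^ n) powr (- \<beta>))) * of_real ((\<gamma> ^ n) powr \<beta>) = pareto_char \<beta> \<mu> (\<gamma> ^ n)"
      by (auto simp: eventually_at_filter)
  qed
  have "((\<lambda>\<gamma>. pareto_char \<beta> \<mu> (\<gamma> ^ n) * exp (- (of_real (t / G) * ((1 - pareto_char \<beta> \<mu> (\<gamma> ^ n)) * of_real ((\<gamma> ^ n) powr (- \<beta>))))))
     \<longlongrightarrow> 1 * exp (- (of_real (t / G) * (of_real G * L)))) (at_right 0)"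
    by (intro tendsto_intros one l)
  moreover have "1 * exp (- (of_real (t / G) * (of_real G * L))) = exp (- (of_real t * L))" using G by simp
  ultimately have "((\<lambda>\<gamma>. pareto_char \<beta> \<mu> (\<gamma> ^ n) * exp (- (of_real (t / G) * ((1 - pareto_char \<beta> \<mu> (\<gamma> ^ n)) * of_real ((\<gamma> ^ n) powr (- \<beta>))))))
     \<longlongrightarrow> exp (- (of_real t * L))) (at_right 0)" by (simp only:)
  then show ?thesis unfolding L_def[symmetric]
  proof (rule Lim_transform_eventually)
    have "- (of_real (t / G) * ((1 - p) * of_real ((\<gamma> ^ n) powr (- \<beta>)))) = of_real (1 / G * (t * \<gamma> powr (- (real n * \<beta>)))) * (p - 1)"
      if "0 < \<gamma>" for \<gamma> and p :: complex
    proof -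
      have "(\<gamma> ^ n) powr (- \<beta>) = \<gamma> powr (- (real n * \<beta>))" using that by (simp add: powr_realpow[symmetric] powr_powr)
      moreover define q where "q = 1 - p"
      moreover have "p - 1 = - q" by (simp add: q_def)
      ultimately show ?thesis unfolding q_def[symmetric] by (simp add: divide_inverse mult_ac)
    qed
    then show "\<forall>\<^sub>F \<gamma> in at_right 0. pareto_char \<beta> \<mu> (\<gamma> ^ n) * exp (- (of_real (t / G) * ((1 - pareto_char \<beta> \<mu> (\<gamma> ^ n)) * of_real ((\<gamma> ^ n) powr (- \<beta>)))))
      = pareto_char \<beta> \<mu> (\<gamma> ^ n) * exp (of_real (1 / Gamma (1 - \<beta>) * (t * \<gamma> powr (- (real n * \<beta>)))) * (pareto_char \<beta> \<mu> (\<gamma> ^ n) - 1))"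
      unfolding G_def[symmetric] by (auto simp: eventually_at_filter)
  qed
qed

text \<open>For each \<gamma> the transform is an exact product of two compound Poisson factors.
  Their limits are the exponentials of the two scaled stable exponents with opposite angles, which
  the time-scale identity merges.\<close>

lemma feller_walk_limit:
  fixes M :: "'w measure" and X Y :: "real \<Rightarrow> nat \<Rightarrow> 'w \<Rightarrow> real"
  assumes beta: "0 < \<beta>" "\<beta> < 1"
    and theta: "- \<beta> < \<theta>" "\<theta> < \<beta>"
    and k: "1 \<le> k"
    and prob: "prob_space M"
    and poissonX: "homogeneous_poisson_process M (1 / Gamma (1 - \<beta>)) NX"
    and poissonY: "homogeneous_poisson_process M (1 / Gamma (1 - \<beta>)) NY"
    and jumpsX: "\<And>\<gamma> j. 0 < \<gamma> \<Longrightarrow> has_power_tail M \<gamma> (real (2 * k + 1) * \<beta>) (X \<gamma> j)"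
    and jumpsY: "\<And>\<gamma> j. 0 < \<gamma> \<Longrightarrow> has_power_tail M \<gamma> (real (2 * k + 1) * \<beta>) (Y \<gamma> j)"
    and indep: "\<And>\<gamma>. 0 < \<gamma> \<Longrightarrow>
      prob_space.indep_sets M (source_events M NX NY (X \<gamma>) (Y \<gamma>)) UNIV"
    and t: "0 < t"
  shows "((\<lambda>\<gamma>. feller_walk_fourier k \<beta> \<theta> M NX NY (X \<gamma>) (Y \<gamma>) t \<gamma> \<xi>)
          \<longlongrightarrow> stable_transform (\<beta> * real (2 * k + 1)) (pi * \<theta> / 2) t \<xi>) (at_right 0)"
proof -
  define n where "n = 2 * k + 1"
  define \<alpha> where "\<alpha> = real n * \<beta>"
  define a b where "a = time_scale \<beta> \<theta> powr (1 / \<alpha>)" and "b = time_scale \<beta> (- \<theta>) powr (1 / \<alpha>)"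
  have n: "odd n" "0 < n" by (auto simp: n_def)
  have \<alpha>: "0 < \<alpha>" using beta n by (simp add: \<alpha>_def)
  have c: "0 < time_scale \<beta> \<theta>" "0 < time_scale \<beta> (- \<theta>)"
    using time_scale_pos[OF beta, of \<theta>] time_scale_pos[OF beta, of "- \<theta>"] theta by auto
  have ab: "0 < a" "0 < b" "a powr \<alpha> = time_scale \<beta> \<theta>" "b powr \<alpha> = time_scale \<beta> (- \<theta>)"
    using c \<alpha> by (simp_all add: a_def b_def powr_powr)
  have Gpos: "0 < Gamma (1 - \<beta>)" by (rule Gamma_real_pos) (use beta in simp)
  have "0 < sin (pi * \<beta>)" by (rule sin_pi_mult_pos) (use beta in auto)
  then have s: "sin (pi * \<beta>) \<noteq> 0" by simp
  let ?L = "\<lambda>\<gamma>. complex_of_real (1 / Gamma (1 - \<beta>) * (t * \<gamma> powr (- (real n * \<beta>))))"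
  let ?p = "\<lambda>\<mu> \<gamma>. pareto_char \<beta> \<mu> (\<gamma> ^ n)"
  let ?x = "(\<xi> * a) ^ n" and ?y = "(\<xi> * - b) ^ n"
  have eq: "feller_walk_fourier k \<beta> \<theta> M NX NY (X \<gamma>) (Y \<gamma>) t \<gamma> \<xi> = (?p ?x \<gamma> * exp (?L \<gamma> * (?p ?x \<gamma> - 1))) * (?p ?y \<gamma> * exp (?L \<gamma> * (?p ?y \<gamma> - 1)))"
    if \<gamma>: "0 < \<gamma>" for \<gamma>
  proof -
    have \<tau>: "0 < t * \<gamma> powr (- \<alpha>)" using t \<gamma> by simp
    \<comment> \<open>Given a jump V, the pseudo variable contributes cis (-(\<xi> d V)^n), which
      depends on V only through the Pareto variable V^n of threshold \<gamma>^n and index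
      \<beta>.\<close>
    have E: "(LINT \<omega>|M. cis (- ((\<xi> * (d * V \<omega>)) ^ n))) = ?p ((\<xi> * d) ^ n) \<gamma>"
      if V: "has_power_tail M \<gamma> (real (2 * k + 1) * \<beta>) V" for d V
    proof -
      have "(\<xi> * (d * V \<omega>)) ^ n = (\<xi> * d) ^ n * V \<omega> ^ n" for \<omega> by (simp add: power_mult_distrib mult_ac)
      then show ?thesis
        using expectation_cis_power_tail[OF prob beta(1) zero_less_power[OF \<gamma>] has_power_tail_odd_power[OF n(1) V[folded n_def] \<gamma>], of "(\<xi> * d) ^ n"]
        by simp
    qed
    have "pseudo_walk_fourier M (\<lambda>x. cis (- (x ^ n))) a b (NX (t * \<gamma> powr (- \<alpha>))) (NY (t * \<gamma> powr (- \<alpha>))) (X \<gamma>) (Y \<gamma>) \<xi>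
      = (?p ?x \<gamma> * exp (?L \<gamma> * (?p ?x \<gamma> - 1))) * (?p ?y \<gamma> * exp (?L \<gamma> * (?p ?y \<gamma> - 1)))"
      unfolding \<alpha>_def[symmetric]
    proof (rule pseudo_walk_fourier_eq[OF prob poisson_process_distr[OF poissonX \<tau>] poisson_process_distr[OF poissonY \<tau>] less_imp_le[OF \<tau>] _ _ _ indep[OF \<gamma>]])
      show "0 < 1 / Gamma (1 - \<beta>) * (t * \<gamma> powr (- \<alpha>))" using Gpos \<tau> by simp
      show "X \<gamma> j \<in> borel_measurable M" "Y \<gamma> j \<in> borel_measurable M" for j
        using jumpsX[OF \<gamma>, of j] jumpsY[OF \<gamma>, of j] by (auto simp: has_power_tail_def)
      show "(LINT \<omega>|M. cis (- ((\<xi> * (a * X \<gamma> j \<omega>)) ^ n))) = ?p ?x \<gamma>" for j by (rule E[OF jumpsX[OF \<gamma>]])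
      show "(LINT \<omega>|M. cis (- ((\<xi> * - (b * Y \<gamma> j \<omega>)) ^ n))) = ?p ?y \<gamma>" for j
        using E[OF jumpsY[OF \<gamma>, of j], of "- b"] by simp
    qed auto
    then show ?thesis
      unfolding feller_walk_fourier_def Let_def improper_fourier_odd_order_law[OF k] n_def[symmetric] \<alpha>_def[symmetric] a_def[symmetric] b_def[symmetric] .
  qed
  have "((\<lambda>\<gamma>. (?p ?x \<gamma> * exp (?L \<gamma> * (?p ?x \<gamma> - 1))) * (?p ?y \<gamma> * exp (?L \<gamma> * (?p ?y \<gamma> - 1)))) \<longlongrightarrow>
      exp (- (of_real t * (\<i> * of_real ?x) powr of_real \<beta>)) * exp (- (of_real t * (\<i> * of_real ?y) powr of_real \<beta>))) (at_right 0)"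
    by (intro tendsto_mult compound_poisson_limit beta n(2))
  moreover have "exp (- (of_real t * (\<i> * of_real ?x) powr of_real \<beta>)) * exp (- (of_real t * (\<i> * of_real ?y) powr of_real \<beta>))
    = stable_transform \<alpha> (pi * \<theta> / 2) t \<xi>"
  proof -
    have an: "\<beta> * real (2 * k + 1) = \<alpha>" by (simp add: \<alpha>_def n_def mult.commute)
    have "(\<i> * of_real ?x) powr of_real \<beta> = of_real (time_scale \<beta> \<theta>) * stable_exponent \<alpha> (pi * \<beta> / 2) \<xi>"
      "(\<i> * of_real ?y) powr of_real \<beta> = of_real (time_scale \<beta> (- \<theta>)) * stable_exponent \<alpha> (- (pi * \<beta> / 2)) \<xi>"
      unfolding n_def stable_exponent_odd_power[OF beta] an stable_exponent_mult[OF ab(1)] stable_exponent_mult[OF ab(2)] ab by simp_all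
    then show ?thesis
      unfolding stable_transform_time_scale[OF s, of \<alpha> \<theta> t \<xi>, symmetric]
      unfolding stable_transform_def by (simp only: of_real_mult mult_ac)
  qed
  ultimately have "((\<lambda>\<gamma>. (?p ?x \<gamma> * exp (?L \<gamma> * (?p ?x \<gamma> - 1))) * (?p ?y \<gamma> * exp (?L \<gamma> * (?p ?y \<gamma> - 1)))) \<longlongrightarrow> stable_transform \<alpha> (pi * \<theta> / 2) t \<xi>) (at_right 0)"
    by (simp only:)
  then have "((\<lambda>\<gamma>. feller_walk_fourier k \<beta> \<theta> M NX NY (X \<gamma>) (Y \<gamma>) t \<gamma> \<xi>) \<longlongrightarrow> stable_transform \<alpha> (pi * \<theta> / 2) t \<xi>) (at_right 0)"
    by (rule Lim_transform_eventually) (simp add: eventually_at_filter eq)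
  then show ?thesis by (simp only: \<alpha>_def n_def mult.commute)
qed

section \<open>Uniqueness in the Fourier variable and the final assembly\<close>

text \<open>For fixed \<xi> the problem is a linear ordinary differential equation. The integrating
  factor makes the product constant on t > 0, and the limit at 0 fixes the constant as 1.\<close>

lemma feller_cauchy_solution_fourier_eq:
  assumes w: "feller_cauchy_solution_fourier g \<theta> w" and t: "0 < t"
  shows "fourier (\<lambda>x. w x t) \<xi> = exp (of_real t * feller_symbol g \<theta> \<xi>)"
proof -
  define \<sigma> where "\<sigma> = feller_symbol g \<theta> \<xi>"
  define D where "D = (\<lambda>\<tau>. fourier (\<lambda>x. w x \<tau>) \<xi> * exp (- (of_real \<tau> * \<sigma>)))"
  have D': "(D has_vector_derivative 0) (at \<tau> within {0<..})" if "\<tau> \<in> {0<..}" for \<tau>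
  proof -
    have 1: "((\<lambda>\<tau>. fourier (\<lambda>x. w x \<tau>) \<xi>) has_vector_derivative \<sigma> * fourier (\<lambda>x. w x \<tau>) \<xi>) (at \<tau>)"
      using w that unfolding feller_cauchy_solution_fourier_def \<sigma>_def by simp
    have "((\<lambda>z. exp (- (z * \<sigma>))) has_field_derivative - \<sigma> * exp (- (of_real \<tau> * \<sigma>))) (at (of_real \<tau>))"
      by (auto intro!: derivative_eq_intros)
    note 2 = has_vector_derivative_real_field[OF this]
    have 3: "F * (- \<sigma> * e) + \<sigma> * F * e = 0" for F e :: complex by algebra
    from has_vector_derivative_mult[OF 1 2] have "(D has_vector_derivative 0) (at \<tau>)"
      unfolding D_def 3 .
    then show ?thesis by (rule has_vector_derivative_at_within)
  qed
  obtain c where c: "\<And>\<tau>. 0 < \<tau> \<Longrightarrow> D \<tau> = c"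
  proof -
    have "convex {0::real<..}" by (rule convex_real_interval)
    from has_vector_derivative_zero_constant[OF this D'] obtain c where "\<And>\<tau>. \<tau> \<in> {0<..} \<Longrightarrow> D \<tau> = c"
      by blast
    then show ?thesis by (intro that) simp
  qed
  have "((\<lambda>\<tau>. fourier (\<lambda>x. w x \<tau>) \<xi> * exp (- (of_real \<tau> * \<sigma>))) \<longlongrightarrow> 1 * exp (- (of_real 0 * \<sigma>))) (at_right 0)"
    by (intro tendsto_intros) (use w in \<open>simp add: feller_cauchy_solution_fourier_def\<close>)
  then have "(D \<longlongrightarrow> 1) (at_right 0)" by (simp add: D_def)
  moreover have "(D \<longlongrightarrow> c) (at_right 0)"
    by (rule tendsto_eventually) (auto simp: eventually_at_filter c)
  ultimately have "c = 1" using tendsto_unique[of "at_right (0::real)" D] by auto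
  then have "fourier (\<lambda>x. w x t) \<xi> * exp (- (of_real t * \<sigma>)) = 1" using c[OF t] by (simp add: D_def)
  then show ?thesis by (simp add: exp_minus \<sigma>_def field_simps)
qed

text \<open>Both transforms are the same explicit exponential; injectivity of the Fourier transform
  determines the densities up to null sets only.\<close>

lemma feller_cauchy_solution_fourier_unique:
  assumes w: "feller_cauchy_solution_fourier g \<theta> w" and z: "feller_cauchy_solution_fourier g \<theta> z" and t: "0 < t"
  shows "AE x in lborel. w x t = z x t"
proof -
  have i: "integrable lborel (\<lambda>x. w x t)" "integrable lborel (\<lambda>x. z x t)"
    using w z t by (auto simp: feller_cauchy_solution_fourier_def)
  have ic: "integrable lborel (\<lambda>x. cis (\<xi> * x) * complex_of_real (f x))" if "integrable lborel f" for f \<xi>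
    by (rule Bochner_Integration.integrable_bound[OF that]) (use that in \<open>auto simp: norm_mult\<close>)
  have "fourier (\<lambda>x. w x t - z x t) \<xi> = 0" for \<xi>
  proof -
    have "fourier (\<lambda>x. w x t - z x t) \<xi> = fourier (\<lambda>x. w x t) \<xi> - fourier (\<lambda>x. z x t) \<xi>"
      unfolding fourier_def of_real_diff right_diff_distrib
      by (rule Bochner_Integration.integral_diff[OF ic[OF i(1)] ic[OF i(2)]])
    then show ?thesis by (simp add: feller_cauchy_solution_fourier_eq[OF w t] feller_cauchy_solution_fourier_eq[OF z t])
  qed
  then have "AE x in lborel. w x t - z x t = 0"
    using i by (intro fourier_eq_0_imp_AE_eq_0) auto
  then show ?thesis by eventually_elim simp
qed

theorem theorem4p4:
  fixes \<beta> \<theta> :: real and k :: nat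
    and h :: "real \<Rightarrow> real \<Rightarrow> real"
    and M :: "'w measure"
    and NX NY :: "real \<Rightarrow> 'w \<Rightarrow> nat"
    and X Y :: "real \<Rightarrow> nat \<Rightarrow> 'w \<Rightarrow> real"
  assumes beta: "0 < \<beta>" "\<beta> < 1"
    and theta: "- \<beta> < \<theta>" "\<theta> < \<beta>"
    and k: "1 \<le> k"
    and order: "\<beta> * real (2 * k + 1) \<notin> \<nat>"
    and subordinator: "stable_subordinator_density \<beta> h"
    and prob: "prob_space M"
    and poissonX: "homogeneous_poisson_process M (1 / Gamma (1 - \<beta>)) NX"
    and poissonY: "homogeneous_poisson_process M (1 / Gamma (1 - \<beta>)) NY"
    and jumpsX: "\<And>\<gamma> j. 0 < \<gamma> \<Longrightarrow> has_power_tail M \<gamma> (real (2 * k + 1) * \<beta>) (X \<gamma> j)"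
    and jumpsY: "\<And>\<gamma> j. 0 < \<gamma> \<Longrightarrow> has_power_tail M \<gamma> (real (2 * k + 1) * \<beta>) (Y \<gamma> j)"
    and indep: "\<And>\<gamma>. 0 < \<gamma> \<Longrightarrow>
      prob_space.indep_sets M (source_events M NX NY (X \<gamma>) (Y \<gamma>)) UNIV"
  shows "odd_order_fundamental_solution k (odd_order_law k) \<and>
    (\<exists>z :: real \<Rightarrow> real \<Rightarrow> real.
       (\<forall>t>0. integrable lborel (\<lambda>x. z x t)) \<and>
       (\<forall>t>0. \<forall>\<xi>. ((\<lambda>\<gamma>. feller_walk_fourier k \<beta> \<theta> M NX NY (X \<gamma>) (Y \<gamma>) t \<gamma> \<xi>)
          \<longlongrightarrow> fourier (\<lambda>x. z x t) \<xi>) (at_right 0)) \<and>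
       feller_cauchy_solution (\<beta> * real (2 * k + 1)) \<theta> z \<and>
       feller_cauchy_solution_fourier (\<beta> * real (2 * k + 1)) \<theta> z \<and>
       (\<forall>w. feller_cauchy_solution_fourier (\<beta> * real (2 * k + 1)) \<theta> w \<longrightarrow>
          (\<forall>t>0. AE x in lborel. w x t = z x t)) \<and>
       (\<forall>t>0. \<forall>x. z x t = composition_law k \<beta> \<theta> h x t)) \<and>
    (\<forall>\<eta>. \<bar>\<eta>\<bar> \<le> 2 \<and> 0 < time_scale \<beta> \<eta> \<and> 0 < time_scale \<beta> (- \<eta>)
       \<longrightarrow> - \<beta> < \<eta> \<and> \<eta> < \<beta>)"
proof (intro conjI exI[of _ "\<lambda>x t. stable_kernel (\<beta> * real (2 * k + 1)) (pi * \<theta> / 2) t x"])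
  have g: "0 < \<beta> * real (2 * k + 1)" using beta by simp
  \<comment> \<open>This puts the angle \<pi>\<theta>/2 of the witness strictly inside (-\<pi>/2,
    \<pi>/2), so that its transform decays and all results on stable kernels apply.\<close>
  have \<theta>1: "\<bar>\<theta>\<bar> < 1" using beta theta by auto
  have \<kappa>: "\<bar>pi * \<theta> / 2\<bar> < pi / 2" using \<theta>1 by (simp add: abs_mult)
  note sol = feller_cauchy_solution_stable_kernel[OF g order \<theta>1]
  show "odd_order_fundamental_solution k (odd_order_law k)" by (rule odd_order_fundamental_solution[OF k])
  show "\<forall>t>0. integrable lborel (\<lambda>x. stable_kernel (\<beta> * real (2 * k + 1)) (pi * \<theta> / 2) t x)"
    using integrable_stable_kernel[OF g \<kappa>] by simp
  show "\<forall>t>0. \<forall>\<xi>. ((\<lambda>\<gamma>. feller_walk_fourier k \<beta> \<theta> M NX NY (X \<gamma>) (Y \<gamma>) t \<gamma> \<xi>)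
      \<longlongrightarrow> fourier (\<lambda>x. stable_kernel (\<beta> * real (2 * k + 1)) (pi * \<theta> / 2) t x) \<xi>) (at_right 0)"
  proof (intro allI impI)
    fix t \<xi> :: real assume t: "0 < t"
    show "((\<lambda>\<gamma>. feller_walk_fourier k \<beta> \<theta> M NX NY (X \<gamma>) (Y \<gamma>) t \<gamma> \<xi>)
      \<longlongrightarrow> fourier (\<lambda>x. stable_kernel (\<beta> * real (2 * k + 1)) (pi * \<theta> / 2) t x) \<xi>) (at_right 0)"
      unfolding fourier_stable_kernel[OF g \<kappa> t]
      by (rule feller_walk_limit[OF beta theta k prob poissonX poissonY jumpsX jumpsY indep t])
  qed
  show "feller_cauchy_solution (\<beta> * real (2 * k + 1)) \<theta> (\<lambda>x t. stable_kernel (\<beta> * real (2 * k + 1)) (pi * \<theta> / 2) t x)"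
    "feller_cauchy_solution_fourier (\<beta> * real (2 * k + 1)) \<theta> (\<lambda>x t. stable_kernel (\<beta> * real (2 * k + 1)) (pi * \<theta> / 2) t x)"
    by (rule sol)+
  show "\<forall>w. feller_cauchy_solution_fourier (\<beta> * real (2 * k + 1)) \<theta> w \<longrightarrow>
      (\<forall>t>0. AE x in lborel. w x t = stable_kernel (\<beta> * real (2 * k + 1)) (pi * \<theta> / 2) t x)"
    using feller_cauchy_solution_fourier_unique[OF _ sol(2)] by blast
  show "\<forall>t>0. \<forall>x. stable_kernel (\<beta> * real (2 * k + 1)) (pi * \<theta> / 2) t x = composition_law k \<beta> \<theta> h x t"
    using composition_law_eq[OF beta theta k subordinator] by simp
  show "\<forall>\<eta>. \<bar>\<eta>\<bar> \<le> 2 \<and> 0 < time_scale \<beta> \<eta> \<and> 0 < time_scale \<beta> (- \<eta>) \<longrightarrow> - \<beta> < \<eta> \<and> \<eta> < \<beta>"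
  proof (intro allI impI conjI)
    fix \<eta> assume \<eta>: "\<bar>\<eta>\<bar> \<le> 2 \<and> 0 < time_scale \<beta> \<eta> \<and> 0 < time_scale \<beta> (- \<eta>)"
    show "\<eta> < \<beta>" using time_scale_pos_imp[OF beta, of \<eta>] \<eta> by simp
    show "- \<beta> < \<eta>" using time_scale_pos_imp[OF beta, of "- \<eta>"] \<eta> by simp
  qed
qed

end
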